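(* Let $\mathbb G$ be a Carnot group represented in exponential coordinates on $\mathbb{R}^n$, let $D\subset\mathbb{R}^n$ be an open set, let $q\ge1$, and let $(f_\varepsilon)$ (indexed by $\varepsilon\to0$) be functions with $f_\varepsilon\rightharpoonup f$ weakly in $L^q(D)$ and such that, for some $M$ independent of $\varepsilon$, $$\int_D\frac{1}{\mathcal L^n(U(x,\varepsilon))}\int_{U(x,\varepsilon)}|f_\varepsilon(y)-f_\varepsilon(x)|^q\,d\mathcal L^n(y)\,d\mathcal L^n(x)\le M\varepsilon^q,$$ where all functions are extended by zero outside $D$. If $q>1$ then $f\in W^{1,q}_X(D)$; if $q=1$ then $f\in BV_X(D)$. Moreover, along a subsequence, $$\chi_{U(0,1)}(z)\,\chi_D(x\circ\delta_\varepsilon(z))\,\frac{f_\varepsilon(x\circ\delta_\varepsilon(z))-f_\varepsilon(x)}{\varepsilon}\rightharpoonup\chi_{U(0,1)}(z)\,\langle z,Xf(x)\rangle$$ weakly in $L^q(D\times\mathbb{R}^n)$ (in the variables $(x,z)$) if $q>1$, and weakly as measures on $D\times\mathbb{R}^n$ if $q=1$.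
   Context: A Carnot group is a finite-dimensional, connected, simply connected Lie group with stratified Lie algebra $\mathfrak g_1\oplus\dots\oplus\mathfrak g_l$; it is identified with $\mathbb{R}^n$ by exponential coordinates relative to a basis $X_1,\dots,X_n$ of left-invariant fields adapted to the stratification, with group law $\circ$, $x^{-1}=-x$, and dilations $\delta_\lambda$ multiplying the coordinates of layer $j$ by $\lambda^j$; $X_1,\dots,X_m$ ($m=\dim\mathfrak g_1$) are the horizontal fields and $Xf=(X_1f,\dots,X_mf)$ in the sense of distributions. $\mathcal L^n$ is the Haar measure. Box norm: $\|x\|=\max$ over coordinates of $|x_i|^{1/j}$, where $j$ is the layer of coordinate $i$; box distance $d(x,y)=\|x^{-1}\circ y\|$, and $U(x,r)$ is the open ball of radius $r$ in this distance. $W^{1,q}_X(D)$: $f\in L^q(D)$ with $Xf\in L^q(D;\mathbb{R}^m)$; $BV_X(D)$: $f\in L^1(D)$ with $Xf$ a finite vector Radon measure. $\langle z,v\rangle=\sum_{i=1}^mz_iv_i$ for $z\in\mathbb{R}^n$ (for $q=1$, $\chi_{U(0,1)}(z)\langle z,Xf\rangle$ denotes the measure $\sum_{i=1}^m X_if\otimes \chi_{U(0,1)}(z)z_i\,\mathcal L^n(z)$). *)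

theory Defs
  imports "HOL-Analysis.Analysis"
begin

definition pdir :: "'a::euclidean_space \<Rightarrow> ('a \<Rightarrow> real) \<Rightarrow> 'a \<Rightarrow> real" where
  "pdir b g x = deriv (\<lambda>t::real. g (x + t *\<^sub>R b)) 0"

fun iter_pd :: "'a::euclidean_space list \<Rightarrow> ('a \<Rightarrow> real) \<Rightarrow> 'a \<Rightarrow> real" where
  "iter_pd [] g = g"
| "iter_pd (b # bs) g = pdir b (iter_pd bs g)"

definition smooth_on :: "'a::euclidean_space set \<Rightarrow> ('a \<Rightarrow> real) \<Rightarrow> bool" where
  "smooth_on S g \<longleftrightarrow>
     (\<forall>bs. set bs \<subseteq> Basis \<longrightarrow>
        continuous_on S (iter_pd bs g) \<and>
        (\<forall>b\<in>Basis. \<forall>x\<in>S. (\<lambda>t::real. iter_pd bs g (x + t *\<^sub>R b)) differentiable (at 0)))"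

definition csupp :: "('a::topological_space \<Rightarrow> real) \<Rightarrow> 'a set" where
  "csupp g = closure {x. g x \<noteq> 0}"

definition test_fn :: "'a::euclidean_space set \<Rightarrow> ('a \<Rightarrow> real) \<Rightarrow> bool" where
  "test_fn D \<phi> \<longleftrightarrow> smooth_on UNIV \<phi> \<and> compact (csupp \<phi>) \<and> csupp \<phi> \<subseteq> D"

text \<open>Coordinates are indexed by the finite type 'n; w i is the layer of coordinate i.
  Dilations: coordinates of layer j are multiplied by lambda^j.\<close>
definition dil :: "('n::finite \<Rightarrow> nat) \<Rightarrow> real \<Rightarrow> real^'n \<Rightarrow> real^'n" where
  "dil w s x = (\<chi> i. s ^ w i * x $ i)"

text \<open>Lie bracket of the Lie algebra identified with R^n via exponential coordinates
  (by Baker-Campbell-Hausdorff, (tx)o(ty) - (ty)o(tx) = t^2 [x,y] + O(t^3)).\<close>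
definition lie_br :: "(real^'n::finite \<Rightarrow> real^'n \<Rightarrow> real^'n) \<Rightarrow> real^'n \<Rightarrow> real^'n \<Rightarrow> real^'n" where
  "lie_br gm x y =
     Lim (at (0::real)) (\<lambda>t. (gm (t *\<^sub>R x) (t *\<^sub>R y) - gm (t *\<^sub>R y) (t *\<^sub>R x)) /\<^sub>R (t^2))"

inductive_set lie_gen :: "(real^'n::finite \<Rightarrow> real^'n \<Rightarrow> real^'n) \<Rightarrow> (real^'n) set \<Rightarrow> (real^'n) set"
  for gm V where
  base: "v \<in> V \<Longrightarrow> v \<in> lie_gen gm V"
| add: "u \<in> lie_gen gm V \<Longrightarrow> v \<in> lie_gen gm V \<Longrightarrow> u + v \<in> lie_gen gm V"
| scale: "u \<in> lie_gen gm V \<Longrightarrow> c *\<^sub>R u \<in> lie_gen gm V"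
| br: "u \<in> lie_gen gm V \<Longrightarrow> v \<in> lie_gen gm V \<Longrightarrow> lie_br gm u v \<in> lie_gen gm V"

text \<open>(R^n, gm) is a Carnot group in exponential coordinates adapted to the stratification
  given by the layer function w:
  smooth group law with identity 0 and inverse x^{-1} = -x; one-parameter subgroups are the
  lines through 0 (exponential coordinates); dilations are group automorphisms; the Lie algebra
  is generated by the first layer (stratification).\<close>
definition carnot_group :: "(real^'n::finite \<Rightarrow> real^'n \<Rightarrow> real^'n) \<Rightarrow> ('n \<Rightarrow> nat) \<Rightarrow> bool" where
  "carnot_group gm w \<longleftrightarrow>
     (\<forall>x y z. gm (gm x y) z = gm x (gm y z)) \<and>
     (\<forall>x. gm x 0 = x \<and> gm 0 x = x) \<and>
     (\<forall>x. gm x (- x) = 0 \<and> gm (- x) x = 0) \<and>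
     (\<forall>i. smooth_on UNIV (\<lambda>p::(real^'n) \<times> (real^'n). gm (fst p) (snd p) $ i)) \<and>
     (\<forall>x s t. gm (s *\<^sub>R x) (t *\<^sub>R x) = (s + t) *\<^sub>R x) \<and>
     (\<forall>i. w i \<ge> 1) \<and>
     (\<forall>s>0. \<forall>x y. dil w s (gm x y) = gm (dil w s x) (dil w s y)) \<and>
     lie_gen gm {x. \<forall>i. w i \<noteq> 1 \<longrightarrow> x $ i = 0} = UNIV"

definition bnorm :: "('n::finite \<Rightarrow> nat) \<Rightarrow> real^'n \<Rightarrow> real" where
  "bnorm w x = Max (range (\<lambda>i. \<bar>x $ i\<bar> powr (1 / real (w i))))"

definition bdist :: "(real^'n::finite \<Rightarrow> real^'n \<Rightarrow> real^'n) \<Rightarrow> ('n \<Rightarrow> nat) \<Rightarrow> real^'n \<Rightarrow> real^'n \<Rightarrow> real" where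
  "bdist gm w x y = bnorm w (gm (- x) y)"

definition Uball :: "(real^'n::finite \<Rightarrow> real^'n \<Rightarrow> real^'n) \<Rightarrow> ('n \<Rightarrow> nat) \<Rightarrow> real^'n \<Rightarrow> real \<Rightarrow> (real^'n) set" where
  "Uball gm w x r = {y. bdist gm w x y < r}"

text \<open>Left-invariant field X_i with X_i(0) = e_i, applied to a function.\<close>
definition hX :: "(real^'n::finite \<Rightarrow> real^'n \<Rightarrow> real^'n) \<Rightarrow> 'n \<Rightarrow> (real^'n \<Rightarrow> real) \<Rightarrow> real^'n \<Rightarrow> real" where
  "hX gm i \<phi> x = deriv (\<lambda>t::real. \<phi> (gm x (t *\<^sub>R axis i 1))) 0"

definition Lq :: "'a measure \<Rightarrow> 'a set \<Rightarrow> real \<Rightarrow> ('a \<Rightarrow> real) \<Rightarrow> bool" where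
  "Lq M D q g \<longleftrightarrow> set_borel_measurable M D g \<and> set_integrable M D (\<lambda>x. \<bar>g x\<bar> powr q)"

definition Linf :: "'a measure \<Rightarrow> 'a set \<Rightarrow> ('a \<Rightarrow> real) \<Rightarrow> bool" where
  "Linf M D g \<longleftrightarrow> set_borel_measurable M D g \<and> (\<exists>C. AE x in M. x \<in> D \<longrightarrow> \<bar>g x\<bar> \<le> C)"

definition weak_Lq_conv :: "'a measure \<Rightarrow> 'a set \<Rightarrow> real \<Rightarrow> (nat \<Rightarrow> 'a \<Rightarrow> real) \<Rightarrow> ('a \<Rightarrow> real) \<Rightarrow> bool" where
  "weak_Lq_conv M D q F f \<longleftrightarrow>
     (\<forall>g. (if q = 1 then Linf M D g else Lq M D (q / (q - 1)) g) \<longrightarrow>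
        (\<lambda>k. LINT x:D|M. F k x * g x) \<longlonglongrightarrow> (LINT x:D|M. f x * g x))"

text \<open>g is the distributional derivative X_i f in D (X_i^* = -X_i since Haar = Lebesgue).\<close>
definition weak_hderiv :: "(real^'n::finite \<Rightarrow> real^'n \<Rightarrow> real^'n) \<Rightarrow> (real^'n) set \<Rightarrow> 'n
    \<Rightarrow> (real^'n \<Rightarrow> real) \<Rightarrow> (real^'n \<Rightarrow> real) \<Rightarrow> bool" where
  "weak_hderiv gm D i f g \<longleftrightarrow>
     (\<forall>\<phi>. test_fn D \<phi> \<longrightarrow>
        (LINT x:D|lebesgue. f x * hX gm i \<phi> x) = - (LINT x:D|lebesgue. g x * \<phi> x))"

definition W1q_X :: "(real^'n::finite \<Rightarrow> real^'n \<Rightarrow> real^'n) \<Rightarrow> ('n \<Rightarrow> nat) \<Rightarrow> (real^'n) set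
    \<Rightarrow> real \<Rightarrow> (real^'n \<Rightarrow> real) \<Rightarrow> bool" where
  "W1q_X gm w D q f \<longleftrightarrow>
     Lq lebesgue D q f \<and>
     (\<forall>i. w i = 1 \<longrightarrow> (\<exists>g. Lq lebesgue D q g \<and> weak_hderiv gm D i f g))"

text \<open>A finite signed Radon measure on the open set D, given by its Jordan decomposition
  (mu_p - mu_n) into finite Borel measures on R^n concentrated on D.\<close>
definition fin_meas_on :: "(real^'n::finite) set \<Rightarrow> (real^'n) measure \<Rightarrow> bool" where
  "fin_meas_on D \<mu> \<longleftrightarrow> finite_measure \<mu> \<and> sets \<mu> = sets borel \<and> emeasure \<mu> (UNIV - D) = 0"

definition meas_hderiv :: "(real^'n::finite \<Rightarrow> real^'n \<Rightarrow> real^'n) \<Rightarrow> (real^'n) set \<Rightarrow> 'n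
    \<Rightarrow> (real^'n \<Rightarrow> real) \<Rightarrow> (real^'n) measure \<Rightarrow> (real^'n) measure \<Rightarrow> bool" where
  "meas_hderiv gm D i f \<mu>p \<mu>n \<longleftrightarrow>
     fin_meas_on D \<mu>p \<and> fin_meas_on D \<mu>n \<and>
     (\<forall>\<phi>. test_fn D \<phi> \<longrightarrow>
        (LINT x:D|lebesgue. f x * hX gm i \<phi> x) = - ((\<integral>x. \<phi> x \<partial>\<mu>p) - (\<integral>x. \<phi> x \<partial>\<mu>n)))"

definition BV_X :: "(real^'n::finite \<Rightarrow> real^'n \<Rightarrow> real^'n) \<Rightarrow> ('n \<Rightarrow> nat) \<Rightarrow> (real^'n) set
    \<Rightarrow> (real^'n \<Rightarrow> real) \<Rightarrow> bool" where
  "BV_X gm w D f \<longleftrightarrow>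
     Lq lebesgue D 1 f \<and>
     (\<forall>i. w i = 1 \<longrightarrow> (\<exists>\<mu>p \<mu>n. meas_hderiv gm D i f \<mu>p \<mu>n))"

definition diff_quot :: "(real^'n::finite \<Rightarrow> real^'n \<Rightarrow> real^'n) \<Rightarrow> ('n \<Rightarrow> nat) \<Rightarrow> (real^'n) set
    \<Rightarrow> real \<Rightarrow> (real^'n \<Rightarrow> real) \<Rightarrow> (real^'n) \<times> (real^'n) \<Rightarrow> real" where
  "diff_quot gm w D \<epsilon> g p =
     (let x = fst p; z = snd p; y = gm x (dil w \<epsilon> z) in
       indicator (Uball gm w 0 1) z * indicator D y * (g y - g x) / \<epsilon>)"

end

theory Submission
  imports Defs "HOL-Probability.Helly_Selection"
begin

text \<open>
  Right translations preserve Lebesgue measure, so in the pairing of the difference quotient of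
  \<open>f\<^sub>\<epsilon>\<close> with a \<open>C\<^sup>1\<close> test function the quotient can be moved onto the test function, where it
  converges uniformly; weak convergence of \<open>f\<^sub>\<epsilon>\<close> then gives the limit. Left translations and
  dilations turn the averaged oscillation bound into an \<open>L\<^sup>q\<close> bound for the difference quotients.
  Their first moments in \<open>z\<close> are bounded densities approximating \<open>X\<^sub>i f\<close>, so by vague compactness
  (transport to the unit interval by a space-filling curve, and Helly's theorem) \<open>X\<^sub>i f\<close> is a
  finite signed measure; if \<open>q > 1\<close>, Young's inequality and the Radon-Nikodym theorem give it an
  \<open>L\<^sup>q\<close> density. Finally \<open>C\<^sup>1\<close> test functions are dense enough, given the \<open>L\<^sup>q\<close> bound, to obtain
  the convergence against all test functions; no subsequence has to be extracted.
\<close>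

subsection \<open>Vague compactness of bounded densities\<close>

text \<open>The limit against each C^1 test function exists along the whole sequence: it is minus
  the pairing of f with the horizontal derivative of the test function. Subsequences serve only to
  represent this functional by measures, so the identity can be taken as the subsequence at the end.
  Moving the quotient onto the test function leaves a uniform error times the L^1 norm of
  f_\<epsilon> on a compact set; these norms are bounded because a weakly convergent sequence is
  bounded. Only X_1, ..., X_m survive in the limit, because \<delta>_\<epsilon> scales layer j by
  \<epsilon>^j and after division by \<epsilon> the layers j \<ge> 2 vanish. The moment in z_i
  isolates X_i because the unit ball of the box distance is the cube (-1,1)^n, on which different
  coordinates are orthogonal. Vague compactness needs L^1 bounds, whereas for q > 1 the moments are
  bounded in L^q only; a positive integrable weight bridges the gap and is divided out again in the
  test functions.\<close>

text \<open>Young's inequality without its constants. If b is at most a^(q-1), then a b is at most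
  a^q; otherwise a is at most b^(1/(q-1)), and a b is at most b raised to the conjugate exponent.
  The uses below ask for finiteness, or rescale the two factors first.\<close>

lemma mult_le_powr_add_powr:
  fixes a b q :: real
  assumes "a \<ge> 0" "b \<ge> 0" "q > 1"
  shows "a * b \<le> a powr q + b powr (q / (q - 1))"
proof (cases "a = 0 \<or> b = 0")
  case False
  then have pos: "a > 0" "b > 0" using assms by auto
  show ?thesis
  proof (cases "b \<le> a powr (q - 1)")
    case True
    then have "a * b \<le> a powr 1 * a powr (q - 1)" using pos by (simp add: mult_left_mono)
    also have "\<dots> = a powr q" using powr_add[of a 1 "q - 1"] by simp
    finally show ?thesis by (smt (verit) powr_ge_zero)
  next
    case F: False
    have "(a powr (q - 1)) powr (1 / (q - 1)) \<le> b powr (1 / (q - 1))"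
      using F assms by (intro powr_mono2) auto
    then have "a \<le> b powr (1 / (q - 1))" using assms pos by (simp add: powr_powr)
    then have "a * b \<le> b powr (1 / (q - 1)) * b powr 1" using pos by (simp add: mult_right_mono)
    also have "\<dots> = b powr (1 / (q - 1) + 1)" using powr_add[of b "1 / (q - 1)" 1] by simp
    also have "1 / (q - 1) + 1 = q / (q - 1)" using assms by (simp add: field_simps)
    finally show ?thesis by (smt (verit) powr_ge_zero)
  qed
qed (use assms in auto)

text \<open>Sokal's proof of the uniform boundedness principle: of the two candidates
  \<open>g + h\<close> and \<open>g - h\<close> one is mapped to a value of modulus at least that of \<open>h\<close>.\<close>

lemma integrals_bounded_imp_L1_bounded:
  fixes F :: "nat \<Rightarrow> 'a \<Rightarrow> real"
  assumes int: "\<And>k. integrable M (F k)"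
    and bdd: "\<And>g. g \<in> borel_measurable M \<Longrightarrow> (\<And>x. \<bar>g x\<bar> \<le> 1) \<Longrightarrow> Bseq (\<lambda>k. \<integral>x. F k x * g x \<partial>M)"
  shows "\<exists>B. \<forall>k. (\<integral>x. \<bar>F k x\<bar> \<partial>M) \<le> B"
proof (rule ccontr)
  assume "\<not> ?thesis"
  \<comment> \<open>The norms grow like 4^n while the test functions \<open>h n\<close> shrink like
    3^-n, so the pairings below grow like (4/3)^n.\<close>
  then have "\<forall>n. \<exists>k. (\<integral>x. \<bar>F k x\<bar> \<partial>M) > 4 ^ n" by (meson not_le)
  then obtain k where k: "\<And>n. (\<integral>x. \<bar>F (k n) x\<bar> \<partial>M) > 4 ^ n" by metis
  define I where "I n g = (\<integral>x. F (k n) x * g x \<partial>M)" for n and g :: "'a \<Rightarrow> real"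
  have [measurable]: "F n \<in> borel_measurable M" for n using int by auto
  define h where "h n x = (1/3) ^ Suc n * sgn (F (k n) x)" for n x
  have hm [measurable]: "h n \<in> borel_measurable M" for n unfolding h_def by measurable
  have hb: "\<bar>h n x\<bar> \<le> (1/3) ^ Suc n" for n x
    unfolding h_def by (auto simp: abs_mult sgn_if)
  define step where "step n g = (if \<bar>I n (\<lambda>x. g x + h n x)\<bar> \<ge> \<bar>I n (h n)\<bar> then 1 else - 1 :: real)" for n g
  define g where "g = rec_nat (\<lambda>x. 0) (\<lambda>n gn x. gn x + step n gn * h n x)"
  have g0: "g 0 x = 0" and gS: "g (Suc n) x = g n x + step n (g n) * h n x" for n x
    unfolding g_def by auto
  have step_abs: "\<bar>step n u\<bar> = 1" for n u unfolding step_def by auto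
  have gm [measurable]: "g n \<in> borel_measurable M" for n
  proof (induction n)
    case (Suc n)
    then show ?case unfolding gS[abs_def] by measurable
  qed (auto simp: g0[abs_def])
  define s where "s n x = step n (g n) * h n x" for n x
  have sb: "\<bar>s n x\<bar> \<le> (1/3) ^ Suc n" for n x
    unfolding s_def using hb by (simp add: abs_mult step_abs)
  have summ_geo: "summable (\<lambda>n. (1/3::real) ^ Suc (n + m))" for m
    using summable_ignore_initial_segment[OF summable_geometric[of "1/3::real"], of "Suc m"] by simp
  have summ: "summable (\<lambda>n. \<bar>s n x\<bar>)" for x
    by (rule summable_comparison_test'[OF summ_geo[of 0], of 0]) (use sb[of _ x] in auto)
  then have summ': "summable (\<lambda>n. s n x)" for x by (rule summable_rabs_cancel)
  define G where "G x = (\<Sum>n. s n x)" for x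
  have g_sum: "g n x = (\<Sum>i<n. s i x)" for n x
    by (induction n) (auto simp: g0 gS s_def)
  have Gm: "G \<in> borel_measurable M" unfolding G_def s_def by measurable
  \<comment> \<open>With ratio 1/3, \<open>G\<close> deviates from \<open>g (Suc n)\<close> by at
    most half the size of \<open>h n\<close>. The corrections made after stage n therefore cannot
    undo what stage n has gained.\<close>
  have geo_tail: "(\<Sum>i. (1/3::real) ^ Suc (i + m)) = (1/2) * (1/3) ^ m" for m
  proof -
    have "(\<Sum>i. (1/3::real) ^ Suc (i + m)) = (\<Sum>i. (1/3) ^ Suc m * (1/3) ^ i)"
      by (simp add: power_add mult_ac)
    also have "\<dots> = (1/3) ^ Suc m * (\<Sum>i. (1/3) ^ i)"
      by (rule suminf_mult) (simp add: summable_geometric)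
    also have "(\<Sum>i. (1/3::real) ^ i) = 3/2" by (subst suminf_geometric) auto
    finally show ?thesis by simp
  qed
  have tail: "\<bar>G x - g n x\<bar> \<le> (1/2) * (1/3) ^ n" for n x
  proof -
    have "G x - g n x = (\<Sum>i. s (i + n) x)"
      unfolding G_def g_sum using suminf_split_initial_segment[OF summ', of x n] by simp
    moreover have "\<bar>\<Sum>i. s (i + n) x\<bar> \<le> (\<Sum>i. (1/3) ^ Suc (i + n))"
      using sb by (intro norm_suminf_le[where 'a=real, simplified]) (auto intro: summ_geo[simplified])
    ultimately show ?thesis using geo_tail[of n] by linarith
  qed
  have Gb: "\<bar>G x\<bar> \<le> 1" for x using tail[of x 0] g0 by auto
  have intb: "integrable M (\<lambda>x. F n x * u x)"
    if "u \<in> borel_measurable M" "\<And>x. \<bar>u x\<bar> \<le> c" for n u c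
  proof (rule Bochner_Integration.integrable_bound[of _ "\<lambda>x. c * \<bar>F n x\<bar>"])
    show "AE x in M. norm (F n x * u x) \<le> norm (c * \<bar>F n x\<bar>)"
    proof (rule AE_I2)
      fix x
      have "\<bar>u x\<bar> * \<bar>F n x\<bar> \<le> \<bar>c\<bar> * \<bar>F n x\<bar>"
        by (rule mult_right_mono) (use that(2)[of x] in auto)
      then show "norm (F n x * u x) \<le> norm (c * \<bar>F n x\<bar>)"
        by (simp add: abs_mult mult.commute)
    qed
  qed (use that int[of n] in auto)
  have gb: "\<bar>g n x\<bar> \<le> 2" for n x
  proof -
    have "(1/3::real) ^ n \<le> 1" by (rule power_le_one) auto
    then show ?thesis using tail[of x n] Gb[of x] by linarith
  qed
  have Ih: "I n (h n) = (1/3) ^ Suc n * (\<integral>x. \<bar>F (k n) x\<bar> \<partial>M)" for n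
    unfolding I_def h_def by (simp add: mult.left_commute abs_sgn flip: integral_mult_right_zero)
  have hi: "\<bar>I n (g (Suc n))\<bar> \<ge> \<bar>I n (h n)\<bar>" for n
  proof -
    have hb1: "\<bar>h n x\<bar> \<le> 1" for x
      using hb[of n x] power_le_one[of "1/3::real" "Suc n"] by linarith
    have a: "I n (\<lambda>x. g n x + c * h n x) = I n (g n) + c * I n (h n)" for c
      unfolding I_def
      using intb[of "g n" 2 "k n"] intb[of "h n" 1 "k n"] gb[of n] hb1
      by (simp add: distrib_left Bochner_Integration.integral_add mult.left_commute[of _ c])
    have "I n (g (Suc n)) = I n (g n) + step n (g n) * I n (h n)"
      using a[of "step n (g n)"] ext[of "g (Suc n)", OF gS] by simp
    \<comment> \<open>When the plus sign is rejected, 2 I(h) = I(g + h) - I(g - h) forces the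
      modulus of I(g - h) to be at least that of I(h).\<close>
    then show ?thesis unfolding step_def using a[of 1] by (auto split: if_splits)
  qed
  have diff: "\<bar>I n G - I n (g (Suc n))\<bar> \<le> (1/2) * (1/3) ^ Suc n * (\<integral>x. \<bar>F (k n) x\<bar> \<partial>M)" for n
  proof -
    have "I n G - I n (g (Suc n)) = (\<integral>x. F (k n) x * (G x - g (Suc n) x) \<partial>M)"
      unfolding I_def using intb[of "g (Suc n)" 2 "k n"] intb[of G 1 "k n"] gb[of "Suc n"] Gb Gm
      by (simp add: right_diff_distrib)
    also have "\<bar>\<dots>\<bar> \<le> (\<integral>x. \<bar>F (k n) x\<bar> * ((1/2) * (1/3) ^ Suc n) \<partial>M)"
    proof (rule order_trans[OF integral_abs_bound], rule integral_mono)
      show "integrable M (\<lambda>x. \<bar>F (k n) x * (G x - g (Suc n) x)\<bar>)"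
        using intb[of "\<lambda>x. G x - g (Suc n) x" "(1/2) * (1/3) ^ Suc n" "k n"] tail[of _ "Suc n"] Gm by auto
      show "integrable M (\<lambda>x. \<bar>F (k n) x\<bar> * ((1/2) * (1/3) ^ Suc n))" using int by auto
      show "\<bar>F (k n) x * (G x - g (Suc n) x)\<bar> \<le> \<bar>F (k n) x\<bar> * ((1/2) * (1/3) ^ Suc n)" for x
        unfolding abs_mult by (rule mult_left_mono[OF tail[of x "Suc n"]]) simp
    qed
    finally show ?thesis by (simp add: mult_ac)
  qed
  \<comment> \<open>Half of the gain \<open>I n (h n)\<close> survives the later corrections, and
    1/2 times 3^-(n+1) times 4^n is 1/6 times (4/3)^n.\<close>
  have big: "\<bar>I n G\<bar> \<ge> (1/6) * (4/3) ^ n" for n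
  proof -
    have "\<bar>I n G\<bar> \<ge> (1/2) * (1/3) ^ Suc n * (\<integral>x. \<bar>F (k n) x\<bar> \<partial>M)"
    proof -
      have "\<bar>I n (h n)\<bar> = (1/3) ^ Suc n * (\<integral>x. \<bar>F (k n) x\<bar> \<partial>M)" unfolding Ih by simp
      then show ?thesis using hi[of n] diff[of n] by linarith
    qed
    moreover have "(1/2) * (1/3) ^ Suc n * (\<integral>x. \<bar>F (k n) x\<bar> \<partial>M) \<ge> (1/2) * (1/3::real) ^ Suc n * 4 ^ n"
      using k[of n] by (intro mult_left_mono) auto
    moreover have "(1/2) * (1/3::real) ^ Suc n * 4 ^ n = (1/6) * (4/3) ^ n"
      by (simp add: power_divide)
    ultimately show ?thesis by linarith
  qed
  obtain B where B: "\<And>n. \<bar>\<integral>x. F n x * G x \<partial>M\<bar> \<le> B"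
    using bdd[OF Gm Gb] unfolding Bseq_def by (metis real_norm_def)
  obtain n where "(4/3::real) ^ n > 6 * B" using real_arch_pow[of "4/3::real" "6 * B"] by auto
  with big[of n] B[of "k n"] show False unfolding I_def by linarith
qed

section \<open>Digit expansions and a space-filling curve\<close>

text \<open>Iterate the doubling map: \<open>r k\<close> is the remainder after k digits, scaled
  back to the unit interval, and \<open>c k\<close> is the next digit. The identity
  \<open>eq\<close> bounds the error of the partial sums by 2^-k.\<close>

lemma binary_expansion:
  fixes x :: real
  assumes "0 \<le> x" "x \<le> 1"
  shows "\<exists>c::nat \<Rightarrow> real. (\<forall>k. c k = 0 \<or> c k = 1) \<and> (\<lambda>k. c k / 2 ^ Suc k) sums x"
proof -
  define r where "r = rec_nat x (\<lambda>_ y. 2 * y - (if y \<ge> 1/2 then 1 else 0 :: real))"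
  define c where "c k = (if r k \<ge> 1/2 then 1 else 0 :: real)" for k
  have r0: "r 0 = x" and rS: "r (Suc k) = 2 * r k - c k" for k
    unfolding r_def c_def by auto
  have rb: "0 \<le> r k \<and> r k \<le> 1" for k
    by (induction k) (use assms in \<open>auto simp: r0 rS c_def\<close>)
  have eq: "x - (\<Sum>i<k. c i / 2 ^ Suc i) = r k / 2 ^ k" for k
    by (induction k) (auto simp: r0 rS field_simps)
  have "(\<lambda>k. r k / 2 ^ k) \<longlonglongrightarrow> 0"
  proof (rule Lim_null_comparison)
    show "\<forall>\<^sub>F k in sequentially. norm (r k / 2 ^ k) \<le> (1/2) ^ k"
      using rb by (auto simp: power_divide divide_right_mono)
    show "(\<lambda>k. (1/2::real) ^ k) \<longlonglongrightarrow> 0" by (rule LIMSEQ_power_zero) auto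
  qed
  then have "(\<lambda>k. x - (\<Sum>i<k. c i / 2 ^ Suc i)) \<longlonglongrightarrow> 0" unfolding eq .
  then have "(\<lambda>k. x - (x - (\<Sum>i<k. c i / 2 ^ Suc i))) \<longlonglongrightarrow> x - 0" by (intro tendsto_intros)
  then have "(\<lambda>k. c k / 2 ^ Suc k) sums x" unfolding sums_def by simp
  moreover have "\<forall>k. c k = 0 \<or> c k = 1" unfolding c_def by auto
  ultimately show ?thesis by blast
qed

text \<open>A clamped cosine, equal to 0 on [0, 1/3] and to 1 on [2/3, 1], the two pieces left when
  the middle third of the unit interval is removed. The flat pieces come from cos(pi/3) = 1/2 and
  cos(2 pi/3) = -1/2.\<close>

definition digit_fn :: "real \<Rightarrow> real" where
  "digit_fn t = max 0 (min 1 (1/2 - cos (pi * t)))"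

text \<open>\<open>digit_fn (3 ^ k * t)\<close> reads off the \<open>k\<close>-th digit of a point \<open>t\<close> of the Cantor set:
  the earlier digits contribute an even integer, and \<open>digit_fn\<close> has period 2.\<close>

lemma digit_fn_ternary:
  fixes c :: "nat \<Rightarrow> real"
  assumes c: "\<And>k. c k = 0 \<or> c k = 1" and t: "(\<lambda>k. 2 * c k / 3 ^ Suc k) sums t"
  shows "digit_fn (3 ^ k * t) = c k"
proof -
  have summ: "summable (\<lambda>i. 2 * c i / 3 ^ Suc i)" and t_eq: "t = (\<Sum>i. 2 * c i / 3 ^ Suc i)"
    using t by (auto simp: sums_iff)
  \<comment> \<open>The digits after position k, rescaled; as ternary digits are at most 2,
    \<open>s\<close> lies in [0, 1].\<close>
  define s where "s = (\<Sum>i. 2 * c (i + Suc k) / 3 ^ Suc i)"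
  have summ1: "summable (\<lambda>i. 2 * c (i + m) / 3 ^ Suc i)" for m
  proof -
    have "summable (\<lambda>i. 3 ^ m * (2 * c (i + m) / 3 ^ Suc (i + m)))"
      using summable_ignore_initial_segment[OF summ, of m] by (rule summable_mult)
    then show ?thesis by (simp add: power_add)
  qed
  have geo: "(\<lambda>i. 2 / 3 ^ Suc i) sums (1::real)"
  proof -
    have "(\<lambda>i. (2/3) * (1/3::real) ^ i) sums ((2/3) * (1 / (1 - 1/3)))"
      by (intro sums_mult geometric_sums) auto
    then show ?thesis by (simp add: power_divide)
  qed
  have s_nonneg: "s \<ge> 0" unfolding s_def using c
    by (intro suminf_nonneg summ1) (metis divide_nonneg_nonneg mult_nonneg_nonneg order_refl zero_le_numeral zero_le_one zero_le_power)
  have "s \<le> (\<Sum>i. 2 / 3 ^ Suc i)" unfolding s_def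
  proof (intro suminf_le summ1)
    show "2 * c (i + Suc k) / 3 ^ Suc i \<le> 2 / 3 ^ Suc i" for i
      using c[of "i + Suc k"] by auto
  qed (use geo in \<open>auto simp: sums_iff\<close>)
  then have s_le: "s \<le> 1" using geo by (simp add: sums_iff)
  \<comment> \<open>The digits before position k, multiplied by 3^k, add up to the even integer 2
    N.\<close>
  define N where "N = (\<Sum>i<k. nat \<lfloor>c i\<rfloor> * 3 ^ (k - Suc i))"
  have "t = (\<Sum>i. 2 * c (i + Suc k) / 3 ^ Suc (i + Suc k)) + (\<Sum>i<Suc k. 2 * c i / 3 ^ Suc i)"
    unfolding t_eq by (rule suminf_split_initial_segment[OF summ])
  also have "(\<Sum>i. 2 * c (i + Suc k) / 3 ^ Suc (i + Suc k)) = s / 3 ^ Suc k"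
    unfolding s_def by (subst suminf_divide[symmetric, OF summ1]) (simp add: power_add)
  finally have "3 ^ k * t = s / 3 + 3 ^ k * (\<Sum>i<k. 2 * c i / 3 ^ Suc i) + 2 * c k / 3"
    by (simp add: field_simps)
  also have "3 ^ k * (\<Sum>i<k. 2 * c i / 3 ^ Suc i) = 2 * real N"
    unfolding N_def of_nat_sum sum_distrib_left
  proof (rule sum.cong)
    fix i assume "i \<in> {..<k}"
    then have pw: "(3::real) ^ k = 3 ^ (k - Suc i) * 3 ^ Suc i"
      using power_add[of "3::real" "k - Suc i" "Suc i"] by simp
    show "3 ^ k * (2 * c i / 3 ^ Suc i) = 2 * real (nat \<lfloor>c i\<rfloor> * 3 ^ (k - Suc i))"
      using c[of i] unfolding pw by auto
  qed simp
  finally have eq: "3 ^ k * t = (s + 2 * c k) / 3 + 2 * real N" by simp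
  \<comment> \<open>\<open>u\<close> lies in [0, 1/3] if digit k is 0 and in [2/3, 1] if it is 1,
    exactly the pieces on which \<open>digit_fn\<close> is constant.\<close>
  define u where "u = (s + 2 * c k) / 3"
  have per: "cos (pi * (u + 2 * real N)) = cos (pi * u)"
  proof -
    have "pi * (u + 2 * real N) = pi * u + 2 * real N * pi" by (simp add: algebra_simps)
    then show ?thesis by (simp add: cos_add cos_2npi sin_2npi)
  qed
  have c60: "cos (pi / 3) = 1/2" by (rule cos_60)
  have "cos (pi * u) \<ge> cos (pi * (1/3))" if "c k = 0"
    using s_nonneg s_le that by (intro cos_monotone_0_pi_le mult_left_mono mult_nonneg_nonneg) (auto simp: u_def)
  moreover have "cos (pi * u) \<le> cos (pi * (2/3))" if "c k = 1"
    using s_nonneg s_le that mult_left_le[of u pi]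
    by (intro cos_monotone_0_pi_le mult_left_mono mult_nonneg_nonneg) (auto simp: u_def)
  moreover have "cos (pi * (2/3)) = - 1/2" using c60 cos_pi_minus[of "pi / 3"] by (simp add: field_simps)
  ultimately show ?thesis
    unfolding eq digit_fn_def u_def[symmetric] per using c[of k] c60 by auto
qed

text \<open>Schoenberg's construction.\<close>

lemma space_filling_curve:
  "\<exists>\<gamma>::real \<Rightarrow> 'a::euclidean_space. continuous_on UNIV \<gamma> \<and> \<gamma> 0 = 0 \<and>
      (\<forall>x\<in>cbox 0 One. \<exists>t\<in>{0..1}. \<gamma> t = x)"
proof -
  let ?n = "DIM('a)"
  obtain e where e: "bij_betw e (Basis::'a set) {0..<?n}"
    using ex_bij_betw_finite_nat[OF finite_Basis] by blast
  \<comment> \<open>Coordinate b reads the ternary positions congruent to \<open>e b\<close> modulo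
    the dimension and uses them as its binary digits.\<close>
  define g where "g b t = (\<Sum>k. digit_fn (3 ^ (?n * k + e b) * t) / 2 ^ Suc k)" for b :: 'a and t
  have db: "0 \<le> digit_fn t \<and> digit_fn t \<le> 1" for t unfolding digit_fn_def by auto
  have summ2: "summable (\<lambda>k. 1 / 2 ^ Suc k :: real)"
    using summable_mult[OF summable_geometric[of "1/2::real"], of "1/2"] by (simp add: power_divide)
  have cont: "continuous_on UNIV (g b)" for b
  proof (rule uniform_limit_theorem)
    show "uniform_limit UNIV (\<lambda>n t. \<Sum>k<n. digit_fn (3 ^ (?n * k + e b) * t) / 2 ^ Suc k) (g b) sequentially"
      unfolding g_def by (rule Weierstrass_m_test[OF _ summ2]) (use db in \<open>auto intro!: divide_right_mono\<close>)
    show "\<forall>\<^sub>F n in sequentially. continuous_on UNIV (\<lambda>t. \<Sum>k<n. digit_fn (3 ^ (?n * k + e b) * t) / 2 ^ Suc k)"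
      unfolding digit_fn_def by (intro always_eventually allI continuous_intros) auto
  qed simp
  define \<gamma> where "\<gamma> t = (\<Sum>b\<in>Basis. g b t *\<^sub>R b)" for t
  have "continuous_on UNIV \<gamma>" unfolding \<gamma>_def by (intro continuous_intros cont)
  moreover have "\<gamma> 0 = 0" unfolding \<gamma>_def g_def by (simp add: digit_fn_def)
  moreover have "\<exists>t\<in>{0..1}. \<gamma> t = x" if x: "x \<in> cbox 0 One" for x
  proof -
    have "\<forall>b\<in>Basis. \<exists>c::nat \<Rightarrow> real. (\<forall>k. c k = 0 \<or> c k = 1) \<and> (\<lambda>k. c k / 2 ^ Suc k) sums (x \<bullet> b)"
      using x by (intro ballI binary_expansion) (auto simp: mem_box)
    then obtain c :: "'a \<Rightarrow> nat \<Rightarrow> real" where c: "\<And>b k. b \<in> Basis \<Longrightarrow> c b k = 0 \<or> c b k = 1"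
      and cs: "\<And>b. b \<in> Basis \<Longrightarrow> (\<lambda>k. c b k / 2 ^ Suc k) sums (x \<bullet> b)" by metis
    \<comment> \<open>Interleaves the binary digits of all coordinates: digit m belongs to the basis
      vector with number m mod n, as its digit m div n. Doubled, these are the ternary digits of the
      parameter t.\<close>
    define d where "d m = c (inv_into Basis e (m mod ?n)) (m div ?n)" for m
    have inv: "inv_into Basis e (m mod ?n) \<in> Basis" for m
      using e by (intro inv_into_into) (auto simp: bij_betw_def)
    have d01: "d m = 0 \<or> d m = 1" for m unfolding d_def by (rule c[OF inv])
    have geo: "(\<lambda>i. 2 / 3 ^ Suc i) sums (1::real)"
    proof -
      have "(\<lambda>i. (2/3) * (1/3::real) ^ i) sums ((2/3) * (1 / (1 - 1/3)))"
        by (intro sums_mult geometric_sums) auto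
      then show ?thesis by (simp add: power_divide)
    qed
    have le: "0 \<le> 2 * d i / 3 ^ Suc i \<and> 2 * d i / 3 ^ Suc i \<le> 2 / 3 ^ Suc i" for i
      using d01[of i] by auto
    have "norm (2 * d i / 3 ^ Suc i) \<le> 2 / 3 ^ Suc i" for i
      using d01[of i] by auto
    then have summ: "summable (\<lambda>i. 2 * d i / 3 ^ Suc i)"
      by (intro summable_comparison_test'[OF sums_summable[OF geo], of 0 "\<lambda>i. 2 * d i / 3 ^ Suc i"])
    define t where "t = (\<Sum>i. 2 * d i / 3 ^ Suc i)"
    have ts: "(\<lambda>i. 2 * d i / 3 ^ Suc i) sums t" unfolding t_def using summ by (rule summable_sums)
    have "t \<ge> 0" unfolding t_def by (rule suminf_nonneg[OF summ]) (use le in auto)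
    moreover have "t \<le> 1" unfolding t_def using geo le
      by (subst sums_unique[OF geo]) (intro suminf_le summ, auto simp: sums_iff)
    moreover have "g b t = x \<bullet> b" if b: "b \<in> Basis" for b
    proof -
      have lt: "e b < ?n" using e b by (auto simp: bij_betw_def)
      have "digit_fn (3 ^ (?n * k + e b) * t) = c b k" for k
        using digit_fn_ternary[OF d01 ts, of "?n * k + e b"] lt b e
        by (simp add: d_def bij_betw_def inv_into_f_f)
      then show ?thesis unfolding g_def using cs[OF b] by (simp add: sums_iff)
    qed
    ultimately show ?thesis
      unfolding \<gamma>_def using euclidean_representation[of x] by (intro bexI[of _ t]) auto
  qed
  ultimately show ?thesis by blast
qed

section \<open>The open unit cube as a chart of the whole space; vague compactness\<close>

text \<open>The curve is known to reach the points of the unit cube. This arctan chart, inverted by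
  \<open>cube_decode\<close>, carries the whole space onto the interior of the cube, so that
  measures on the space can be transported to the parameter interval.\<close>

definition cube_code :: "'a::euclidean_space \<Rightarrow> 'a" where
  "cube_code x = (\<Sum>b\<in>Basis. (arctan (x \<bullet> b) / pi + 1/2) *\<^sub>R b)"

definition cube_decode :: "'a::euclidean_space \<Rightarrow> 'a" where
  "cube_decode y = (\<Sum>b\<in>Basis. tan (pi * (y \<bullet> b - 1/2)) *\<^sub>R b)"

text \<open>Continuity of \<open>cube_decode\<close> is asserted on the open cube, because the
  tangent blows up at the boundary. Borel measurability is asserted everywhere, because a
  push-forward requires a total measurable map.\<close>

lemma cube_code:
    "continuous_on UNIV (cube_code :: 'a::euclidean_space \<Rightarrow> 'a)" "\<And>x::'a. cube_code x \<in> box 0 One" "\<And>x::'a. cube_decode (cube_code x) = x"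
    "\<And>y::'a. y \<in> box 0 One \<Longrightarrow> cube_code (cube_decode y) = y" "continuous_on (box 0 One) (cube_decode :: 'a \<Rightarrow> 'a)" "(cube_decode :: 'a \<Rightarrow> 'a) \<in> borel_measurable borel"
proof -
  show "continuous_on UNIV (cube_code :: 'a \<Rightarrow> 'a)" unfolding cube_code_def[abs_def] by (intro continuous_intros) auto
  show "cube_code x \<in> box 0 One" for x :: 'a
  proof -
    have "0 < arctan t / pi + 1/2 \<and> arctan t / pi + 1/2 < 1" for t
      using arctan_bounded[of t] by (auto simp: field_simps)
    then show ?thesis by (simp add: cube_code_def mem_box)
  qed
  show "cube_decode (cube_code x) = x" for x :: 'a
  proof -
    have "tan (pi * (cube_code x \<bullet> b - 1/2)) = x \<bullet> b" if "b \<in> Basis" for b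
      using that by (simp add: cube_code_def[abs_def] tan_arctan)
    then show ?thesis unfolding cube_decode_def[abs_def] using euclidean_representation[of x] by simp
  qed
  have rng: "- (pi/2) < pi * (t - 1/2) \<and> pi * (t - 1/2) < pi/2" if "0 < t" "t < 1" for t
    using that by (auto simp: algebra_simps)
  show "cube_code (cube_decode y) = y" if "y \<in> box 0 One" for y :: 'a
  proof -
    have "arctan (cube_decode y \<bullet> b) / pi + 1/2 = y \<bullet> b" if b: "b \<in> Basis" for b
    proof -
      have "arctan (tan (pi * (y \<bullet> b - 1/2))) = pi * (y \<bullet> b - 1/2)"
        using rng[of "y \<bullet> b"] \<open>y \<in> box 0 One\<close> b by (intro arctan_tan) (auto simp: mem_box)
      then show ?thesis using b by (simp add: cube_decode_def[abs_def])
    qed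
    then show ?thesis unfolding cube_code_def[abs_def] using euclidean_representation[of y] by simp
  qed
  show "continuous_on (box 0 One) (cube_decode :: 'a \<Rightarrow> 'a)"
  proof -
    have "cos (pi * (x \<bullet> b - 1/2)) \<noteq> 0" if "x \<in> box 0 One" "b \<in> Basis" for x b :: 'a
      using that rng[of "x \<bullet> b"] cos_gt_zero_pi[of "pi * (x \<bullet> b - 1/2)"] by (auto simp: mem_box)
    then show ?thesis unfolding cube_decode_def[abs_def] tan_def by (intro continuous_intros) auto
  qed
  show "(cube_decode :: 'a \<Rightarrow> 'a) \<in> borel_measurable borel" unfolding cube_decode_def[abs_def] tan_def by measurable
qed

text \<open>A bounded sequence of densities is transported to the unit interval by a Borel section of a
  space-filling curve, where Helly's theorem applies. Translating unit cubes to infinity turns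
  the densities into probability densities without affecting compactly supported test functions.\<close>

lemma vague_compactness:
  fixes h :: "nat \<Rightarrow> 'a::euclidean_space \<Rightarrow> real"
  assumes hm [measurable]: "\<And>k. h k \<in> borel_measurable borel" and h0: "\<And>k x. 0 \<le> h k x"
    and hC: "\<And>k. (\<integral>\<^sup>+x. ennreal (h k x) \<partial>lborel) \<le> ennreal C"
  shows "\<exists>r \<mu>. strict_mono (r :: nat \<Rightarrow> nat) \<and> finite_measure \<mu> \<and> sets \<mu> = sets borel \<and>
    (\<forall>\<phi>. continuous_on UNIV \<phi> \<and> compact (csupp \<phi>) \<longrightarrow>
       (\<lambda>k. \<integral>x. \<phi> x * h (r k) x \<partial>lborel) \<longlonglongrightarrow> (\<integral>x. \<phi> x \<partial>\<mu>))"
proof -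
  obtain \<gamma> :: "real \<Rightarrow> 'a" where \<gamma>c: "continuous_on UNIV \<gamma>"
    and \<gamma>s: "\<And>x. x \<in> cbox 0 One \<Longrightarrow> \<exists>t\<in>{0..1}. \<gamma> t = x"
    using space_filling_curve by blast
  define E Ei where "E = (cube_code :: 'a \<Rightarrow> 'a)" and "Ei = (cube_decode :: 'a \<Rightarrow> 'a)"
  note E = cube_code[where 'a='a, folded E_def Ei_def]
  have Eim [measurable]: "Ei \<in> borel_measurable borel" by (rule E(6))
  have Em [measurable]: "E \<in> borel_measurable borel" using E(1) by (rule borel_measurable_continuous_onI)
  have \<gamma>m [measurable]: "\<gamma> \<in> borel_measurable borel" using \<gamma>c by (rule borel_measurable_continuous_onI)
  \<comment> \<open>All parameters at which the curve meets the code of x. The least of them is a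
    section of the curve, and it is Borel because \<open>s x \<le> a\<close> says that the code of x
    lies in a compact set, the image of \<open>{0..1} \<inter> {..a}\<close> under the
    curve.\<close>
  define T where "T x = {t\<in>{0..1}. \<gamma> t = E x}" for x
  define s where "s x = Inf (T x)" for x
  have T_ne: "T x \<noteq> {}" for x
    using \<gamma>s[of "E x"] E(2)[of x] box_subset_cbox[of 0 "One::'a"] by (fastforce simp: T_def)
  have T_cl: "closed (T x)" for x
  proof -
    have "T x = {0..1} \<inter> \<gamma> -` {E x}" unfolding T_def by auto
    then show ?thesis
      using closed_vimage[of "{E x}" \<gamma>] \<gamma>c by (auto intro!: closed_Int simp: closed_vimage)
  qed
  have T_bdd: "bdd_below (T x)" for x unfolding T_def by (rule bdd_belowI[of _ 0]) auto
  have sT: "s x \<in> T x" for x unfolding s_def by (rule closed_contains_Inf[OF T_ne T_bdd T_cl])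
  have s_le: "s x \<le> a \<longleftrightarrow> E x \<in> \<gamma> ` ({0..1} \<inter> {..a})" for x a
  proof
    assume "s x \<le> a"
    then show "E x \<in> \<gamma> ` ({0..1} \<inter> {..a})" using sT[of x] unfolding T_def by (auto intro!: image_eqI[of _ _ "s x"])
  next
    assume "E x \<in> \<gamma> ` ({0..1} \<inter> {..a})"
    then obtain t where "t \<in> T x" "t \<le> a" unfolding T_def by auto
    then show "s x \<le> a" unfolding s_def using cInf_lower[OF _ T_bdd, of t x] by simp
  qed
  have sm [measurable]: "s \<in> borel_measurable borel"
  proof (rule borel_measurableI_le)
    fix a
    have "compact (\<gamma> ` ({0..1} \<inter> {..a}))"
      by (intro compact_continuous_image compact_Int_closed continuous_on_subset[OF \<gamma>c]) auto
    then have "closed (\<gamma> ` ({0..1} \<inter> {..a}))" by (rule compact_imp_closed)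
    then have "E -` (\<gamma> ` ({0..1} \<inter> {..a})) \<inter> space borel \<in> sets borel" by measurable
    then show "{x \<in> space borel. s x \<le> a} \<in> sets borel" unfolding s_le by (simp add: vimage_def)
  qed
  have \<gamma>sx: "\<gamma> (s x) = E x" and s01: "s x \<in> {0..1}" for x using sT[of x] unfolding T_def by auto
  define C' where "C' = max C 1"
  have C': "C' > 0" "C \<le> C'" unfolding C'_def by auto
  have hi: "integrable lborel (h k)" for k
    using hC[of k] h0 by (intro integrableI_bounded) (auto intro: le_less_trans[OF _ ennreal_less_top])
  define m where "m k = (\<integral>x. h k x \<partial>lborel)" for k
  have m0: "0 \<le> m k" for k unfolding m_def using h0 by simp
  have mC: "m k \<le> C'" for k
  proof -
    have "ennreal (m k) \<le> ennreal C'"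
      unfolding m_def using hC[of k] C' by (subst nn_integral_eq_integral[OF hi, symmetric]) (auto simp: h0 intro: order_trans ennreal_leI)
    then show ?thesis using C' by simp
  qed
  define Q where "Q k = cbox (real k *\<^sub>R One) (real (Suc k) *\<^sub>R One :: 'a)" for k
  have Qe: "emeasure lborel (Q k) = 1" for k
    unfolding Q_def by (subst emeasure_lborel_cbox) (auto simp: algebra_simps inner_diff_left)
  have Qm [measurable]: "Q k \<in> sets borel" for k unfolding Q_def by auto
  \<comment> \<open>\<open>C' - m k\<close> is the mass by which \<open>h k\<close> falls short of
    C'. Placing it on \<open>Q k\<close>, a cube of volume one, gives total mass C', and division by
    C' normalises.\<close>
  define p where "p k x = (h k x + (C' - m k) * indicator (Q k) x) / C'" for k x
  have p0: "0 \<le> p k x" for k x unfolding p_def using h0 mC C' by (auto intro!: divide_nonneg_pos add_nonneg_nonneg)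
  have pm [measurable]: "p k \<in> borel_measurable borel" for k unfolding p_def by measurable
  have Qi: "integrable lborel (\<lambda>x. indicator (Q k) x :: real)" for k using Qe[of k] by (intro integrable_real_indicator) auto
  have pi: "integrable lborel (p k)" for k unfolding p_def using hi Qi by auto
  have "(\<integral>x. p k x \<partial>lborel) = 1" for k
    unfolding p_def using hi[of k] Qi[of k] C' Qe[of k] by (simp add: measure_def m_def[symmetric])
  then have pn: "(\<integral>\<^sup>+x. ennreal (p k x) \<partial>lborel) = 1" for k
    using nn_integral_eq_integral[OF pi, of k] p0 by simp
  define M where "M k = distr (density lborel (\<lambda>x. ennreal (p k x))) borel s" for k
  have M_prob: "real_distribution (M k)" for k
  proof -
    have "prob_space (density lborel (\<lambda>x. ennreal (p k x)))"
      by (rule prob_spaceI) (simp add: emeasure_density pn)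
    then have "prob_space (M k)" unfolding M_def by (rule prob_space.prob_space_distr) simp
    then show ?thesis unfolding real_distribution_def real_distribution_axioms_def by (simp add: M_def)
  qed
  \<comment> \<open>All laws live on the unit interval, so tightness is automatic; a half-open
    interval is what the definition of \<open>tight\<close> asks for.\<close>
  have M1: "measure (M n) {- 1<..1} = 1" for n
  proof -
    interpret real_distribution "M n" by (rule M_prob)
    have "AE t in M n. t \<in> {- 1<..1}"
    proof -
      have "s x \<in> {- 1<..1}" for x using s01[of x] by simp
      then show ?thesis unfolding M_def by (subst AE_distr_iff) (simp_all del: greaterThanAtMost_iff)
    qed
    moreover have "{- 1<..1::real} \<in> sets (M n)" by (simp add: M_def)
    ultimately show ?thesis using prob_eq_1 by blast
  qed
  have tight: "tight M" unfolding tight_def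
  proof (intro conjI allI impI)
    fix \<epsilon> :: real assume "\<epsilon> > 0"
    then have "\<forall>n. 1 - \<epsilon> < measure (M n) {- 1<..1}" using M1 by simp
    moreover have "(- 1 :: real) < 1" by simp
    ultimately show "\<exists>a b. a < b \<and> (\<forall>n. 1 - \<epsilon> < measure (M n) {a<..b})" by blast
  qed (rule M_prob)
  obtain r N where r: "strict_mono (r :: nat \<Rightarrow> nat)" and N: "real_distribution N"
    and conv: "weak_conv_m (M \<circ> id \<circ> r) N"
    using tight_imp_convergent_subsubsequence[OF tight strict_mono_id] by blast
  interpret N: real_distribution N by (rule N)
  have setsN [measurable_cong]: "sets N = sets borel" by simp
  \<comment> \<open>The part of the limit law lying over the open cube, sent back to the space. What
    lies elsewhere is mass that was lost at infinity and is discarded. The factor C' undoes the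
    normalisation.\<close>
  define \<mu> where "\<mu> = distr (density N (\<lambda>t. ennreal (C' * indicator (\<gamma> -` box 0 One) t))) borel (Ei \<circ> \<gamma>)"
  have \<gamma>box [measurable]: "\<gamma> -` box 0 One \<in> sets borel"
    using measurable_sets[OF \<gamma>m, of "box 0 One"] by simp
  have fin: "finite_measure \<mu>"
  proof (rule finite_measureI)
    have "emeasure \<mu> (space \<mu>) = (\<integral>\<^sup>+t. ennreal (C' * indicator (\<gamma> -` box 0 One) t) \<partial>N)"
      unfolding \<mu>_def by (subst emeasure_distr) (auto simp: emeasure_density)
    also have "\<dots> \<le> (\<integral>\<^sup>+t. ennreal C' \<partial>N)"
      using C' by (intro nn_integral_mono ennreal_leI) (auto simp: indicator_def)
    also have "\<dots> = ennreal C'" by (simp add: N.emeasure_space_1[unfolded N.space_eq_univ])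
    finally show "emeasure \<mu> (space \<mu>) \<noteq> \<infinity>" by (auto simp: top_unique)
  qed
  have main: "(\<lambda>k. \<integral>x. \<phi> x * h (r k) x \<partial>lborel) \<longlonglongrightarrow> (\<integral>x. \<phi> x \<partial>\<mu>)"
    if \<phi>: "continuous_on UNIV \<phi>" "compact (csupp \<phi>)" for \<phi>
  proof -
    have \<phi>m [measurable]: "\<phi> \<in> borel_measurable borel" using \<phi>(1) by (rule borel_measurable_continuous_onI)
    have \<phi>0: "\<phi> x = 0" if "x \<notin> csupp \<phi>" for x
      using that closure_subset[of "{x. \<phi> x \<noteq> 0}"] unfolding csupp_def by auto
    obtain B where B: "\<And>x. \<bar>\<phi> x\<bar> \<le> B"
    proof -
      have "bounded (\<phi> ` csupp \<phi>)"
        by (intro compact_imp_bounded compact_continuous_image continuous_on_subset[OF \<phi>(1)] \<phi>(2)) auto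
      then obtain B where "\<forall>x\<in>csupp \<phi>. \<bar>\<phi> x\<bar> \<le> B" unfolding bounded_iff by auto
      then have "\<bar>\<phi> x\<bar> \<le> max B 0" for x using \<phi>0[of x] by (cases "x \<in> csupp \<phi>") fastforce+
      then show ?thesis using that by blast
    qed
    \<comment> \<open>The coded support of the test function is a compact subset of the open cube,
      so \<open>\<psi>\<close> vanishes near the boundary of the cube; this makes the extension by
      zero continuous.\<close>
    define \<psi> where "\<psi> y = (if y \<in> box 0 One then \<phi> (Ei y) else 0)" for y
    have \<psi>E: "\<psi> (E x) = \<phi> x" for x unfolding \<psi>_def using E(2,3) by simp
    have Ecl: "closed (E ` csupp \<phi>)"
      by (intro compact_imp_closed compact_continuous_image continuous_on_subset[OF E(1)] \<phi>(2)) auto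
    have "continuous_on (box 0 One \<union> - E ` csupp \<phi>) \<psi>"
    proof (rule continuous_on_open_Un)
      have "continuous_on (box 0 One) (\<lambda>y. \<phi> (Ei y))"
        by (rule continuous_on_compose2[OF \<phi>(1) E(5)]) auto
      then show "continuous_on (box 0 One) \<psi>"
        by (rule continuous_on_cong[THEN iffD1, rotated 2]) (auto simp: \<psi>_def)
      have \<psi>0: "0 = \<psi> y" if "y \<in> - E ` csupp \<phi>" for y
        using that E(4)[of y] \<phi>0[of "Ei y"] unfolding \<psi>_def by force
      have "continuous_on (- E ` csupp \<phi>) (\<lambda>_. 0 :: real)" by simp
      then show "continuous_on (- E ` csupp \<phi>) \<psi>"
        by (rule continuous_on_cong[THEN iffD1, rotated 2]) (use \<psi>0 in auto)
    qed (use Ecl in auto)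
    moreover have "box 0 One \<union> - E ` csupp \<phi> = UNIV" using E(2) by auto
    ultimately have \<psi>c: "continuous_on UNIV \<psi>" by simp
    have \<psi>m [measurable]: "\<psi> \<in> borel_measurable borel" using \<psi>c by (rule borel_measurable_continuous_onI)
    have c: "continuous_on UNIV (\<lambda>t. \<psi> (\<gamma> t))" by (rule continuous_on_compose2[OF \<psi>c \<gamma>c]) auto
    have lim: "(\<lambda>k. \<integral>t. \<psi> (\<gamma> t) \<partial>M (r k)) \<longlonglongrightarrow> (\<integral>t. \<psi> (\<gamma> t) \<partial>N)"
    proof (rule weak_conv_imp_integral_bdd_continuous_conv[of "\<lambda>k. M (r k)", where B="max B 0"])
      show "weak_conv_m (\<lambda>k. M (r k)) N" using conv by (simp add: comp_def)
      show "isCont (\<lambda>t. \<psi> (\<gamma> t)) x" for x using c by (simp add: continuous_on_eq_continuous_at)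
      show "norm (\<psi> (\<gamma> x)) \<le> max B 0" for x unfolding \<psi>_def using B by (auto simp: max.coboundedI1)
    qed (auto simp: M_prob N)
    have Mint: "(\<integral>t. \<psi> (\<gamma> t) \<partial>M k) = (\<integral>x. \<phi> x * p k x \<partial>lborel)" for k
      unfolding M_def by (subst integral_distr) (auto simp: integral_density p0 \<gamma>sx \<psi>E mult.commute)
    have \<mu>int: "(\<integral>x. \<phi> x \<partial>\<mu>) = C' * (\<integral>t. \<psi> (\<gamma> t) \<partial>N)"
    proof -
      have "(\<integral>x. \<phi> x \<partial>\<mu>) = (\<integral>t. C' * indicator (\<gamma> -` box 0 One) t * \<phi> (Ei (\<gamma> t)) \<partial>N)"
        unfolding \<mu>_def using C' by (subst integral_distr) (auto simp: integral_density)
      also have "\<dots> = (\<integral>t. C' * \<psi> (\<gamma> t) \<partial>N)"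
        by (rule Bochner_Integration.integral_cong) (auto simp: \<psi>_def indicator_def)
      finally show ?thesis by simp
    qed
    \<comment> \<open>A point of \<open>Q k\<close> has all coordinates at least k, so for large k
      its norm exceeds every norm in the support.\<close>
    have escape: "eventually (\<lambda>k. \<forall>x. \<phi> x * indicator (Q k) x = 0) sequentially"
    proof -
      obtain R where R: "\<And>x. x \<in> csupp \<phi> \<Longrightarrow> norm x \<le> R"
        using compact_imp_bounded[OF \<phi>(2)] unfolding bounded_iff by auto
      obtain b :: 'a where b: "b \<in> Basis" using nonempty_Basis by blast
      have "\<phi> x * indicator (Q k) x = 0" if "real k > R" for k x
      proof (rule ccontr)
        assume "\<not> ?thesis"
        then have "x \<in> csupp \<phi>" "x \<in> Q k" using \<phi>0[of x] by (auto simp: indicator_def split: if_splits)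
        then have "real k \<le> x \<bullet> b" using b unfolding Q_def by (auto simp: mem_box)
        also have "\<dots> \<le> norm x" using b by (rule Basis_le_norm[THEN order_trans[OF abs_ge_self]])
        finally show False using R[OF \<open>x \<in> csupp \<phi>\<close>] that by simp
      qed
      moreover have "eventually (\<lambda>k. real k > R) sequentially"
        using filterlim_real_sequentially by (simp add: filterlim_at_top_dense)
      ultimately show ?thesis by (auto elim!: eventually_mono)
    qed
    have "(\<lambda>k. C' * (\<integral>x. \<phi> x * p (r k) x \<partial>lborel)) \<longlonglongrightarrow> (\<integral>x. \<phi> x \<partial>\<mu>)"
      unfolding \<mu>int using lim unfolding Mint by (intro tendsto_intros)
    moreover have "eventually (\<lambda>k. C' * (\<integral>x. \<phi> x * p (r k) x \<partial>lborel) = (\<integral>x. \<phi> x * h (r k) x \<partial>lborel)) sequentially"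
      using eventually_compose_filterlim[OF escape filterlim_subseq[OF r]]
    proof eventually_elim
      case (elim k)
      have "C' * (\<phi> x * p (r k) x) = \<phi> x * h (r k) x" for x
      proof -
        have "C' * (\<phi> x * p (r k) x) = \<phi> x * h (r k) x + (C' - m (r k)) * (\<phi> x * indicator (Q (r k)) x)"
          unfolding p_def using C' by (simp add: field_simps)
        then show ?thesis using elim by simp
      qed
      then show ?case by (subst integral_mult_right_zero[symmetric]) (simp only:)
    qed
    ultimately show ?thesis by (rule Lim_transform_eventually)
  qed
  show ?thesis
    by (intro exI[of _ r] exI[of _ \<mu>]) (use r fin main in \<open>auto simp: \<mu>_def\<close>)
qed

subsection \<open>Test functions and \<open>L\<^sup>q\<close> densities\<close>

text \<open>Compact support, witnessed by any compact set off which the function vanishes. In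
  contrast to \<open>csupp\<close> no closure has to be computed, which suits products and
  approximants with a prescribed support.\<close>

definition supp_cpt :: "'a::euclidean_space set \<Rightarrow> ('a \<Rightarrow> real) \<Rightarrow> bool" where
  "supp_cpt W u \<longleftrightarrow> (\<exists>K. compact K \<and> K \<subseteq> W \<and> (\<forall>x. x \<notin> K \<longrightarrow> u x = 0))"

lemma supp_cpt_csupp:
  assumes "supp_cpt W u"
  shows "compact (csupp u)" "csupp u \<subseteq> W"
proof -
  obtain K where K: "compact K" "K \<subseteq> W" "\<And>x. x \<notin> K \<Longrightarrow> u x = 0"
    using assms unfolding supp_cpt_def by blast
  then have "csupp u \<subseteq> K" unfolding csupp_def
    by (intro closure_minimal compact_imp_closed) auto
  then show "compact (csupp u)" "csupp u \<subseteq> W"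
    using K compact_Int_closed[of K "csupp u"] by (auto simp: csupp_def Int_absorb1)
qed

lemma csupp_supp_cpt: "compact (csupp u) \<Longrightarrow> csupp u \<subseteq> W \<Longrightarrow> supp_cpt W u"
  unfolding supp_cpt_def csupp_def by (meson closure_subset in_mono mem_Collect_eq)

lemma supp_cpt_mono: "supp_cpt V u \<Longrightarrow> V \<subseteq> W \<Longrightarrow> supp_cpt W u"
  unfolding supp_cpt_def by blast

lemma supp_cpt_mult:
  assumes "supp_cpt W u" shows "supp_cpt W (\<lambda>x. g x * u x)"
proof -
  obtain K where "compact K" "K \<subseteq> W" "\<And>x. x \<notin> K \<Longrightarrow> u x = 0"
    using assms unfolding supp_cpt_def by blast
  then show ?thesis unfolding supp_cpt_def by (intro exI[of _ K]) simp
qed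

lemma supp_cpt_bounded:
  assumes "supp_cpt W u" "continuous_on UNIV u"
  shows "\<exists>B. \<forall>x. \<bar>u x\<bar> \<le> B"
proof -
  obtain K where K: "compact K" "\<And>x. x \<notin> K \<Longrightarrow> u x = 0"
    using assms unfolding supp_cpt_def by blast
  have "bounded (u ` K)"
    by (intro compact_imp_bounded compact_continuous_image continuous_on_subset[OF assms(2)] K) auto
  then obtain B where "\<forall>x\<in>K. \<bar>u x\<bar> \<le> B" unfolding bounded_iff by auto
  then have "\<bar>u x\<bar> \<le> max B 0" for x using K(2)[of x] by (cases "x \<in> K") fastforce+
  then show ?thesis by blast
qed

text \<open>A product of two ramps. One depends on the distance to the complement of W and vanishes
  where m times this distance is at most 1; the other vanishes outside the ball of radius m. At a
  point of W both are eventually equal to 1.\<close>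

lemma cutoff_sequence:
  fixes W :: "'a::euclidean_space set"
  assumes "open W"
  shows "\<exists>\<kappa>::nat \<Rightarrow> 'a \<Rightarrow> real. (\<forall>m. continuous_on UNIV (\<kappa> m) \<and> supp_cpt W (\<kappa> m) \<and> (\<forall>x. 0 \<le> \<kappa> m x \<and> \<kappa> m x \<le> 1)) \<and>
     (\<forall>x. (\<lambda>m. \<kappa> m x) \<longlonglongrightarrow> indicator W x)"
proof -
  \<comment> \<open>If W is the whole space, its complement is empty and \<open>infdist\<close>
    would return 0; hence the separate value 1.\<close>
  define d where "d x = (if W = UNIV then 1 else infdist x (- W))" for x
  have dc: "continuous_on UNIV d"
    unfolding d_def by (cases "W = UNIV") (simp_all add: continuous_on_infdist continuous_on_id)
  have d0: "0 \<le> d x" for x unfolding d_def by (simp add: infdist_nonneg)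
  have dW: "0 < d x \<longleftrightarrow> x \<in> W" for x
    using in_closed_iff_infdist_zero[of "- W" x] assms infdist_nonneg[of x "- W"]
    by (auto simp: d_def less_le)
  define \<kappa> where "\<kappa> m x = min 1 (max 0 (real m * d x - 1)) * max 0 (min 1 (real m - norm x))" for m x
  have "supp_cpt W (\<kappa> m)" for m
  proof -
    let ?K = "cball 0 (real m) \<inter> {x. 1 \<le> real m * d x}"
    have "compact ?K"
      by (intro compact_Int_closed closed_Collect_le) (auto intro!: continuous_intros dc)
    moreover have "?K \<subseteq> W"
    proof
      fix x assume "x \<in> ?K"
      then have "d x \<noteq> 0" by auto
      then show "x \<in> W" using dW[of x] d0[of x] by linarith
    qed
    moreover have "\<forall>x. x \<notin> ?K \<longrightarrow> \<kappa> m x = 0" by (auto simp: \<kappa>_def)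
    ultimately show ?thesis unfolding supp_cpt_def by blast
  qed
  moreover have "continuous_on UNIV (\<kappa> m)" for m unfolding \<kappa>_def by (intro continuous_intros dc)
  moreover have "0 \<le> \<kappa> m x \<and> \<kappa> m x \<le> 1" for m x
    unfolding \<kappa>_def by (auto intro!: mult_le_one mult_nonneg_nonneg)
  moreover have "(\<lambda>m. \<kappa> m x) \<longlonglongrightarrow> indicator W x" for x
  proof (cases "x \<in> W")
    case False
    then have "d x = 0" using dW[of x] d0[of x] by auto
    then show ?thesis using False by (simp add: \<kappa>_def)
  next
    case True
    then have "d x > 0" using dW by auto
    obtain n where n: "real n > 2 / d x + norm x + 1" using reals_Archimedean2 by blast
    have "\<kappa> m x = 1" if "m \<ge> n" for m
    proof -
      have m: "real m > 2 / d x + norm x + 1" using n that by linarith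
      have "real m * d x \<ge> (2 / d x) * d x"
        using m \<open>d x > 0\<close> norm_ge_zero[of x] by (intro mult_right_mono) linarith+
      then have "real m * d x \<ge> 2" using \<open>d x > 0\<close> by simp
      moreover have "2 / d x \<ge> 0" using \<open>d x > 0\<close> by simp
      then have "real m - norm x \<ge> 1" using m by linarith
      ultimately show ?thesis unfolding \<kappa>_def by auto
    qed
    then have "eventually (\<lambda>m. \<kappa> m x = 1) sequentially" unfolding eventually_sequentially by blast
    then show ?thesis using True by (simp add: tendsto_eventually)
  qed
  ultimately show ?thesis by blast
qed

text \<open>Measurability in the sense of \<open>measurable_on\<close> supplies continuous functions
  that converge off a null set. Truncating them to an interval that contains the values of u, and
  multiplying by cutoffs of W, adds the bound and the compact support without changing the
  limit.\<close>

lemma Cc_approx_AE: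
  fixes u :: "'a::euclidean_space \<Rightarrow> real"
  assumes [measurable]: "u \<in> borel_measurable borel" and B: "\<And>x. \<bar>u x\<bar> \<le> B"
    and W: "open W" and u0: "\<forall>x. x \<notin> W \<longrightarrow> u x = 0"
  shows "\<exists>g. (\<forall>n::nat. continuous_on UNIV (g n) \<and> supp_cpt W (g n) \<and> (\<forall>x. \<bar>g n x\<bar> \<le> B)
            \<and> ((\<forall>x. 0 \<le> u x) \<longrightarrow> (\<forall>x. 0 \<le> g n x)))
     \<and> (AE x in lborel. (\<lambda>n. g n x) \<longlonglongrightarrow> u x)"
proof -
  have "u measurable_on UNIV"
  proof (subst measurable_on_iff_borel_measurable)
    have "u \<in> borel_measurable lebesgue" by (rule measurable_completion) simp
    then show "u \<in> borel_measurable (lebesgue_on UNIV)" by (rule measurable_restrict_space1)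
  qed simp
  then obtain N g where N: "negligible N" and gc: "\<And>n. continuous_on UNIV (g n)"
    and gl: "\<And>x. x \<notin> N \<Longrightarrow> (\<lambda>n::nat. g n x) \<longlonglongrightarrow> u x"
    unfolding measurable_on_def by auto
  obtain \<kappa> :: "nat \<Rightarrow> 'a \<Rightarrow> real" where \<kappa>: "\<And>m. continuous_on UNIV (\<kappa> m)" "\<And>m. supp_cpt W (\<kappa> m)"
    "\<And>m x. 0 \<le> \<kappa> m x" "\<And>m x. \<kappa> m x \<le> 1" "\<And>x. (\<lambda>m. \<kappa> m x) \<longlonglongrightarrow> indicator W x"
    using cutoff_sequence[OF W] by blast
  have B0: "0 \<le> B" using B[of undefined] by linarith
  \<comment> \<open>The lower truncation level 0 keeps the approximants of a nonnegative function
    nonnegative.\<close>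
  define lo where "lo = (if \<forall>x. 0 \<le> u x then 0 else - B)"
  have lo: "- B \<le> lo" "lo \<le> B" using B0 unfolding lo_def by auto
  have lou: "lo \<le> u x" for x
  proof (cases "\<forall>x. 0 \<le> u x")
    case False
    then show ?thesis using B[of x] unfolding lo_def by auto
  qed (simp add: lo_def)
  define g' where "g' n x = max lo (min B (g n x)) * \<kappa> n x" for n x
  have "continuous_on UNIV (g' n)" for n unfolding g'_def by (intro continuous_intros gc \<kappa>)
  moreover have "supp_cpt W (g' n)" for n
    unfolding g'_def by (rule supp_cpt_mult[OF \<kappa>(2)])
  moreover have "\<bar>g' n x\<bar> \<le> B" for n x
  proof -
    have "\<bar>max lo (min B (g n x))\<bar> \<le> B" using lo B0 by auto
    then have "\<bar>max lo (min B (g n x))\<bar> * \<bar>\<kappa> n x\<bar> \<le> B * 1"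
      using \<kappa>(3,4)[of n x] by (intro mult_mono) auto
    then show ?thesis unfolding g'_def by (simp add: abs_mult)
  qed
  moreover have "0 \<le> g' n x" if "\<forall>x. 0 \<le> u x" for n x
    using that \<kappa>(3) unfolding g'_def lo_def by (auto intro!: mult_nonneg_nonneg)
  moreover have "AE x in lborel. (\<lambda>n. g' n x) \<longlonglongrightarrow> u x"
  proof -
    have "(\<lambda>n. g' n x) \<longlonglongrightarrow> u x" if "x \<notin> N" for x
    proof -
      have "(\<lambda>n. g' n x) \<longlonglongrightarrow> max lo (min B (u x)) * indicator W x"
        unfolding g'_def by (intro tendsto_intros gl[OF that] \<kappa>)
      moreover have "max lo (min B (u x)) = u x" using lou[of x] B[of x] by auto
      ultimately show ?thesis using u0 by (cases "x \<in> W") auto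
    qed
    moreover have "AE x in lebesgue. x \<notin> N"
      using N by (simp add: negligible_iff_null_sets AE_not_in)
    then have "AE x in lborel. x \<notin> N" by (simp add: AE_completion_iff)
    ultimately show ?thesis by (auto elim!: eventually_mono)
  qed
  ultimately show ?thesis by (intro exI[of _ g']) blast
qed

section \<open>Continuously differentiable functions and uniform approximation by them\<close>

text \<open>A continuous gradient is what the uniform convergence of difference quotients requires.
  The class contains the smooth functions as well as the piecewise polynomial bumps from which
  approximants are built.\<close>

definition C1_fun :: "('a::euclidean_space \<Rightarrow> real) \<Rightarrow> bool" where
  "C1_fun g \<longleftrightarrow> (\<exists>G. continuous_on UNIV G \<and> (\<forall>x. (g has_derivative (\<lambda>h. G x \<bullet> h)) (at x)))"

lemma C1_fun_continuous: "C1_fun g \<Longrightarrow> continuous_on UNIV g"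
  unfolding C1_fun_def by (meson continuous_at_imp_continuous_on has_derivative_continuous)

lemma C1_fun_const [intro]: "C1_fun (\<lambda>x. c)"
  unfolding C1_fun_def
  by (intro exI[of _ "\<lambda>_. 0"] conjI allI has_derivative_eq_rhs[OF has_derivative_const]) auto

lemma C1_fun_add [intro]:
  assumes "C1_fun f" "C1_fun g" shows "C1_fun (\<lambda>x. f x + g x)"
proof -
  obtain F G where FG: "continuous_on UNIV F" "continuous_on UNIV G"
    "\<And>x. (f has_derivative (\<lambda>h. F x \<bullet> h)) (at x)" "\<And>x. (g has_derivative (\<lambda>h. G x \<bullet> h)) (at x)"
    using assms unfolding C1_fun_def by blast
  have "((\<lambda>x. f x + g x) has_derivative (\<lambda>h. (F x + G x) \<bullet> h)) (at x)" for x
    unfolding inner_add_left by (rule has_derivative_add[OF FG(3) FG(4)])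
  then show ?thesis unfolding C1_fun_def
    using FG by (intro exI[of _ "\<lambda>x. F x + G x"] conjI allI continuous_on_add)
qed

lemma C1_fun_mult [intro]:
  assumes "C1_fun f" "C1_fun g" shows "C1_fun (\<lambda>x. f x * g x)"
proof -
  obtain F G where FG: "continuous_on UNIV F" "continuous_on UNIV G"
    "\<And>x. (f has_derivative (\<lambda>h. F x \<bullet> h)) (at x)" "\<And>x. (g has_derivative (\<lambda>h. G x \<bullet> h)) (at x)"
    using assms unfolding C1_fun_def by blast
  have "continuous_on UNIV (\<lambda>x. f x *\<^sub>R G x + g x *\<^sub>R F x)"
    by (intro continuous_intros FG C1_fun_continuous assms)
  moreover have "((\<lambda>x. f x * g x) has_derivative (\<lambda>h. (f x *\<^sub>R G x + g x *\<^sub>R F x) \<bullet> h)) (at x)" for x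
    using has_derivative_mult[OF FG(3)[of x] FG(4)[of x]] by (simp add: inner_add_left mult.commute)
  ultimately show ?thesis unfolding C1_fun_def by blast
qed

lemma C1_fun_sum [intro]:
  "(\<And>i. i \<in> I \<Longrightarrow> C1_fun (f i)) \<Longrightarrow> C1_fun (\<lambda>x. \<Sum>i\<in>I. f i x)"
  by (induction I rule: infinite_finite_induct) auto

lemma C1_fun_bounded_linear:
  assumes "bounded_linear f" shows "C1_fun f"
proof -
  have "f h = (\<Sum>b\<in>Basis. f b *\<^sub>R b) \<bullet> h" for h
  proof -
    have "f h = f (\<Sum>b\<in>Basis. (h \<bullet> b) *\<^sub>R b)" by (simp add: euclidean_representation)
    also have "\<dots> = (\<Sum>b\<in>Basis. (h \<bullet> b) * f b)"
      using assms by (simp add: linear_sum linear_scale bounded_linear.linear)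
    also have "\<dots> = (\<Sum>b\<in>Basis. f b *\<^sub>R b) \<bullet> h"
      unfolding inner_sum_left by (intro sum.cong refl) (simp add: inner_commute[of h])
    finally show ?thesis .
  qed
  then have eq: "f = (\<lambda>h. (\<Sum>b\<in>Basis. f b *\<^sub>R b) \<bullet> h)" by blast
  show ?thesis unfolding C1_fun_def
    using bounded_linear_imp_has_derivative[OF assms] eq
    by (intro exI[of _ "\<lambda>_. \<Sum>b\<in>Basis. f b *\<^sub>R b"]) auto
qed

lemma C1_fun_polynomial: "real_polynomial_function f \<Longrightarrow> C1_fun f"
  by (induction rule: real_polynomial_function.induct) (auto intro: C1_fun_bounded_linear)

text \<open>Squaring removes the corner of the positive part: at 0 the difference quotient is
  bounded by the modulus of the increment.\<close>

lemma DERIV_max0_square: "((\<lambda>t::real. (max 0 t)\<^sup>2) has_real_derivative 2 * max 0 t) (at t)"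
proof -
  consider "t > 0" | "t < 0" | "t = 0" by linarith
  then show ?thesis
  proof cases
    case 1
    have "((\<lambda>t::real. t\<^sup>2) has_real_derivative 2 * max 0 t) (at t)"
      using 1 by (auto intro!: derivative_eq_intros)
    then show ?thesis
      by (rule has_field_derivative_transform_within_open[of _ _ _ "{0<..}"]) (use 1 in auto)
  next
    case 2
    have "((\<lambda>t::real. 0) has_real_derivative 2 * max 0 t) (at t)" using 2 by auto
    then show ?thesis
      by (rule has_field_derivative_transform_within_open[of _ _ _ "{..<0}"]) (use 2 in auto)
  next
    case 3
    have "((\<lambda>h. (max 0 h)\<^sup>2 / h) \<longlongrightarrow> 0) (at (0::real))"
    proof (rule Lim_null_comparison)
      show "\<forall>\<^sub>F h in at 0. norm ((max 0 h)\<^sup>2 / h) \<le> \<bar>h\<bar>"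
        by (rule always_eventually) (auto simp: power2_eq_square max_def)
      show "((\<lambda>h. \<bar>h\<bar>) \<longlongrightarrow> 0) (at (0::real))" by (intro tendsto_rabs_zero tendsto_ident_at)
    qed
    then show ?thesis using 3 by (simp add: DERIV_def)
  qed
qed

text \<open>For r > 0 a bump of the ball of radius r around x: positive inside and zero outside,
  with the outer square smoothing the passage through the sphere.\<close>

lemma C1_fun_bump: "C1_fun (\<lambda>y. (max 0 (r\<^sup>2 - (norm (y - x))\<^sup>2))\<^sup>2)"
proof -
  define s where "s y = r\<^sup>2 - (norm (y - x))\<^sup>2" for y
  have "(s has_derivative (\<lambda>h. - 2 * ((y - x) \<bullet> h))) (at y)" for y
  proof -
    have "((\<lambda>y. r\<^sup>2 - (y - x) \<bullet> (y - x)) has_derivative (\<lambda>h. - 2 * ((y - x) \<bullet> h))) (at y)"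
      by (auto intro!: derivative_eq_intros simp: inner_commute)
    then show ?thesis unfolding s_def[abs_def] power2_norm_eq_inner .
  qed
  then have "((\<lambda>y. (max 0 (s y))\<^sup>2) has_derivative (\<lambda>h. (- 4 * max 0 (s y)) *\<^sub>R (y - x) \<bullet> h)) (at y)" for y
    using has_derivative_compose[of s _ y UNIV "\<lambda>t. (max 0 t)\<^sup>2" "\<lambda>h. 2 * max 0 (s y) * h"]
      DERIV_max0_square[of "s y"] unfolding has_field_derivative_def by (fastforce simp: algebra_simps)
  then show ?thesis unfolding C1_fun_def s_def
    by (intro exI[of _ "\<lambda>y. (- 4 * max 0 (r\<^sup>2 - (norm (y - x))\<^sup>2)) *\<^sub>R (y - x)"] conjI allI)
       (intro continuous_intros, blast)
qed

text \<open>Stone-Weierstrass yields polynomials, which are not compactly supported. Let \<beta> be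
  a sum of bumps that is positive on the support of u. Then u / \<beta> is continuous; if P is a
  polynomial close to it on K, then P \<beta> is a C^1 function close to u that vanishes off K. The
  set K does not depend on the accuracy, so all approximants share it.\<close>

lemma C1c_uniform_approx:
  fixes u :: "'a::euclidean_space \<Rightarrow> real"
  assumes W: "open W" and u: "continuous_on UNIV u" "supp_cpt W u"
  shows "\<exists>K. compact K \<and> K \<subseteq> W \<and> (\<forall>x. x \<notin> K \<longrightarrow> u x = 0) \<and>
    (\<forall>\<eta>>0. \<exists>\<Psi>. C1_fun \<Psi> \<and> (\<forall>x. x \<notin> K \<longrightarrow> \<Psi> x = 0) \<and> (\<forall>x. \<bar>\<Psi> x - u x\<bar> \<le> \<eta>))"
proof -
  obtain S where S: "compact S" "S \<subseteq> W" and S0: "\<And>x. x \<notin> S \<Longrightarrow> u x = 0"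
    using u(2) unfolding supp_cpt_def by blast
  have "\<forall>x\<in>S. \<exists>r>0. cball x r \<subseteq> W" using S(2) W open_contains_cball by blast
  then obtain r where r: "\<And>x. x \<in> S \<Longrightarrow> r x > 0 \<and> cball x (r x) \<subseteq> W" by metis
  obtain X where X: "finite X" "X \<subseteq> S" "S \<subseteq> (\<Union>x\<in>X. ball x (r x))"
  proof -
    have "S \<subseteq> (\<Union>x\<in>S. ball x (r x))" using r by fastforce
    then show ?thesis using compactE_image[OF S(1), of S "\<lambda>x. ball x (r x)"] that by (metis open_ball)
  qed
  define \<beta> where "\<beta> y = (\<Sum>x\<in>X. (max 0 ((r x)\<^sup>2 - (norm (y - x))\<^sup>2))\<^sup>2)" for y
  define K where "K = (\<Union>x\<in>X. cball x (r x))"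
  have K: "compact K" unfolding K_def using X(1) by (intro compact_UN) auto
  have KW: "K \<subseteq> W" unfolding K_def using X(2) r by blast
  have "(\<Union>x\<in>X. ball x (r x)) \<subseteq> K" unfolding K_def by (intro UN_mono) auto
  then have SK: "S \<subseteq> K" using X(3) by (rule order_trans[rotated])
  have \<beta>C1: "C1_fun \<beta>" unfolding \<beta>_def by (intro C1_fun_sum C1_fun_bump)
  note \<beta>c = C1_fun_continuous[OF \<beta>C1]
  have \<beta>pos: "\<beta> y > 0" if "y \<in> S" for y
  proof -
    obtain x where x: "x \<in> X" "norm (y - x) < r x"
      using X(3) \<open>y \<in> S\<close> by (auto simp: dist_norm norm_minus_commute)
    then have "(norm (y - x))\<^sup>2 < (r x)\<^sup>2" by (intro power_strict_mono) auto
    then have "(max 0 ((r x)\<^sup>2 - (norm (y - x))\<^sup>2))\<^sup>2 > 0" by simp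
    then show ?thesis unfolding \<beta>_def using X(1) x(1) by (intro sum_pos2[of _ x]) auto
  qed
  have \<beta>0: "\<beta> y = 0" if "y \<notin> K" for y
  proof -
    have "(max 0 ((r x)\<^sup>2 - (norm (y - x))\<^sup>2))\<^sup>2 = 0" if "x \<in> X" for x
    proof -
      have "r x < norm (y - x)" using \<open>y \<notin> K\<close> that unfolding K_def by (auto simp: dist_norm norm_minus_commute)
      moreover have "r x > 0" using r that X by auto
      ultimately have "(r x)\<^sup>2 < (norm (y - x))\<^sup>2" by (intro power_strict_mono) auto
      then show ?thesis by simp
    qed
    then show ?thesis unfolding \<beta>_def by simp
  qed
  have \<beta>nn: "0 \<le> \<beta> y" for y unfolding \<beta>_def by (intro sum_nonneg) auto
  obtain B where B: "\<And>x. \<bar>\<beta> x\<bar> \<le> B"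
    using supp_cpt_bounded[of UNIV \<beta>] K \<beta>0 \<beta>c unfolding supp_cpt_def by blast
  \<comment> \<open>Where \<beta> is positive the quotient is continuous; the zeros of \<beta> lie
    in the open complement of S, on which u, and hence the quotient, is identically 0.\<close>
  have vc: "continuous_on UNIV (\<lambda>y. u y / \<beta> y)"
  proof -
    have "continuous_on ({y. 0 < \<beta> y} \<union> - S) (\<lambda>y. u y / \<beta> y)"
    proof (rule continuous_on_open_Un)
      show "open {y. 0 < \<beta> y}" by (intro open_Collect_less continuous_intros \<beta>c)
      show "open (- S)" using S(1) by (simp add: compact_imp_closed open_Compl)
      show "continuous_on {y. 0 < \<beta> y} (\<lambda>y. u y / \<beta> y)"
        by (intro continuous_intros continuous_on_subset[OF u(1)] continuous_on_subset[OF \<beta>c]) auto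
      have "continuous_on (- S) (\<lambda>_. 0::real)" by simp
      then show "continuous_on (- S) (\<lambda>y. u y / \<beta> y)"
        by (rule continuous_on_cong[THEN iffD1, rotated 2]) (use S0 in auto)
    qed
    moreover have "{y. 0 < \<beta> y} \<union> - S = UNIV" using \<beta>pos by auto
    ultimately show ?thesis by simp
  qed
  have "\<exists>\<Psi>. C1_fun \<Psi> \<and> (\<forall>x. x \<notin> K \<longrightarrow> \<Psi> x = 0) \<and> (\<forall>x. \<bar>\<Psi> x - u x\<bar> \<le> \<eta>)" if \<eta>: "\<eta> > 0" for \<eta>
  proof -
    have B0: "0 \<le> B" using B[of undefined] by linarith
    \<comment> \<open>Multiplication by \<beta>, which is bounded by B, enlarges the error by at
      most that factor; B + 1 keeps the denominator positive.\<close>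
    obtain P where P: "real_polynomial_function P" "\<And>y. y \<in> K \<Longrightarrow> \<bar>u y / \<beta> y - P y\<bar> < \<eta> / (B + 1)"
      using Stone_Weierstrass_real_polynomial_function[OF K continuous_on_subset[OF vc], of "\<eta> / (B + 1)"]
        \<eta> B0 by auto
    have "\<bar>P y * \<beta> y - u y\<bar> \<le> \<eta>" for y
    proof (cases "y \<in> K")
      case True
      have "u y = u y / \<beta> y * \<beta> y" using \<beta>pos[of y] S0[of y] by (cases "y \<in> S") auto
      then have "P y * \<beta> y - u y = (P y - u y / \<beta> y) * \<beta> y" unfolding left_diff_distrib by linarith
      then have "\<bar>P y * \<beta> y - u y\<bar> = \<bar>P y - u y / \<beta> y\<bar> * \<bar>\<beta> y\<bar>" by (simp only: abs_mult)
      also have "\<dots> \<le> \<eta> / (B + 1) * (B + 1)"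
        using P(2)[OF True] B[of y] B0 by (intro mult_mono) auto
      finally show ?thesis using B0 by simp
    next
      case False
      then have "y \<notin> S" using SK by blast
      then show ?thesis using \<beta>0[OF False] S0[of y] \<eta> by simp
    qed
    then show ?thesis
      using C1_fun_mult[OF C1_fun_polynomial[OF P(1)] \<beta>C1] \<beta>0 by (intro exI[of _ "\<lambda>y. P y * \<beta> y"]) auto
  qed
  moreover have "\<forall>x. x \<notin> K \<longrightarrow> u x = 0" using SK S0 by blast
  ultimately show ?thesis using K KW by blast
qed

lemma supp_cpt_Lp_finite:
  assumes u: "continuous_on UNIV u" "supp_cpt W u" and "p > 0"
  shows "(\<integral>\<^sup>+x. ennreal (\<bar>u x\<bar> powr p) * indicator V x \<partial>lborel) < \<infinity>"
proof -
  obtain B where B: "\<And>x. \<bar>u x\<bar> \<le> B" using supp_cpt_bounded[OF u(2,1)] by blast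
  obtain K where K: "compact K" "\<And>x. x \<notin> K \<Longrightarrow> u x = 0" using u(2) unfolding supp_cpt_def by blast
  have "(\<integral>\<^sup>+x. ennreal (\<bar>u x\<bar> powr p) * indicator V x \<partial>lborel) \<le> (\<integral>\<^sup>+x. ennreal (B powr p) * indicator K x \<partial>lborel)"
    using B K(2) \<open>p > 0\<close>
    by (intro nn_integral_mono) (auto simp: indicator_def intro!: ennreal_leI powr_mono2)
  also have "\<dots> = ennreal (B powr p) * emeasure lborel K"
    using K(1) by (intro nn_integral_cmult_indicator) (auto simp: compact_imp_closed)
  also have "\<dots> < \<infinity>" using emeasure_compact_finite[OF K(1)] by (simp add: ennreal_mult_less_top less_top)
  finally show ?thesis .
qed

section \<open>Density and duality in L^p spaces\<close>

text \<open>Density of the compactly supported C^1 functions in L^p, cast as an induction rule: a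
  property that passes to L^p limits has to be checked on those functions alone. The class grows in
  three stages: continuous functions of compact support, bounded Borel functions of bounded support,
  all of L^p.\<close>

lemma Lp_density_induct:
  fixes W :: "'a::euclidean_space set" and P :: "('a \<Rightarrow> real) \<Rightarrow> bool"
  assumes W: "open W" and p: "p > 0"
    and C1c: "\<And>\<Psi>. C1_fun \<Psi> \<Longrightarrow> supp_cpt W \<Psi> \<Longrightarrow> P \<Psi>"
    and closed: "\<And>g u. (\<And>n. g n \<in> borel_measurable borel) \<Longrightarrow> u \<in> borel_measurable borel \<Longrightarrow> (\<And>n::nat. P (g n)) \<Longrightarrow>
        (\<And>n. (\<integral>\<^sup>+x. ennreal (\<bar>g n x\<bar> powr p) * indicator W x \<partial>lborel) < \<infinity>) \<Longrightarrow>
        (\<integral>\<^sup>+x. ennreal (\<bar>u x\<bar> powr p) * indicator W x \<partial>lborel) < \<infinity> \<Longrightarrow>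
        (\<lambda>n. \<integral>\<^sup>+x. ennreal (\<bar>g n x - u x\<bar> powr p) * indicator W x \<partial>lborel) \<longlonglongrightarrow> 0 \<Longrightarrow> P u"
    and u: "u \<in> borel_measurable borel" "(\<integral>\<^sup>+x. ennreal (\<bar>u x\<bar> powr p) * indicator W x \<partial>lborel) < \<infinity>"
  shows "P u"
proof -
  have [measurable]: "W \<in> sets borel" "\<And>R. ball 0 R \<in> sets (borel :: 'a measure)" using W by auto
  \<comment> \<open>Uniform approximation by functions that share one compact support is
    approximation in L^p, because that set has finite measure.\<close>
  have A: "P u" if u: "continuous_on UNIV u" "supp_cpt W u" for u
  proof -
    obtain K where K: "compact K" "K \<subseteq> W"
      and ex: "\<And>\<eta>. \<eta> > 0 \<Longrightarrow> \<exists>\<Psi>. C1_fun \<Psi> \<and> (\<forall>x. x \<notin> K \<longrightarrow> \<Psi> x = 0) \<and> (\<forall>x. \<bar>\<Psi> x - u x\<bar> \<le> \<eta>)"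
      and K0: "\<And>x. x \<notin> K \<Longrightarrow> u x = 0"
      using C1c_uniform_approx[OF W u] by blast
    have "\<forall>n. \<exists>\<Psi>. C1_fun \<Psi> \<and> (\<forall>x. x \<notin> K \<longrightarrow> \<Psi> x = 0) \<and> (\<forall>x. \<bar>\<Psi> x - u x\<bar> \<le> inverse (real (Suc n)))"
      by (intro allI ex) simp
    then obtain \<Psi> where C: "\<And>n. C1_fun (\<Psi> n)" and \<Psi>0: "\<And>n x. x \<notin> K \<Longrightarrow> \<Psi> n x = 0"
      and \<Psi>u: "\<And>n x. \<bar>\<Psi> n x - u x\<bar> \<le> inverse (real (Suc n))" by metis
    have s: "supp_cpt W (\<Psi> n)" for n unfolding supp_cpt_def using K \<Psi>0 by blast
    have Kb [measurable]: "K \<in> sets borel" using K(1) by (simp add: compact_imp_closed)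
    have le: "(\<integral>\<^sup>+x. ennreal (\<bar>\<Psi> n x - u x\<bar> powr p) * indicator W x \<partial>lborel)
        \<le> ennreal (inverse (real (Suc n)) powr p) * emeasure lborel K" for n
    proof -
      have "(\<integral>\<^sup>+x. ennreal (\<bar>\<Psi> n x - u x\<bar> powr p) * indicator W x \<partial>lborel)
        \<le> (\<integral>\<^sup>+x. ennreal (inverse (real (Suc n)) powr p) * indicator K x \<partial>lborel)"
      proof (rule nn_integral_mono)
        fix x
        show "ennreal (\<bar>\<Psi> n x - u x\<bar> powr p) * indicator W x \<le> ennreal (inverse (real (Suc n)) powr p) * indicator K x"
          using \<Psi>u[of n x] \<Psi>0[of x n] K0[of x] p
          by (cases "x \<in> K") (auto simp: indicator_def intro!: ennreal_leI powr_mono2)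
      qed
      then show ?thesis by (simp add: nn_integral_cmult_indicator)
    qed
    have lim: "(\<lambda>n. ennreal (inverse (real (Suc n)) powr p) * emeasure lborel K) \<longlonglongrightarrow> 0"
    proof -
      have "(\<lambda>n. inverse (real (Suc n)) powr p) \<longlonglongrightarrow> 0 powr p"
        using p LIMSEQ_inverse_real_of_nat by (intro tendsto_powr') auto
      then have "(\<lambda>n. ennreal (inverse (real (Suc n)) powr p)) \<longlonglongrightarrow> ennreal 0"
        by (intro tendsto_ennrealI) simp
      from ennreal_tendsto_cmult[OF _ this, of "emeasure lborel K"] emeasure_compact_finite[OF K(1)]
      show ?thesis by (simp add: mult.commute less_top)
    qed
    show ?thesis
    proof (rule closed[of \<Psi>])
      show "(\<lambda>n. \<integral>\<^sup>+x. ennreal (\<bar>\<Psi> n x - u x\<bar> powr p) * indicator W x \<partial>lborel) \<longlonglongrightarrow> 0"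
        by (rule tendsto_sandwich[OF _ _ tendsto_const lim]) (use le in auto)
    qed (use C s u p in \<open>auto intro!: C1c borel_measurable_continuous_onI C1_fun_continuous
           supp_cpt_Lp_finite[unfolded infinity_ennreal_def]\<close>)
  qed
  \<comment> \<open>Almost everywhere convergence of uniformly bounded functions that live in one
    ball is convergence in L^p, by domination.\<close>
  have B: "P u" if um [measurable]: "u \<in> borel_measurable borel" and b: "\<And>x. \<bar>u x\<bar> \<le> B" and
     u0: "\<And>x. x \<notin> W \<inter> ball 0 R \<Longrightarrow> u x = 0" for u B R
  proof -
    have "open (W \<inter> ball 0 R)" using W by auto
    moreover have "\<forall>x. x \<notin> W \<inter> ball 0 R \<longrightarrow> u x = 0" using u0 by blast
    ultimately have "\<exists>g. (\<forall>n::nat. continuous_on UNIV (g n) \<and> supp_cpt (W \<inter> ball 0 R) (g n) \<and> (\<forall>x. \<bar>g n x\<bar> \<le> B)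
          \<and> ((\<forall>x. 0 \<le> u x) \<longrightarrow> (\<forall>x. 0 \<le> g n x))) \<and> (AE x in lborel. (\<lambda>n. g n x) \<longlonglongrightarrow> u x)"
      by (rule Cc_approx_AE[OF um b])
    then
    obtain g where g': "\<forall>n::nat. continuous_on UNIV (g n) \<and> supp_cpt (W \<inter> ball 0 R) (g n) \<and> (\<forall>x. \<bar>g n x\<bar> \<le> B)
          \<and> ((\<forall>x. 0 \<le> u x) \<longrightarrow> (\<forall>x. 0 \<le> g n x))"
      and gu: "AE x in lborel. (\<lambda>n::nat. g n x) \<longlonglongrightarrow> u x" by (elim exE conjE)
    then have g: "\<And>n. continuous_on UNIV (g n)" "\<And>n. supp_cpt (W \<inter> ball 0 R) (g n)"
      "\<And>n x. \<bar>g n x\<bar> \<le> B" by simp_all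
    have gm [measurable]: "g n \<in> borel_measurable borel" for n using g(1) by (rule borel_measurable_continuous_onI)
    have B0: "0 \<le> B" using b[of undefined] by linarith
    have g0: "g n x = 0" if "x \<notin> ball 0 R" for n x
      using g(2)[of n] that unfolding supp_cpt_def by blast
    let ?w = "\<lambda>x::'a. ennreal ((2 * B) powr p) * indicator (ball 0 R) x"
    have fin: "(\<integral>\<^sup>+x. ?w x \<partial>lborel) < \<infinity>"
      using emeasure_bounded_finite[OF bounded_ball, of "0::'a" R]
      by (subst nn_integral_cmult_indicator) (auto simp: ennreal_mult_less_top less_top)
    have bnd: "\<bar>a\<bar> \<le> 2 * B \<Longrightarrow> (x \<notin> ball 0 R \<Longrightarrow> a = 0) \<Longrightarrow> ennreal (\<bar>a\<bar> powr p) * indicator W x \<le> ?w x" for a x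
      using p by (cases "x \<in> ball 0 R") (auto simp: indicator_def intro!: ennreal_leI powr_mono2)
    have ufin: "(\<integral>\<^sup>+x. ennreal (\<bar>u x\<bar> powr p) * indicator W x \<partial>lborel) < \<infinity>"
    proof (intro le_less_trans[OF nn_integral_mono fin] bnd)
      show "\<bar>u x\<bar> \<le> 2 * B" for x using b[of x] B0 by linarith
      show "u x = 0" if "x \<notin> ball 0 R" for x using u0 that by blast
    qed
    have "(\<lambda>n. \<integral>\<^sup>+x. ennreal (\<bar>g n x - u x\<bar> powr p) * indicator W x \<partial>lborel) \<longlonglongrightarrow> (\<integral>\<^sup>+x. 0 \<partial>(lborel::'a measure))"
    proof (rule nn_integral_dominated_convergence[where w = ?w])
      show "AE x in lborel. ennreal (\<bar>g n x - u x\<bar> powr p) * indicator W x \<le> ?w x" for n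
      proof (intro AE_I2 bnd)
        show "\<bar>g n x - u x\<bar> \<le> 2 * B" for x using g(3)[of n x] b[of x] by linarith
        show "g n x - u x = 0" if "x \<notin> ball 0 R" for x using g0[OF that] u0[of x] that by simp
      qed
      show "AE x in lborel. (\<lambda>n. ennreal (\<bar>g n x - u x\<bar> powr p) * indicator W x) \<longlonglongrightarrow> 0"
        using gu
      proof eventually_elim
        case (elim x)
        have "(\<lambda>n. \<bar>g n x - u x\<bar> powr p) \<longlonglongrightarrow> 0 powr p"
          using elim p by (intro tendsto_powr') (auto simp: tendsto_rabs_zero_iff LIM_zero_iff)
        then have "(\<lambda>n. ennreal (\<bar>g n x - u x\<bar> powr p)) \<longlonglongrightarrow> 0"
          using tendsto_ennrealI by fastforce
        then show ?case by (cases "x \<in> W") auto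
      qed
      show "(\<integral>\<^sup>+x. ?w x \<partial>lborel) < \<infinity>" by (rule fin)
    qed measurable
    then have lim: "(\<lambda>n. \<integral>\<^sup>+x. ennreal (\<bar>g n x - u x\<bar> powr p) * indicator W x \<partial>lborel) \<longlonglongrightarrow> 0" by simp
    have gW: "supp_cpt W (g n)" for n by (rule supp_cpt_mono[OF g(2)]) simp
    show ?thesis
      by (rule closed[OF gm um A[OF g(1) gW] supp_cpt_Lp_finite[OF g(1) gW p] ufin lim])
  qed
  have um [measurable]: "u \<in> borel_measurable borel" by fact
  \<comment> \<open>Truncated both in the argument and in the value; the error is dominated by the
    function u itself.\<close>
  define v where "v n x = (if x \<in> W \<inter> ball 0 (real n) then max (- real n) (min (real n) (u x)) else 0)" for n x
  have vm [measurable]: "v n \<in> borel_measurable borel" for n unfolding v_def by measurable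
  have Pv: "P (v n)" for n by (rule B[of _ "real n" "real n"]) (auto simp: v_def)
  have vu: "\<bar>v n x\<bar> \<le> \<bar>u x\<bar>" "\<bar>v n x - u x\<bar> \<le> \<bar>u x\<bar>" for n x unfolding v_def by auto
  have "(\<lambda>n. \<integral>\<^sup>+x. ennreal (\<bar>v n x - u x\<bar> powr p) * indicator W x \<partial>lborel) \<longlonglongrightarrow> (\<integral>\<^sup>+x. 0 \<partial>(lborel::'a measure))"
  proof (rule nn_integral_dominated_convergence[where w = "\<lambda>x. ennreal (\<bar>u x\<bar> powr p) * indicator W x"])
    show "AE x in lborel. ennreal (\<bar>v n x - u x\<bar> powr p) * indicator W x \<le> ennreal (\<bar>u x\<bar> powr p) * indicator W x" for n
      using vu p by (intro AE_I2 mult_right_mono ennreal_leI powr_mono2) auto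
    show "AE x in lborel. (\<lambda>n. ennreal (\<bar>v n x - u x\<bar> powr p) * indicator W x) \<longlonglongrightarrow> 0"
    proof (rule AE_I2)
      fix x
      obtain N where N: "real N > norm x + \<bar>u x\<bar>" using reals_Archimedean2 by blast
      have "ennreal (\<bar>v n x - u x\<bar> powr p) * indicator W x = 0" if "n \<ge> N" for n
      proof -
        have "real n > norm x + \<bar>u x\<bar>" using N that by linarith
        then have "norm x < real n" "\<bar>u x\<bar> < real n" using norm_ge_zero[of x] by linarith+
        then show ?thesis using p by (auto simp: v_def indicator_def)
      qed
      then show "(\<lambda>n. ennreal (\<bar>v n x - u x\<bar> powr p) * indicator W x) \<longlonglongrightarrow> 0"
        by (intro tendsto_eventually) (auto simp: eventually_sequentially)
    qed
    show "(\<integral>\<^sup>+x. ennreal (\<bar>u x\<bar> powr p) * indicator W x \<partial>lborel) < \<infinity>" by (rule u(2))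
  qed measurable
  moreover have "(\<integral>\<^sup>+x. ennreal (\<bar>v n x\<bar> powr p) * indicator W x \<partial>lborel) < \<infinity>" for n
    using vu p by (intro le_less_trans[OF nn_integral_mono u(2)] mult_right_mono ennreal_leI powr_mono2) auto
  ultimately show ?thesis
    using closed[OF vm um Pv _ u(2)] by simp
qed

text \<open>The weight makes the measure finite; the hypothesis has the additive form produced by
  Young's inequality, which is as good as a norm bound since test functions may be scaled.\<close>

lemma Lq_density_of_functional_bound:
  fixes \<mu> :: "'a::euclidean_space measure" and \<rho> :: "'a \<Rightarrow> real"
  assumes fin: "finite_measure \<mu>" and sets\<mu> [measurable_cong]: "sets \<mu> = sets borel"
    and \<rho>c: "continuous_on UNIV \<rho>" and \<rho>0: "\<And>x. 0 < \<rho> x" and \<rho>1: "\<And>x. \<rho> x \<le> 1"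
    and q: "q > 1" and C: "C \<ge> 0"
    and bnd: "\<And>\<phi>. continuous_on UNIV \<phi> \<Longrightarrow> supp_cpt UNIV \<phi> \<Longrightarrow> (\<And>x. 0 \<le> \<phi> x) \<Longrightarrow>
      (\<integral>\<^sup>+x. ennreal (\<phi> x) \<partial>\<mu>) \<le> (\<integral>\<^sup>+x. ennreal ((\<rho> x * \<phi> x) powr (q / (q - 1))) \<partial>lborel) + ennreal C"
  shows "\<exists>h. h \<in> borel_measurable borel \<and> (\<forall>x. 0 \<le> h x) \<and> \<mu> = density lborel (\<lambda>x. ennreal (\<rho> x * h x)) \<and>
     (\<integral>\<^sup>+x. ennreal (h x powr q) \<partial>lborel) < \<infinity>"
proof -
  interpret finite_measure \<mu> by (rule fin)
  have [measurable]: "\<And>R. ball 0 R \<in> sets (borel :: 'a measure)" by simp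
  define p where "p = q / (q - 1)"
  have p: "p > 1" unfolding p_def using q by simp
  have \<rho>m [measurable]: "\<rho> \<in> borel_measurable borel" using \<rho>c by (rule borel_measurable_continuous_onI)
  \<comment> \<open>A null set N lies in an open set T of measure at most t^-p. Testing with t times
    the cutoffs of T costs at most t^p t^-p = 1 on the right and gives t \<mu>(T) \<le> 1 + C.
    Letting t grow then shows that \<mu> vanishes on N.\<close>
  have small: "t * measure \<mu> N \<le> 1 + C" if N: "N \<in> null_sets lborel" and t: "t \<ge> 1" for N t
  proof -
    have Nb [measurable]: "N \<in> sets borel" using N by auto
    have NL: "N \<in> sets lebesgue" by (rule sets_completionI_sets) simp
    have tp: "t powr - p > 0" using t by simp
    obtain T where T: "open T" "N \<subseteq> T" "emeasure lebesgue (T - N) < ennreal (t powr - p)"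
      using sets_lebesgue_outer_open[OF NL tp] by metis
    have [measurable]: "T \<in> sets borel" using T(1) by auto
    have "emeasure lborel T \<le> emeasure lborel N + emeasure lborel (T - N)"
      using emeasure_subadditive[of N lborel "T - N"] T(2) by (simp add: Un_absorb1)
    also have "emeasure lborel (T - N) = emeasure lebesgue (T - N)" by simp
    finally have Te: "emeasure lborel T \<le> ennreal (t powr - p)" using N T(3) by (auto simp: null_sets_def)
    obtain \<kappa> :: "nat \<Rightarrow> 'a \<Rightarrow> real" where \<kappa>: "\<And>m. continuous_on UNIV (\<kappa> m)" "\<And>m. supp_cpt T (\<kappa> m)"
      "\<And>m x. 0 \<le> \<kappa> m x" "\<And>m x. \<kappa> m x \<le> 1" "\<And>x. (\<lambda>m. \<kappa> m x) \<longlonglongrightarrow> indicator T x"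
      using cutoff_sequence[OF T(1)] by blast
    have [measurable]: "\<kappa> m \<in> borel_measurable borel" for m using \<kappa>(1) by (rule borel_measurable_continuous_onI)
    have \<kappa>0: "\<kappa> m x = 0" if "x \<notin> T" for m x using \<kappa>(2)[of m] that unfolding supp_cpt_def by blast
    have le: "(\<integral>\<^sup>+x. ennreal (t * \<kappa> m x) \<partial>\<mu>) \<le> ennreal (1 + C)" for m
    proof -
      have "(\<integral>\<^sup>+x. ennreal (t * \<kappa> m x) \<partial>\<mu>) \<le> (\<integral>\<^sup>+x. ennreal ((\<rho> x * (t * \<kappa> m x)) powr p) \<partial>lborel) + ennreal C"
        unfolding p_def
      proof (rule bnd)
        show "supp_cpt UNIV (\<lambda>x. t * \<kappa> m x)" by (rule supp_cpt_mono[OF supp_cpt_mult[OF \<kappa>(2)]]) simp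
      qed (use t \<kappa> in \<open>auto intro!: continuous_intros\<close>)
      also have "(\<integral>\<^sup>+x. ennreal ((\<rho> x * (t * \<kappa> m x)) powr p) \<partial>lborel) \<le> (\<integral>\<^sup>+x. ennreal (t powr p) * indicator T x \<partial>lborel)"
      proof (rule nn_integral_mono)
        fix x
        show "ennreal ((\<rho> x * (t * \<kappa> m x)) powr p) \<le> ennreal (t powr p) * indicator T x"
        proof (cases "x \<in> T")
          case True
          have "\<rho> x * (t * \<kappa> m x) \<le> 1 * (t * 1)"
            using \<rho>1[of x] \<rho>0[of x] \<kappa>(3,4)[of m x] t by (intro mult_mono) auto
          then show ?thesis using True p \<rho>0[of x] t \<kappa>(3)[of m x]
            by (auto intro!: ennreal_leI powr_mono2 mult_nonneg_nonneg less_imp_le[OF \<rho>0])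
        qed (use \<kappa>0 in auto)
      qed
      also have "\<dots> = ennreal (t powr p) * emeasure lborel T" by (rule nn_integral_cmult_indicator) auto
      also have "\<dots> \<le> ennreal (t powr p) * ennreal (t powr - p)" by (rule mult_left_mono[OF Te]) auto
      also have "\<dots> = ennreal 1" using t by (simp flip: ennreal_mult powr_add)
      finally show ?thesis using C by (simp add: ennreal_plus)
    qed
    have "(\<lambda>m. \<integral>\<^sup>+x. ennreal (t * \<kappa> m x) \<partial>\<mu>) \<longlonglongrightarrow> (\<integral>\<^sup>+x. ennreal (t * indicator T x) \<partial>\<mu>)"
    proof (rule nn_integral_dominated_convergence[where w="\<lambda>_. ennreal t"])
      show "AE x in \<mu>. ennreal (t * \<kappa> m x) \<le> ennreal t" for m
        using \<kappa>(4) t by (intro AE_I2 ennreal_leI) (simp add: mult_left_le)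
      show "AE x in \<mu>. (\<lambda>m. ennreal (t * \<kappa> m x)) \<longlonglongrightarrow> ennreal (t * indicator T x)"
        by (intro AE_I2 tendsto_ennrealI tendsto_intros \<kappa>)
      show "(\<integral>\<^sup>+x. ennreal t \<partial>\<mu>) < \<infinity>"
        using emeasure_real[of "space \<mu>"] by (auto simp: ennreal_mult_less_top)
    qed auto
    then have "(\<integral>\<^sup>+x. ennreal (t * indicator T x) \<partial>\<mu>) \<le> ennreal (1 + C)"
      using le by (intro LIMSEQ_le_const2) auto
    also have "(\<integral>\<^sup>+x. ennreal (t * indicator T x) \<partial>\<mu>) = ennreal t * emeasure \<mu> T"
      using t by (subst nn_integral_cmult_indicator[symmetric]) (auto intro!: nn_integral_cong simp: indicator_def sets\<mu>)
    finally have "ennreal (t * measure \<mu> T) \<le> ennreal (1 + C)"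
      using t by (simp add: emeasure_eq_measure ennreal_mult)
    then have "t * measure \<mu> T \<le> 1 + C" using C by (subst (asm) ennreal_le_iff) auto
    moreover have "measure \<mu> N \<le> measure \<mu> T" using T(2) by (intro finite_measure_mono) (auto simp: sets\<mu>)
    then have "t * measure \<mu> N \<le> t * measure \<mu> T" using t by (intro mult_left_mono) auto
    ultimately show ?thesis by linarith
  qed
  have ac: "absolutely_continuous lborel \<mu>" unfolding absolutely_continuous_def
  proof
    fix N assume N: "N \<in> null_sets (lborel :: 'a measure)"
    have "measure \<mu> N = 0"
    proof (rule ccontr)
      assume "measure \<mu> N \<noteq> 0"
      then have m: "measure \<mu> N > 0" by (simp add: less_le)
      then have "max 1 ((2 + C) / measure \<mu> N) * measure \<mu> N \<ge> 2 + C"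
        by (auto simp: max_def field_simps)
      then show False using small[OF N, of "max 1 ((2 + C) / measure \<mu> N)"] by simp
    qed
    then show "N \<in> null_sets \<mu>" using N by (auto simp: null_sets_def sets\<mu> emeasure_eq_measure)
  qed
  obtain D where Dm [measurable]: "D \<in> borel_measurable lborel"
    and DR: "AE x in lborel. RN_deriv lborel \<mu> x = ennreal (D x)" and D0: "\<And>x. 0 \<le> D x"
    by (rule sigma_finite_measure.real_RN_deriv[OF sigma_finite_lborel fin ac]) (simp_all add: sets\<mu>)
  have "density lborel (RN_deriv lborel \<mu>) = \<mu>"
    by (rule sigma_finite_measure.density_RN_deriv[OF sigma_finite_lborel ac]) (simp add: sets\<mu>)
  then have \<mu>D: "\<mu> = density lborel (\<lambda>x. ennreal (D x))"
    using density_cong[OF _ _ DR] by simp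
  define h where "h x = D x / \<rho> x" for x
  have hm [measurable]: "h \<in> borel_measurable borel" unfolding h_def by measurable
  have h0: "0 \<le> h x" for x unfolding h_def using D0[of x] \<rho>0[of x] by simp
  have Dh: "D x = \<rho> x * h x" for x unfolding h_def using \<rho>0[of x] by simp
  \<comment> \<open>The functional bound is carried over from continuous functions to bounded Borel
    functions of bounded support. Absolute continuity makes the approximants converge almost
    everywhere for \<mu> as well.\<close>
  have ext: "(\<integral>\<^sup>+x. ennreal (u x) \<partial>\<mu>) \<le> (\<integral>\<^sup>+x. ennreal ((\<rho> x * u x) powr p) \<partial>lborel) + ennreal C"
    if um [measurable]: "u \<in> borel_measurable borel" and u: "\<And>x. 0 \<le> u x" "\<And>x. u x \<le> B" "\<And>x. x \<notin> ball 0 R \<Longrightarrow> u x = 0" for u B R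
  proof -
    have ub: "\<bar>u x\<bar> \<le> B" for x using u(1,2)[of x] by simp
    have "\<forall>x. x \<notin> ball 0 R \<longrightarrow> u x = 0" using u(3) by blast
    with open_ball have "\<exists>g. (\<forall>n::nat. continuous_on UNIV (g n) \<and> supp_cpt (ball 0 R) (g n) \<and> (\<forall>x. \<bar>g n x\<bar> \<le> B)
          \<and> ((\<forall>x. 0 \<le> u x) \<longrightarrow> (\<forall>x. 0 \<le> g n x))) \<and> (AE x in lborel. (\<lambda>n. g n x) \<longlonglongrightarrow> u x)"
      by (rule Cc_approx_AE[OF um ub])
    then
    obtain g where g': "\<forall>n::nat. continuous_on UNIV (g n) \<and> supp_cpt (ball 0 R) (g n) \<and> (\<forall>x. \<bar>g n x\<bar> \<le> B)
          \<and> ((\<forall>x. 0 \<le> u x) \<longrightarrow> (\<forall>x. 0 \<le> g n x))"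
      and gu: "AE x in lborel. (\<lambda>n::nat. g n x) \<longlonglongrightarrow> u x" by (elim exE conjE)
    then have g: "\<And>n. continuous_on UNIV (g n)" "\<And>n. supp_cpt (ball 0 R) (g n)"
      "\<And>n x. \<bar>g n x\<bar> \<le> B" "\<And>n x. 0 \<le> g n x" using u(1) by blast+
    have B0: "0 \<le> B" using u(1,2)[of undefined] by linarith
    have [measurable]: "g n \<in> borel_measurable borel" for n using g(1) by (rule borel_measurable_continuous_onI)
    have g0: "g n x = 0" if "x \<notin> ball 0 R" for n x using g(2)[of n] that unfolding supp_cpt_def by blast
    have gu\<mu>: "AE x in \<mu>. (\<lambda>n::nat. g n x) \<longlonglongrightarrow> u x"
      using absolutely_continuous_AE[OF _ ac gu] by (simp add: sets\<mu>)
    have l1: "(\<lambda>n. \<integral>\<^sup>+x. ennreal (g n x) \<partial>\<mu>) \<longlonglongrightarrow> (\<integral>\<^sup>+x. ennreal (u x) \<partial>\<mu>)"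
    proof (rule nn_integral_dominated_convergence[where w="\<lambda>_. ennreal B"])
      show "AE x in \<mu>. ennreal (g n x) \<le> ennreal B" for n
        using g(3) by (intro AE_I2 ennreal_leI) (simp add: abs_le_iff)
      show "AE x in \<mu>. (\<lambda>n. ennreal (g n x)) \<longlonglongrightarrow> ennreal (u x)"
        using gu\<mu> by eventually_elim (rule tendsto_ennrealI)
      show "(\<integral>\<^sup>+x. ennreal B \<partial>\<mu>) < \<infinity>"
        using emeasure_real[of "space \<mu>"] by (auto simp: ennreal_mult_less_top)
    qed auto
    let ?w = "\<lambda>x::'a. ennreal (B powr p) * indicator (ball 0 R) x"
    have l2: "(\<lambda>n. \<integral>\<^sup>+x. ennreal ((\<rho> x * g n x) powr p) \<partial>lborel) \<longlonglongrightarrow> (\<integral>\<^sup>+x. ennreal ((\<rho> x * u x) powr p) \<partial>lborel)"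
    proof (rule nn_integral_dominated_convergence[where w="?w"])
      show "(\<integral>\<^sup>+x. ?w x \<partial>lborel) < \<infinity>"
        using emeasure_bounded_finite[OF bounded_ball, of "0::'a" R]
        by (subst nn_integral_cmult_indicator) (auto simp: ennreal_mult_less_top less_top)
      show "AE x in lborel. ennreal ((\<rho> x * g n x) powr p) \<le> ?w x" for n
      proof (rule AE_I2)
        fix x
        have "\<rho> x * g n x \<le> 1 * B" using \<rho>0[of x] \<rho>1[of x] g(3,4)[of n x] by (intro mult_mono) auto
        then show "ennreal ((\<rho> x * g n x) powr p) \<le> ?w x"
          using g0[of x n] p \<rho>0[of x] g(4)[of n x]
          by (cases "x \<in> ball 0 R") (auto intro!: ennreal_leI powr_mono2 mult_nonneg_nonneg less_imp_le[OF \<rho>0])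
      qed
      show "AE x in lborel. (\<lambda>n. ennreal ((\<rho> x * g n x) powr p)) \<longlonglongrightarrow> ennreal ((\<rho> x * u x) powr p)"
        using gu
      proof eventually_elim
        case (elim x)
        have "(\<lambda>n. (\<rho> x * g n x) powr p) \<longlonglongrightarrow> (\<rho> x * u x) powr p"
          using p \<rho>0[of x] g(4)[of _ x] by (intro tendsto_powr' tendsto_intros elim) (auto intro!: always_eventually mult_nonneg_nonneg less_imp_le[OF \<rho>0])
        then show ?case by (rule tendsto_ennrealI)
      qed
    qed measurable
    show ?thesis
    proof (rule LIMSEQ_le[OF l1])
      show "(\<lambda>n. (\<integral>\<^sup>+x. ennreal ((\<rho> x * g n x) powr p) \<partial>lborel) + ennreal C)
         \<longlonglongrightarrow> (\<integral>\<^sup>+x. ennreal ((\<rho> x * u x) powr p) \<partial>lborel) + ennreal C"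
        by (intro tendsto_add l2 tendsto_const)
      have "supp_cpt UNIV (g n)" for n by (rule supp_cpt_mono[OF g(2)]) simp
      then show "\<exists>N. \<forall>n\<ge>N. (\<integral>\<^sup>+x. ennreal (g n x) \<partial>\<mu>) \<le> (\<integral>\<^sup>+x. ennreal ((\<rho> x * g n x) powr p) \<partial>lborel) + ennreal C"
        unfolding p_def by (intro exI[of _ 0] allI impI bnd g)
    qed
  qed
  define v where "v n x = (min (h x) (real n)) powr q * indicator (ball 0 (real n)) x" for n x
  have vm [measurable]: "v n \<in> borel_measurable borel" for n unfolding v_def by measurable
  \<comment> \<open>What is left after absorption: because of the factor 1/2 in the test function u
    below, the left side carries 1/2 and the right side (1/2)^p, and p > 1 makes the difference
    positive.\<close>
  define c where "c = 1/2 - (1/2) powr p"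
  have c: "c > 0"
  proof -
    have "(1/2::real) powr p < (1/2) powr 1" using p by (intro powr_less_mono') auto
    then show ?thesis unfolding c_def by simp
  qed
  have vbound: "(\<integral>\<^sup>+x. ennreal (v n x) \<partial>lborel) \<le> ennreal (C / c)" for n
  proof -
    define V where "V = (\<integral>\<^sup>+x. ennreal (v n x) \<partial>lborel)"
    have cm: "(\<integral>\<^sup>+x. ennreal (a * v n x) \<partial>lborel) = ennreal a * V" if "a \<ge> 0" for a
    proof -
      have "(\<integral>\<^sup>+x. ennreal (a * v n x) \<partial>lborel) = (\<integral>\<^sup>+x. ennreal a * ennreal (v n x) \<partial>lborel)"
        using that by (intro nn_integral_cong ennreal_mult')
      then show ?thesis unfolding V_def by (simp add: nn_integral_cmult)
    qed
    \<comment> \<open>The truncation makes V finite; without this V could not be moved from one side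
      of the inequality to the other.\<close>
    have "V \<le> (\<integral>\<^sup>+x. ennreal (real n powr q) * indicator (ball (0::'a) (real n)) x \<partial>lborel)"
      unfolding V_def v_def using q h0 by (intro nn_integral_mono) (auto simp: indicator_def intro!: ennreal_leI powr_mono2)
    also have "\<dots> < \<infinity>"
      using emeasure_bounded_finite[OF bounded_ball, of "0::'a" "real n"]
      by (subst nn_integral_cmult_indicator) (auto simp: ennreal_mult_less_top less_top)
    finally obtain V' where V': "V = ennreal V'" "V' \<ge> 0" by (cases V) auto
    \<comment> \<open>The extremal function of Hoelder's inequality, truncated and halved. On the
      ball (\<rho> u)^p equals (1/2)^p min(h, n)^q, while D u = \<rho> h u is at least half of
      min(h, n)^q.\<close>
    define u where "u x = 1/2 * (min (h x) (real n)) powr (q - 1) / \<rho> x * indicator (ball 0 (real n)) x" for x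
    have um [measurable]: "u \<in> borel_measurable borel" unfolding u_def by measurable
    have u0: "0 \<le> u x" for x unfolding u_def using \<rho>0[of x] by (auto intro!: mult_nonneg_nonneg divide_nonneg_pos)
    \<comment> \<open>On the closed ball \<rho> has a positive minimum, so that dividing by \<rho>
      leaves u bounded.\<close>
    obtain x0 where x0: "\<forall>x\<in>cball 0 (real n). \<rho> x0 \<le> \<rho> x"
      using continuous_attains_inf[OF compact_cball _ continuous_on_subset[OF \<rho>c subset_UNIV], of "0::'a" "real n"]
      by auto
    define a where "a = \<rho> x0"
    have a: "a > 0" "\<And>x. x \<in> cball 0 (real n) \<Longrightarrow> a \<le> \<rho> x" unfolding a_def using \<rho>0 x0 by auto
    have ub: "u x \<le> 1/2 * (real n powr (q - 1)) / a" for x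
    proof (cases "x \<in> ball 0 (real n)")
      case True
      have "1/2 * (min (h x) (real n)) powr (q - 1) / \<rho> x \<le> 1/2 * (real n powr (q - 1)) / a"
        using a True q h0[of x] by (intro frac_le mult_left_mono powr_mono2) auto
      then show ?thesis using True unfolding u_def by simp
    qed (use a in \<open>auto simp: u_def\<close>)
    have "(\<integral>\<^sup>+x. ennreal (u x) \<partial>\<mu>) \<le> (\<integral>\<^sup>+x. ennreal ((\<rho> x * u x) powr p) \<partial>lborel) + ennreal C"
      by (rule ext[OF um u0 ub, of "real n"]) (auto simp: u_def)
    also have "(\<lambda>x. (\<rho> x * u x) powr p) = (\<lambda>x. (1/2) powr p * v n x)"
    proof
      fix x
      show "(\<rho> x * u x) powr p = (1/2) powr p * v n x"
      proof (cases "x \<in> ball 0 (real n)")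
        case True
        have "\<rho> x * u x = 1/2 * (min (h x) (real n)) powr (q - 1)" unfolding u_def using True \<rho>0[of x] by simp
        then have "(\<rho> x * u x) powr p = (1/2) powr p * ((min (h x) (real n)) powr (q - 1)) powr p"
          by (simp only: powr_mult)
        also have "((min (h x) (real n)) powr (q - 1)) powr p = (min (h x) (real n)) powr q"
          unfolding powr_powr p_def using q by simp
        finally show ?thesis using True by (simp add: v_def)
      qed (use p in \<open>simp add: u_def v_def\<close>)
    qed
    also have "(\<integral>\<^sup>+x. ennreal ((1/2) powr p * v n x) \<partial>lborel) = ennreal ((1/2) powr p) * V"
      by (rule cm) simp
    finally have up: "(\<integral>\<^sup>+x. ennreal (u x) \<partial>\<mu>) \<le> ennreal ((1/2) powr p) * V + ennreal C" .
    have "ennreal (1/2) * V = (\<integral>\<^sup>+x. ennreal (1/2 * v n x) \<partial>lborel)"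
      by (rule cm[symmetric]) simp
    also have "\<dots> \<le> (\<integral>\<^sup>+x. ennreal (D x * u x) \<partial>lborel)"
    proof (intro nn_integral_mono ennreal_leI)
      fix x
      show "1/2 * v n x \<le> D x * u x"
      proof (cases "x \<in> ball 0 (real n)")
        case True
        define m where "m = min (h x) (real n)"
        have m: "0 \<le> m" "m \<le> h x" unfolding m_def using h0[of x] by auto
        have "m powr q = m powr 1 * m powr (q - 1)" using powr_add[of m 1 "q - 1"] by simp
        also have "\<dots> = m * m powr (q - 1)" using m by (cases "m = 0") auto
        also have "\<dots> \<le> h x * m powr (q - 1)" using m by (intro mult_right_mono) auto
        finally show ?thesis using True \<rho>0[of x] by (simp add: Dh u_def v_def m_def[symmetric])
      qed (simp add: u_def v_def)
    qed
    also have "\<dots> = (\<integral>\<^sup>+x. ennreal (u x) \<partial>\<mu>)"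
      unfolding \<mu>D by (subst nn_integral_density) (auto simp: ennreal_mult' D0)
    finally have "ennreal (1/2) * V \<le> ennreal ((1/2) powr p) * V + ennreal C" using up by (rule order_trans)
    moreover have "ennreal (1/2) * V = ennreal (1/2 * V')" "ennreal ((1/2) powr p) * V = ennreal ((1/2) powr p * V')"
      unfolding V'(1) by (rule ennreal_mult[symmetric], use V' in simp_all)+
    moreover have "ennreal ((1/2) powr p * V') + ennreal C = ennreal ((1/2) powr p * V' + C)"
      using V'(2) C by (intro ennreal_plus[symmetric]) auto
    ultimately have "ennreal (1/2 * V') \<le> ennreal ((1/2) powr p * V' + C)" by metis
    then have "1/2 * V' \<le> (1/2) powr p * V' + C" using C V' by (subst (asm) ennreal_le_iff) auto
    then have "c * V' \<le> C" unfolding c_def by (simp add: left_diff_distrib)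
    then have "V' \<le> C / c" using c by (simp add: field_simps)
    then show ?thesis using V' V_def by (simp add: ennreal_leI)
  qed
  have "(\<integral>\<^sup>+x. ennreal (h x powr q) \<partial>lborel) = (\<integral>\<^sup>+x. liminf (\<lambda>n. ennreal (v n x)) \<partial>lborel)"
  proof (rule nn_integral_cong)
    fix x
    obtain N where N: "real N > norm x + h x" using reals_Archimedean2 by blast
    have "ennreal (v n x) = ennreal (h x powr q)" if "n \<ge> N" for n
    proof -
      have "real n > norm x + h x" using N that by linarith
      then have "norm x < real n" "h x < real n" using norm_ge_zero[of x] h0[of x] by linarith+
      then show ?thesis by (simp add: v_def)
    qed
    then have "(\<lambda>n. ennreal (v n x)) \<longlonglongrightarrow> ennreal (h x powr q)"
      by (intro tendsto_eventually) (auto simp: eventually_sequentially)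
    then show "ennreal (h x powr q) = liminf (\<lambda>n. ennreal (v n x))"
      by (simp add: lim_imp_Liminf)
  qed
  \<comment> \<open>Fatou's lemma removes the truncation, since the bound on \<open>v n\<close> does
    not depend on n.\<close>
  also have "\<dots> \<le> liminf (\<lambda>n. \<integral>\<^sup>+x. ennreal (v n x) \<partial>lborel)"
    by (rule nn_integral_liminf) auto
  also have "\<dots> \<le> ennreal (C / c)"
    using vbound by (intro Liminf_le) (auto intro: always_eventually)
  finally have "(\<integral>\<^sup>+x. ennreal (h x powr q) \<partial>lborel) < \<infinity>" by (simp add: le_less_trans)
  then show ?thesis using \<mu>D h0 hm unfolding Dh by (intro exI[of _ h]) auto
qed

section \<open>From continuous partial derivatives to a continuous gradient\<close>

lemma DERIV_mean_value:
  fixes k :: "real \<Rightarrow> real"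
  assumes "\<And>s. (k has_real_derivative k' s) (at s)"
  shows "\<exists>\<xi>. \<bar>\<xi>\<bar> \<le> \<bar>s\<bar> \<and> k s - k 0 = s * k' \<xi>"
proof -
  consider "s = 0" | "s > 0" | "s < 0" by linarith
  then show ?thesis
  proof cases
    case 1
    then show ?thesis by auto
  next
    case 2
    then obtain z where "0 < z" "z < s" "k s - k 0 = (s - 0) * k' z"
      using MVT2[of 0 s k k'] assms by blast
    then show ?thesis by (intro exI[of _ z]) auto
  next
    case 3
    then obtain z where "s < z" "z < 0" "k 0 - k s = (0 - s) * k' z"
      using MVT2[of s 0 k k'] assms by blast
    then show ?thesis by (intro exI[of _ z]) auto
  qed
qed

lemma smooth_on_partials:
  assumes g: "smooth_on UNIV g" and b: "b \<in> Basis"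
  shows "continuous_on UNIV (pdir b g)"
    and "((\<lambda>s. g (x + s *\<^sub>R b)) has_real_derivative pdir b g (x + s *\<^sub>R b)) (at s)"
proof -
  show "continuous_on UNIV (pdir b g)"
    using g[unfolded smooth_on_def, rule_format, of "[b]"] b by simp
  have "(\<lambda>t. g ((x + s *\<^sub>R b) + t *\<^sub>R b)) differentiable (at 0)"
    using g[unfolded smooth_on_def, rule_format, of "[]"] b by simp
  then have "((\<lambda>t. g ((x + s *\<^sub>R b) + t *\<^sub>R b)) has_real_derivative pdir b g (x + s *\<^sub>R b)) (at 0)"
    unfolding pdir_def by (simp add: DERIV_deriv_iff_real_differentiable)
  then show "((\<lambda>s. g (x + s *\<^sub>R b)) has_real_derivative pdir b g (x + s *\<^sub>R b)) (at s)"
    using DERIV_shift[of "\<lambda>s. g (x + s *\<^sub>R b)" _ 0 s] by (simp add: algebra_simps)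
qed

text \<open>Change one coordinate at a time. The mean value theorem turns each step into a value of
  one partial derivative at a point near x, and continuity of that derivative at x bounds the error.
  The induction is on the set of coordinates that may change.\<close>

lemma partials_increment_bound:
  fixes g :: "'a::euclidean_space \<Rightarrow> real"
  assumes g: "smooth_on UNIV g" and A: "finite A" "A \<subseteq> Basis" and e: "e > 0"
  shows "\<exists>d>0. \<forall>y h. norm (y - x) < d \<longrightarrow> norm h < d \<longrightarrow> (\<forall>b\<in>Basis - A. h \<bullet> b = 0) \<longrightarrow>
    \<bar>g (y + h) - g y - (\<Sum>b\<in>A. (h \<bullet> b) * pdir b g x)\<bar> \<le> e * (\<Sum>b\<in>A. \<bar>h \<bullet> b\<bar>)"
  using A
proof (induction A rule: finite_induct)
  case empty
  have "(\<forall>b\<in>Basis. h \<bullet> b = 0) \<longleftrightarrow> h = 0" for h :: 'a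
    by (rule euclidean_all_zero_iff)
  then show ?case by (intro exI[of _ 1]) simp
next
  case (insert a A)
  then have a: "a \<in> Basis" and AB: "A \<subseteq> Basis" by auto
  obtain d1 where d1: "d1 > 0" and IH: "\<And>y h. norm (y - x) < d1 \<Longrightarrow> norm h < d1 \<Longrightarrow> (\<forall>b\<in>Basis - A. h \<bullet> b = 0) \<Longrightarrow>
    \<bar>g (y + h) - g y - (\<Sum>b\<in>A. (h \<bullet> b) * pdir b g x)\<bar> \<le> e * (\<Sum>b\<in>A. \<bar>h \<bullet> b\<bar>)"
    using insert.IH[OF AB] by blast
  have "isCont (pdir a g) x"
    using smooth_on_partials(1)[OF g a] by (simp add: continuous_on_eq_continuous_at)
  then obtain d2 where d2: "d2 > 0" and cont: "\<And>z. norm (z - x) < d2 \<Longrightarrow> \<bar>pdir a g z - pdir a g x\<bar> < e"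
    using e unfolding continuous_at_eps_delta by (metis dist_norm real_norm_def)
  \<comment> \<open>The intermediate point has distance at most norm (y - x) + 2 norm h + norm h
    from x, which is below 4 d; hence the factor 4.\<close>
  define d where "d = min d1 d2 / 4"
  have d: "d > 0" "4 * d \<le> d1" "4 * d \<le> d2" unfolding d_def using d1 d2 by auto
  have "\<bar>g (y + h) - g y - (\<Sum>b\<in>insert a A. (h \<bullet> b) * pdir b g x)\<bar> \<le> e * (\<Sum>b\<in>insert a A. \<bar>h \<bullet> b\<bar>)"
    if y: "norm (y - x) < d" and h: "norm h < d" and h0: "\<forall>b\<in>Basis - insert a A. h \<bullet> b = 0" for y h
  proof -
    define h' where "h' = h - (h \<bullet> a) *\<^sub>R a"
    have ha: "\<bar>h \<bullet> a\<bar> \<le> norm h" using a by (rule Basis_le_norm)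
    have "norm h' \<le> norm h + norm ((h \<bullet> a) *\<^sub>R a)" unfolding h'_def by (rule norm_triangle_ineq4)
    then have nh': "norm h' \<le> 2 * norm h" using ha a by simp
    have h'b: "h' \<bullet> b = (if b = a then 0 else h \<bullet> b)" if "b \<in> Basis" for b
      using that a by (auto simp: h'_def inner_diff_left inner_Basis)
    have 1: "\<bar>g (y + h') - g y - (\<Sum>b\<in>A. (h' \<bullet> b) * pdir b g x)\<bar> \<le> e * (\<Sum>b\<in>A. \<bar>h' \<bullet> b\<bar>)"
    proof (rule IH)
      show "\<forall>b\<in>Basis - A. h' \<bullet> b = 0" using h0 h'b by auto
    qed (use y h d nh' in linarith)+
    have eqA: "h' \<bullet> b = h \<bullet> b" if "b \<in> A" for b using that h'b[of b] AB insert.hyps by auto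
    have 1: "\<bar>g (y + h') - g y - (\<Sum>b\<in>A. (h \<bullet> b) * pdir b g x)\<bar> \<le> e * (\<Sum>b\<in>A. \<bar>h \<bullet> b\<bar>)"
      using 1 by (simp add: eqA)
    obtain \<xi> where \<xi>: "\<bar>\<xi>\<bar> \<le> \<bar>h \<bullet> a\<bar>"
      and mv: "g (y + h' + (h \<bullet> a) *\<^sub>R a) - g (y + h' + 0 *\<^sub>R a) = (h \<bullet> a) * pdir a g (y + h' + \<xi> *\<^sub>R a)"
      using DERIV_mean_value[OF smooth_on_partials(2)[OF g a, of "y + h'"], of "h \<bullet> a"] by blast
    have "norm (y + h' + \<xi> *\<^sub>R a - x) \<le> norm (y - x) + norm h' + norm (\<xi> *\<^sub>R a)"
      using norm_triangle_ineq[of "(y - x) + h'" "\<xi> *\<^sub>R a"] norm_triangle_ineq[of "y - x" h']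
      by (simp add: algebra_simps)
    also have "norm (\<xi> *\<^sub>R a) \<le> norm h" using \<xi> ha a by simp
    finally have "norm (y + h' + \<xi> *\<^sub>R a - x) < d2" using y h d nh' by linarith
    then have "\<bar>pdir a g (y + h' + \<xi> *\<^sub>R a) - pdir a g x\<bar> < e" by (rule cont)
    then have "\<bar>h \<bullet> a\<bar> * \<bar>pdir a g (y + h' + \<xi> *\<^sub>R a) - pdir a g x\<bar> \<le> \<bar>h \<bullet> a\<bar> * e"
      by (intro mult_left_mono) auto
    moreover have yh: "y + h = y + h' + (h \<bullet> a) *\<^sub>R a" unfolding h'_def by simp
    have "g (y + h) - g (y + h') - (h \<bullet> a) * pdir a g x
        = (h \<bullet> a) * (pdir a g (y + h' + \<xi> *\<^sub>R a) - pdir a g x)"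
      using mv unfolding yh[symmetric] by (simp add: right_diff_distrib)
    ultimately have 2: "\<bar>g (y + h) - g (y + h') - (h \<bullet> a) * pdir a g x\<bar> \<le> e * \<bar>h \<bullet> a\<bar>"
      by (simp add: abs_mult mult.commute)
    have "(\<Sum>b\<in>insert a A. (h \<bullet> b) * pdir b g x) = (h \<bullet> a) * pdir a g x + (\<Sum>b\<in>A. (h \<bullet> b) * pdir b g x)"
      "(\<Sum>b\<in>insert a A. \<bar>h \<bullet> b\<bar>) = \<bar>h \<bullet> a\<bar> + (\<Sum>b\<in>A. \<bar>h \<bullet> b\<bar>)"
      using insert.hyps by auto
    then show ?thesis using 1 2 by (simp add: distrib_left)
  qed
  then show ?case using d(1) by blast
qed

text \<open>\<open>smooth_on\<close> speaks of partial derivatives along basis vectors; the chain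
  rule used for the group law asks for total derivatives. Continuity of the partial derivatives
  provides them.\<close>

lemma smooth_on_C1_fun:
  fixes g :: "'a::euclidean_space \<Rightarrow> real"
  assumes g: "smooth_on UNIV g" shows "C1_fun g"
proof -
  define G where "G x = (\<Sum>b\<in>Basis. pdir b g x *\<^sub>R b)" for x
  have "continuous_on UNIV G" unfolding G_def
    by (intro continuous_intros smooth_on_partials(1)[OF g])
  moreover have "(g has_derivative (\<lambda>h. G x \<bullet> h)) (at x)" for x
    unfolding has_derivative_at_alt
  proof (intro conjI allI impI)
    show "bounded_linear (\<lambda>h. G x \<bullet> h)" by (rule bounded_linear_inner_right)
    fix e :: real assume e: "e > 0"
    \<comment> \<open>Each of the DIM('a) coordinates of an increment is bounded by its norm, so the
      sum costs a factor DIM('a).\<close>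
    define e' where "e' = e / real DIM('a)"
    have e': "e' > 0" unfolding e'_def using e by simp
    obtain d where d: "d > 0" and D: "\<And>y h. norm (y - x) < d \<Longrightarrow> norm h < d \<Longrightarrow>
       \<bar>g (y + h) - g y - (\<Sum>b\<in>Basis. (h \<bullet> b) * pdir b g x)\<bar> \<le> e' * (\<Sum>b\<in>Basis. \<bar>h \<bullet> b\<bar>)"
      using partials_increment_bound[OF g finite_Basis order_refl e', of x] by auto
    have "norm (g y - g x - G x \<bullet> (y - x)) \<le> e * norm (y - x)" if "norm (y - x) < d" for y
    proof -
      have "(\<Sum>b\<in>Basis. \<bar>(y - x) \<bullet> b\<bar>) \<le> (\<Sum>b\<in>(Basis::'a set). norm (y - x))"
        by (intro sum_mono Basis_le_norm)
      then have "e' * (\<Sum>b\<in>Basis. \<bar>(y - x) \<bullet> b\<bar>) \<le> e' * (real DIM('a) * norm (y - x))"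
        using e' by (intro mult_left_mono) auto
      also have "\<dots> = e * norm (y - x)" unfolding e'_def by simp
      finally have 1: "e' * (\<Sum>b\<in>Basis. \<bar>(y - x) \<bullet> b\<bar>) \<le> e * norm (y - x)" .
      have 2: "G x \<bullet> (y - x) = (\<Sum>b\<in>Basis. ((y - x) \<bullet> b) * pdir b g x)"
        unfolding G_def inner_sum_left by (intro sum.cong refl) (simp add: inner_commute[of _ "y - x"])
      show ?thesis using D[of x "y - x"] that d 1 unfolding 2 by simp
    qed
    then show "\<exists>d>0. \<forall>y. norm (y - x) < d \<longrightarrow> norm (g y - g x - G x \<bullet> (y - x)) \<le> e * norm (y - x)"
      using d by blast
  qed
  ultimately show ?thesis unfolding C1_fun_def by blast
qed

subsection \<open>Invariance of Lebesgue measure\<close>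

text \<open>The change of variables theorem of the library needs a well-ordered index type; this is
  one of the same size as a given finite type.\<close>

typedef (overloaded) ('a::finite) ord_index = "{..<CARD('a)}"
  by (rule exI[of _ 0]) simp

instantiation ord_index :: (finite) linorder
begin
definition "a \<le> b \<longleftrightarrow> Rep_ord_index a \<le> Rep_ord_index b"
definition "a < b \<longleftrightarrow> Rep_ord_index a < Rep_ord_index b"
instance
  by intro_classes (auto simp: less_eq_ord_index_def less_ord_index_def Rep_ord_index_inject)
end

instance ord_index :: (finite) finite
proof
  have "finite (Abs_ord_index ` {..<CARD('a)} :: 'a ord_index set)" by simp
  then show "finite (UNIV :: 'a ord_index set)"
    using type_definition.Abs_image[OF type_definition_ord_index] by metis
qed

instance ord_index :: (finite) wellorder
proof
  fix P :: "'a ord_index \<Rightarrow> bool" and a :: "'a ord_index"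
  assume step: "\<And>x. (\<And>y. y < x \<Longrightarrow> P y) \<Longrightarrow> P x"
  show "P a"
    by (induction a rule: measure_induct_rule[of Rep_ord_index]) (auto intro: step simp: less_ord_index_def)
qed

lemma ex_bij_ord_index: "\<exists>e::'a::finite ord_index \<Rightarrow> 'a. bij e"
proof -
  have "CARD('a ord_index) = CARD('a)"
    using type_definition.card[OF type_definition_ord_index] by simp
  then show ?thesis using bij_betw_iff_card[of "UNIV :: 'a ord_index set" "UNIV :: 'a set"] by auto
qed

lemma dil_linear: "linear (dil w s)"
  by (intro linearI) (auto simp: dil_def vec_eq_iff algebra_simps)

lemma dil_tendsto_0:
  assumes "\<And>i. w i \<ge> 1" "e \<longlonglongrightarrow> 0"
  shows "(\<lambda>n. dil w (e n) x) \<longlonglongrightarrow> 0"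
proof (rule vec_tendstoI)
  fix i
  have "(\<lambda>n. e n ^ w i * x $ i) \<longlonglongrightarrow> 0 ^ w i * x $ i" by (intro tendsto_intros assms)
  moreover have "(0::real) ^ w i = 0" using assms(1)[of i] by (simp add: power_0_left)
  ultimately show "(\<lambda>n. dil w (e n) x $ i) \<longlonglongrightarrow> 0 $ i" by (simp add: dil_def)
qed

text \<open>The Jacobian determinant of a smooth dilation-equivariant family is constant along dilation
  orbits, hence equal to its value at the origin.\<close>

lemma equivariant_family_lborel_wellorder:
  fixes F :: "real^'m::{finite,wellorder} \<Rightarrow> real^'m::_ \<Rightarrow> real^'m::_"
  assumes der: "\<And>y x. (F y has_derivative F' y x) (at x)"
    and cont: "\<And>i j. continuous_on UNIV (\<lambda>p. F' (fst p) (snd p) (axis i 1) $ j)"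
    and dil: "\<And>s x y. s > 0 \<Longrightarrow> dil w s (F y x) = F (dil w s y) (dil w s x)"
    and F0: "\<And>x. F 0 x = x" and inv: "\<And>y x. F y (F (- y) x) = x" and w: "\<And>i. w i \<ge> 1"
  shows "distr lborel borel (F y) = lborel"
proof -
  define J where "J p = det (matrix (F' (fst p) (snd p)))" for p
  have Jc: "continuous_on UNIV J"
    unfolding J_def det_def matrix_def by (simp, intro continuous_intros cont)
  have lin: "linear (F' y x)" for y x using der[of y x] by (rule has_derivative_linear)
  have J00: "J 0 = 1"
  proof -
    have "(F 0 has_derivative (\<lambda>h. h)) (at 0)" using F0 by (simp add: fun_eq_iff[symmetric] ext[of "F 0" "\<lambda>x. x"])
    then have "F' 0 0 = (\<lambda>h. h)" using der[of 0 0] has_derivative_unique by blast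
    then show ?thesis by (simp add: J_def matrix_id_mat_1[unfolded id_def])
  qed
  \<comment> \<open>Differentiating the equivariance relation shows that the derivative at the
    dilated point, composed with the dilation, is the dilation composed with the derivative. The
    determinant of the dilation is nonzero and cancels.\<close>
  have Jdil: "J (dil w s y, dil w s x) = J (y, x)" if s: "s > 0" for s x y
  proof -
    have dd: "(dil w s has_derivative dil w s) (at z)" for z
      by (rule bounded_linear_imp_has_derivative[OF linear_conv_bounded_linear[THEN iffD1, OF dil_linear]])
    have "((\<lambda>x. F (dil w s y) (dil w s x)) has_derivative (\<lambda>h. F' (dil w s y) (dil w s x) (dil w s h))) (at x)"
      by (rule has_derivative_compose[OF dd der])
    moreover have "((\<lambda>x. dil w s (F y x)) has_derivative (\<lambda>h. dil w s (F' y x h))) (at x)"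
      by (rule has_derivative_compose[OF der dd])
    ultimately have "(\<lambda>h. F' (dil w s y) (dil w s x) (dil w s h)) = (\<lambda>h. dil w s (F' y x h))"
      using has_derivative_unique dil[OF s] by (simp only: dil[OF s])
    then have "F' (dil w s y) (dil w s x) \<circ> dil w s = dil w s \<circ> F' y x" by (simp add: comp_def)
    then have "matrix (F' (dil w s y) (dil w s x)) ** matrix (dil w s) = matrix (dil w s) ** matrix (F' y x)"
      by (metis matrix_compose lin dil_linear)
    then have "det (matrix (F' (dil w s y) (dil w s x))) * det (matrix (dil w s)) = det (matrix (dil w s)) * det (matrix (F' y x))"
      by (metis det_mul)
    moreover have "det (matrix (dil w s)) \<noteq> 0"
    proof -
      have "det (matrix (dil w s)) = (\<Prod>i\<in>UNIV. matrix (dil w s) $ i $ i)"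
        by (rule det_diagonal) (simp add: matrix_def dil_def axis_def)
      also have "\<dots> = (\<Prod>i\<in>UNIV. s ^ w i)" by (simp add: matrix_def dil_def axis_def)
      finally show ?thesis using s by simp
    qed
    ultimately show ?thesis unfolding J_def by simp
  qed
  have J1: "J (y, x) = 1" for y x
  proof -
    let ?e = "\<lambda>n. inverse (real (Suc n))"
    have "(\<lambda>n. (dil w (?e n) y, dil w (?e n) x)) \<longlonglongrightarrow> (0, 0)"
      by (intro tendsto_Pair dil_tendsto_0 w LIMSEQ_inverse_real_of_nat)
    then have "(\<lambda>n. J (dil w (?e n) y, dil w (?e n) x)) \<longlonglongrightarrow> J (0, 0)"
      using Jc by (auto simp: continuous_on_eq_continuous_at intro!: isCont_tendsto_compose[of _ J])
    then have "(\<lambda>n. J (y, x)) \<longlonglongrightarrow> 1" using J00 by (simp add: Jdil zero_prod_def)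
    then show ?thesis using LIMSEQ_unique tendsto_const by blast
  qed
  have Fc: "continuous_on UNIV (F y)" for y
    using der by (meson continuous_at_imp_continuous_on has_derivative_continuous)
  have Fm [measurable]: "F y \<in> borel_measurable borel" for y using Fc by (rule borel_measurable_continuous_onI)
  have inv': "F (- y) (F y x) = x" for x y using inv[of "- y" x] by simp
  \<comment> \<open>The preimage under \<open>F y\<close> is the image under \<open>F (- y)\<close>,
    to which the change of variables for injective images applies with Jacobian 1. Boxes suffice
    because they determine \<open>lborel\<close>.\<close>
  have box: "emeasure lborel (F y -` box l u) = emeasure lborel (box l u)" for l u
  proof -
    let ?S = "box l u"
    have S: "?S \<in> lmeasurable" by (rule lmeasurable_box)
    have inj: "inj_on (F (- y)) ?S" by (rule inj_on_inverseI[of _ "F y"]) (rule inv)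
    have vi: "F y -` ?S = F (- y) ` ?S"
    proof
      show "F y -` ?S \<subseteq> F (- y) ` ?S" using inv'[of y] by (metis image_eqI subsetI vimageD)
      show "F (- y) ` ?S \<subseteq> F y -` ?S" using inv[of y] by auto
    qed
    have "((\<lambda>x. 1::real) has_integral measure lebesgue ?S) ?S"
      using S lmeasure_integral[OF S] lmeasurable_iff_integrable_on[of ?S] by (metis integrable_integral)
    moreover have "\<bar>det (matrix (F' (- y) x))\<bar> = 1" for x using J1[of "- y" x] by (simp add: J_def)
    ultimately have "((\<lambda>x. \<bar>det (matrix (F' (- y) x))\<bar>) has_integral measure lebesgue ?S) ?S" by simp
    then have "F (- y) ` ?S \<in> lmeasurable \<and> measure lebesgue (F (- y) ` ?S) = measure lebesgue ?S"
      using has_measure_differentiable_image[OF fmeasurableD[OF S] has_derivative_at_withinI[OF der] inj, of "measure lebesgue ?S"] by blast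
    then have "emeasure lebesgue (F (- y) ` ?S) = emeasure lebesgue ?S"
      using S by (simp add: emeasure_eq_measure2)
    moreover have Sb: "F y -` ?S \<in> sets borel" using measurable_sets[OF Fm, of ?S y] by simp
    have "emeasure lborel (F y -` ?S) = emeasure lebesgue (F y -` ?S)" using Sb by simp
    ultimately show ?thesis by (simp add: vi)
  qed
  have "lborel = distr lborel borel (F y)"
  proof (rule lborel_eqI)
    fix l u :: "real^'m::_" assume "\<And>b. b \<in> Basis \<Longrightarrow> l \<bullet> b \<le> u \<bullet> b"
    then show "emeasure (distr lborel borel (F y)) (box l u) = (\<Prod>b\<in>Basis. (u - l) \<bullet> b)"
      by (subst emeasure_distr) (auto simp: box emeasure_lborel_box)
  qed simp
  then show ?thesis by simp
qed

lemma lborel_reindex: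
  fixes e :: "'m::finite \<Rightarrow> 'n::finite"
  assumes e: "bij e"
  shows "distr lborel borel (\<lambda>y::real^'m. \<chi> i. y $ inv e i) = (lborel :: (real^'n) measure)"
proof -
  let ?T = "\<lambda>y::real^'m. (\<chi> i. y $ inv e i) :: real^'n"
  have Tc: "continuous_on UNIV ?T" by (intro continuous_intros)
  have Tm [measurable]: "?T \<in> borel_measurable borel" using Tc by (rule borel_measurable_continuous_onI)
  have "lborel = distr lborel borel ?T"
  proof (rule lborel_eqI)
    fix l u :: "real^'n" assume le: "\<And>b. b \<in> Basis \<Longrightarrow> l \<bullet> b \<le> u \<bullet> b"
    have le': "l $ i \<le> u $ i" for i using le[of "axis i 1"] by (simp add: inner_axis)
    let ?l = "(\<chi> j. l $ e j) :: real^'m" and ?u = "(\<chi> j. u $ e j) :: real^'m"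
    have "?T -` box l u = box ?l ?u"
    proof (intro set_eqI)
      fix y
      have "(\<forall>i. l $ i < y $ inv e i \<and> y $ inv e i < u $ i) \<longleftrightarrow> (\<forall>j. l $ e j < y $ j \<and> y $ j < u $ e j)"
        using e by (metis bij_inv_eq_iff)
      then show "y \<in> ?T -` box l u \<longleftrightarrow> y \<in> box ?l ?u" by (simp add: mem_box_cart)
    qed
    then have "emeasure (distr lborel borel ?T) (box l u) = emeasure lborel (box ?l ?u)"
      by (subst emeasure_distr) auto
    also have "\<dots> = ennreal (\<Prod>b\<in>Basis. (?u - ?l) \<bullet> b)"
      by (rule emeasure_lborel_box) (auto simp: Basis_vec_def inner_axis le')
    also have "(\<Prod>b\<in>Basis. (?u - ?l) \<bullet> b) = (\<Prod>j\<in>UNIV. (?u - ?l) $ j)"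
      by (simp add: Basis_vec_def prod.UNION_disjoint inner_axis axis_eq_axis prod.reindex inj_on_def UNION_singleton_eq_range)
    also have "\<dots> = (\<Prod>i\<in>UNIV. (u - l) $ i)"
      using prod.reindex_bij_betw[OF e, of "\<lambda>i. (u - l) $ i"] by simp
    also have "\<dots> = (\<Prod>b\<in>Basis. (u - l) \<bullet> b)"
      by (simp add: Basis_vec_def prod.UNION_disjoint inner_axis axis_eq_axis prod.reindex inj_on_def UNION_singleton_eq_range)
    finally show "emeasure (distr lborel borel ?T) (box l u) = (\<Prod>b\<in>Basis. (u - l) \<bullet> b)" .
  qed simp
  then show ?thesis by simp
qed

text \<open>Conjugation by a renumbering of the coordinates moves the family to the well-ordered
  index type and back. The renumbering preserves Lebesgue measure, and it commutes with dilations
  once the weights are renumbered as well.\<close>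

lemma equivariant_family_lborel:
  fixes F :: "real^'n::finite \<Rightarrow> real^'n \<Rightarrow> real^'n"
  assumes der: "\<And>y x. (F y has_derivative F' y x) (at x)"
    and cont: "\<And>i j. continuous_on UNIV (\<lambda>p. F' (fst p) (snd p) (axis i 1) $ j)"
    and dil: "\<And>s x y. s > 0 \<Longrightarrow> dil w s (F y x) = F (dil w s y) (dil w s x)"
    and F0: "\<And>x. F 0 x = x" and inv: "\<And>y x. F y (F (- y) x) = x" and w: "\<And>i. w i \<ge> 1"
  shows "distr lborel borel (F y) = lborel"
proof -
  obtain e :: "'n ord_index \<Rightarrow> 'n" where e: "bij e" using ex_bij_ord_index by blast
  define T where "T x = (\<chi> j. x $ e j)" for x :: "real^'n"
  define T' where "T' y = (\<chi> i. y $ inv e i)" for y :: "real^'n ord_index"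
  have TT': "T (T' y) = y" "T' (T x) = x" for x y
    using e by (simp_all add: T_def T'_def vec_eq_iff bij_is_inj bij_is_surj surj_f_inv_f)
  have blT: "bounded_linear T" "bounded_linear T'"
    unfolding linear_conv_bounded_linear[symmetric]
    by (intro linearI; simp add: T_def T'_def vec_eq_iff)+
  note Tder = bounded_linear_imp_has_derivative[OF blT(1)] and T'der = bounded_linear_imp_has_derivative[OF blT(2)]
  have T'c: "continuous_on UNIV T'" using blT(2) by (simp add: linear_continuous_on)
  define H where "H y x = T (F (T' y) (T' x))" for y x
  have H: "distr lborel borel (H y) = lborel" for y
  proof (rule equivariant_family_lborel_wellorder[where F' = "\<lambda>y x h. T (F' (T' y) (T' x) (T' h))" and w = "\<lambda>j. w (e j)"])
    show "(H y has_derivative (\<lambda>h. T (F' (T' y) (T' x) (T' h)))) (at x)" for y x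
      unfolding H_def by (rule has_derivative_compose[OF has_derivative_compose[OF T'der der] Tder])
    have ax: "T' (axis i 1) = axis (e i) 1" for i
      using e by (simp add: T'_def vec_eq_iff axis_def) (metis bij_inv_eq_iff)
    show "continuous_on UNIV (\<lambda>p. T (F' (T' (fst p)) (T' (snd p)) (T' (axis i 1))) $ j)" for i j
    proof -
      have "continuous_on UNIV (\<lambda>p. (T' (fst p), T' (snd p)))"
        by (intro continuous_on_Pair continuous_on_compose2[OF T'c] continuous_intros) auto
      from continuous_on_compose2[OF cont[of "e i" "e j"] this]
      show ?thesis unfolding ax T_def by simp
    qed
    have dT: "dil (\<lambda>j. w (e j)) s (T x) = T (dil w s x)" for s x by (simp add: dil_def T_def vec_eq_iff)
    have dT': "T' (dil (\<lambda>j. w (e j)) s y) = dil w s (T' y)" for s y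
      using e by (simp add: dil_def T'_def vec_eq_iff bij_is_surj surj_f_inv_f)
    show "dil (\<lambda>j. w (e j)) s (H y x) = H (dil (\<lambda>j. w (e j)) s y) (dil (\<lambda>j. w (e j)) s x)" if "s > 0" for s y x
      unfolding H_def dT dT' dil[OF that] ..
    show "H 0 x = x" for x unfolding H_def using F0 TT' by (simp add: linear_0[OF bounded_linear.linear[OF blT(2)]])
    have "T' (- y) = - T' y" for y by (rule linear_neg[OF bounded_linear.linear[OF blT(2)]])
    then show "H y (H (- y) x) = x" for y x unfolding H_def TT' using inv TT' by simp
  qed (rule w)
  have Fc: "continuous_on UNIV (F y)" for y
    using der by (meson continuous_at_imp_continuous_on has_derivative_continuous)
  have [measurable]: "F y \<in> borel_measurable borel" for y using Fc by (rule borel_measurable_continuous_onI)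
  have T'm [measurable]: "T' \<in> borel_measurable borel" using T'c by (rule borel_measurable_continuous_onI)
  have [measurable]: "T \<in> borel_measurable borel" using blT(1) by (simp add: linear_continuous_on borel_measurable_continuous_onI)
  have Hm [measurable]: "H y \<in> borel_measurable borel" for y unfolding H_def by measurable
  have lT': "distr lborel borel T' = lborel" using lborel_reindex[OF e] unfolding T'_def[abs_def] by simp
  have "distr lborel borel (F y) = distr (distr lborel borel T') borel (F y)" by (simp only: lT')
  also have "\<dots> = distr lborel borel (F y \<circ> T')" by (rule distr_distr) auto
  also have "F y \<circ> T' = T' \<circ> H (T y)" by (simp add: fun_eq_iff H_def TT')
  also have "distr lborel borel (T' \<circ> H (T y)) = distr (distr lborel borel (H (T y))) borel T'"
    by (rule distr_distr[symmetric]) auto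
  also have "\<dots> = lborel" by (simp only: H lT')
  finally show ?thesis .
qed

lemma has_derivative_vecI:
  fixes f :: "'a::real_normed_vector \<Rightarrow> real^'n::finite"
  assumes "\<And>j. ((\<lambda>x. f x $ j) has_derivative (\<lambda>h. f' h $ j)) (at x)"
  shows "(f has_derivative f') (at x)"
  unfolding has_derivative_componentwise_within[of f f' x UNIV]
  using assms by (auto simp: Basis_vec_def inner_axis)

section \<open>Translations, dilations and box balls of a Carnot group\<close>

locale carnot =
  fixes gm :: "real^'n::finite \<Rightarrow> real^'n \<Rightarrow> real^'n" and w :: "'n \<Rightarrow> nat"
  assumes carnot: "carnot_group gm w"
begin

lemma gm_assoc: "gm (gm x y) z = gm x (gm y z)"
  and gm_0 [simp]: "gm x 0 = x" "gm 0 x = x"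
  and gm_inv [simp]: "gm x (- x) = 0" "gm (- x) x = 0"
  and w_ge_1: "w i \<ge> 1"
  and dil_gm: "s > 0 \<Longrightarrow> dil w s (gm x y) = gm (dil w s x) (dil w s y)"
  using carnot unfolding carnot_group_def by blast+

lemma gm_inv_cancel [simp]:
  "gm (gm x y) (- y) = x" "gm (gm x (- y)) y = x" "gm (- x) (gm x y) = y" "gm x (gm (- x) y) = y"
  by (simp_all add: gm_assoc) (simp_all flip: gm_assoc)

lemma ex_grad: "\<exists>G. continuous_on UNIV G \<and>
    (\<forall>p. ((\<lambda>p. gm (fst p) (snd p) $ j) has_derivative (\<lambda>h. G p \<bullet> h)) (at p))"
proof -
  have "smooth_on UNIV (\<lambda>p::(real^'n) \<times> (real^'n). gm (fst p) (snd p) $ j)"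
    using carnot unfolding carnot_group_def by blast
  from smooth_on_C1_fun[OF this] show ?thesis unfolding C1_fun_def .
qed

text \<open>The gradient of component j of the group law with respect to both arguments together,
  chosen once, so that partial gradients in either argument inherit joint continuity.\<close>

definition grad :: "'n \<Rightarrow> (real^'n) \<times> (real^'n) \<Rightarrow> (real^'n) \<times> (real^'n)" where
  "grad j = (SOME G. continuous_on UNIV G \<and>
     (\<forall>p. ((\<lambda>p. gm (fst p) (snd p) $ j) has_derivative (\<lambda>h. G p \<bullet> h)) (at p)))"

lemma grad_continuous: "continuous_on UNIV (grad j)"
  and grad_derivative: "((\<lambda>p. gm (fst p) (snd p) $ j) has_derivative (\<lambda>h. grad j p \<bullet> h)) (at p)"
  using someI_ex[OF ex_grad[of j]] unfolding grad_def[symmetric] by blast+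

lemma grad_continuous': "continuous_on S f \<Longrightarrow> continuous_on S (\<lambda>x. grad j (f x))"
  by (rule continuous_on_compose2[OF grad_continuous]) auto

lemma gm_derivative: "((\<lambda>p. gm (fst p) (snd p)) has_derivative (\<lambda>h. \<chi> j. grad j p \<bullet> h)) (at p)"
  by (rule has_derivative_vecI) (simp add: grad_derivative)

lemma gm_continuous: "continuous_on UNIV (\<lambda>p. gm (fst p) (snd p))"
  using gm_derivative by (meson continuous_at_imp_continuous_on has_derivative_continuous)

lemma gm_continuous': "continuous_on S f \<Longrightarrow> continuous_on S g \<Longrightarrow> continuous_on S (\<lambda>x. gm (f x) (g x))"
  using continuous_on_compose2[OF gm_continuous, of S "\<lambda>x. (f x, g x)"] continuous_on_Pair by force

lemma gm_measurable [measurable]: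
  assumes [measurable]: "f \<in> borel_measurable M" "g \<in> borel_measurable M"
  shows "(\<lambda>x. gm (f x) (g x)) \<in> borel_measurable M"
proof -
  have "(\<lambda>x. (f x, g x)) \<in> borel_measurable M" by (rule borel_measurable_Pair) auto
  then have "(\<lambda>x. gm (fst (f x, g x)) (snd (f x, g x))) \<in> borel_measurable M"
    by (rule measurable_compose) (rule borel_measurable_continuous_onI[OF gm_continuous])
  then show ?thesis by simp
qed

lemma gm_derivative_left: "((\<lambda>x. gm x y) has_derivative (\<lambda>h. \<chi> j. grad j (x, y) \<bullet> (h, 0))) (at x)"
proof -
  have "((\<lambda>x. (x, y)) has_derivative (\<lambda>h. (h, 0))) (at x)" by (auto intro!: derivative_eq_intros)
  from has_derivative_compose[OF this gm_derivative] show ?thesis by simp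
qed

lemma gm_derivative_right: "((\<lambda>y. gm x y) has_derivative (\<lambda>h. \<chi> j. grad j (x, y) \<bullet> (0, h))) (at y)"
proof -
  have "((\<lambda>y. (x, y)) has_derivative (\<lambda>h. (0, h))) (at y)" by (auto intro!: derivative_eq_intros)
  from has_derivative_compose[OF this gm_derivative] show ?thesis by simp
qed

text \<open>The right translations form an equivariant family, since dilations are automorphisms and
  -y inverts y. Right translations serve to move difference quotients onto test functions, left
  translations to compute averages over balls.\<close>

lemma right_translation_lborel: "distr lborel borel (\<lambda>x. gm x y) = lborel"
proof (rule equivariant_family_lborel[where F = "\<lambda>y x. gm x y" and w = w])
  show "((\<lambda>x. gm x y) has_derivative (\<lambda>h. \<chi> j. grad j (x, y) \<bullet> (h, 0))) (at x)" for x y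
    by (rule gm_derivative_left)
  show "continuous_on UNIV (\<lambda>p. (\<chi> j. grad j (snd p, fst p) \<bullet> (axis i 1, 0)) $ j)" for i j
    by (simp, intro continuous_intros grad_continuous')
qed (simp_all add: dil_gm w_ge_1[unfolded One_nat_def])

lemma left_translation_lborel: "distr lborel borel (gm y) = lborel"
proof (rule equivariant_family_lborel[where w = w])
  show "(gm y has_derivative (\<lambda>h. \<chi> j. grad j (y, x) \<bullet> (0, h))) (at x)" for x y
    by (rule gm_derivative_right)
  show "continuous_on UNIV (\<lambda>p. (\<chi> j. grad j (fst p, snd p) \<bullet> (0, axis i 1)) $ j)" for i j
    by (simp, intro continuous_intros grad_continuous')
qed (simp_all add: dil_gm w_ge_1[unfolded One_nat_def])

lemma nn_integral_right_translation:
  assumes [measurable]: "f \<in> borel_measurable borel"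
  shows "(\<integral>\<^sup>+x. f (gm x y) \<partial>lborel) = (\<integral>\<^sup>+x. f x \<partial>lborel)"
  by (subst (2) right_translation_lborel[of y, symmetric]) (simp add: nn_integral_distr)

lemma nn_integral_left_translation:
  assumes [measurable]: "f \<in> borel_measurable borel"
  shows "(\<integral>\<^sup>+x. f (gm y x) \<partial>lborel) = (\<integral>\<^sup>+x. f x \<partial>lborel)"
  by (subst (2) left_translation_lborel[of y, symmetric]) (simp add: nn_integral_distr)

text \<open>The Jacobian determinant of the dilation: for s > 0 it is s raised to the homogeneous
  dimension, the sum of the layers of all coordinates. The product over \<open>Basis\<close> is the
  shape in which the affine change of variables delivers it.\<close>

definition dil_jac :: "real \<Rightarrow> real" where
  "dil_jac s = (\<Prod>b\<in>Basis. \<bar>dil w s b \<bullet> b\<bar>)"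

lemma dil_measurable [measurable]: "dil w s \<in> borel_measurable borel"
  using dil_linear by (intro borel_measurable_continuous_onI linear_continuous_on) (simp add: linear_conv_bounded_linear)

lemma dil_axis: "dil w s (axis i 1) = s ^ w i *\<^sub>R axis i 1"
  by (simp add: dil_def axis_def vec_eq_iff)

lemma dil_Basis: "b \<in> Basis \<Longrightarrow> dil w s b = (dil w s b \<bullet> b) *\<^sub>R b"
  by (auto simp: Basis_vec_def dil_axis inner_axis_axis)

lemma dil_Basis_pos: "b \<in> Basis \<Longrightarrow> s > 0 \<Longrightarrow> dil w s b \<bullet> b > 0"
  by (auto simp: Basis_vec_def dil_axis inner_axis_axis)

lemma dil_jac_pos: "s > 0 \<Longrightarrow> dil_jac s > 0"
  unfolding dil_jac_def using dil_Basis_pos by (intro prod_pos) (metis abs_of_pos)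

lemma nn_integral_dil:
  assumes s: "s > 0" and [measurable]: "f \<in> borel_measurable borel"
  shows "(\<integral>\<^sup>+x. f x \<partial>lborel) = ennreal (dil_jac s) * (\<integral>\<^sup>+x. f (dil w s x) \<partial>lborel)"
proof -
  have eq: "(0::real^'n) + (\<Sum>b\<in>Basis. ((dil w s b \<bullet> b) * (x \<bullet> b)) *\<^sub>R b) = dil w s x" for x
  proof -
    have "dil w s x = dil w s (\<Sum>b\<in>Basis. (x \<bullet> b) *\<^sub>R b)" by (simp add: euclidean_representation)
    also have "\<dots> = (\<Sum>b\<in>Basis. (x \<bullet> b) *\<^sub>R dil w s b)"
      by (simp add: linear_sum[OF dil_linear] linear_scale[OF dil_linear])
    also have "\<dots> = (\<Sum>b\<in>Basis. ((dil w s b \<bullet> b) * (x \<bullet> b)) *\<^sub>R b)"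
    proof (rule sum.cong)
      fix b :: "real^'n" assume "b \<in> Basis"
      then have "(x \<bullet> b) *\<^sub>R dil w s b = (x \<bullet> b) *\<^sub>R ((dil w s b \<bullet> b) *\<^sub>R b)" using dil_Basis by metis
      then show "(x \<bullet> b) *\<^sub>R dil w s b = ((dil w s b \<bullet> b) * (x \<bullet> b)) *\<^sub>R b" by (simp add: mult.commute)
    qed simp
    finally show ?thesis by simp
  qed
  have nz: "dil w s b \<bullet> b \<noteq> 0" if "b \<in> Basis" for b using dil_Basis_pos[OF that s] by simp
  have "lborel = density (distr lborel borel (\<lambda>x. 0 + (\<Sum>b\<in>Basis. ((dil w s b \<bullet> b) * (x \<bullet> b)) *\<^sub>R b))) (\<lambda>_. ennreal (dil_jac s))"
    unfolding dil_jac_def by (rule lborel_affine_euclidean) (rule nz)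
  then have L: "lborel = density (distr lborel borel (dil w s)) (\<lambda>_. ennreal (dil_jac s))" unfolding eq .
  show ?thesis by (subst (1) L) (simp add: nn_integral_density nn_integral_distr nn_integral_cmult)
qed

text \<open>Raising to the power \<open>w i\<close> clears the roots in the box norm. Balls become
  coordinate inequalities, which makes their measurability and their behaviour under dilations
  visible.\<close>

lemma bnorm_less: "r > 0 \<Longrightarrow> bnorm w x < r \<longleftrightarrow> (\<forall>i. \<bar>x $ i\<bar> < r ^ w i)"
proof -
  assume r: "r > 0"
  have "\<bar>x $ i\<bar> powr (1 / real (w i)) < r \<longleftrightarrow> \<bar>x $ i\<bar> < r ^ w i" for i
  proof -
    define b where "b = \<bar>x $ i\<bar> powr (1 / real (w i))"
    have b0: "b \<ge> 0" unfolding b_def by simp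
    have wi: "w i > 0" using w_ge_1[of i] by simp
    have "b ^ w i = \<bar>x $ i\<bar>"
    proof (cases "x $ i = 0")
      case False
      then have "b > 0" unfolding b_def by simp
      then have "b ^ w i = b powr real (w i)" by (simp add: powr_realpow)
      then show ?thesis unfolding b_def using wi False by (simp add: powr_powr)
    qed (use wi in \<open>simp add: b_def\<close>)
    moreover have "b < r \<longleftrightarrow> b ^ w i < r ^ w i"
      using b0 r wi by (meson less_imp_le not_less power_mono power_strict_mono)
    ultimately show ?thesis unfolding b_def by simp
  qed
  then show ?thesis unfolding bnorm_def by (subst Max_less_iff) auto
qed

abbreviation U1 :: "(real^'n) set" where "U1 \<equiv> Uball gm w 0 1"

lemma U1_iff: "z \<in> U1 \<longleftrightarrow> (\<forall>i. \<bar>z $ i\<bar> < 1)"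
  by (simp add: Uball_def bdist_def bnorm_less)

text \<open>At radius 1 all layers impose the same condition, so the unit ball is a Euclidean cube.
  Its symmetry under a change of sign of a single coordinate is what makes the coordinates
  orthogonal on it.\<close>

lemma U1_eq_box: "U1 = box (- (\<chi> i. 1)) (\<chi> i. 1)"
  by (auto simp: U1_iff mem_box_cart abs_less_iff)

lemma U1_measurable [measurable]: "U1 \<in> sets borel"
  by (simp add: U1_eq_box)

lemma U1_uminus: "- z \<in> U1 \<longleftrightarrow> z \<in> U1" by (simp add: U1_iff)

lemma emeasure_U1: "emeasure lborel U1 < \<infinity>" "measure lborel U1 > 0"
proof -
  show "emeasure lborel U1 < \<infinity>" unfolding U1_eq_box by (simp add: emeasure_lborel_box_eq)
  have "measure lborel U1 = (\<Prod>b\<in>Basis. ((\<chi> i. 1) - (- (\<chi> i. 1)) :: real^'n) \<bullet> b)"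
    unfolding U1_eq_box by (rule measure_lborel_box) (auto simp: Basis_vec_def inner_axis)
  also have "\<dots> > 0" by (rule prod_pos) (auto simp: Basis_vec_def inner_axis)
  finally show "measure lborel U1 > 0" .
qed

text \<open>Left translation by -x cancels the centre, and the box norm is homogeneous under
  dilations.\<close>

lemma Uball_iff: "e > 0 \<Longrightarrow> gm x (dil w e z) \<in> Uball gm w x e \<longleftrightarrow> z \<in> U1"
  by (simp add: Uball_def bdist_def bnorm_less dil_def abs_mult)

lemma Uball_measurable [measurable]: "e > 0 \<Longrightarrow> Uball gm w x e \<in> sets borel"
proof -
  assume e: "e > 0"
  have "Uball gm w x e = {y \<in> space borel. \<forall>i\<in>UNIV. \<bar>gm (- x) y $ i\<bar> < e ^ w i}"
    using e by (simp add: Uball_def bdist_def bnorm_less)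
  also have "\<dots> \<in> sets borel"
  proof (rule sets.sets_Collect_finite_All)
    show "{y \<in> space borel. \<bar>gm (- x) y $ i\<bar> < e ^ w i} \<in> sets borel" for i
    proof -
      have "continuous_on UNIV (\<lambda>y. \<bar>gm (- x) y $ i\<bar>)"
        by (intro continuous_intros gm_continuous')
      then have "open {y. \<bar>gm (- x) y $ i\<bar> < e ^ w i}"
        by (intro open_Collect_less) (auto intro: continuous_intros)
      then show ?thesis by simp
    qed
  qed simp
  finally show ?thesis .
qed

text \<open>The substitution y = x \<circ> \<delta>_e(z): left invariance moves the centre to the
  origin, and the dilation turns the ball into the unit ball.\<close>

lemma nn_integral_Uball:
  assumes e: "e > 0" and [measurable]: "f \<in> borel_measurable borel"
  shows "(\<integral>\<^sup>+y. f y * indicator (Uball gm w x e) y \<partial>lborel)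
     = ennreal (dil_jac e) * (\<integral>\<^sup>+z. f (gm x (dil w e z)) * indicator U1 z \<partial>lborel)"
proof -
  have [measurable]: "Uball gm w x e \<in> sets borel" using e by (rule Uball_measurable)
  have "(\<integral>\<^sup>+y. f y * indicator (Uball gm w x e) y \<partial>lborel)
     = (\<integral>\<^sup>+v. f (gm x v) * indicator (Uball gm w x e) (gm x v) \<partial>lborel)"
    by (rule nn_integral_left_translation[symmetric]) auto
  also have "\<dots> = ennreal (dil_jac e) *
     (\<integral>\<^sup>+z. f (gm x (dil w e z)) * indicator (Uball gm w x e) (gm x (dil w e z)) \<partial>lborel)"
    by (rule nn_integral_dil[OF e]) auto
  also have "(\<lambda>z. indicator (Uball gm w x e) (gm x (dil w e z)) :: ennreal) = indicator U1"
    using Uball_iff[OF e] by (auto simp: indicator_def fun_eq_iff)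
  finally show ?thesis by (simp add: fun_eq_iff[symmetric])
qed

text \<open>The Jacobian of the substitution cancels against the volume of the ball, so that
  averages over all balls become integrals over one fixed cube.\<close>

lemma average_Uball:
  assumes e: "e > 0" and f [measurable]: "f \<in> borel_measurable borel"
  shows "ennreal (1 / measure lebesgue (Uball gm w x e)) * (\<integral>\<^sup>+y. f y * indicator (Uball gm w x e) y \<partial>lborel)
     = ennreal (1 / measure lborel U1) * (\<integral>\<^sup>+z. f (gm x (dil w e z)) * indicator U1 z \<partial>lborel)"
proof -
  have [measurable]: "Uball gm w x e \<in> sets borel" using e by (rule Uball_measurable)
  have "emeasure lborel (Uball gm w x e) = ennreal (dil_jac e) * emeasure lborel U1"
    using nn_integral_Uball[OF e, of "\<lambda>_. 1" x] by simp
  also have "\<dots> = ennreal (dil_jac e * measure lborel U1)"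
    using emeasure_U1 dil_jac_pos[OF e] by (simp add: emeasure_eq_ennreal_measure ennreal_mult)
  finally have m: "measure lebesgue (Uball gm w x e) = dil_jac e * measure lborel U1"
    using dil_jac_pos[OF e] emeasure_U1(2) by (simp add: measure_def)
  have "ennreal (1 / (dil_jac e * measure lborel U1)) * ennreal (dil_jac e) = ennreal (1 / measure lborel U1)"
    using dil_jac_pos[OF e] emeasure_U1(2) by (simp flip: ennreal_mult)
  then show ?thesis unfolding m nn_integral_Uball[OF e f] by (simp flip: mult.assoc)
qed

text \<open>Since e is at most 1, every layer shrinks at least as fast as the first one.\<close>

lemma norm_dil_le:
  assumes "z \<in> U1" "0 < e" "e \<le> 1"
  shows "norm (dil w e z) \<le> real CARD('n) * e" "\<bar>dil w e z $ i\<bar> \<le> e"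
proof -
  have *: "\<bar>dil w e z $ i\<bar> \<le> e" for i
  proof -
    have "e ^ w i \<le> e ^ 1" using assms w_ge_1[of i] by (intro power_decreasing) auto
    then have "e ^ w i * \<bar>z $ i\<bar> \<le> e * 1"
      using assms U1_iff[of z] by (intro mult_mono) (auto intro: less_imp_le)
    then show ?thesis using assms by (simp add: dil_def abs_mult)
  qed
  show "\<bar>dil w e z $ i\<bar> \<le> e" by (rule *)
  have "norm (dil w e z) \<le> (\<Sum>i\<in>UNIV. \<bar>dil w e z $ i\<bar>)" by (rule norm_le_l1_cart)
  also have "\<dots> \<le> (\<Sum>i\<in>(UNIV::'n set). e)" by (intro sum_mono *)
  finally show "norm (dil w e z) \<le> real CARD('n) * e" by simp
qed

text \<open>By uniform continuity of the group law near the points (x, 0),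
  \<open>gm x (dil w e z)\<close> is close to \<open>gm x 0\<close>, which is x. This makes the
  indicator of D inside the difference quotient equal to 1 over the support of a test function, and
  it confines the values of f_\<epsilon> that matter to one compact set.\<close>

lemma compact_thickening:
  assumes K: "compact K" "K \<subseteq> D" and D: "open D"
  shows "\<exists>K'. compact K' \<and> K \<subseteq> K' \<and> K' \<subseteq> D \<and> (\<exists>d>0. d \<le> 1 \<and> (\<forall>e z x. 0 < e \<longrightarrow> e < d \<longrightarrow> z \<in> U1 \<longrightarrow> x \<in> K \<longrightarrow> gm x (dil w e z) \<in> K'))"
proof -
  obtain r where r: "r > 0" "(\<Union>x\<in>K. cball x r) \<subseteq> D"
    using compact_subset_open_imp_cball_epsilon_subset[OF K(1) D K(2)] by blast
  define K' where "K' = (\<lambda>p. fst p + snd p) ` (K \<times> cball (0::real^'n) r)"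
  have "compact K'" unfolding K'_def
    by (intro compact_continuous_image compact_Times K continuous_intros) auto
  moreover have K'_iff: "y \<in> K'" if "x \<in> K" "norm (y - x) \<le> r" for x y
    unfolding K'_def using that by (intro image_eqI[of _ _ "(x, y - x)"]) auto
  then have "K \<subseteq> K'" using r(1) by (metis diff_self less_imp_le norm_zero subsetI)
  moreover have "K' \<subseteq> D"
  proof
    fix y assume "y \<in> K'"
    then obtain x v where "x \<in> K" "v \<in> cball 0 r" "y = x + v" unfolding K'_def by auto
    then have "y \<in> cball x r" by (simp add: dist_norm)
    then show "y \<in> D" using r(2) \<open>x \<in> K\<close> by blast
  qed
  moreover have "\<exists>d>0. d \<le> 1 \<and> (\<forall>e z x. 0 < e \<longrightarrow> e < d \<longrightarrow> z \<in> U1 \<longrightarrow> x \<in> K \<longrightarrow> gm x (dil w e z) \<in> K')"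
  proof -
    have "uniformly_continuous_on (K \<times> cball 0 (real CARD('n))) (\<lambda>p. gm (fst p) (snd p))"
      by (intro compact_uniformly_continuous compact_Times K continuous_on_subset[OF gm_continuous]) auto
    then obtain d where d: "d > 0" and dd: "\<And>p p'. p \<in> K \<times> cball 0 (real CARD('n)) \<Longrightarrow> p' \<in> K \<times> cball 0 (real CARD('n)) \<Longrightarrow>
        dist p' p < d \<Longrightarrow> dist (gm (fst p') (snd p')) (gm (fst p) (snd p)) < r"
      using r(1) unfolding uniformly_continuous_on_def by metis
    define d' where "d' = min 1 (d / real CARD('n))"
    have "gm x (dil w e z) \<in> K'" if e: "0 < e" "e < d'" and z: "z \<in> U1" and x: "x \<in> K" for e z x
    proof -
      have e1: "e \<le> 1" using e unfolding d'_def by simp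
      have n: "norm (dil w e z) \<le> real CARD('n) * e" by (rule norm_dil_le(1)[OF z e(1) e1])
      also have "\<dots> < d" using e unfolding d'_def by (simp add: field_simps)
      finally have "dist (x, dil w e z) (x, 0) < d" by (simp add: dist_Pair_Pair)
      moreover have "norm (dil w e z) \<le> real CARD('n)" 
      proof -
        have "real CARD('n) * e \<le> real CARD('n) * 1" using e1 by (intro mult_left_mono) auto
        then show ?thesis using norm_dil_le(1)[OF z e(1) e1] by linarith
      qed
      ultimately have "dist (gm x (dil w e z)) (gm x 0) < r"
        using dd[of "(x, 0)" "(x, dil w e z)"] x by simp
      then show ?thesis using K'_iff[OF x, of "gm x (dil w e z)"] by (simp add: dist_norm)
    qed
    moreover have "d' > 0" "d' \<le> 1" unfolding d'_def using d by auto
    ultimately show ?thesis by blast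
  qed
  ultimately show ?thesis by blast
qed

end

subsection \<open>Difference quotients\<close>

lemma
  fixes f :: "'a::euclidean_space \<times> 'b::euclidean_space \<Rightarrow> ennreal"
  assumes f: "f \<in> borel_measurable borel"
  shows nn_integral_lborel_fst: "(\<integral>\<^sup>+p. f p \<partial>lborel) = (\<integral>\<^sup>+x. \<integral>\<^sup>+z. f (x, z) \<partial>lborel \<partial>lborel)"
    and nn_integral_lborel_snd: "(\<integral>\<^sup>+p. f p \<partial>lborel) = (\<integral>\<^sup>+z. \<integral>\<^sup>+x. f (x, z) \<partial>lborel \<partial>lborel)"
proof -
  have m: "f \<in> borel_measurable (lborel \<Otimes>\<^sub>M lborel)" using f by (simp add: lborel_prod)
  show "(\<integral>\<^sup>+p. f p \<partial>lborel) = (\<integral>\<^sup>+x. \<integral>\<^sup>+z. f (x, z) \<partial>lborel \<partial>lborel)"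
    using lborel.nn_integral_fst[OF m] by (simp add: lborel_prod)
  show "(\<integral>\<^sup>+p. f p \<partial>lborel) = (\<integral>\<^sup>+z. \<integral>\<^sup>+x. f (x, z) \<partial>lborel \<partial>lborel)"
    using lborel_pair.nn_integral_snd[OF m] by (simp add: lborel_prod)
qed

lemma
  fixes f :: "'a::euclidean_space \<times> 'b::euclidean_space \<Rightarrow> real"
  assumes f: "integrable lborel f"
  shows integral_lborel_fst: "(\<integral>p. f p \<partial>lborel) = (\<integral>x. \<integral>z. f (x, z) \<partial>lborel \<partial>lborel)"
    and integral_lborel_snd: "(\<integral>p. f p \<partial>lborel) = (\<integral>z. \<integral>x. f (x, z) \<partial>lborel \<partial>lborel)"
    and integrable_lborel_fst: "integrable lborel (\<lambda>x. \<integral>z. f (x, z) \<partial>lborel)"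
proof -
  have m: "integrable (lborel \<Otimes>\<^sub>M lborel) (case_prod (\<lambda>x z. f (x, z)))" using f by (simp add: lborel_prod)
  show "(\<integral>p. f p \<partial>lborel) = (\<integral>x. \<integral>z. f (x, z) \<partial>lborel \<partial>lborel)"
    using lborel_pair.integral_fst[OF m] by (simp add: lborel_prod)
  show "(\<integral>p. f p \<partial>lborel) = (\<integral>z. \<integral>x. f (x, z) \<partial>lborel \<partial>lborel)"
    using lborel_pair.integral_snd[OF m] by (simp add: lborel_prod)
  show "integrable lborel (\<lambda>x. \<integral>z. f (x, z) \<partial>lborel)"
    using lborel_pair.integrable_fst[OF m] .
qed

lemma fst_snd_borel_measurable [measurable]:
  "fst \<in> borel_measurable (borel :: ('a::euclidean_space \<times> 'b::euclidean_space) measure)"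
  "snd \<in> borel_measurable (borel :: ('a::euclidean_space \<times> 'b::euclidean_space) measure)"
  by (intro borel_measurable_continuous_onI continuous_intros)+

lemma slice_borel_measurable:
  assumes "f \<in> borel_measurable (borel :: ('a::euclidean_space \<times> 'b::euclidean_space) measure)"
  shows "(\<lambda>x. f (x, z)) \<in> borel_measurable borel" "(\<lambda>z. f (x, z)) \<in> borel_measurable borel"
  by (intro measurable_compose[OF _ assms] borel_measurable_continuous_onI continuous_intros)+

lemma
  fixes a :: "'a::euclidean_space \<Rightarrow> real" and b :: "'b::euclidean_space \<Rightarrow> real"
  assumes a: "integrable lborel a" and b: "integrable lborel b"
  shows integrable_lborel_times: "integrable lborel (\<lambda>p. a (fst p) * b (snd p))"
    and integral_lborel_times: "(\<integral>p. a (fst p) * b (snd p) \<partial>lborel) = (\<integral>x. a x \<partial>lborel) * (\<integral>z. b z \<partial>lborel)"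
proof -
  have [measurable]: "a \<in> borel_measurable borel" "b \<in> borel_measurable borel" using a b by auto
  show i: "integrable lborel (\<lambda>p. a (fst p) * b (snd p))"
  proof (rule integrableI_bounded)
    have "(\<integral>\<^sup>+p. ennreal (norm (a (fst p) * b (snd p))) \<partial>lborel)
        = (\<integral>\<^sup>+x. \<integral>\<^sup>+z. ennreal \<bar>a x\<bar> * ennreal \<bar>b z\<bar> \<partial>lborel \<partial>lborel)"
      by (subst nn_integral_lborel_fst) (auto simp: abs_mult ennreal_mult)
    also have "\<dots> = (\<integral>\<^sup>+x. ennreal \<bar>a x\<bar> * (\<integral>\<^sup>+z. ennreal \<bar>b z\<bar> \<partial>lborel) \<partial>lborel)"
      by (subst nn_integral_cmult) auto
    also have "\<dots> = (\<integral>\<^sup>+x. ennreal \<bar>a x\<bar> \<partial>lborel) * (\<integral>\<^sup>+z. ennreal \<bar>b z\<bar> \<partial>lborel)"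
      by (subst nn_integral_multc) auto
    also have "\<dots> < \<infinity>"
      using a b by (simp add: integrable_iff_bounded ennreal_mult_less_top)
    finally show "(\<integral>\<^sup>+p. ennreal (norm (a (fst p) * b (snd p))) \<partial>lborel) < \<infinity>" .
  qed simp
  show "(\<integral>p. a (fst p) * b (snd p) \<partial>lborel) = (\<integral>x. a x \<partial>lborel) * (\<integral>z. b z \<partial>lborel)"
    by (subst integral_lborel_fst[OF i]) simp
qed

section \<open>Horizontal derivatives of C^1 functions\<close>

lemma C1_fun_fst: "C1_fun \<phi> \<Longrightarrow> C1_fun (\<lambda>p. \<phi> (fst p))"
proof -
  assume "C1_fun \<phi>"
  then obtain G where G: "continuous_on UNIV G" "\<And>x. (\<phi> has_derivative (\<lambda>h. G x \<bullet> h)) (at x)"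
    unfolding C1_fun_def by blast
  have "continuous_on UNIV (\<lambda>p. (G (fst p), 0))"
    by (intro continuous_intros continuous_on_compose2[OF G(1)]) auto
  moreover have "((\<lambda>p. \<phi> (fst p)) has_derivative (\<lambda>h. (G (fst p), 0) \<bullet> h)) (at p)" for p
  proof -
    have "(fst has_derivative fst) (at p)" by (rule has_derivative_fst) (rule has_derivative_ident)
    from has_derivative_compose[OF this G(2)] show ?thesis by (simp add: inner_prod_def)
  qed
  ultimately show ?thesis unfolding C1_fun_def by (intro exI[of _ "\<lambda>p. (G (fst p), 0)"] conjI allI)
qed

lemma C1_fun_slice: "C1_fun \<Psi> \<Longrightarrow> C1_fun (\<lambda>x. \<Psi> (x, z))"
proof -
  assume "C1_fun \<Psi>"
  then obtain G where G: "continuous_on UNIV G" "\<And>x. (\<Psi> has_derivative (\<lambda>h. G x \<bullet> h)) (at x)"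
    unfolding C1_fun_def by blast
  have "continuous_on UNIV (\<lambda>x. fst (G (x, z)))"
    by (intro continuous_intros continuous_on_compose2[OF G(1)]) auto
  moreover have "((\<lambda>x. \<Psi> (x, z)) has_derivative (\<lambda>h. fst (G (x, z)) \<bullet> h)) (at x)" for x
  proof -
    have "((\<lambda>x. (x, z)) has_derivative (\<lambda>h. (h, 0))) (at x)" by (auto intro!: derivative_eq_intros)
    from has_derivative_compose[OF this G(2)] show ?thesis by (simp add: inner_prod_def)
  qed
  ultimately show ?thesis unfolding C1_fun_def by (intro exI[of _ "\<lambda>x. fst (G (x, z))"] conjI allI)
qed

context carnot begin

text \<open>\<open>A x z y\<close> is the gradient in y of \<Psi>(x \<circ> y, z). This one field,
  jointly continuous in its three arguments, yields the uniform expansion of \<Psi> along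
  \<delta>_e(-z) and, at y = 0, the left-invariant derivatives.\<close>

lemma C1_fun_right_gradient:
  assumes "C1_fun (\<Psi> :: (real^'n) \<times> (real^'n) \<Rightarrow> real)"
  shows "\<exists>A. continuous_on UNIV (\<lambda>p. A (fst p) (fst (snd p)) (snd (snd p))) \<and>
    (\<forall>x z y. ((\<lambda>y. \<Psi> (gm x y, z)) has_derivative (\<lambda>h. A x z y \<bullet> h)) (at y)) \<and>
    (\<forall>i x z. ((\<lambda>t. \<Psi> (gm x (t *\<^sub>R axis i 1), z)) has_real_derivative A x z 0 $ i) (at 0)) \<and>
    (\<forall>i x z. hX gm i (\<lambda>x. \<Psi> (x, z)) x = A x z 0 $ i)"
proof -
  obtain P where P: "continuous_on UNIV P" "\<And>p. (\<Psi> has_derivative (\<lambda>h. P p \<bullet> h)) (at p)"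
    using assms unfolding C1_fun_def by blast
  define A where "A x z y = (\<Sum>j\<in>UNIV. (fst (P (gm x y, z)) $ j) *\<^sub>R snd (grad j (x, y)))" for x z y
  have cA: "continuous_on UNIV (\<lambda>p. A (fst p) (fst (snd p)) (snd (snd p)))"
    unfolding A_def
    by (intro continuous_intros continuous_on_compose2[OF P(1)] grad_continuous' gm_continuous') auto
  have dA: "((\<lambda>y. \<Psi> (gm x y, z)) has_derivative (\<lambda>h. A x z y \<bullet> h)) (at y)" for x z y
  proof -
    have "((\<lambda>y. (gm x y, z)) has_derivative (\<lambda>h. (\<chi> j. grad j (x, y) \<bullet> (0, h), 0))) (at y)"
      by (rule has_derivative_Pair[OF gm_derivative_right has_derivative_const])
    from has_derivative_compose[OF this P(2)]
    have d: "((\<lambda>y. \<Psi> (gm x y, z)) has_derivative (\<lambda>h. P (gm x y, z) \<bullet> (\<chi> j. grad j (x, y) \<bullet> (0, h), 0))) (at y)" .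
    have "P (gm x y, z) \<bullet> (\<chi> j. grad j (x, y) \<bullet> (0, h), 0) = A x z y \<bullet> h" for h
      unfolding A_def by (simp add: inner_prod_def inner_vec_def[of "fst (P (gm x y, z))"] inner_sum_left)
    with d show ?thesis by simp
  qed
  have DA: "((\<lambda>t. \<Psi> (gm x (t *\<^sub>R axis i 1), z)) has_real_derivative A x z 0 $ i) (at 0)" for i x z
  proof -
    have "((\<lambda>t. t *\<^sub>R axis i 1) has_derivative (\<lambda>t. t *\<^sub>R axis i 1)) (at (0::real))"
      by (auto intro!: derivative_eq_intros)
    from has_derivative_compose[OF this, of "\<lambda>y. \<Psi> (gm x y, z)" "\<lambda>h. A x z 0 \<bullet> h"] dA[of x z 0]
    have "((\<lambda>t. \<Psi> (gm x (t *\<^sub>R axis i 1), z)) has_derivative (\<lambda>t. A x z 0 \<bullet> (t *\<^sub>R axis i 1))) (at 0)"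
      by simp
    then show ?thesis unfolding has_field_derivative_def
      by (rule has_derivative_eq_rhs) (simp add: fun_eq_iff inner_axis)
  qed
  have hA: "hX gm i (\<lambda>x. \<Psi> (x, z)) x = A x z 0 $ i" for i x z
    unfolding hX_def using DA by (rule DERIV_imp_deriv)
  show ?thesis by (intro exI[of _ A] conjI allI cA dA DA hA)
qed

text \<open>Obtained from the statement in two variables by reading \<phi> as a function of (x, z)
  that is constant in z.\<close>

lemma hX_C1:
  assumes "C1_fun \<phi>"
  shows "((\<lambda>t. \<phi> (gm x (t *\<^sub>R axis i 1))) has_real_derivative hX gm i \<phi> x) (at 0)"
    and "continuous_on UNIV (hX gm i \<phi>)"
proof -
  obtain A where A: "continuous_on UNIV (\<lambda>p. A (fst p) (fst (snd p)) (snd (snd p)))"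
    "\<And>x z y. ((\<lambda>y. \<phi> (fst (gm x y, z :: real^'n))) has_derivative (\<lambda>h. A x z y \<bullet> h)) (at y)"
    "\<And>i x z. ((\<lambda>t. \<phi> (fst (gm x (t *\<^sub>R axis i 1), z :: real^'n))) has_real_derivative A x z 0 $ i) (at 0)"
    "\<And>i x z. hX gm i (\<lambda>x. \<phi> (fst (x, z :: real^'n))) x = A x z 0 $ i"
    using C1_fun_right_gradient[OF C1_fun_fst[OF assms]] by blast
  have h: "hX gm i \<phi> x = A x 0 0 $ i" for x using A(4)[of i 0 x] by simp
  show "((\<lambda>t. \<phi> (gm x (t *\<^sub>R axis i 1))) has_real_derivative hX gm i \<phi> x) (at 0)"
    using A(3)[of x i 0] h by simp
  have "continuous_on UNIV (\<lambda>x. (x, 0, 0) :: (real^'n) \<times> (real^'n) \<times> (real^'n))" by (intro continuous_intros)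
  from continuous_on_compose2[OF A(1) this] have "continuous_on UNIV (\<lambda>x. A x 0 0)" by simp
  then have "continuous_on UNIV (\<lambda>x. A x 0 0 $ i)" by (intro continuous_intros)
  then show "continuous_on UNIV (hX gm i \<phi>)" using ext[of "hX gm i \<phi>", OF h] by simp
qed

lemma hX_cmult: "C1_fun \<phi> \<Longrightarrow> hX gm i (\<lambda>x. c * \<phi> x) x = c * hX gm i \<phi> x"
  unfolding hX_def[of _ _ "\<lambda>x. c * \<phi> x"] by (intro DERIV_imp_deriv DERIV_cmult hX_C1)

lemma hX_eq_0:
  assumes "compact K" "\<And>x. x \<notin> K \<Longrightarrow> \<phi> x = 0" "x \<notin> K"
  shows "hX gm i \<phi> x = 0"
proof -
  have c: "continuous_on UNIV (\<lambda>t::real. gm x (t *\<^sub>R axis i 1))" by (intro gm_continuous' continuous_intros)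
  have op: "open ((\<lambda>t::real. gm x (t *\<^sub>R axis i 1)) -` (- K))"
    using assms(1) by (intro open_vimage[OF _ c]) (simp add: compact_imp_closed open_Compl)
  have z: "((\<lambda>t::real. 0::real) has_real_derivative 0) (at 0)" by simp
  have "((\<lambda>t. \<phi> (gm x (t *\<^sub>R axis i 1))) has_real_derivative 0) (at 0)"
    by (rule has_field_derivative_transform_within_open[OF z op]) (use assms in auto)
  then show ?thesis unfolding hX_def by (rule DERIV_imp_deriv)
qed

text \<open>The pairing of z with the horizontal gradient of \<Psi>(., z) at x. The variable z acts
  both as the direction and as a frozen argument of \<Psi>; differentiation is in x alone.\<close>

definition hdir :: "((real^'n) \<times> (real^'n) \<Rightarrow> real) \<Rightarrow> (real^'n) \<times> (real^'n) \<Rightarrow> real" where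
  "hdir \<Psi> p = (\<Sum>i\<in>{i. w i = 1}. snd p $ i * hX gm i (\<lambda>x. \<Psi> (x, snd p)) (fst p))"

lemma hdir_continuous: "C1_fun \<Psi> \<Longrightarrow> continuous_on UNIV (hdir \<Psi>)"
proof -
  assume "C1_fun \<Psi>"
  then obtain A where A: "continuous_on UNIV (\<lambda>p. A (fst p) (fst (snd p)) (snd (snd p)))"
    "\<And>x z y. ((\<lambda>y. \<Psi> (gm x y, z)) has_derivative (\<lambda>h. A x z y \<bullet> h)) (at y)"
    "\<And>i x z. ((\<lambda>t. \<Psi> (gm x (t *\<^sub>R axis i 1), z)) has_real_derivative A x z 0 $ i) (at 0)"
    "\<And>i x z. hX gm i (\<lambda>x. \<Psi> (x, z)) x = A x z 0 $ i"
    using C1_fun_right_gradient[of \<Psi>] by blast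
  have "continuous_on UNIV (\<lambda>p. (fst p, snd p, 0) :: (real^'n) \<times> (real^'n) \<times> (real^'n))"
    by (intro continuous_intros)
  from continuous_on_compose2[OF A(1) this] have "continuous_on UNIV (\<lambda>p. A (fst p) (snd p) 0)" by simp
  then show ?thesis unfolding hdir_def[abs_def] A(4) by (intro continuous_intros)
qed

lemma hdir_eq_0: "compact K \<Longrightarrow> (\<And>x z. x \<notin> K \<Longrightarrow> \<Psi> (x, z) = 0) \<Longrightarrow> fst p \<notin> K \<Longrightarrow> hdir \<Psi> p = 0"
  unfolding hdir_def by (intro sum.neutral ballI) (simp add: hX_eq_0[of K])

text \<open>The quotient is the gradient \<open>A\<close> at an intermediate point, applied to
  \<delta>_e(-z) / e. This vector differs from minus the horizontal part of z by O(e), since a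
  coordinate of layer j carries the factor e^(j-1); hence the plus sign before \<open>hdir\<close>.
  Compactness makes both errors uniform.\<close>

lemma difference_quotient_uniform:
  fixes \<Psi> :: "(real^'n) \<times> (real^'n) \<Rightarrow> real"
  assumes \<Psi>: "C1_fun \<Psi>" and K: "compact K" and \<eta>: "\<eta> > 0"
  shows "\<exists>d>0. \<forall>e x z. 0 < e \<longrightarrow> e < d \<longrightarrow> x \<in> K \<longrightarrow> z \<in> U1 \<longrightarrow>
    \<bar>(\<Psi> (gm x (dil w e (- z)), z) - \<Psi> (x, z)) / e + hdir \<Psi> (x, z)\<bar> \<le> \<eta>"
proof -
  obtain A where cA: "continuous_on UNIV (\<lambda>p. A (fst p) (fst (snd p)) (snd (snd p)))"
    and dA: "\<And>x z y. ((\<lambda>y. \<Psi> (gm x y, z)) has_derivative (\<lambda>h. A x z y \<bullet> h)) (at y)"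
    and "\<And>i x z. ((\<lambda>t. \<Psi> (gm x (t *\<^sub>R axis i 1), z)) has_real_derivative A x z 0 $ i) (at 0)"
    and hA: "\<And>i x z. hX gm i (\<lambda>x. \<Psi> (x, z)) x = A x z 0 $ i"
    using C1_fun_right_gradient[OF \<Psi>] by blast
  define n where "n = real CARD('n)"
  have n: "n \<ge> 1" unfolding n_def by (simp add: Suc_leI)
  have U1n: "norm z \<le> n" if "z \<in> U1" for z
  proof -
    have "norm z \<le> (\<Sum>i\<in>UNIV. \<bar>z $ i\<bar>)" by (rule norm_le_l1_cart)
    also have "\<dots> \<le> (\<Sum>i\<in>(UNIV::'n set). 1)" using that by (intro sum_mono) (simp add: U1_iff less_imp_le)
    finally show ?thesis by (simp add: n_def)
  qed
  let ?C = "K \<times> cball (0::real^'n) n \<times> cball (0::real^'n) n"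
  let ?A = "\<lambda>p. A (fst p) (fst (snd p)) (snd (snd p))"
  have C: "compact ?C" by (intro compact_Times K compact_cball)
  have "uniformly_continuous_on ?C ?A"
    by (intro compact_uniformly_continuous C continuous_on_subset[OF cA]) auto
  obtain d1 where d1: "d1 > 0" and uc: "\<And>p p'. p \<in> ?C \<Longrightarrow> p' \<in> ?C \<Longrightarrow> dist p' p < d1 \<Longrightarrow> dist (?A p') (?A p) < \<eta> / (2 * n)"
  proof -
    have "\<eta> / (2 * n) > 0" using \<eta> n by simp
    with that show ?thesis using \<open>uniformly_continuous_on ?C ?A\<close> unfolding uniformly_continuous_on_def by meson
  qed
  have "bounded (?A ` ?C)"
    by (intro compact_imp_bounded compact_continuous_image C continuous_on_subset[OF cA]) auto
  then obtain B where B: "B > 0" and Bb: "\<And>p. p \<in> ?C \<Longrightarrow> norm (?A p) \<le> B"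
    unfolding bounded_pos by auto
  \<comment> \<open>This bound keeps the intermediate point within the modulus \<open>d1\<close> of
    uniform continuity and makes the error \<open>n * e * B\<close> of the higher layers at most
    \<eta>/2.\<close>
  define d where "d = min 1 (min (d1 / n) (\<eta> / (2 * n * B)))"
  have d: "d > 0" unfolding d_def using d1 n \<eta> B by auto
  have "\<bar>(\<Psi> (gm x (dil w e (- z)), z) - \<Psi> (x, z)) / e + hdir \<Psi> (x, z)\<bar> \<le> \<eta>"
    if e: "0 < e" "e < d" and x: "x \<in> K" and z: "z \<in> U1" for e x z
  proof -
    have e1: "e \<le> 1" and ed1: "n * e < d1" and e\<eta>: "n * e * B \<le> \<eta> / 2"
      using e n B unfolding d_def by (auto simp: field_simps)
    define y where "y = dil w e (- z)"
    have mz: "- z \<in> U1" using z by (simp add: U1_uminus)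
    have ny: "norm y \<le> n * e" unfolding y_def n_def by (rule norm_dil_le(1)[OF mz e(1) e1])
    have "n * e \<le> n * 1" using n e1 by (intro mult_left_mono) auto
    then have yn: "norm y \<le> n" using ny by simp
    define v where "v = (1 / e) *\<^sub>R y"
    have yv: "y = e *\<^sub>R v" unfolding v_def using e by simp
    have "norm v = norm y / e" unfolding v_def using e by simp
    moreover have "norm y / e \<le> n * e / e" using ny e by (intro divide_right_mono) auto
    ultimately have nv: "norm v \<le> n" using e by simp
    define z1 where "z1 = (\<chi> i. if w i = 1 then z $ i else 0)"
    have "\<bar>(v + z1) $ i\<bar> \<le> e" for i
    proof (cases "w i = 1")
      case True
      then show ?thesis using e by (simp add: v_def y_def dil_def z1_def)
    next
      case False
      then have w2: "w i = Suc (Suc (w i - 2))" using w_ge_1[of i] by simp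
      have "e ^ w i = e * (e * e ^ (w i - 2))" by (subst w2) simp
      moreover have "e ^ (w i - 2) \<le> 1" using e e1 by (intro power_le_one) auto
      then have "e * e ^ (w i - 2) * \<bar>z $ i\<bar> \<le> e * 1 * 1"
        using z e by (intro mult_mono) (auto simp: U1_iff less_imp_le)
      ultimately show ?thesis using False e by (simp add: v_def y_def dil_def z1_def abs_mult)
    qed
    then have "(\<Sum>i\<in>UNIV. \<bar>(v + z1) $ i\<bar>) \<le> (\<Sum>i\<in>(UNIV::'n set). e)" by (intro sum_mono)
    then have nvz: "norm (v + z1) \<le> n * e" using norm_le_l1_cart[of "v + z1"] by (simp add: n_def)
    have hd: "hdir \<Psi> (x, z) = A x z 0 \<bullet> z1"
    proof -
      have "A x z 0 \<bullet> z1 = (\<Sum>i\<in>UNIV. if w i = 1 then z $ i * A x z 0 $ i else 0)"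
        unfolding inner_vec_def z1_def by (intro sum.cong) auto
      also have "\<dots> = (\<Sum>i\<in>{i. w i = 1}. z $ i * A x z 0 $ i)" by (simp add: sum.If_cases)
      finally show ?thesis by (simp add: hdir_def hA)
    qed
    have "((\<lambda>s. \<Psi> (gm x (s *\<^sub>R y), z)) has_real_derivative A x z (s *\<^sub>R y) \<bullet> y) (at s)" for s
    proof -
      have "((\<lambda>s. s *\<^sub>R y) has_derivative (\<lambda>t. t *\<^sub>R y)) (at s)" by (auto intro!: derivative_eq_intros)
      from has_derivative_compose[OF this dA]
      show ?thesis unfolding has_field_derivative_def
        by (rule has_derivative_eq_rhs) (simp add: fun_eq_iff)
    qed
    from DERIV_mean_value[OF this, of 1] obtain \<xi> where \<xi>: "\<bar>\<xi>\<bar> \<le> 1"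
      and mv: "\<Psi> (gm x y, z) - \<Psi> (x, z) = A x z (\<xi> *\<^sub>R y) \<bullet> y" by auto
    have n\<xi>: "norm (\<xi> *\<^sub>R y) \<le> norm y" using \<xi> mult_right_mono[OF \<xi>, of "norm y"] by simp
    have p1: "(x, z, \<xi> *\<^sub>R y) \<in> ?C" using x U1n[OF z] n\<xi> yn by (simp add: order_trans)
    have p0: "(x, z, 0) \<in> ?C" using x U1n[OF z] n by simp
    have "dist (x, z, \<xi> *\<^sub>R y) (x, z, 0) < d1" using n\<xi> ny ed1 by (simp add: dist_Pair_Pair)
    from uc[OF p0 p1 this] have nA: "norm (A x z (\<xi> *\<^sub>R y) - A x z 0) < \<eta> / (2 * n)" by (simp add: dist_norm)
    \<comment> \<open>Two errors are separated: the change of the gradient between 0 and the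
      intermediate point, tested on v, and the gradient at 0 tested on v + z1, the deviation of v
      from minus the horizontal part of z.\<close>
    have "(\<Psi> (gm x y, z) - \<Psi> (x, z)) / e + hdir \<Psi> (x, z)
        = (A x z (\<xi> *\<^sub>R y) - A x z 0) \<bullet> v + A x z 0 \<bullet> (v + z1)"
      unfolding mv hd using e by (simp add: yv inner_diff_left inner_add_right)
    also have "\<bar>\<dots>\<bar> \<le> norm (A x z (\<xi> *\<^sub>R y) - A x z 0) * norm v + norm (A x z 0) * norm (v + z1)"
      by (intro order_trans[OF abs_triangle_ineq] add_mono Cauchy_Schwarz_ineq2)
    also have "\<dots> \<le> \<eta> / (2 * n) * n + B * (n * e)"
      using nA nv nvz Bb[OF p0] B \<eta> n by (intro add_mono mult_mono) auto
    also have "\<dots> \<le> \<eta>" using e\<eta> n by (simp add: mult_ac)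
    finally show ?thesis unfolding y_def .
  qed
  then show ?thesis using d by blast
qed

lemma dil_uminus: "dil w e (- z) = - dil w e z"
  by (simp add: dil_def vec_eq_iff)

text \<open>For fixed z the map is a right translation in x, so the invariance follows by Fubini
  with the integral over x inside.\<close>

lemma shear_lborel:
  "distr lborel borel (\<lambda>p. (gm (fst p) (dil w e (snd p)), snd p)) = (lborel :: ((real^'n) \<times> (real^'n)) measure)"
proof (rule measure_eqI)
  let ?F = "\<lambda>p. (gm (fst p) (dil w e (snd p)), snd p)"
  have [measurable]: "?F \<in> borel_measurable borel"
  proof (rule borel_measurable_continuous_onI)
    have "continuous_on UNIV (dil w e)"
      using dil_linear by (intro linear_continuous_on) (simp add: linear_conv_bounded_linear)
    then have "continuous_on UNIV (\<lambda>p. dil w e (snd p))"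
      by (rule continuous_on_compose2) (auto intro: continuous_intros)
    then show "continuous_on UNIV ?F" by (intro continuous_on_Pair gm_continuous' continuous_intros)
  qed
  fix A assume "A \<in> sets (distr lborel borel ?F)"
  then have A [measurable]: "A \<in> sets borel" by simp
  have sl: "(\<lambda>x. indicator A (x, z) :: ennreal) \<in> borel_measurable borel" for z
  proof -
    have "(\<lambda>x. (x, z)) \<in> borel_measurable borel" by (intro borel_measurable_continuous_onI continuous_intros)
    from measurable_compose[OF this, of "indicator A :: _ \<Rightarrow> ennreal"] show ?thesis using A by simp
  qed
  have "emeasure (distr lborel borel ?F) A = (\<integral>\<^sup>+p. indicator A p \<partial>distr lborel borel ?F)" by simp
  also have "\<dots> = (\<integral>\<^sup>+p. indicator A (?F p) \<partial>lborel)" by (rule nn_integral_distr) auto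
  also have "\<dots> = (\<integral>\<^sup>+z. \<integral>\<^sup>+x. indicator A (gm x (dil w e z), z) \<partial>lborel \<partial>lborel)"
    by (subst nn_integral_lborel_snd) auto
  also have "\<dots> = (\<integral>\<^sup>+z. \<integral>\<^sup>+x. indicator A (x, z) \<partial>lborel \<partial>lborel)"
    using nn_integral_right_translation[OF sl] by simp
  also have "\<dots> = (\<integral>\<^sup>+p. indicator A p \<partial>lborel)"
    by (subst nn_integral_lborel_snd) auto
  finally show "emeasure (distr lborel borel ?F) A = emeasure lborel A" by simp
qed simp

text \<open>Passing to the limit against a test function: a right translation moves the difference
  quotient onto the test function, where it converges uniformly.\<close>

lemma diff_quot_C1_limit:
  fixes fk :: "nat \<Rightarrow> real^'n \<Rightarrow> real" and f :: "real^'n \<Rightarrow> real" and \<Psi> :: "(real^'n) \<times> (real^'n) \<Rightarrow> real"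
  assumes D: "open D" and eps: "\<And>k. eps k > 0" "eps \<longlonglongrightarrow> 0"
    and fm [measurable]: "\<And>k. fk k \<in> borel_measurable borel" "f \<in> borel_measurable borel"
    and fint: "\<And>k K. compact K \<Longrightarrow> K \<subseteq> D \<Longrightarrow> integrable lborel (\<lambda>x. indicator K x * fk k x)"
    and weak: "\<And>K g. compact K \<Longrightarrow> K \<subseteq> D \<Longrightarrow> g \<in> borel_measurable borel \<Longrightarrow> bounded (range g) \<Longrightarrow>
       (\<lambda>k. \<integral>x. indicator K x * fk k x * g x \<partial>lborel) \<longlonglongrightarrow> (\<integral>x. indicator K x * f x * g x \<partial>lborel)"
    and \<Psi>: "C1_fun \<Psi>" and K: "compact K" "K \<subseteq> D" and \<Psi>0: "\<And>x z. x \<notin> K \<Longrightarrow> \<Psi> (x, z) = 0"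
  shows "(\<lambda>k. \<integral>p. indicator D (fst p) * \<Psi> p * diff_quot gm w D (eps k) (fk k) p \<partial>lborel)
     \<longlonglongrightarrow> - (\<integral>x. indicator D x * f x * (\<integral>z. indicator U1 z * hdir \<Psi> (x, z) \<partial>lborel) \<partial>lborel)"
proof -
  have [measurable]: "D \<in> sets borel" using D by auto
  obtain K' d where K': "compact K'" "K \<subseteq> K'" "K' \<subseteq> D" and d: "d > 0" "d \<le> 1"
    and move: "\<And>e z x. 0 < e \<Longrightarrow> e < d \<Longrightarrow> z \<in> U1 \<Longrightarrow> x \<in> K \<Longrightarrow> gm x (dil w e z) \<in> K'"
    using compact_thickening[OF K D] by blast
  have [measurable]: "K' \<in> sets borel" using K'(1) by (simp add: compact_imp_closed)
  define F where "F k x = indicator K' x * fk k x" for k x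
  have Fm [measurable]: "F k \<in> borel_measurable borel" for k unfolding F_def by measurable
  have Fi: "integrable lborel (F k)" for k unfolding F_def by (rule fint[OF K'(1,3)])
  \<comment> \<open>Weak convergence bounds the pairings with every bounded function, and the
    uniform boundedness principle turns this into one L^1 bound on K' for the whole
    sequence.\<close>
  obtain B where B: "\<And>k. (\<integral>x. \<bar>F k x\<bar> \<partial>lborel) \<le> B"
  proof -
    have "\<exists>B. \<forall>k. (\<integral>x. \<bar>F k x\<bar> \<partial>lborel) \<le> B"
    proof (rule integrals_bounded_imp_L1_bounded[OF Fi])
      fix g :: "real^'n \<Rightarrow> real" assume g: "g \<in> borel_measurable lborel" "\<And>x. \<bar>g x\<bar> \<le> 1"
      have "bounded (range g)" unfolding bounded_iff using g(2) by auto
      then have "(\<lambda>k. \<integral>x. F k x * g x \<partial>lborel) \<longlonglongrightarrow> (\<integral>x. indicator K' x * f x * g x \<partial>lborel)"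
        unfolding F_def using g(1) by (intro weak K') auto
      then show "Bseq (\<lambda>k. \<integral>x. F k x * g x \<partial>lborel)" by (intro convergent_imp_Bseq convergentI)
    qed
    then show ?thesis using that by blast
  qed
  have "0 \<le> (\<integral>x. \<bar>F 0 x\<bar> \<partial>lborel)" by simp
  then have B0: "B \<ge> 0" using B[of 0] by linarith
  define u where "u = measure lborel U1"
  have u: "u > 0" unfolding u_def by (rule emeasure_U1)
  have Ui: "integrable lborel (\<lambda>z. indicator U1 z :: real)"
    using emeasure_U1(1) by (intro integrable_real_indicator) auto
  have FU: "integrable lborel (\<lambda>p. \<bar>F k (fst p)\<bar> * indicator U1 (snd p))"
    and FUi: "(\<integral>p. \<bar>F k (fst p)\<bar> * indicator U1 (snd p) \<partial>lborel) = (\<integral>x. \<bar>F k x\<bar> \<partial>lborel) * u" for k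
    using integrable_lborel_times[of "\<lambda>x. \<bar>F k x\<bar>" "indicator U1"] integral_lborel_times[of "\<lambda>x. \<bar>F k x\<bar>" "indicator U1"] Fi[of k] Ui
    by (simp_all add: u_def)
  have bdd_int: "integrable lborel (\<lambda>p. F k (fst p) * indicator U1 (snd p) * h p)"
    if hm [measurable]: "h \<in> borel_measurable borel" and hc: "\<And>x z. x \<in> K' \<Longrightarrow> z \<in> U1 \<Longrightarrow> \<bar>h (x, z)\<bar> \<le> c" for h c k
  proof (rule Bochner_Integration.integrable_bound)
    show "integrable lborel (\<lambda>p. c * (\<bar>F k (fst p)\<bar> * indicator U1 (snd p)))" using FU by simp
    show "AE p in lborel. norm (F k (fst p) * indicator U1 (snd p) * h p) \<le> norm (c * (\<bar>F k (fst p)\<bar> * indicator U1 (snd p)))"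
    proof (rule AE_I2)
      fix p :: "(real^'n) \<times> (real^'n)"
      show "norm (F k (fst p) * indicator U1 (snd p) * h p) \<le> norm (c * (\<bar>F k (fst p)\<bar> * indicator U1 (snd p)))"
      proof (cases "fst p \<in> K' \<and> snd p \<in> U1")
        case True
        then have "\<bar>h p\<bar> \<le> \<bar>c\<bar>" using hc[of "fst p" "snd p"] by simp
        then have "\<bar>F k (fst p)\<bar> * \<bar>h p\<bar> \<le> \<bar>F k (fst p)\<bar> * \<bar>c\<bar>" by (intro mult_left_mono) auto
        then show ?thesis using True by (simp add: abs_mult mult.commute)
      qed (auto simp: F_def)
    qed
  qed measurable
  have Um [measurable]: "U1 \<in> sets borel" by (rule U1_measurable)
  have \<Psi>c: "continuous_on UNIV \<Psi>" by (rule C1_fun_continuous[OF \<Psi>])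
  have \<Psi>m [measurable]: "\<Psi> \<in> borel_measurable borel" using \<Psi>c by (rule borel_measurable_continuous_onI)
  have Sc: "continuous_on UNIV (hdir \<Psi>)" by (rule hdir_continuous[OF \<Psi>])
  have Sm [measurable]: "hdir \<Psi> \<in> borel_measurable borel" using Sc by (rule borel_measurable_continuous_onI)
  let ?C = "K' \<times> cbox (- (\<chi> i. 1)) (\<chi> i. 1 :: real^'n)"
  have Cc: "compact ?C" by (intro compact_Times K' compact_cbox)
  have inC: "(x, z) \<in> ?C" if "x \<in> K'" "z \<in> U1" for x z
    using that box_subset_cbox by (auto simp: U1_eq_box)
  obtain B1 where B1: "\<And>x z. x \<in> K' \<Longrightarrow> z \<in> U1 \<Longrightarrow> \<bar>\<Psi> (x, z)\<bar> \<le> B1"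
  proof -
    have "bounded (\<Psi> ` ?C)" by (intro compact_imp_bounded compact_continuous_image Cc continuous_on_subset[OF \<Psi>c]) auto
    then obtain b where "\<forall>p\<in>?C. norm (\<Psi> p) \<le> b" unfolding bounded_iff by blast
    then show ?thesis using inC by (intro that[of b]) auto
  qed
  obtain B2 where B2: "\<And>x z. x \<in> K' \<Longrightarrow> z \<in> U1 \<Longrightarrow> \<bar>hdir \<Psi> (x, z)\<bar> \<le> B2"
  proof -
    have "bounded (hdir \<Psi> ` ?C)" by (intro compact_imp_bounded compact_continuous_image Cc continuous_on_subset[OF Sc]) auto
    then obtain b where "\<forall>p\<in>?C. norm (hdir \<Psi> p) \<le> b" unfolding bounded_iff by blast
    then show ?thesis using inC by (intro that[of b]) auto
  qed
  have B1': "\<bar>\<Psi> (x, z)\<bar> \<le> \<bar>B1\<bar>" if z: "z \<in> U1" for x z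
  proof (cases "x \<in> K'")
    case True
    then show ?thesis using B1[OF True z] by linarith
  next
    case False
    then have "x \<notin> K" using K'(2) by blast
    then show ?thesis using \<Psi>0[of x z] by simp
  qed
  define G where "G x = (\<integral>z. indicator U1 z * hdir \<Psi> (x, z) \<partial>lborel)" for x
  have G0: "G x = 0" if "x \<notin> K" for x
  proof -
    have "hdir \<Psi> (x, z) = 0" for z by (rule hdir_eq_0[of K]) (use K(1) \<Psi>0 that in auto)
    then show ?thesis unfolding G_def by simp
  qed
  have Gm [measurable]: "G \<in> borel_measurable borel"
  proof -
    have "case_prod (\<lambda>x z. indicator U1 z * hdir \<Psi> (x, z)) \<in> borel_measurable (borel \<Otimes>\<^sub>M lborel)"
    proof -
      have "(\<lambda>p. indicator U1 (snd p) * hdir \<Psi> p) \<in> borel_measurable borel" by measurable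
      moreover have "sets (borel \<Otimes>\<^sub>M lborel) = sets (borel :: ((real^'n) \<times> (real^'n)) measure)"
        by (simp add: borel_prod[symmetric] cong: sets_pair_measure_cong)
      ultimately show ?thesis by (simp add: case_prod_beta' cong: measurable_cong_sets)
    qed
    then show ?thesis unfolding G_def by (rule lborel.borel_measurable_lebesgue_integral)
  qed
  have Gb: "bounded (range G)"
  proof -
    have "\<bar>G x\<bar> \<le> \<bar>B2\<bar> * u" for x
    proof (cases "x \<in> K'")
      case True
      have "\<bar>G x\<bar> \<le> (\<integral>z. \<bar>B2\<bar> * indicator U1 z \<partial>lborel)"
        unfolding G_def
      proof (rule order_trans[OF integral_abs_bound], rule integral_mono_AE')
        show "integrable lborel (\<lambda>z. \<bar>B2\<bar> * indicator U1 z)" using Ui by simp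
        show "AE z in lborel. \<bar>indicator U1 z * hdir \<Psi> (x, z)\<bar> \<le> \<bar>B2\<bar> * indicator U1 z"
        proof (rule AE_I2)
          fix z
          show "\<bar>indicator U1 z * hdir \<Psi> (x, z)\<bar> \<le> \<bar>B2\<bar> * indicator U1 z"
            using B2[OF True, of z] by (cases "z \<in> U1") auto
        qed
      qed auto
      then show ?thesis by (simp add: u_def)
    next
      case False
      then have "x \<notin> K" using K'(2) by blast
      then show ?thesis using G0[of x] u by simp
    qed
    then show ?thesis unfolding bounded_iff by auto
  qed
  \<comment> \<open>The pairing in which the difference quotient of the test function is replaced by
    its uniform limit, minus \<open>hdir\<close>. Here weak convergence of the sequence applies
    directly.\<close>
  define T where "T k = - (\<integral>x. indicator K' x * fk k x * G x \<partial>lborel)" for k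
  have Tlim: "T \<longlonglongrightarrow> - (\<integral>x. indicator K' x * f x * G x \<partial>lborel)"
    unfolding T_def by (intro tendsto_minus weak K' Gm Gb)
  have T_eq: "T k = - (\<integral>p. F k (fst p) * indicator U1 (snd p) * hdir \<Psi> p \<partial>lborel)" for k
    unfolding T_def
    by (subst integral_lborel_fst[OF bdd_int[OF Sm B2]]) (simp_all add: F_def G_def mult.assoc)
  have lim_eq: "(\<integral>x. indicator K' x * f x * G x \<partial>lborel) = (\<integral>x. indicator D x * f x * G x \<partial>lborel)"
    using G0 K'(2,3) by (intro Bochner_Integration.integral_cong) (auto simp: indicator_def)
  define LHS where "LHS k = (\<integral>p. indicator D (fst p) * \<Psi> p * diff_quot gm w D (eps k) (fk k) p \<partial>lborel)" for k
  have LHS_eq: "LHS k = (\<integral>p. F k (fst p) * indicator U1 (snd p) *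
        ((\<Psi> (gm (fst p) (dil w (eps k) (- snd p)), snd p) - \<Psi> p) / eps k) \<partial>lborel)"
    if ek: "eps k < d" for k
  proof -
    let ?e = "eps k"
    define \<Phi> where "\<Phi> p = (gm (fst p) (dil w ?e (snd p)), snd p)" for p :: "(real^'n) \<times> (real^'n)"
    have \<Phi>l: "distr lborel borel \<Phi> = lborel" unfolding \<Phi>_def[abs_def] by (rule shear_lborel)
    have dc: "continuous_on UNIV (dil w ?e)"
      using dil_linear by (intro linear_continuous_on) (simp add: linear_conv_bounded_linear)
    have \<Phi>m [measurable]: "\<Phi> \<in> borel_measurable borel"
      unfolding \<Phi>_def[abs_def]
      by (intro borel_measurable_continuous_onI continuous_on_Pair gm_continuous' continuous_on_compose2[OF dc] continuous_intros) auto
    define h2 where "h2 p = F k (fst p) * indicator U1 (snd p) * \<Psi> p" for p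
    \<comment> \<open>The term with the translated test function. Composed with the measure
      preserving shear it becomes F k(x \<circ> \<delta>_e(z)) \<Psi>(x, z) on the cube, so its
      integral can be read in both ways.\<close>
    define k1 where "k1 p = F k (fst p) * indicator U1 (snd p) * \<Psi> (gm (fst p) (dil w ?e (- snd p)), snd p)" for p
    have km: "(\<lambda>p. \<Psi> (gm (fst p) (dil w ?e (- snd p)), snd p)) \<in> borel_measurable borel"
      by (intro borel_measurable_continuous_onI continuous_on_compose2[OF \<Psi>c] continuous_on_Pair gm_continuous'
          continuous_on_compose2[OF dc] continuous_intros) auto
    have h2i: "integrable lborel h2" unfolding h2_def using B1 by (intro bdd_int) auto
    have k1i: "integrable lborel k1" unfolding k1_def using B1' by (intro bdd_int[OF km, of "\<bar>B1\<bar>"]) auto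
    have k1\<Phi>: "k1 (\<Phi> p) = F k (gm (fst p) (dil w ?e (snd p))) * indicator U1 (snd p) * \<Psi> p" for p
      unfolding k1_def \<Phi>_def by (simp add: dil_uminus)
    have k1\<Phi>i: "integrable lborel (\<lambda>p. k1 (\<Phi> p))"
      using k1i by (subst integrable_distr_eq[symmetric, of \<Phi> lborel borel]) (auto simp: \<Phi>l)
    have k1\<Phi>e: "(\<integral>p. k1 (\<Phi> p) \<partial>lborel) = (\<integral>p. k1 p \<partial>lborel)"
      using k1i by (subst integral_distr[symmetric, of \<Phi> lborel borel]) (auto simp: \<Phi>l)
    \<comment> \<open>Where \<Psi> is nonzero and z lies in the cube, x belongs to K and x \<circ>
      \<delta>_e(z) to K'. All indicators are then 1, and \<open>F k\<close> agrees with
      \<open>fk k\<close> at both points.\<close>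
    have pt: "indicator D (fst p) * \<Psi> p * diff_quot gm w D ?e (fk k) p = (k1 (\<Phi> p) - h2 p) / ?e" for p
    proof (cases "\<Psi> p = 0 \<or> snd p \<notin> U1")
      case True
      then show ?thesis by (auto simp: k1\<Phi> h2_def diff_quot_def Let_def)
    next
      case False
      then have x: "fst p \<in> K" and z: "snd p \<in> U1" using \<Psi>0[of "fst p" "snd p"] by auto
      have y: "gm (fst p) (dil w ?e (snd p)) \<in> K'" using move[OF eps(1) ek z x] .
      have "fst p \<in> D" "fst p \<in> K'" "gm (fst p) (dil w ?e (snd p)) \<in> D" using x y K' by auto
      then show ?thesis using x y z unfolding k1\<Phi> h2_def diff_quot_def Let_def F_def
        by (simp add: algebra_simps diff_divide_distrib)
    qed
    have "LHS k = (\<integral>p. (k1 (\<Phi> p) - h2 p) / ?e \<partial>lborel)" unfolding LHS_def pt ..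
    also have "\<dots> = ((\<integral>p. k1 p \<partial>lborel) - (\<integral>p. h2 p \<partial>lborel)) / ?e"
      using k1\<Phi>i h2i k1\<Phi>e by simp
    also have "\<dots> = (\<integral>p. (k1 p - h2 p) / ?e \<partial>lborel)" using k1i h2i by simp
    also have "(\<lambda>p. (k1 p - h2 p) / ?e) = (\<lambda>p. F k (fst p) * indicator U1 (snd p) *
        ((\<Psi> (gm (fst p) (dil w ?e (- snd p)), snd p) - \<Psi> p) / ?e))"
      unfolding k1_def h2_def by (simp add: fun_eq_iff right_diff_distrib diff_divide_distrib)
    finally show ?thesis .
  qed
  have "(\<lambda>k. LHS k - T k) \<longlonglongrightarrow> 0"
  proof (rule LIMSEQ_I)
    fix r :: real assume r: "r > 0"
    \<comment> \<open>The difference of the two pairings is at most \<eta> B u; the added 1 keeps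
      the denominator positive.\<close>
    define \<eta> where "\<eta> = r / (2 * (B * u + 1))"
    have Bu: "B * u \<ge> 0" using B0 u by simp
    have \<eta>: "\<eta> > 0" unfolding \<eta>_def using r Bu by simp
    obtain d2 where d2: "d2 > 0" and unif: "\<And>e x z. 0 < e \<Longrightarrow> e < d2 \<Longrightarrow> x \<in> K' \<Longrightarrow> z \<in> U1 \<Longrightarrow>
      \<bar>(\<Psi> (gm x (dil w e (- z)), z) - \<Psi> (x, z)) / e + hdir \<Psi> (x, z)\<bar> \<le> \<eta>"
      using difference_quotient_uniform[OF \<Psi> K'(1) \<eta>] by blast
    have "eventually (\<lambda>k. eps k < min d d2) sequentially"
      using eps(2) d(1) d2 by (intro order_tendstoD(2)[OF eps(2)]) simp
    then obtain N where N: "\<And>k. k \<ge> N \<Longrightarrow> eps k < min d d2" unfolding eventually_sequentially by blast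
    have "norm (LHS k - T k - 0) < r" if "k \<ge> N" for k
    proof -
      let ?e = "eps k"
      have ek: "?e < d" "?e < d2" using N[OF that] by auto
      define q where "q p = (\<Psi> (gm (fst p) (dil w ?e (- snd p)), snd p) - \<Psi> p) / ?e" for p
      have dc: "continuous_on UNIV (dil w ?e)"
        using dil_linear by (intro linear_continuous_on) (simp add: linear_conv_bounded_linear)
      have "(\<lambda>p. \<Psi> (gm (fst p) (dil w ?e (- snd p)), snd p)) \<in> borel_measurable borel"
        by (intro borel_measurable_continuous_onI continuous_on_compose2[OF \<Psi>c] continuous_on_Pair gm_continuous'
            continuous_on_compose2[OF dc] continuous_intros) auto
      then have qm [measurable]: "q \<in> borel_measurable borel" unfolding q_def by measurable
      have qS: "\<bar>q (x, z) + hdir \<Psi> (x, z)\<bar> \<le> \<eta>" if "x \<in> K'" "z \<in> U1" for x z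
        unfolding q_def using unif[OF eps(1) ek(2) that] by simp
      have qSm: "(\<lambda>p. q p + hdir \<Psi> p) \<in> borel_measurable borel" by measurable
      have i1: "integrable lborel (\<lambda>p. F k (fst p) * indicator U1 (snd p) * (q p + hdir \<Psi> p))"
        by (rule bdd_int[OF qSm qS])
      have i2: "integrable lborel (\<lambda>p. F k (fst p) * indicator U1 (snd p) * hdir \<Psi> p)"
        by (rule bdd_int[OF Sm B2])
      have i3: "integrable lborel (\<lambda>p. F k (fst p) * indicator U1 (snd p) * q p)"
        using Bochner_Integration.integrable_diff[OF i1 i2] by (simp add: algebra_simps)
      have "LHS k - T k = (\<integral>p. F k (fst p) * indicator U1 (snd p) * q p \<partial>lborel) + (\<integral>p. F k (fst p) * indicator U1 (snd p) * hdir \<Psi> p \<partial>lborel)"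
        unfolding LHS_eq[OF ek(1)] T_eq q_def by simp
      also have "\<dots> = (\<integral>p. F k (fst p) * indicator U1 (snd p) * (q p + hdir \<Psi> p) \<partial>lborel)"
        using i2 i3 by (simp add: distrib_left)
      also have "\<bar>\<dots>\<bar> \<le> (\<integral>p. \<eta> * (\<bar>F k (fst p)\<bar> * indicator U1 (snd p)) \<partial>lborel)"
      proof (rule order_trans[OF integral_abs_bound], rule integral_mono_AE')
        show "integrable lborel (\<lambda>p. \<eta> * (\<bar>F k (fst p)\<bar> * indicator U1 (snd p)))" using FU by simp
        show "AE p in lborel. \<bar>F k (fst p) * indicator U1 (snd p) * (q p + hdir \<Psi> p)\<bar> \<le> \<eta> * (\<bar>F k (fst p)\<bar> * indicator U1 (snd p))"
        proof (rule AE_I2)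
          fix p :: "(real^'n) \<times> (real^'n)"
          show "\<bar>F k (fst p) * indicator U1 (snd p) * (q p + hdir \<Psi> p)\<bar> \<le> \<eta> * (\<bar>F k (fst p)\<bar> * indicator U1 (snd p))"
          proof (cases "fst p \<in> K' \<and> snd p \<in> U1")
            case True
            then have "\<bar>q p + hdir \<Psi> p\<bar> \<le> \<eta>" using qS[of "fst p" "snd p"] by simp
            then have "\<bar>F k (fst p)\<bar> * \<bar>q p + hdir \<Psi> p\<bar> \<le> \<bar>F k (fst p)\<bar> * \<eta>" by (intro mult_left_mono) auto
            then show ?thesis using True by (simp add: abs_mult mult.commute)
          qed (auto simp: F_def)
        qed
      qed (use \<eta> in auto)
      also have "\<dots> = \<eta> * ((\<integral>x. \<bar>F k x\<bar> \<partial>lborel) * u)" by (simp add: FUi)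
      also have "\<dots> \<le> \<eta> * (B * u)" using B[of k] \<eta> u by (intro mult_left_mono mult_right_mono) auto
      also have "\<dots> < r" unfolding \<eta>_def using r Bu mult_nonneg_nonneg[OF Bu less_imp_le[OF r]] by (simp add: field_simps)
      finally show ?thesis by simp
    qed
    then show "\<exists>no. \<forall>n\<ge>no. norm (LHS n - T n - 0) < r" by blast
  qed
  from tendsto_add[OF this Tlim] have "LHS \<longlonglongrightarrow> - (\<integral>x. indicator D x * f x * G x \<partial>lborel)"
    by (simp add: lim_eq)
  then show ?thesis unfolding LHS_def[abs_def] G_def .
qed

end

section \<open>Weights, signed vague limits and moments of the cube\<close>

text \<open>The function exp(-|x_1| - ... - |x_n|), whose integral factorises. For q > 1 the moments
  are bounded in L^q, and multiplication by such a weight bounds them in L^1, as vague compactness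
  demands.\<close>

lemma weight_function:
  "\<exists>\<rho>::'a::euclidean_space \<Rightarrow> real. continuous_on UNIV \<rho> \<and> (\<forall>x. 0 < \<rho> x \<and> \<rho> x \<le> 1) \<and>
     (\<integral>\<^sup>+x. ennreal (\<rho> x) \<partial>lborel) < \<infinity>"
proof -
  define g where "g t = exp (- \<bar>t\<bar>)" for t :: real
  have gm [measurable]: "g \<in> borel_measurable borel" unfolding g_def by measurable
  have "(\<integral>\<^sup>+t. ennreal (g t) \<partial>lborel) < \<infinity>"
  proof -
    have half: "(\<integral>\<^sup>+t. ennreal (exp (- t)) * indicator {0..} t \<partial>lborel) = 1"
    proof -
      have "(\<integral>\<^sup>+t. ennreal (exp (- t)) * indicator {0..} t \<partial>lborel) = ennreal (0 - (- exp (- 0)))"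
      proof (rule nn_integral_FTC_atLeast[where F = "\<lambda>t. - exp (- t)"])
        show "((\<lambda>t::real. - exp (- t)) \<longlongrightarrow> 0) at_top"
          using tendsto_minus[OF filterlim_compose[OF exp_at_bot filterlim_uminus_at_bot_at_top]] by simp
      qed (auto intro!: derivative_eq_intros)
      then show ?thesis by simp
    qed
    have "(\<integral>\<^sup>+t. ennreal (g t) \<partial>lborel)
       \<le> (\<integral>\<^sup>+t. ennreal (exp (- t)) * indicator {0..} t + ennreal (exp (- (- t))) * indicator {0..} (- t) \<partial>lborel)"
      by (intro nn_integral_mono) (auto simp: g_def indicator_def abs_if)
    also have "\<dots> = (\<integral>\<^sup>+t. ennreal (exp (- t)) * indicator {0..} t \<partial>lborel)
        + (\<integral>\<^sup>+t. ennreal (exp (- (- t))) * indicator {0..} (- t) \<partial>lborel)"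
      by (rule nn_integral_add) auto
    also have "(\<integral>\<^sup>+t. ennreal (exp (- (- t))) * indicator {0..} (- t) \<partial>lborel)
        = (\<integral>\<^sup>+t. ennreal (exp (- t)) * indicator {0..} t \<partial>lborel)"
      using nn_integral_real_affine[of "\<lambda>t. ennreal (exp (- t)) * indicator {0..} t" "-1" 0] by simp
    finally show ?thesis unfolding half by (auto intro: le_less_trans)
  qed
  then have f1: "(\<Prod>b\<in>(Basis::'a set). (\<integral>\<^sup>+t. ennreal (g t) \<partial>lborel)) < \<infinity>"
    by (simp add: power_less_top_ennreal)
  define \<rho> where "\<rho> x = (\<Prod>b\<in>Basis. g (x \<bullet> b))" for x :: 'a
  have "continuous_on UNIV \<rho>" unfolding \<rho>_def g_def by (intro continuous_intros)
  moreover have "0 < \<rho> x \<and> \<rho> x \<le> 1" for x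
    unfolding \<rho>_def g_def by (auto intro!: prod_pos prod_le_1)
  moreover have "(\<integral>\<^sup>+x. ennreal (\<rho> x) \<partial>lborel) < \<infinity>"
  proof -
    have "(\<integral>\<^sup>+x. ennreal (\<rho> x) \<partial>lborel) = (\<integral>\<^sup>+x. (\<Prod>b\<in>Basis. ennreal (g ((x::'a) \<bullet> b))) \<partial>lborel)"
      unfolding \<rho>_def by (subst prod_ennreal) (auto simp: g_def)
    also have "\<dots> = (\<Prod>b\<in>(Basis::'a set). (\<integral>\<^sup>+t. ennreal (g t) \<partial>lborel))"
      by (rule nn_integral_lborel_prod) auto
    finally show ?thesis using f1 by simp
  qed
  ultimately show ?thesis by blast
qed

text \<open>Hoelder's inequality on a set of finite measure, up to a constant factor, derived from
  Young's inequality with a free parameter l.\<close>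

lemma power_integral_le:
  fixes v :: "'a::euclidean_space \<Rightarrow> real"
  assumes [measurable]: "v \<in> borel_measurable borel" "U \<in> sets borel" and q: "q \<ge> 1"
    and U: "emeasure lborel U < \<infinity>" "measure lborel U > 0"
  shows "ennreal ((\<integral>x. \<bar>v x\<bar> * indicator U x \<partial>lborel) powr q)
     \<le> ennreal ((2 * measure lborel U) powr q / measure lborel U) * (\<integral>\<^sup>+x. ennreal (\<bar>v x\<bar> powr q) * indicator U x \<partial>lborel)"
proof -
  define u where "u = measure lborel U"
  have u: "u > 0" "emeasure lborel U = ennreal u" using U by (simp_all add: u_def emeasure_eq_ennreal_measure)
  define V where "V = (\<integral>\<^sup>+x. ennreal (\<bar>v x\<bar> powr q) * indicator U x \<partial>lborel)"
  define s where "s = (\<integral>x. \<bar>v x\<bar> * indicator U x \<partial>lborel)"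
  have s0: "s \<ge> 0" unfolding s_def by simp
  \<comment> \<open>If the integrand is not integrable, its Bochner integral is 0 and the inequality
    is trivial.\<close>
  have sle: "ennreal s \<le> (\<integral>\<^sup>+x. ennreal \<bar>v x\<bar> * indicator U x \<partial>lborel)"
  proof (cases "integrable lborel (\<lambda>x. \<bar>v x\<bar> * indicator U x)")
    case True
    then have "ennreal s = (\<integral>\<^sup>+x. ennreal (\<bar>v x\<bar> * indicator U x) \<partial>lborel)"
      unfolding s_def by (subst nn_integral_eq_integral) auto
    also have "\<dots> = (\<integral>\<^sup>+x. ennreal \<bar>v x\<bar> * indicator U x \<partial>lborel)"
      by (intro nn_integral_cong) (auto simp: indicator_def)
    finally show ?thesis by simp
  qed (simp add: s_def not_integrable_integral_eq)
  have "ennreal (s powr q) \<le> ennreal ((2 * u) powr q / u) * V"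
  proof (cases "V = \<infinity>")
    case True
    then show ?thesis using u by (simp add: ennreal_mult_top)
  next
    case False
    then obtain V' where V': "V = ennreal V'" "V' \<ge> 0" by (cases V) auto
    show ?thesis
    proof (cases "q = 1")
      case True
      have "(\<integral>\<^sup>+x. ennreal \<bar>v x\<bar> * indicator U x \<partial>lborel) = V" unfolding V_def True by simp
      then have "s \<le> V'" using sle V' by simp
      then have "s \<le> 2 * V'" using V' by simp
      then show ?thesis using True u V' s0 by (simp add: ennreal_mult'[symmetric] del: ennreal_numeral)
    next
      case False
      then have q1: "q > 1" using q by simp
      \<comment> \<open>With this l the product \<open>l * s\<close> equals 2 u (s / (2 u))^q, twice
        the term that Young's inequality puts on the other side, so that half of it can be
        absorbed.\<close>
      define l where "l = (s / (2 * u)) powr (q - 1)"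
      have l0: "l \<ge> 0" unfolding l_def by simp
      have lp: "l powr (q / (q - 1)) = (s / (2 * u)) powr q" unfolding l_def powr_powr using q1 by simp
      have "ennreal (l * s) = ennreal l * ennreal s" using l0 by (simp add: ennreal_mult')
      also have "\<dots> \<le> ennreal l * (\<integral>\<^sup>+x. ennreal \<bar>v x\<bar> * indicator U x \<partial>lborel)" by (rule mult_left_mono[OF sle]) simp
      also have "\<dots> = (\<integral>\<^sup>+x. ennreal (\<bar>v x\<bar> * l) * indicator U x \<partial>lborel)"
        using l0 by (subst nn_integral_cmult[symmetric]) (auto simp: ennreal_mult' mult_ac)
      also have "\<dots> \<le> (\<integral>\<^sup>+x. ennreal (\<bar>v x\<bar> powr q) * indicator U x + ennreal (l powr (q / (q - 1))) * indicator U x \<partial>lborel)"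
      proof (rule nn_integral_mono)
        fix x
        have "\<bar>v x\<bar> * l \<le> \<bar>v x\<bar> powr q + l powr (q / (q - 1))" using mult_le_powr_add_powr[of "\<bar>v x\<bar>" l q] l0 q1 by simp
        then show "ennreal (\<bar>v x\<bar> * l) * indicator U x \<le> ennreal (\<bar>v x\<bar> powr q) * indicator U x + ennreal (l powr (q / (q - 1))) * indicator U x"
          by (auto simp: indicator_def ennreal_plus[symmetric] simp del: ennreal_plus intro!: ennreal_leI)
      qed
      also have "\<dots> = V + ennreal (l powr (q / (q - 1))) * ennreal u"
        unfolding V_def by (subst nn_integral_add) (auto simp: nn_integral_cmult_indicator u(2))
      also have "\<dots> = ennreal (V' + (s / (2 * u)) powr q * u)"
        using V' u by (simp add: lp ennreal_mult' ennreal_plus)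
      finally have "l * s \<le> V' + (s / (2 * u)) powr q * u"
        using V' u by (subst (asm) ennreal_le_iff) auto
      moreover have "l * s = 2 * u * (s / (2 * u)) powr q"
      proof (cases "s = 0")
        case False
        have "(s / (2 * u)) powr q = (s / (2 * u)) powr (q - 1) * (s / (2 * u)) powr 1"
          using powr_add[of "s / (2 * u)" "q - 1" 1] by simp
        also have "(s / (2 * u)) powr 1 = s / (2 * u)" using s0 u by simp
        finally show ?thesis unfolding l_def using u by (simp add: field_simps)
      qed simp
      ultimately have "u * (s / (2 * u)) powr q \<le> V'" by (simp add: algebra_simps)
      moreover have "(s / (2 * u)) powr q = s powr q / (2 * u) powr q" using s0 u by (simp add: powr_divide)
      then have "s powr q = (2 * u) powr q / u * (u * (s / (2 * u)) powr q)" using u by simp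
      moreover have "(2 * u) powr q / u * (u * (s / (2 * u)) powr q) \<le> (2 * u) powr q / u * V'"
        if "u * (s / (2 * u)) powr q \<le> V'" using that u by (intro mult_left_mono) auto
      ultimately have "s powr q \<le> (2 * u) powr q / u * V'" by simp
      then show ?thesis using V' u by (simp add: ennreal_mult'[symmetric] ennreal_leI)
    qed
  qed
  then show ?thesis unfolding s_def V_def u_def .
qed

text \<open>The positive and the negative parts are treated by two extractions in succession, the
  second from the first. The limits of the parts are recorded separately, because a density bound is
  later derived for each of the two measures.\<close>

lemma vague_limit_pos_neg:
  fixes H :: "nat \<Rightarrow> 'a::euclidean_space \<Rightarrow> real" and \<rho> :: "'a \<Rightarrow> real"
  assumes Hm [measurable]: "\<And>k. H k \<in> borel_measurable borel" and \<rho>m [measurable]: "\<rho> \<in> borel_measurable borel"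
    and \<rho>0: "\<And>x. 0 \<le> \<rho> x" and bd: "\<And>k. (\<integral>\<^sup>+x. ennreal (\<rho> x * \<bar>H k x\<bar>) \<partial>lborel) \<le> ennreal C"
  shows "\<exists>r \<mu> \<nu>. strict_mono (r :: nat \<Rightarrow> nat) \<and> finite_measure \<mu> \<and> sets \<mu> = sets borel \<and>
    finite_measure \<nu> \<and> sets \<nu> = sets borel \<and>
    (\<forall>\<phi>. continuous_on UNIV \<phi> \<longrightarrow> supp_cpt UNIV \<phi> \<longrightarrow>
       (\<lambda>k. \<integral>x. \<phi> x * (\<rho> x * max 0 (H (r k) x)) \<partial>lborel) \<longlonglongrightarrow> (\<integral>x. \<phi> x \<partial>\<mu>) \<and>
       (\<lambda>k. \<integral>x. \<phi> x * (\<rho> x * max 0 (- H (r k) x)) \<partial>lborel) \<longlonglongrightarrow> (\<integral>x. \<phi> x \<partial>\<nu>) \<and>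
       (\<lambda>k. \<integral>x. \<phi> x * (\<rho> x * H (r k) x) \<partial>lborel) \<longlonglongrightarrow> (\<integral>x. \<phi> x \<partial>\<mu>) - (\<integral>x. \<phi> x \<partial>\<nu>))"
proof -
  have bdp: "(\<integral>\<^sup>+x. ennreal (\<rho> x * max 0 (c * H k x)) \<partial>lborel) \<le> ennreal C" if "\<bar>c\<bar> = 1" for k c
  proof (rule order_trans[OF nn_integral_mono bd[of k]])
    fix x
    have "max 0 (c * H k x) \<le> \<bar>c\<bar> * \<bar>H k x\<bar>" by (simp add: abs_mult[symmetric])
    then show "ennreal (\<rho> x * max 0 (c * H k x)) \<le> ennreal (\<rho> x * \<bar>H k x\<bar>)"
      using \<rho>0[of x] that by (intro ennreal_leI mult_left_mono) auto
  qed
  obtain r1 \<mu> where r1: "strict_mono (r1 :: nat \<Rightarrow> nat)" and \<mu>: "finite_measure \<mu>" "sets \<mu> = sets borel"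
    and l1: "\<And>\<phi>. continuous_on UNIV \<phi> \<Longrightarrow> compact (csupp \<phi>) \<Longrightarrow>
       (\<lambda>k. \<integral>x. \<phi> x * (\<rho> x * max 0 (H (r1 k) x)) \<partial>lborel) \<longlonglongrightarrow> (\<integral>x. \<phi> x \<partial>\<mu>)"
    using vague_compactness[of "\<lambda>k x. \<rho> x * max 0 (H k x)" C] bdp[of 1] \<rho>0 by auto
  obtain r2 \<nu> where r2: "strict_mono (r2 :: nat \<Rightarrow> nat)" and \<nu>: "finite_measure \<nu>" "sets \<nu> = sets borel"
    and l2: "\<And>\<phi>. continuous_on UNIV \<phi> \<Longrightarrow> compact (csupp \<phi>) \<Longrightarrow>
       (\<lambda>k. \<integral>x. \<phi> x * (\<rho> x * max 0 (- H (r1 (r2 k)) x)) \<partial>lborel) \<longlonglongrightarrow> (\<integral>x. \<phi> x \<partial>\<nu>)"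
    using vague_compactness[of "\<lambda>k x. \<rho> x * max 0 (- H (r1 k) x)" C] bdp[of "-1"] \<rho>0 by auto
  define r where "r k = r1 (r2 k)" for k
  have r: "strict_mono r" unfolding r_def using strict_mono_o[OF r1 r2] by (simp add: comp_def)
  have "(\<lambda>k. \<integral>x. \<phi> x * (\<rho> x * max 0 (H (r k) x)) \<partial>lborel) \<longlonglongrightarrow> (\<integral>x. \<phi> x \<partial>\<mu>) \<and>
       (\<lambda>k. \<integral>x. \<phi> x * (\<rho> x * max 0 (- H (r k) x)) \<partial>lborel) \<longlonglongrightarrow> (\<integral>x. \<phi> x \<partial>\<nu>) \<and>
       (\<lambda>k. \<integral>x. \<phi> x * (\<rho> x * H (r k) x) \<partial>lborel) \<longlonglongrightarrow> (\<integral>x. \<phi> x \<partial>\<mu>) - (\<integral>x. \<phi> x \<partial>\<nu>)"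
    if \<phi>: "continuous_on UNIV \<phi>" "supp_cpt UNIV \<phi>" for \<phi>
  proof -
    have cs: "compact (csupp \<phi>)" by (rule supp_cpt_csupp[OF \<phi>(2)])
    have [measurable]: "\<phi> \<in> borel_measurable borel" using \<phi>(1) by (rule borel_measurable_continuous_onI)
    obtain B where B: "\<And>x. \<bar>\<phi> x\<bar> \<le> B" using supp_cpt_bounded[OF \<phi>(2,1)] by blast
    have A1: "(\<lambda>k. \<integral>x. \<phi> x * (\<rho> x * max 0 (H (r k) x)) \<partial>lborel) \<longlonglongrightarrow> (\<integral>x. \<phi> x \<partial>\<mu>)"
      using LIMSEQ_subseq_LIMSEQ[OF l1[OF \<phi>(1) cs] r2] by (simp add: comp_def r_def)
    have A2: "(\<lambda>k. \<integral>x. \<phi> x * (\<rho> x * max 0 (- H (r k) x)) \<partial>lborel) \<longlonglongrightarrow> (\<integral>x. \<phi> x \<partial>\<nu>)"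
      using l2[OF \<phi>(1) cs] by (simp add: r_def)
    have int: "integrable lborel (\<lambda>x. \<phi> x * (\<rho> x * max 0 (c * H k x)))" if "\<bar>c\<bar> = 1" for c k
    proof (rule Bochner_Integration.integrable_bound)
      show "integrable lborel (\<lambda>x. B * (\<rho> x * max 0 (c * H k x)))"
        using bdp[OF that, of k] \<rho>0
        by (intro integrable_mult_right integrableI_bounded) (auto intro: le_less_trans[OF _ ennreal_less_top])
      show "AE x in lborel. norm (\<phi> x * (\<rho> x * max 0 (c * H k x))) \<le> norm (B * (\<rho> x * max 0 (c * H k x)))"
      proof (rule AE_I2)
        fix x
        have "\<bar>\<phi> x\<bar> \<le> \<bar>B\<bar>" using B[of x] by linarith
        then show "norm (\<phi> x * (\<rho> x * max 0 (c * H k x))) \<le> norm (B * (\<rho> x * max 0 (c * H k x)))"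
          unfolding real_norm_def abs_mult by (intro mult_right_mono) auto
      qed
    qed measurable
    have "(\<integral>x. \<phi> x * (\<rho> x * H k x) \<partial>lborel)
        = (\<integral>x. \<phi> x * (\<rho> x * max 0 (H k x)) \<partial>lborel) - (\<integral>x. \<phi> x * (\<rho> x * max 0 (- H k x)) \<partial>lborel)" for k
    proof -
      have "\<phi> x * (\<rho> x * H k x) = \<phi> x * (\<rho> x * max 0 (H k x)) - \<phi> x * (\<rho> x * max 0 (- H k x))" for x
        by (auto simp: max_def)
      then show ?thesis using int[of 1 k] int[of "-1" k] by simp
    qed
    then have A3: "(\<lambda>k. \<integral>x. \<phi> x * (\<rho> x * H (r k) x) \<partial>lborel) \<longlonglongrightarrow> (\<integral>x. \<phi> x \<partial>\<mu>) - (\<integral>x. \<phi> x \<partial>\<nu>)"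
      using tendsto_diff[OF A1 A2] by simp
    show ?thesis using A1 A2 A3 by blast
  qed
  then show ?thesis using r \<mu> \<nu> by blast
qed

context carnot begin

text \<open>Reflecting the coordinate z_i preserves the cube and Lebesgue measure and reverses the
  sign of the integrand. This orthogonality is what lets the moment in z_i single out X_i.\<close>

lemma integral_U1_moments:
  assumes "i \<noteq> j"
  shows "(\<integral>z. indicator U1 z * (z $ i * z $ j) \<partial>lborel) = 0"
proof -
  define T where "T z = (\<chi> k. if k = i then - z $ k else z $ k)" for z :: "real^'n"
  define c where "c b = (if b = axis i 1 then - 1 else 1 :: real)" for b :: "real^'n"
  have eq: "(0::real^'n) + (\<Sum>b\<in>Basis. (c b * (z \<bullet> b)) *\<^sub>R b) = T z" for z
  proof (rule euclidean_eqI)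
    fix b :: "real^'n" assume b: "b \<in> Basis"
    then obtain k where k: "b = axis k 1" by (auto simp: Basis_vec_def)
    have "((0::real^'n) + (\<Sum>b\<in>Basis. (c b * (z \<bullet> b)) *\<^sub>R b)) \<bullet> b = c b * (z \<bullet> b)" using b by simp
    also have "\<dots> = T z \<bullet> b" by (simp add: k c_def T_def inner_axis axis_eq_axis)
    finally show "((0::real^'n) + (\<Sum>b\<in>Basis. (c b * (z \<bullet> b)) *\<^sub>R b)) \<bullet> b = T z \<bullet> b" .
  qed
  have "lborel = density (distr lborel borel (\<lambda>z. 0 + (\<Sum>b\<in>Basis. (c b * (z \<bullet> b)) *\<^sub>R b))) (\<lambda>_. ennreal (\<Prod>b\<in>Basis. \<bar>c b\<bar>))"
    by (rule lborel_affine_euclidean) (simp add: c_def)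
  moreover have "(\<Prod>b\<in>(Basis :: (real^'n) set). \<bar>c b\<bar>) = 1" by (intro prod.neutral) (simp add: c_def)
  ultimately have L: "lborel = distr lborel borel T" unfolding eq by (simp add: density_1)
  have Tm [measurable]: "T \<in> borel_measurable borel"
  proof (rule borel_measurable_continuous_onI)
    have "continuous_on UNIV (\<lambda>z :: real^'n. if k = i then - z $ k else z $ k)" for k
      by (cases "k = i") (simp_all add: continuous_on_minus linear_continuous_on bounded_linear_vec_nth)
    then show "continuous_on UNIV T" unfolding T_def[abs_def] by (intro continuous_on_vec_lambda)
  qed
  have gm: "(\<lambda>z. indicator U1 z * (z $ i * z $ j) :: real) \<in> borel_measurable borel"
    by (intro borel_measurable_times borel_measurable_indicator U1_measurable borel_measurable_continuous_onI continuous_intros)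
  have "(\<integral>z. indicator U1 z * (z $ i * z $ j) \<partial>lborel) = (\<integral>z. indicator U1 (T z) * (T z $ i * T z $ j) \<partial>lborel)"
    by (subst L) (rule integral_distr[OF _ gm], simp)
  also have "(\<lambda>z. indicator U1 (T z) * (T z $ i * T z $ j)) = (\<lambda>z. - (indicator U1 z * (z $ i * z $ j) :: real))"
  proof
    fix z
    have "T z \<in> U1 \<longleftrightarrow> z \<in> U1" unfolding U1_iff T_def by (auto split: if_splits)
    then show "indicator U1 (T z) * (T z $ i * T z $ j) = - (indicator U1 z * (z $ i * z $ j) :: real)"
      using assms by (auto simp: T_def indicator_def)
  qed
  finally show ?thesis by simp
qed

text \<open>The integrand vanishes in the cube on a hyperplane only, which is a null set, while the
  cube has positive volume. The value serves as the normalising divisor of the moments.\<close>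

lemma integral_U1_square_pos: "(\<integral>z. indicator U1 z * (z $ i * z $ i) \<partial>lborel) > 0"
proof -
  have m: "(\<lambda>z. indicator U1 z * (z $ i * z $ i) :: real) \<in> borel_measurable lborel"
  proof -
    have "(\<lambda>z. indicator U1 z * (z $ i * z $ i) :: real) \<in> borel_measurable borel"
      by (intro borel_measurable_times borel_measurable_indicator U1_measurable borel_measurable_continuous_onI continuous_intros)
    then show ?thesis by simp
  qed
  have int: "integrable lborel (\<lambda>z. indicator U1 z * (z $ i * z $ i) :: real)"
  proof (rule Bochner_Integration.integrable_bound[OF _ m])
    show "integrable lborel (\<lambda>z. indicator U1 z :: real)"
      using emeasure_U1(1) by (intro integrable_real_indicator) auto
    show "AE z in lborel. norm (indicator U1 z * (z $ i * z $ i)) \<le> norm (indicator U1 z :: real)"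
    proof (rule AE_I2)
      fix z :: "real^'n"
      have "\<bar>z $ i\<bar> * \<bar>z $ i\<bar> \<le> 1 * 1" if "z \<in> U1"
        using that by (intro mult_mono) (auto simp: U1_iff less_imp_le)
      then show "norm (indicator U1 z * (z $ i * z $ i)) \<le> norm (indicator U1 z :: real)"
        by (cases "z \<in> U1") (auto simp: abs_mult)
    qed
  qed
  have "(\<integral>z. indicator U1 z * (z $ i * z $ i) \<partial>lborel) \<noteq> 0"
  proof
    assume "(\<integral>z. indicator U1 z * (z $ i * z $ i) \<partial>lborel) = 0"
    then have ae: "AE z in lborel. indicator U1 z * (z $ i * z $ i) = (0::real)"
      using int by (subst (asm) integral_nonneg_eq_0_iff_AE) auto
    let ?N = "{z. z $ i = 0}"
    have ni: "negligible {z :: real^'n. z $ i = 0}" by (rule negligible_standard_hyperplane_cart)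
    have nb: "{z :: real^'n. z $ i = 0} \<in> sets borel"
      by (intro borel_closed closed_Collect_eq continuous_intros)
    have "emeasure lborel {z :: real^'n. z $ i = 0} = emeasure lebesgue {z :: real^'n. z $ i = 0}" using nb by simp
    also have "\<dots> = 0" using ni by (simp add: negligible_iff_emeasure0 nb sets_completionI_sets)
    finally have "{z :: real^'n. z $ i = 0} \<in> null_sets lborel" using nb by (simp add: null_sets_def)
    then have "AE z in lborel. z \<notin> {z :: real^'n. z $ i = 0}" by (rule AE_not_in)
    with ae have "AE z in lborel. z \<notin> U1" by eventually_elim (auto simp: indicator_def split: if_splits)
    then have "emeasure lborel U1 = 0" by (subst (asm) AE_iff_measurable[of U1]) auto
    then show False using emeasure_U1(2) by (simp add: measure_def)
  qed
  moreover have "(\<integral>z. indicator U1 z * (z $ i * z $ i) \<partial>lborel) \<ge> 0" by (rule Bochner_Integration.integral_nonneg) simp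
  ultimately show ?thesis by linarith
qed

end

text \<open>The elementary bound |u| \<le> 1 + |u|^q gives integrability over sets of finite
  measure.\<close>

lemma integrable_indicator_Lq:
  fixes u :: "'a::euclidean_space \<Rightarrow> real"
  assumes um [measurable]: "u \<in> borel_measurable borel" and q: "q \<ge> 1"
    and uq: "(\<integral>\<^sup>+x. ennreal (\<bar>u x\<bar> powr q) \<partial>lborel) < \<infinity>"
    and Am [measurable]: "A \<in> sets borel" and A: "emeasure lborel A < \<infinity>"
  shows "integrable lborel (\<lambda>x. indicator A x * u x)"
proof (rule integrableI_bounded)
  have "(\<integral>\<^sup>+x. ennreal (norm (indicator A x * u x)) \<partial>lborel)
      \<le> (\<integral>\<^sup>+x. indicator A x + ennreal (\<bar>u x\<bar> powr q) \<partial>lborel)"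
  proof (rule nn_integral_mono)
    fix x
    have "\<bar>u x\<bar> \<le> 1 + \<bar>u x\<bar> powr q"
    proof (cases "\<bar>u x\<bar> \<le> 1")
      case False
      then have "\<bar>u x\<bar> powr 1 \<le> \<bar>u x\<bar> powr q" using q by (intro powr_mono) auto
      then show ?thesis using False by simp
    qed (simp add: add_increasing2)
    then have "ennreal \<bar>u x\<bar> \<le> ennreal (1 + \<bar>u x\<bar> powr q)" by (rule ennreal_leI)
    also have "\<dots> = 1 + ennreal (\<bar>u x\<bar> powr q)" by (simp add: ennreal_plus)
    finally show "ennreal (norm (indicator A x * u x)) \<le> indicator A x + ennreal (\<bar>u x\<bar> powr q)"
      by (cases "x \<in> A") auto
  qed
  also have "\<dots> = emeasure lborel A + (\<integral>\<^sup>+x. ennreal (\<bar>u x\<bar> powr q) \<partial>lborel)"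
    by (subst nn_integral_add) auto
  also have "\<dots> < \<infinity>" using A uq by simp
  finally show "(\<integral>\<^sup>+x. ennreal (norm (indicator A x * u x)) \<partial>lborel) < \<infinity>" .
qed measurable

lemma (in carnot) integrable_U1_continuous:
  assumes "continuous_on UNIV (h :: real^'n \<Rightarrow> real)"
  shows "integrable lborel (\<lambda>z. indicator U1 z * h z)"
proof -
  have [measurable]: "h \<in> borel_measurable borel" using assms by (rule borel_measurable_continuous_onI)
  have "bounded (h ` cbox (- (\<chi> i. 1)) (\<chi> i. 1))"
    by (intro compact_imp_bounded compact_continuous_image compact_cbox continuous_on_subset[OF assms]) auto
  then obtain b where b: "\<And>z. z \<in> cbox (- (\<chi> i. 1)) (\<chi> i. 1) \<Longrightarrow> \<bar>h z\<bar> \<le> b" unfolding bounded_iff by auto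
  show ?thesis
  proof (rule Bochner_Integration.integrable_bound)
    show "integrable lborel (\<lambda>z. b * indicator U1 z)"
      using emeasure_U1(1) by (intro integrable_mult_right integrable_real_indicator) auto
    show "AE z in lborel. norm (indicator U1 z * h z) \<le> norm (b * indicator U1 z)"
    proof (rule AE_I2)
      fix z
      have "\<bar>h z\<bar> \<le> \<bar>b\<bar>" if "z \<in> U1"
        using b[of z] that box_subset_cbox by (fastforce simp: U1_eq_box)
      then show "norm (indicator U1 z * h z) \<le> norm (b * indicator U1 z)" by (cases "z \<in> U1") auto
    qed
  qed measurable
qed

section \<open>Moments of the difference quotients\<close>

text \<open>The situation after passing to Borel representatives: functions are Borel on the whole
  space, integrals are taken over \<open>lborel\<close>, and the averaged oscillation bound has
  become an L^q bound for the difference quotients over D. Both cases of the theorem work in this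
  locale.\<close>

locale carnot_seq = carnot gm w for gm :: "real^'n::finite \<Rightarrow> real^'n \<Rightarrow> real^'n" and w +
  fixes D :: "(real^'n) set" and q :: real and eps :: "nat \<Rightarrow> real"
    and fk :: "nat \<Rightarrow> real^'n \<Rightarrow> real" and f :: "real^'n \<Rightarrow> real" and C :: real
  assumes D: "open D" and q: "q \<ge> 1" and eps_pos: "eps k > 0" and eps_lim: "eps \<longlonglongrightarrow> 0"
    and fkm [measurable]: "fk k \<in> borel_measurable borel" and fm [measurable]: "f \<in> borel_measurable borel"
    and fkq: "(\<integral>\<^sup>+x. ennreal (\<bar>fk k x\<bar> powr q) \<partial>lborel) < \<infinity>"
    and fq: "(\<integral>\<^sup>+x. ennreal (\<bar>f x\<bar> powr q) \<partial>lborel) < \<infinity>"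
    and weakq: "g \<in> borel_measurable borel \<Longrightarrow>
       (if q = 1 then bounded (range g) else (\<integral>\<^sup>+x. ennreal (\<bar>g x\<bar> powr (q / (q - 1))) \<partial>lborel) < \<infinity>) \<Longrightarrow>
       (\<lambda>k. \<integral>x. fk k x * g x \<partial>lborel) \<longlonglongrightarrow> (\<integral>x. f x * g x \<partial>lborel)"
    and C: "C \<ge> 0"
    and bound: "(\<integral>\<^sup>+p. ennreal (\<bar>diff_quot gm w D (eps k) (fk k) p\<bar> powr q) * indicator D (fst p) \<partial>lborel) \<le> ennreal C"
begin

abbreviation Q :: "nat \<Rightarrow> (real^'n) \<times> (real^'n) \<Rightarrow> real" where "Q k \<equiv> diff_quot gm w D (eps k) (fk k)"

lemma D_measurable [measurable]: "D \<in> sets borel" using D by auto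

lemma Q_measurable [measurable]: "Q k \<in> borel_measurable borel"
proof -
  have dc: "continuous_on UNIV (dil w (eps k))"
    using dil_linear by (intro linear_continuous_on) (simp add: linear_conv_bounded_linear)
  have [measurable]: "(\<lambda>p. gm (fst p) (dil w (eps k) (snd p))) \<in> borel_measurable borel"
    by (intro borel_measurable_continuous_onI gm_continuous' continuous_on_compose2[OF dc] continuous_intros) auto
  show ?thesis unfolding diff_quot_def[abs_def] Let_def by measurable
qed

lemma Q_eq_0: "z \<notin> U1 \<Longrightarrow> Q k (x, z) = 0" by (simp add: diff_quot_def Let_def)

lemma Q_Lq: "(\<integral>\<^sup>+p. ennreal (\<bar>indicator D (fst p) * Q k p\<bar> powr q) \<partial>lborel) \<le> ennreal C"
proof -
  have "(\<integral>\<^sup>+p. ennreal (\<bar>indicator D (fst p) * Q k p\<bar> powr q) \<partial>lborel)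
     = (\<integral>\<^sup>+p. ennreal (\<bar>Q k p\<bar> powr q) * indicator D (fst p) \<partial>lborel)"
    by (intro nn_integral_cong) (auto simp: indicator_def)
  then show ?thesis using bound by simp
qed

text \<open>In z the quotient lives on the cube, so over A it is supported in a set of finite
  measure, where an L^q bound implies integrability.\<close>

lemma Q_integrable:
  assumes Am [measurable]: "A \<in> sets borel" and A: "emeasure lborel A < \<infinity>"
  shows "integrable lborel (\<lambda>p. indicator A (fst p) * (indicator D (fst p) * Q k p))"
proof -
  have AU: "A \<times> U1 \<in> sets borel" using Am U1_measurable by (simp add: borel_prod[symmetric])
  have "emeasure lborel (A \<times> U1) = emeasure lborel A * emeasure lborel U1"
    unfolding lborel_prod[symmetric] by (rule lborel.emeasure_pair_measure_Times) auto
  then have fin: "emeasure lborel (A \<times> U1) < \<infinity>" using A emeasure_U1(1) by (simp add: ennreal_mult_less_top)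
  have "integrable lborel (\<lambda>p. indicator (A \<times> U1) p * (indicator D (fst p) * Q k p))"
  proof (rule integrable_indicator_Lq[OF _ q _ AU fin])
    show "(\<lambda>p. indicator D (fst p) * Q k p) \<in> borel_measurable borel" by measurable
    show "(\<integral>\<^sup>+p. ennreal (\<bar>indicator D (fst p) * Q k p\<bar> powr q) \<partial>lborel) < \<infinity>"
      using Q_Lq[of k] by (rule le_less_trans) simp
  qed
  moreover have "indicator (A \<times> U1) p * (indicator D (fst p) * Q k p) = indicator A (fst p) * (indicator D (fst p) * Q k p)" for p
    using Q_eq_0[of "snd p" k "fst p"] by (cases p) (auto simp: indicator_def)
  ultimately show ?thesis by simp
qed

lemma local_integrable:
  assumes "compact K"
  shows "integrable lborel (\<lambda>x. indicator K x * fk k x)" "integrable lborel (\<lambda>x. indicator K x * f x)"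
  using assms emeasure_compact_finite[OF assms]
  by (auto intro!: integrable_indicator_Lq[OF _ q] fkq fq simp: compact_imp_closed less_top simp del: infinity_ennreal_def)

text \<open>Cut off to a compact set, a bounded function is admissible in \<open>weakq\<close> for
  every q, so that the later arguments need no distinction between the two dual classes.\<close>

lemma weak_local:
  assumes K: "compact K" and gm [measurable]: "g \<in> borel_measurable borel" and gb: "bounded (range g)"
  shows "(\<lambda>k. \<integral>x. indicator K x * fk k x * g x \<partial>lborel) \<longlonglongrightarrow> (\<integral>x. indicator K x * f x * g x \<partial>lborel)"
proof -
  have Km [measurable]: "K \<in> sets borel" using K by (simp add: compact_imp_closed)
  obtain b where b: "\<And>x. \<bar>g x\<bar> \<le> b" using gb unfolding bounded_iff by auto
  have "(\<lambda>k. \<integral>x. fk k x * (indicator K x * g x) \<partial>lborel) \<longlonglongrightarrow> (\<integral>x. f x * (indicator K x * g x) \<partial>lborel)"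
  proof (rule weakq)
    show "(\<lambda>x. indicator K x * g x) \<in> borel_measurable borel" by measurable
    have "\<bar>indicator K x * g x\<bar> \<le> b" for x using b[of x] by (cases "x \<in> K") auto
    then have "bounded (range (\<lambda>x. indicator K x * g x))" unfolding bounded_iff by auto
    moreover have "(\<integral>\<^sup>+x. ennreal (\<bar>indicator K x * g x\<bar> powr (q / (q - 1))) \<partial>lborel) < \<infinity>" if "q \<noteq> 1"
    proof -
      have "q / (q - 1) > 0" using q that by simp
      then have "(\<integral>\<^sup>+x. ennreal (\<bar>indicator K x * g x\<bar> powr (q / (q - 1))) \<partial>lborel)
          \<le> (\<integral>\<^sup>+x. ennreal (b powr (q / (q - 1))) * indicator K x \<partial>lborel)"
        using b by (intro nn_integral_mono) (auto simp: indicator_def intro!: ennreal_leI powr_mono2)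
      also have "\<dots> = ennreal (b powr (q / (q - 1))) * emeasure lborel K" by (rule nn_integral_cmult_indicator) simp
      also have "\<dots> < \<infinity>" using emeasure_compact_finite[OF K] by (simp add: ennreal_mult_less_top less_top)
      finally show ?thesis .
    qed
    ultimately show "if q = 1 then bounded (range (\<lambda>x. indicator K x * g x))
      else (\<integral>\<^sup>+x. ennreal (\<bar>indicator K x * g x\<bar> powr (q / (q - 1))) \<partial>lborel) < \<infinity>" by simp
  qed
  then show ?thesis by (simp add: mult_ac)
qed

lemma C1_limit:
  assumes "C1_fun \<Psi>" "compact K" "K \<subseteq> D" "\<And>x z. x \<notin> K \<Longrightarrow> \<Psi> (x, z) = 0"
  shows "(\<lambda>k. \<integral>p. indicator D (fst p) * \<Psi> p * Q k p \<partial>lborel)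
     \<longlonglongrightarrow> - (\<integral>x. indicator D x * f x * (\<integral>z. indicator U1 z * hdir \<Psi> (x, z) \<partial>lborel) \<partial>lborel)"
  by (rule diff_quot_C1_limit[OF D eps_pos eps_lim fkm fm _ _ assms]) (auto intro: local_integrable weak_local)

definition mom :: "'n \<Rightarrow> real" where
  "mom i = (\<integral>z. indicator U1 z * (z $ i * z $ i) \<partial>lborel)"

lemma mom_pos: "mom i > 0" unfolding mom_def by (rule integral_U1_square_pos)

text \<open>The first moments in \<open>z\<close> of the difference quotients approximate the derivative along \<open>X\<^sub>i\<close>.\<close>

definition H :: "'n \<Rightarrow> nat \<Rightarrow> real^'n \<Rightarrow> real" where
  "H i k x = indicator D x * (\<integral>z. z $ i * Q k (x, z) \<partial>lborel) / mom i"

lemma zQ_measurable: "(\<lambda>p. snd p $ i * Q k p) \<in> borel_measurable borel"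
proof -
  have "(\<lambda>p::(real^'n) \<times> (real^'n). snd p $ i) \<in> borel_measurable borel"
    by (intro borel_measurable_continuous_onI continuous_intros)
  then show ?thesis by measurable
qed

lemma H_measurable [measurable]: "H i k \<in> borel_measurable borel"
proof -
  have "(\<lambda>p. snd p $ i * Q k p) \<in> borel_measurable borel" by (rule zQ_measurable)
  moreover have "sets (borel \<Otimes>\<^sub>M lborel) = sets (borel :: ((real^'n) \<times> (real^'n)) measure)"
    by (simp add: borel_prod[symmetric] cong: sets_pair_measure_cong)
  ultimately have "case_prod (\<lambda>x z. z $ i * Q k (x, z)) \<in> borel_measurable (borel \<Otimes>\<^sub>M lborel)"
    by (simp add: case_prod_beta' cong: measurable_cong_sets)
  then have [measurable]: "(\<lambda>x. \<integral>z. z $ i * Q k (x, z) \<partial>lborel) \<in> borel_measurable borel"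
    by (rule lborel.borel_measurable_lebesgue_integral)
  show ?thesis unfolding H_def by measurable
qed

text \<open>Since |z_i| is at most 1 on the cube, Hoelder's inequality in z bounds |H|^q at x by a
  constant times the slice integral of |Q|^q; integration over x then uses the bound on the
  quotients.\<close>

lemma H_Lq: "\<exists>C'\<ge>0. \<forall>k. (\<integral>\<^sup>+x. ennreal (\<bar>H i k x\<bar> powr q) \<partial>lborel) \<le> ennreal C'"
proof -
  define u where "u = measure lborel U1"
  define A where "A = (2 * u) powr q / u"
  have u: "u > 0" unfolding u_def by (rule emeasure_U1)
  have A: "A \<ge> 0" unfolding A_def using u by simp
  define m where "m = (1 / mom i) powr q"
  have m: "m \<ge> 0" unfolding m_def by simp
  have "(\<integral>\<^sup>+x. ennreal (\<bar>H i k x\<bar> powr q) \<partial>lborel) \<le> ennreal (m * A * C)" for k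
  proof -
    have pt: "ennreal (\<bar>H i k x\<bar> powr q) \<le> ennreal (m * A) * (\<integral>\<^sup>+z. ennreal (\<bar>Q k (x, z)\<bar> powr q) * indicator D x \<partial>lborel)" for x
    proof (cases "x \<in> D")
      case True
      let ?v = "\<lambda>z. z $ i * Q k (x, z)"
      have vm: "?v \<in> borel_measurable borel" using slice_borel_measurable(2)[OF zQ_measurable[of i k], of x] by simp
      have "\<bar>\<integral>z. ?v z \<partial>lborel\<bar> \<le> (\<integral>z. \<bar>?v z\<bar> \<partial>lborel)" by (rule integral_abs_bound)
      also have "(\<integral>z. \<bar>?v z\<bar> \<partial>lborel) = (\<integral>z. \<bar>?v z\<bar> * indicator U1 z \<partial>lborel)"
        using Q_eq_0[of _ k x] by (intro Bochner_Integration.integral_cong) (auto simp: indicator_def)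
      finally have le: "\<bar>\<integral>z. ?v z \<partial>lborel\<bar> \<le> (\<integral>z. \<bar>?v z\<bar> * indicator U1 z \<partial>lborel)" .
      have "\<bar>H i k x\<bar> powr q = m * \<bar>\<integral>z. ?v z \<partial>lborel\<bar> powr q"
        unfolding H_def m_def using True mom_pos[of i] by (simp add: powr_mult[symmetric] abs_divide)
      also have "\<dots> \<le> m * (\<integral>z. \<bar>?v z\<bar> * indicator U1 z \<partial>lborel) powr q"
        using le q m by (intro mult_left_mono powr_mono2) auto
      finally have "ennreal (\<bar>H i k x\<bar> powr q) \<le> ennreal m * ennreal ((\<integral>z. \<bar>?v z\<bar> * indicator U1 z \<partial>lborel) powr q)"
        using m by (simp add: ennreal_leI ennreal_mult'[symmetric])
      also have "\<dots> \<le> ennreal m * (ennreal A * (\<integral>\<^sup>+z. ennreal (\<bar>?v z\<bar> powr q) * indicator U1 z \<partial>lborel))"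
        unfolding A_def u_def using emeasure_U1
        by (intro mult_left_mono power_integral_le[OF vm U1_measurable q]) auto
      finally have a: "ennreal (\<bar>H i k x\<bar> powr q) \<le> ennreal m * (ennreal A * (\<integral>\<^sup>+z. ennreal (\<bar>?v z\<bar> powr q) * indicator U1 z \<partial>lborel))" .
      have "(\<integral>\<^sup>+z. ennreal (\<bar>?v z\<bar> powr q) * indicator U1 z \<partial>lborel) \<le> (\<integral>\<^sup>+z. ennreal (\<bar>Q k (x, z)\<bar> powr q) * indicator D x \<partial>lborel)"
      proof (rule nn_integral_mono)
        fix z
        show "ennreal (\<bar>?v z\<bar> powr q) * indicator U1 z \<le> ennreal (\<bar>Q k (x, z)\<bar> powr q) * indicator D x"
        proof (cases "z \<in> U1")
          case z: True
          then have "\<bar>z $ i\<bar> \<le> 1" by (simp add: U1_iff less_imp_le)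
          then have "\<bar>z $ i\<bar> * \<bar>Q k (x, z)\<bar> \<le> 1 * \<bar>Q k (x, z)\<bar>" by (intro mult_right_mono) auto
          then show ?thesis using True z q by (auto simp: abs_mult intro!: ennreal_leI powr_mono2)
        qed simp
      qed
      then have "ennreal (\<bar>H i k x\<bar> powr q) \<le> ennreal m * (ennreal A * (\<integral>\<^sup>+z. ennreal (\<bar>Q k (x, z)\<bar> powr q) * indicator D x \<partial>lborel))"
        by (intro order_trans[OF a] mult_left_mono) auto
      then show ?thesis using m A by (simp add: ennreal_mult mult.assoc)
    qed (simp add: H_def)
    have QDm [measurable]: "(\<lambda>p. ennreal (\<bar>Q k p\<bar> powr q) * indicator D (fst p)) \<in> borel_measurable borel" by measurable
    have im: "(\<lambda>x. \<integral>\<^sup>+z. ennreal (\<bar>Q k (x, z)\<bar> powr q) * indicator D x \<partial>lborel) \<in> borel_measurable lborel"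
    proof -
      have "(\<lambda>p. ennreal (\<bar>Q k p\<bar> powr q) * indicator D (fst p)) \<in> borel_measurable (lborel \<Otimes>\<^sub>M lborel)"
        using QDm by (simp add: lborel_prod)
      from lborel.borel_measurable_nn_integral_fst[OF this] show ?thesis by simp
    qed
    have "(\<integral>\<^sup>+x. ennreal (\<bar>H i k x\<bar> powr q) \<partial>lborel)
        \<le> (\<integral>\<^sup>+x. ennreal (m * A) * (\<integral>\<^sup>+z. ennreal (\<bar>Q k (x, z)\<bar> powr q) * indicator D x \<partial>lborel) \<partial>lborel)"
      by (intro nn_integral_mono pt)
    also have "\<dots> = ennreal (m * A) * (\<integral>\<^sup>+x. \<integral>\<^sup>+z. ennreal (\<bar>Q k (x, z)\<bar> powr q) * indicator D x \<partial>lborel \<partial>lborel)"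
      by (rule nn_integral_cmult[OF im])
    also have "(\<integral>\<^sup>+x. \<integral>\<^sup>+z. ennreal (\<bar>Q k (x, z)\<bar> powr q) * indicator D x \<partial>lborel \<partial>lborel)
        = (\<integral>\<^sup>+p. ennreal (\<bar>Q k p\<bar> powr q) * indicator D (fst p) \<partial>lborel)"
      using nn_integral_lborel_fst[OF QDm] by simp
    also have "ennreal (m * A) * \<dots> \<le> ennreal (m * A) * ennreal C" by (rule mult_left_mono[OF bound]) simp
    also have "\<dots> = ennreal (m * A * C)" using m A C by (intro ennreal_mult[symmetric]) auto
    finally show ?thesis .
  qed
  moreover have "m * A * C \<ge> 0" using m A C by simp
  ultimately show ?thesis by blast
qed

text \<open>Test with \<Psi>(x, z) = z_i \<phi>(x). By Fubini the pairing with the quotient is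
  \<open>mom i\<close> times the pairing of \<phi> with \<open>H i k\<close>. In the limit the
  integrals of z_i z_j over the cube vanish for j different from i, which leaves
  \<open>mom i\<close> times X_i \<phi>.\<close>

lemma H_limit:
  assumes i: "w i = 1" and \<phi>: "C1_fun \<phi>" "supp_cpt D \<phi>"
  shows "(\<lambda>k. \<integral>x. \<phi> x * H i k x \<partial>lborel) \<longlonglongrightarrow> - (\<integral>x. indicator D x * f x * hX gm i \<phi> x \<partial>lborel)"
proof -
  obtain K where K: "compact K" "K \<subseteq> D" "\<And>x. x \<notin> K \<Longrightarrow> \<phi> x = 0" using \<phi>(2) unfolding supp_cpt_def by blast
  have Km [measurable]: "K \<in> sets borel" using K(1) by (simp add: compact_imp_closed)
  have \<phi>c: "continuous_on UNIV \<phi>" by (rule C1_fun_continuous[OF \<phi>(1)])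
  have \<phi>m [measurable]: "\<phi> \<in> borel_measurable borel" using \<phi>c by (rule borel_measurable_continuous_onI)
  obtain b where b: "\<And>x. \<bar>\<phi> x\<bar> \<le> b" using supp_cpt_bounded[OF \<phi>(2) \<phi>c] by blast
  define \<Psi> where "\<Psi> p = snd p $ i * \<phi> (fst p)" for p :: "(real^'n) \<times> (real^'n)"
  have "C1_fun (\<lambda>p::(real^'n) \<times> (real^'n). snd p $ i)"
    by (intro C1_fun_bounded_linear bounded_linear_compose[OF bounded_linear_vec_nth bounded_linear_snd])
  then have \<Psi>C: "C1_fun \<Psi>" unfolding \<Psi>_def[abs_def] by (intro C1_fun_mult C1_fun_fst \<phi>)
  have \<Psi>0: "\<Psi> (x, z) = 0" if "x \<notin> K" for x z unfolding \<Psi>_def using K(3)[OF that] by simp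
  have LHS: "(\<integral>p. indicator D (fst p) * \<Psi> p * Q k p \<partial>lborel) = mom i * (\<integral>x. \<phi> x * H i k x \<partial>lborel)" for k
  proof -
    have int: "integrable lborel (\<lambda>p. indicator D (fst p) * \<Psi> p * Q k p)"
    proof (rule Bochner_Integration.integrable_bound)
      show "integrable lborel (\<lambda>p. b * (indicator K (fst p) * (indicator D (fst p) * Q k p)))"
        using emeasure_compact_finite[OF K(1)] by (intro integrable_mult_right Q_integrable) (auto simp: less_top)
      have "\<Psi> \<in> borel_measurable borel" by (rule borel_measurable_continuous_onI[OF C1_fun_continuous[OF \<Psi>C]])
      then show "(\<lambda>p. indicator D (fst p) * \<Psi> p * Q k p) \<in> borel_measurable lborel" by simp
      show "AE p in lborel. norm (indicator D (fst p) * \<Psi> p * Q k p) \<le> norm (b * (indicator K (fst p) * (indicator D (fst p) * Q k p)))"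
      proof (rule AE_I2)
        fix p :: "(real^'n) \<times> (real^'n)"
        show "norm (indicator D (fst p) * \<Psi> p * Q k p) \<le> norm (b * (indicator K (fst p) * (indicator D (fst p) * Q k p)))"
        proof (cases "snd p \<in> U1 \<and> fst p \<in> K")
          case True
          then have "\<bar>snd p $ i\<bar> \<le> 1" by (simp add: U1_iff less_imp_le)
          moreover have "\<bar>\<phi> (fst p)\<bar> \<le> \<bar>b\<bar>" using b[of "fst p"] by linarith
          ultimately have "\<bar>snd p $ i\<bar> * \<bar>\<phi> (fst p)\<bar> \<le> 1 * \<bar>b\<bar>" by (intro mult_mono) auto
          then have "\<bar>\<Psi> p\<bar> * \<bar>Q k p\<bar> \<le> \<bar>b\<bar> * \<bar>Q k p\<bar>" unfolding \<Psi>_def abs_mult by (intro mult_right_mono) auto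
          then show ?thesis using True K(2) by (auto simp: abs_mult)
        next
          case False
          then have "\<Psi> p * Q k p = 0" using \<Psi>0[of "fst p" "snd p"] Q_eq_0[of "snd p" k "fst p"] by auto
          then have "indicator D (fst p) * \<Psi> p * Q k p = 0" by (simp only: mult.assoc mult_zero_right)
          then show ?thesis by (simp only: norm_zero norm_ge_zero)
        qed
      qed
    qed
    have "(\<integral>p. indicator D (fst p) * \<Psi> p * Q k p \<partial>lborel) = (\<integral>x. \<integral>z. indicator D x * \<Psi> (x, z) * Q k (x, z) \<partial>lborel \<partial>lborel)"
      using integral_lborel_fst[OF int] by simp
    also have "\<dots> = (\<integral>x. mom i * (\<phi> x * H i k x) \<partial>lborel)"
    proof (rule Bochner_Integration.integral_cong)
      fix x
      have "(\<lambda>z. indicator D x * \<Psi> (x, z) * Q k (x, z)) = (\<lambda>z. (indicator D x * \<phi> x) * (z $ i * Q k (x, z)))"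
        by (simp add: \<Psi>_def fun_eq_iff)
      then show "(\<integral>z. indicator D x * \<Psi> (x, z) * Q k (x, z) \<partial>lborel) = mom i * (\<phi> x * H i k x)"
        using mom_pos[of i] by (simp add: H_def)
    qed simp
    finally show ?thesis by simp
  qed
  have G: "(\<integral>z. indicator U1 z * hdir \<Psi> (x, z) \<partial>lborel) = mom i * hX gm i \<phi> x" for x
  proof -
    have hd: "hdir \<Psi> (x, z) = (\<Sum>j\<in>{j. w j = 1}. (z $ j * z $ i) * hX gm j \<phi> x)" for z
      unfolding hdir_def \<Psi>_def by (simp add: hX_cmult[OF \<phi>(1)] mult.assoc)
    have int: "integrable lborel (\<lambda>z. indicator U1 z * (z $ j * z $ i))" for j
      by (rule integrable_U1_continuous) (intro continuous_intros)
    have "(\<integral>z. indicator U1 z * hdir \<Psi> (x, z) \<partial>lborel)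
        = (\<integral>z. (\<Sum>j\<in>{j. w j = 1}. (indicator U1 z * (z $ j * z $ i)) * hX gm j \<phi> x) \<partial>lborel)"
      by (intro Bochner_Integration.integral_cong) (simp_all add: hd sum_distrib_left mult.assoc)
    also have "\<dots> = (\<Sum>j\<in>{j. w j = 1}. (\<integral>z. indicator U1 z * (z $ j * z $ i) \<partial>lborel) * hX gm j \<phi> x)"
      using int by (subst Bochner_Integration.integral_sum) auto
    also have "\<dots> = (\<Sum>j\<in>{j. w j = 1}. if j = i then mom i * hX gm i \<phi> x else 0)"
      by (intro sum.cong) (auto simp: mom_def integral_U1_moments)
    also have "\<dots> = mom i * hX gm i \<phi> x" using i by simp
    finally show ?thesis .
  qed
  have "(\<lambda>k. mom i * (\<integral>x. \<phi> x * H i k x \<partial>lborel)) \<longlonglongrightarrow> - (\<integral>x. indicator D x * f x * (mom i * hX gm i \<phi> x) \<partial>lborel)"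
    using C1_limit[OF \<Psi>C K(1,2) \<Psi>0] unfolding LHS G .
  also have "(\<integral>x. indicator D x * f x * (mom i * hX gm i \<phi> x) \<partial>lborel) = mom i * (\<integral>x. indicator D x * f x * hX gm i \<phi> x \<partial>lborel)"
    by (subst integral_mult_right_zero[symmetric]) (simp add: mult.left_commute)
  finally have "(\<lambda>k. (1 / mom i) * (mom i * (\<integral>x. \<phi> x * H i k x \<partial>lborel)))
      \<longlonglongrightarrow> (1 / mom i) * - (mom i * (\<integral>x. indicator D x * f x * hX gm i \<phi> x \<partial>lborel))"
    by (rule tendsto_mult_left)
  then show ?thesis using mom_pos[of i] by simp
qed

end

section \<open>Weak convergence in L^q and the Fubini representation of the limit\<close>

lemma ennreal_integral_le_nn_integral:
  assumes "\<And>x. 0 \<le> g x"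
  shows "ennreal (\<integral>x. g x \<partial>M) \<le> (\<integral>\<^sup>+x. ennreal (g x) \<partial>M)"
proof (cases "integrable M g")
  case True
  then show ?thesis using nn_integral_eq_integral[OF True] assms by simp
qed (simp add: not_integrable_integral_eq)

text \<open>Young's inequality after dividing s and multiplying v by l. A large l makes the
  contribution of a bounded family of functions s small uniformly, at the price of a large factor on
  v.\<close>

lemma nn_integral_mult_le_scaled_powr:
  fixes s v :: "'a::euclidean_space \<Rightarrow> real"
  assumes [measurable]: "s \<in> borel_measurable borel" "v \<in> borel_measurable borel" "W \<in> sets borel"
    and s0: "\<And>x. x \<notin> W \<Longrightarrow> s x = 0" and q: "q > 1" and l: "l > 0"
  shows "(\<integral>\<^sup>+x. ennreal \<bar>s x * v x\<bar> \<partial>lborel) \<le> ennreal ((1 / l) powr q) * (\<integral>\<^sup>+x. ennreal (\<bar>s x\<bar> powr q) \<partial>lborel)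
     + ennreal (l powr (q / (q - 1))) * (\<integral>\<^sup>+x. ennreal (\<bar>v x\<bar> powr (q / (q - 1))) * indicator W x \<partial>lborel)"
proof -
  let ?p = "q / (q - 1)"
  have "(\<integral>\<^sup>+x. ennreal \<bar>s x * v x\<bar> \<partial>lborel)
    \<le> (\<integral>\<^sup>+x. ennreal ((1 / l) powr q) * ennreal (\<bar>s x\<bar> powr q) + ennreal (l powr ?p) * (ennreal (\<bar>v x\<bar> powr ?p) * indicator W x) \<partial>lborel)"
  proof (rule nn_integral_mono)
    fix x
    show "ennreal \<bar>s x * v x\<bar> \<le> ennreal ((1 / l) powr q) * ennreal (\<bar>s x\<bar> powr q) + ennreal (l powr ?p) * (ennreal (\<bar>v x\<bar> powr ?p) * indicator W x)"
    proof (cases "x \<in> W")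
      case True
      have "\<bar>s x * v x\<bar> = (\<bar>s x\<bar> / l) * (l * \<bar>v x\<bar>)" using l by (simp add: abs_mult)
      also have "\<dots> \<le> (\<bar>s x\<bar> / l) powr q + (l * \<bar>v x\<bar>) powr ?p"
        using l q by (intro mult_le_powr_add_powr) auto
      also have "(\<bar>s x\<bar> / l) powr q = (1 / l) powr q * \<bar>s x\<bar> powr q"
        using l by (simp add: powr_mult[symmetric])
      also have "(l * \<bar>v x\<bar>) powr ?p = l powr ?p * \<bar>v x\<bar> powr ?p" using l by (simp add: powr_mult)
      finally have "ennreal \<bar>s x * v x\<bar> \<le> ennreal ((1 / l) powr q * \<bar>s x\<bar> powr q + l powr ?p * \<bar>v x\<bar> powr ?p)"
        by (rule ennreal_leI)
      then show ?thesis using True by (simp add: ennreal_plus ennreal_mult')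
    qed (simp add: s0)
  qed
  also have "\<dots> = ennreal ((1 / l) powr q) * (\<integral>\<^sup>+x. ennreal (\<bar>s x\<bar> powr q) \<partial>lborel)
     + ennreal (l powr ?p) * (\<integral>\<^sup>+x. ennreal (\<bar>v x\<bar> powr ?p) * indicator W x \<partial>lborel)"
    by (simp add: nn_integral_add nn_integral_cmult)
  finally show ?thesis .
qed

lemma integrable_mult_conjugate:
  fixes s v :: "'a::euclidean_space \<Rightarrow> real"
  assumes [measurable]: "s \<in> borel_measurable borel" "v \<in> borel_measurable borel" "W \<in> sets borel"
    and s0: "\<And>x. x \<notin> W \<Longrightarrow> s x = 0" and q: "q > 1"
    and sq: "(\<integral>\<^sup>+x. ennreal (\<bar>s x\<bar> powr q) \<partial>lborel) < \<infinity>"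
    and vp: "(\<integral>\<^sup>+x. ennreal (\<bar>v x\<bar> powr (q / (q - 1))) * indicator W x \<partial>lborel) < \<infinity>"
  shows "integrable lborel (\<lambda>x. s x * v x)"
proof (rule integrableI_bounded)
  have "(\<integral>\<^sup>+x. ennreal (norm (s x * v x)) \<partial>lborel) \<le> (\<integral>\<^sup>+x. ennreal (\<bar>s x\<bar> powr q) \<partial>lborel)
     + (\<integral>\<^sup>+x. ennreal (\<bar>v x\<bar> powr (q / (q - 1))) * indicator W x \<partial>lborel)"
    using nn_integral_mult_le_scaled_powr[of s v W q 1] s0 q by simp
  also have "\<dots> < \<infinity>" using sq vp by simp
  finally show "(\<integral>\<^sup>+x. ennreal (norm (s x * v x)) \<partial>lborel) < \<infinity>" .
qed measurable

text \<open>The pairings with \<open>S k\<close> and \<open>S'\<close> are equicontinuous in the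
  test function, because these functions are bounded in L^q together. Convergence therefore passes
  from the approximants \<open>g n\<close> to their limit u.\<close>

lemma weak_convergence_Lp_closed:
  fixes S :: "nat \<Rightarrow> 'a::euclidean_space \<Rightarrow> real"
  assumes Sm [measurable]: "\<And>k. S k \<in> borel_measurable borel" and S'm [measurable]: "S' \<in> borel_measurable borel"
    and Wm [measurable]: "W \<in> sets borel"
    and S0: "\<And>k x. x \<notin> W \<Longrightarrow> S k x = 0" "\<And>x. x \<notin> W \<Longrightarrow> S' x = 0" and q: "q > 1"
    and SC: "\<And>k. (\<integral>\<^sup>+x. ennreal (\<bar>S k x\<bar> powr q) \<partial>lborel) \<le> ennreal C" "(\<integral>\<^sup>+x. ennreal (\<bar>S' x\<bar> powr q) \<partial>lborel) \<le> ennreal C"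
    and C: "C \<ge> 0"
    and gm [measurable]: "\<And>n. g n \<in> borel_measurable borel" and um [measurable]: "u \<in> borel_measurable borel"
    and gp: "\<And>n. (\<integral>\<^sup>+x. ennreal (\<bar>g n x\<bar> powr (q / (q - 1))) * indicator W x \<partial>lborel) < \<infinity>"
    and up: "(\<integral>\<^sup>+x. ennreal (\<bar>u x\<bar> powr (q / (q - 1))) * indicator W x \<partial>lborel) < \<infinity>"
    and gu: "(\<lambda>n::nat. \<integral>\<^sup>+x. ennreal (\<bar>g n x - u x\<bar> powr (q / (q - 1))) * indicator W x \<partial>lborel) \<longlonglongrightarrow> 0"
    and conv: "\<And>n. (\<lambda>k. \<integral>x. S k x * g n x \<partial>lborel) \<longlonglongrightarrow> (\<integral>x. S' x * g n x \<partial>lborel)"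
  shows "(\<lambda>k. \<integral>x. S k x * u x \<partial>lborel) \<longlonglongrightarrow> (\<integral>x. S' x * u x \<partial>lborel)"
proof (rule LIMSEQ_I)
  fix r :: real assume r: "r > 0"
  let ?p = "q / (q - 1)"
  have p: "?p > 0" using q by simp
  \<comment> \<open>This is l^q for the scale l below, chosen so that (1/l)^q C is at most r/8. The
    index n is then taken so large that the other term of the scaled Young inequality is at most r/8
    as well. Two such errors of r/4, and r/4 for the convergence at \<open>g n\<close>, stay below
    r.\<close>
  define c where "c = 8 * (C + 1) / r"
  have c: "c > 0" unfolding c_def using C r by simp
  define l where "l = c powr (1 / q)"
  have l: "l > 0" unfolding l_def using c by simp
  have "(1 / l) powr q = 1 / l powr q" using l by (simp add: powr_divide)
  also have "l powr q = c" unfolding l_def powr_powr using q c by simp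
  finally have lq: "(1 / l) powr q = 1 / c" .
  have lC: "1 / c * C \<le> r / 8" unfolding c_def using C r by (simp add: field_simps)
  define t where "t = r / (8 * l powr ?p)"
  have t: "t > 0" unfolding t_def using r l by simp
  have "eventually (\<lambda>n. (\<integral>\<^sup>+x. ennreal (\<bar>g n x - u x\<bar> powr ?p) * indicator W x \<partial>lborel) < ennreal t) sequentially"
    using t by (intro order_tendstoD(2)[OF gu]) simp
  then obtain n where n: "(\<integral>\<^sup>+x. ennreal (\<bar>g n x - u x\<bar> powr ?p) * indicator W x \<partial>lborel) < ennreal t"
    unfolding eventually_sequentially by blast
  have est: "\<bar>(\<integral>x. s x * u x \<partial>lborel) - (\<integral>x. s x * g n x \<partial>lborel)\<bar> \<le> r / 4"
    if sm [measurable]: "s \<in> borel_measurable borel" and s0: "\<And>x. x \<notin> W \<Longrightarrow> s x = 0"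
      and sC: "(\<integral>\<^sup>+x. ennreal (\<bar>s x\<bar> powr q) \<partial>lborel) \<le> ennreal C" for s
  proof -
    have sfin: "(\<integral>\<^sup>+x. ennreal (\<bar>s x\<bar> powr q) \<partial>lborel) < \<infinity>" using sC by (rule le_less_trans) simp
    have i1: "integrable lborel (\<lambda>x. s x * u x)" by (rule integrable_mult_conjugate[OF sm um Wm s0 q sfin up])
    have i2: "integrable lborel (\<lambda>x. s x * g n x)" by (rule integrable_mult_conjugate[OF sm gm Wm s0 q sfin gp])
    have "(\<integral>x. s x * u x \<partial>lborel) - (\<integral>x. s x * g n x \<partial>lborel) = - (\<integral>x. s x * (g n x - u x) \<partial>lborel)"
      using i1 i2 by (simp add: right_diff_distrib)
    then have "\<bar>(\<integral>x. s x * u x \<partial>lborel) - (\<integral>x. s x * g n x \<partial>lborel)\<bar> \<le> (\<integral>x. \<bar>s x * (g n x - u x)\<bar> \<partial>lborel)"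
      using integral_abs_bound[of lborel "\<lambda>x. s x * (g n x - u x)"] by simp
    then have "ennreal \<bar>(\<integral>x. s x * u x \<partial>lborel) - (\<integral>x. s x * g n x \<partial>lborel)\<bar> \<le> ennreal (\<integral>x. \<bar>s x * (g n x - u x)\<bar> \<partial>lborel)"
      by (rule ennreal_leI)
    also have "\<dots> \<le> (\<integral>\<^sup>+x. ennreal \<bar>s x * (g n x - u x)\<bar> \<partial>lborel)"
      by (rule ennreal_integral_le_nn_integral) simp
    also have "\<dots> \<le> ennreal ((1 / l) powr q) * (\<integral>\<^sup>+x. ennreal (\<bar>s x\<bar> powr q) \<partial>lborel)
       + ennreal (l powr ?p) * (\<integral>\<^sup>+x. ennreal (\<bar>g n x - u x\<bar> powr ?p) * indicator W x \<partial>lborel)"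
      by (rule nn_integral_mult_le_scaled_powr[OF sm _ Wm s0 q l]) measurable
    also have "\<dots> \<le> ennreal (1 / c) * ennreal C + ennreal (l powr ?p) * ennreal t"
      unfolding lq using n sC by (intro add_mono mult_left_mono) auto
    also have "\<dots> = ennreal (1 / c * C + l powr ?p * t)"
    proof -
      have "ennreal (1 / c) * ennreal C = ennreal (1 / c * C)" "ennreal (l powr ?p) * ennreal t = ennreal (l powr ?p * t)"
        by (rule ennreal_mult'[symmetric], use c in simp)+
      moreover have "ennreal (1 / c * C) + ennreal (l powr ?p * t) = ennreal (1 / c * C + l powr ?p * t)"
        using c C t by (intro ennreal_plus[symmetric]) auto
      ultimately show ?thesis by simp
    qed
    also have "\<dots> \<le> ennreal (r / 4)"
    proof (rule ennreal_leI)
      have "l powr ?p * t = r / 8" unfolding t_def using l by simp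
      then show "1 / c * C + l powr ?p * t \<le> r / 4" using lC by linarith
    qed
    finally show ?thesis using r by (subst (asm) ennreal_le_iff) auto
  qed
  obtain N where N: "\<And>k. k \<ge> N \<Longrightarrow> \<bar>(\<integral>x. S k x * g n x \<partial>lborel) - (\<integral>x. S' x * g n x \<partial>lborel)\<bar> < r / 4"
    using LIMSEQ_D[OF conv[of n], of "r / 4"] r by auto
  have "norm ((\<integral>x. S k x * u x \<partial>lborel) - (\<integral>x. S' x * u x \<partial>lborel)) < r" if "k \<ge> N" for k
    using N[OF that] est[OF Sm S0(1) SC(1), of k] est[OF S'm S0(2) SC(2)] r unfolding real_norm_def by linarith
  then show "\<exists>no. \<forall>k\<ge>no. norm ((\<integral>x. S k x * u x \<partial>lborel) - (\<integral>x. S' x * u x \<partial>lborel)) < r" by blast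
qed

lemma fin_meas_on_density:
  assumes "finite_measure \<mu>" and s: "sets \<mu> = sets borel" and D: "D \<in> sets borel"
  shows "fin_meas_on D (density \<mu> (indicator D))"
proof -
  interpret finite_measure \<mu> by fact
  have [measurable]: "D \<in> sets \<mu>" using D s by simp
  have e: "emeasure (density \<mu> (indicator D)) A = emeasure \<mu> (D \<inter> A)" if "A \<in> sets \<mu>" for A
  proof -
    have "emeasure (density \<mu> (indicator D)) A = (\<integral>\<^sup>+x. indicator D x * indicator A x \<partial>\<mu>)"
      using that by (simp add: emeasure_density)
    also have "\<dots> = (\<integral>\<^sup>+x. indicator (D \<inter> A) x \<partial>\<mu>)" by (simp add: indicator_inter_arith)
    also have "\<dots> = emeasure \<mu> (D \<inter> A)" using that by (intro nn_integral_indicator) auto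
    finally show ?thesis .
  qed
  have "finite_measure (density \<mu> (indicator D))"
    by (rule finite_measureI) (simp add: e)
  moreover have "emeasure (density \<mu> (indicator D)) (UNIV - D) = 0"
    using D s by (subst e) (auto simp: Diff_Int_distrib)
  ultimately show ?thesis unfolding fin_meas_on_def using s by simp
qed

context carnot begin

lemma hX_slice_continuous:
  assumes "C1_fun (\<Psi> :: (real^'n) \<times> (real^'n) \<Rightarrow> real)"
  shows "continuous_on UNIV (\<lambda>p. hX gm i (\<lambda>x. \<Psi> (x, snd p)) (fst p))"
proof -
  obtain A where A: "continuous_on UNIV (\<lambda>p. A (fst p) (fst (snd p)) (snd (snd p)))"
    "\<And>x z y. ((\<lambda>y. \<Psi> (gm x y, z)) has_derivative (\<lambda>h. A x z y \<bullet> h)) (at y)"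
    "\<And>i x z. ((\<lambda>t. \<Psi> (gm x (t *\<^sub>R axis i 1), z)) has_real_derivative A x z 0 $ i) (at 0)"
    "\<And>i x z. hX gm i (\<lambda>x. \<Psi> (x, z)) x = A x z 0 $ i"
    using C1_fun_right_gradient[OF assms] by blast
  have "continuous_on UNIV (\<lambda>p. (fst p, snd p, 0) :: (real^'n) \<times> (real^'n) \<times> (real^'n))"
    by (intro continuous_intros)
  from continuous_on_compose2[OF A(1) this] have "continuous_on UNIV (\<lambda>p. A (fst p) (snd p) 0)" by simp
  then show ?thesis unfolding A(4) by (intro continuous_intros)
qed

lemma integrable_times_U1_continuous:
  assumes a: "integrable lborel a" and K: "compact K" and a0: "\<And>x. x \<notin> K \<Longrightarrow> a x = 0"
    and h: "continuous_on UNIV (h :: (real^'n) \<times> (real^'n) \<Rightarrow> real)"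
  shows "integrable lborel (\<lambda>p. a (fst p) * (indicator U1 (snd p) * h p))"
proof -
  have am [measurable]: "a \<in> borel_measurable borel" using a by auto
  have hm [measurable]: "h \<in> borel_measurable borel" using h by (rule borel_measurable_continuous_onI)
  have Um [measurable]: "U1 \<in> sets borel" by (rule U1_measurable)
  let ?C = "K \<times> cbox (- (\<chi> i. 1)) (\<chi> i. 1 :: real^'n)"
  have "bounded (h ` ?C)"
    by (intro compact_imp_bounded compact_continuous_image compact_Times K compact_cbox continuous_on_subset[OF h]) auto
  then obtain b where b: "\<And>p. p \<in> ?C \<Longrightarrow> \<bar>h p\<bar> \<le> b" unfolding bounded_iff by auto
  show ?thesis
  proof (rule Bochner_Integration.integrable_bound)
    have "integrable lborel (\<lambda>z. indicator U1 z :: real)"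
      using emeasure_U1(1) by (intro integrable_real_indicator) auto
    from integrable_lborel_times[OF a this]
    show "integrable lborel (\<lambda>p. b * (a (fst p) * indicator U1 (snd p)))" by simp
    show "AE p in lborel. norm (a (fst p) * (indicator U1 (snd p) * h p)) \<le> norm (b * (a (fst p) * indicator U1 (snd p)))"
    proof (rule AE_I2)
      fix p :: "(real^'n) \<times> (real^'n)"
      show "norm (a (fst p) * (indicator U1 (snd p) * h p)) \<le> norm (b * (a (fst p) * indicator U1 (snd p)))"
      proof (cases "fst p \<in> K \<and> snd p \<in> U1")
        case True
        then have "p \<in> ?C" using box_subset_cbox by (cases p) (auto simp: U1_eq_box)
        then have "\<bar>h p\<bar> \<le> \<bar>b\<bar>" using b[of p] by linarith
        then have "\<bar>a (fst p)\<bar> * \<bar>h p\<bar> \<le> \<bar>a (fst p)\<bar> * \<bar>b\<bar>" by (intro mult_left_mono) auto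
        then show ?thesis using True by (simp add: abs_mult mult.commute)
      qed (auto simp: a0)
    qed
  qed measurable
qed

text \<open>For fixed z the slice \<Psi>(., z) is a test function for the derivative of f.
  Multiplying by z_i and integrating over the cube, with Fubini on both sides, gives the identity.
  The pairs \<open>\<mu> i\<close>, \<open>\<nu> i\<close> will be the derivative measures when q =
  1, and densities restricted to K when q > 1.\<close>

lemma hdir_representation:
  assumes K: "compact K" "K \<subseteq> D" and f: "integrable lborel (\<lambda>x. indicator K x * f x)"
    and \<mu>: "\<And>i. w i = 1 \<Longrightarrow> finite_measure (\<mu> i) \<and> sets (\<mu> i) = sets borel"
    and \<nu>: "\<And>i. w i = 1 \<Longrightarrow> finite_measure (\<nu> i) \<and> sets (\<nu> i) = sets borel"
    and rep: "\<And>i \<phi>. w i = 1 \<Longrightarrow> C1_fun \<phi> \<Longrightarrow> \<forall>x. x \<notin> K \<longrightarrow> \<phi> x = 0 \<Longrightarrow>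
       (\<integral>x. indicator D x * f x * hX gm i \<phi> x \<partial>lborel) = - ((\<integral>x. \<phi> x \<partial>\<mu> i) - (\<integral>x. \<phi> x \<partial>\<nu> i))"
    and \<Psi>: "C1_fun (\<Psi> :: (real^'n) \<times> (real^'n) \<Rightarrow> real)" and \<Psi>0: "\<And>x z. x \<notin> K \<Longrightarrow> \<Psi> (x, z) = 0"
  shows "- (\<integral>x. indicator D x * f x * (\<integral>z. indicator U1 z * hdir \<Psi> (x, z) \<partial>lborel) \<partial>lborel)
    = (\<Sum>i\<in>{i. w i = 1}. (\<integral>x. (\<integral>z. \<Psi> (x, z) * indicator U1 z * z $ i \<partial>lborel) \<partial>\<mu> i)
                       - (\<integral>x. (\<integral>z. \<Psi> (x, z) * indicator U1 z * z $ i \<partial>lborel) \<partial>\<nu> i))"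
proof -
  have Um [measurable]: "U1 \<in> sets borel" by (rule U1_measurable)
  have \<Psi>c: "continuous_on UNIV \<Psi>" by (rule C1_fun_continuous[OF \<Psi>])
  define e where "e i p = snd p $ i * hX gm i (\<lambda>x. \<Psi> (x, snd p)) (fst p)" for i p
  have ec: "continuous_on UNIV (e i)" for i
    unfolding e_def by (intro continuous_intros hX_slice_continuous[OF \<Psi>])
  have e0: "e i (x, z) = 0" if "x \<notin> K" for i x z
    unfolding e_def using hX_eq_0[of K "\<lambda>x. \<Psi> (x, z)" x i] K(1) \<Psi>0 that by simp
  \<comment> \<open>Off K the derivatives of \<Psi> vanish, and on K the indicators of D and K
    agree. Writing K instead of D makes the product integrable.\<close>
  define E where "E i p = (indicator K (fst p) * f (fst p)) * (indicator U1 (snd p) * e i p)" for i p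
  have Ei: "integrable lborel (E i)" for i
    unfolding E_def by (rule integrable_times_U1_continuous[OF f K(1) _ ec]) simp
  have slice: "integrable lborel (\<lambda>z. E i (x, z))" for i x
  proof -
    have "continuous_on UNIV (\<lambda>z. e i (x, z))" by (intro continuous_on_compose2[OF ec] continuous_intros) auto
    then show ?thesis unfolding E_def using integrable_U1_continuous by simp
  qed
  have DE: "indicator D x * f x * (\<integral>z. indicator U1 z * hdir \<Psi> (x, z) \<partial>lborel) = (\<Sum>i\<in>{i. w i = 1}. \<integral>z. E i (x, z) \<partial>lborel)" for x
  proof -
    have "indicator D x * f x * (\<integral>z. indicator U1 z * hdir \<Psi> (x, z) \<partial>lborel)
        = (\<integral>z. indicator D x * f x * (indicator U1 z * hdir \<Psi> (x, z)) \<partial>lborel)" by simp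
    also have "\<dots> = (\<integral>z. (\<Sum>i\<in>{i. w i = 1}. E i (x, z)) \<partial>lborel)"
    proof (rule Bochner_Integration.integral_cong)
      fix z
      have "indicator D x * f x * (indicator U1 z * hdir \<Psi> (x, z)) = indicator K x * f x * (indicator U1 z * hdir \<Psi> (x, z))"
        using hdir_eq_0[of K \<Psi> "(x, z)"] K \<Psi>0 by (cases "x \<in> K") auto
      then show "indicator D x * f x * (indicator U1 z * hdir \<Psi> (x, z)) = (\<Sum>i\<in>{i. w i = 1}. E i (x, z))"
        by (simp only: E_def hdir_def e_def sum_distrib_left fst_conv snd_conv)
    qed simp
    also have "\<dots> = (\<Sum>i\<in>{i. w i = 1}. \<integral>z. E i (x, z) \<partial>lborel)" using slice by simp
    finally show ?thesis .
  qed
  have "(\<integral>x. indicator D x * f x * (\<integral>z. indicator U1 z * hdir \<Psi> (x, z) \<partial>lborel) \<partial>lborel)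
      = (\<Sum>i\<in>{i. w i = 1}. \<integral>x. \<integral>z. E i (x, z) \<partial>lborel \<partial>lborel)"
    unfolding DE using integrable_lborel_fst[OF Ei] by simp
  also have "\<dots> = (\<Sum>i\<in>{i. w i = 1}. - ((\<integral>x. (\<integral>z. \<Psi> (x, z) * indicator U1 z * z $ i \<partial>lborel) \<partial>\<mu> i)
                       - (\<integral>x. (\<integral>z. \<Psi> (x, z) * indicator U1 z * z $ i \<partial>lborel) \<partial>\<nu> i)))"
  proof (rule sum.cong)
    fix i assume "i \<in> {i. w i = 1}"
    then have i: "w i = 1" by simp
    \<comment> \<open>Fubini for a finite measure times Lebesgue measure: the integrand is bounded,
      and in z it is confined to the cube.\<close>
    have fub: "integrable lborel (\<lambda>z. indicator U1 z * z $ i * (\<integral>x. \<Psi> (x, z) \<partial>M)) \<and>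
        (\<integral>z. indicator U1 z * z $ i * (\<integral>x. \<Psi> (x, z) \<partial>M) \<partial>lborel) = (\<integral>x. (\<integral>z. \<Psi> (x, z) * indicator U1 z * z $ i \<partial>lborel) \<partial>M)"
      if M: "finite_measure M" and sM [measurable_cong]: "sets M = sets borel" for M
    proof -
      interpret M: finite_measure M by (rule M)
      interpret P: pair_sigma_finite M "lborel :: (real^'n) measure" ..
      have sp: "sets (M \<Otimes>\<^sub>M lborel) = sets (borel :: ((real^'n) \<times> (real^'n)) measure)"
        by (simp add: borel_prod[symmetric] sM cong: sets_pair_measure_cong)
      let ?g = "\<lambda>p. \<Psi> p * indicator U1 (snd p) * snd p $ i"
      have "continuous_on UNIV (\<lambda>p::(real^'n) \<times> (real^'n). snd p $ i)" by (intro continuous_intros)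
      then have [measurable]: "(\<lambda>p::(real^'n) \<times> (real^'n). snd p $ i) \<in> borel_measurable borel"
        by (rule borel_measurable_continuous_onI)
      have [measurable]: "\<Psi> \<in> borel_measurable borel" using \<Psi>c by (rule borel_measurable_continuous_onI)
      have "?g \<in> borel_measurable borel" by measurable
      then have gm: "?g \<in> borel_measurable (M \<Otimes>\<^sub>M lborel)" using measurable_cong_sets[OF sp refl] by blast
      have "bounded (\<Psi> ` (K \<times> cbox (- (\<chi> i. 1)) (\<chi> i. 1)))"
        by (intro compact_imp_bounded compact_continuous_image compact_Times K compact_cbox continuous_on_subset[OF \<Psi>c]) auto
      then obtain b where b: "\<And>p. p \<in> K \<times> cbox (- (\<chi> i. 1)) (\<chi> i. 1) \<Longrightarrow> \<bar>\<Psi> p\<bar> \<le> b" unfolding bounded_iff by auto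
      have bnd: "\<bar>?g (x, z)\<bar> \<le> \<bar>b\<bar> * indicator U1 z" for x z
      proof (cases "x \<in> K \<and> z \<in> U1")
        case True
        then have "\<bar>\<Psi> (x, z)\<bar> \<le> b" using box_subset_cbox by (intro b) (auto simp: U1_eq_box)
        moreover have "\<bar>z $ i\<bar> \<le> 1" using True by (simp add: U1_iff less_imp_le)
        ultimately have "\<bar>\<Psi> (x, z)\<bar> * \<bar>z $ i\<bar> \<le> \<bar>b\<bar> * 1" by (intro mult_mono) auto
        then show ?thesis using True by (simp add: abs_mult)
      qed (auto simp: \<Psi>0)
      have int: "integrable (M \<Otimes>\<^sub>M lborel) ?g"
      proof (rule integrableI_bounded[OF gm])
        have "(\<integral>\<^sup>+p. ennreal (norm (?g p)) \<partial>(M \<Otimes>\<^sub>M lborel)) \<le> (\<integral>\<^sup>+p. ennreal \<bar>b\<bar> * indicator (UNIV \<times> U1) p \<partial>(M \<Otimes>\<^sub>M lborel))"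
        proof (rule nn_integral_mono)
          fix p
          show "ennreal (norm (?g p)) \<le> ennreal \<bar>b\<bar> * indicator (UNIV \<times> U1) p"
            using bnd[of "fst p" "snd p"] by (cases p) (auto simp: indicator_def split: if_splits intro!: ennreal_leI)
        qed
        also have "\<dots> = ennreal \<bar>b\<bar> * (emeasure M UNIV * emeasure lborel U1)"
          using sM by (subst nn_integral_cmult_indicator) (auto simp: lborel.emeasure_pair_measure_Times sp borel_prod[symmetric])
        also have "\<dots> < \<infinity>"
        proof -
          have "emeasure M UNIV < \<infinity>" 
            unfolding infinity_ennreal_def less_top[symmetric] by (rule M.emeasure_finite[unfolded infinity_ennreal_def])
          then show ?thesis using emeasure_U1(1) by (simp add: ennreal_mult_less_top)
        qed
        finally show "(\<integral>\<^sup>+p. ennreal (norm (?g p)) \<partial>(M \<Otimes>\<^sub>M lborel)) < \<infinity>" .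
      qed
      have int': "integrable (M \<Otimes>\<^sub>M lborel) (case_prod (\<lambda>x z. ?g (x, z)))"
        by (rule back_subst[of "integrable _", OF int]) (auto simp: fun_eq_iff)
      have eq: "(\<integral>x. ?g (x, z) \<partial>M) = indicator U1 z * z $ i * (\<integral>x. \<Psi> (x, z) \<partial>M)" for z
      proof -
        have "(\<lambda>x. ?g (x, z)) = (\<lambda>x. (indicator U1 z * z $ i) * \<Psi> (x, z))" by (simp add: fun_eq_iff)
        then show ?thesis by simp
      qed
      show ?thesis using P.Fubini_integral[OF int'] P.integrable_snd[OF int'] unfolding eq by simp
    qed
    note f\<mu> = fub[OF conjunct1[OF \<mu>[OF i]] conjunct2[OF \<mu>[OF i]]] and f\<nu> = fub[OF conjunct1[OF \<nu>[OF i]] conjunct2[OF \<nu>[OF i]]]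
    have "(\<integral>x. \<integral>z. E i (x, z) \<partial>lborel \<partial>lborel) = (\<integral>z. \<integral>x. E i (x, z) \<partial>lborel \<partial>lborel)"
      using integral_lborel_fst[OF Ei] integral_lborel_snd[OF Ei] by metis
    also have "\<dots> = (\<integral>z. indicator U1 z * z $ i * - ((\<integral>x. \<Psi> (x, z) \<partial>\<mu> i) - (\<integral>x. \<Psi> (x, z) \<partial>\<nu> i)) \<partial>lborel)"
    proof (rule Bochner_Integration.integral_cong)
      fix z
      have "E i (x, z) = (indicator U1 z * z $ i) * (indicator D x * f x * hX gm i (\<lambda>x. \<Psi> (x, z)) x)" for x
        using hX_eq_0[of K "\<lambda>x. \<Psi> (x, z)" x i] K \<Psi>0 by (cases "x \<in> K") (auto simp: E_def e_def)
      then have "(\<integral>x. E i (x, z) \<partial>lborel) = (indicator U1 z * z $ i) * (\<integral>x. indicator D x * f x * hX gm i (\<lambda>x. \<Psi> (x, z)) x \<partial>lborel)"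
        by (simp only: integral_mult_right_zero)
      also have "(\<integral>x. indicator D x * f x * hX gm i (\<lambda>x. \<Psi> (x, z)) x \<partial>lborel) = - ((\<integral>x. \<Psi> (x, z) \<partial>\<mu> i) - (\<integral>x. \<Psi> (x, z) \<partial>\<nu> i))"
        using \<Psi>0 by (intro rep[OF i C1_fun_slice[OF \<Psi>]]) auto
      finally show "(\<integral>x. E i (x, z) \<partial>lborel) = indicator U1 z * z $ i * - ((\<integral>x. \<Psi> (x, z) \<partial>\<mu> i) - (\<integral>x. \<Psi> (x, z) \<partial>\<nu> i))" .
    qed simp
    also have "\<dots> = - ((\<integral>z. indicator U1 z * z $ i * (\<integral>x. \<Psi> (x, z) \<partial>\<mu> i) \<partial>lborel) - (\<integral>z. indicator U1 z * z $ i * (\<integral>x. \<Psi> (x, z) \<partial>\<nu> i) \<partial>lborel))"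
      using f\<mu> f\<nu> by (simp add: right_diff_distrib)
    also have "\<dots> = - ((\<integral>x. (\<integral>z. \<Psi> (x, z) * indicator U1 z * z $ i \<partial>lborel) \<partial>\<mu> i)
                       - (\<integral>x. (\<integral>z. \<Psi> (x, z) * indicator U1 z * z $ i \<partial>lborel) \<partial>\<nu> i))"
      using f\<mu> f\<nu> by simp
    finally show "(\<integral>x. \<integral>z. E i (x, z) \<partial>lborel \<partial>lborel) = - ((\<integral>x. (\<integral>z. \<Psi> (x, z) * indicator U1 z * z $ i \<partial>lborel) \<partial>\<mu> i)
                       - (\<integral>x. (\<integral>z. \<Psi> (x, z) * indicator U1 z * z $ i \<partial>lborel) \<partial>\<nu> i))" .
  qed simp
  finally show ?thesis unfolding sum_negf by linarith
qed

end

section \<open>The horizontal derivative as a measure and as a density; convergence against all test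
  functions\<close>

context carnot_seq begin

text \<open>For q = 1 the moments \<open>H i k\<close> are bounded in L^1, so their positive and
  negative parts have vague limits along a subsequence; \<open>H_limit\<close> shows that the
  difference of these limits acts on test functions as the distributional derivative.\<close>

lemma ex_measures:
  assumes q1: "q = 1" and i: "w i = 1"
  shows "\<exists>\<mu> \<nu>. fin_meas_on D \<mu> \<and> fin_meas_on D \<nu> \<and> (\<forall>\<phi>. C1_fun \<phi> \<longrightarrow> supp_cpt D \<phi> \<longrightarrow>
     (\<integral>x. indicator D x * f x * hX gm i \<phi> x \<partial>lborel) = - ((\<integral>x. \<phi> x \<partial>\<mu>) - (\<integral>x. \<phi> x \<partial>\<nu>)))"
proof -
  obtain C' where C': "\<And>k. (\<integral>\<^sup>+x. ennreal (\<bar>H i k x\<bar> powr q) \<partial>lborel) \<le> ennreal C'" using H_Lq by blast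
  have b: "(\<integral>\<^sup>+x. ennreal (1 * \<bar>H i k x\<bar>) \<partial>lborel) \<le> ennreal C'" for k using C'[of k] q1 by simp
  obtain r \<mu> \<nu> where r: "strict_mono (r :: nat \<Rightarrow> nat)"
    and \<mu>: "finite_measure \<mu>" "sets \<mu> = sets borel" and \<nu>: "finite_measure \<nu>" "sets \<nu> = sets borel"
    and lim: "\<And>\<phi>. continuous_on UNIV \<phi> \<Longrightarrow> supp_cpt UNIV \<phi> \<Longrightarrow>
      (\<lambda>k. \<integral>x. \<phi> x * (1 * H i (r k) x) \<partial>lborel) \<longlonglongrightarrow> (\<integral>x. \<phi> x \<partial>\<mu>) - (\<integral>x. \<phi> x \<partial>\<nu>)"
    using vague_limit_pos_neg[of "H i" "\<lambda>_. 1" C', OF H_measurable _ _ b] by auto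
  \<comment> \<open>The vague limits live on the whole space and may charge the boundary of D.
    Restricting them to D leaves the pairings with functions supported in D unchanged.\<close>
  have restr: "(\<integral>x. \<phi> x \<partial>density M (indicator D)) = (\<integral>x. \<phi> x \<partial>M)"
    if \<phi>: "continuous_on UNIV \<phi>" "supp_cpt D \<phi>" and sM: "sets M = sets borel" for \<phi> M
  proof -
    have 0: "\<phi> x = 0" if "x \<notin> D" for x using \<phi>(2) that unfolding supp_cpt_def by blast
    have m: "\<phi> \<in> borel_measurable M" using borel_measurable_continuous_onI[OF \<phi>(1)] measurable_cong_sets[OF sM refl] by blast
    have Dm: "(\<lambda>x. indicator D x :: real) \<in> borel_measurable M" using sM by simp
    have "(\<integral>x. \<phi> x \<partial>density M (\<lambda>x. ennreal (indicator D x))) = (\<integral>x. indicator D x *\<^sub>R \<phi> x \<partial>M)"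
      by (rule integral_density[OF m Dm]) simp
    also have "(\<lambda>x. indicator D x *\<^sub>R \<phi> x) = \<phi>" using 0 by (auto simp: fun_eq_iff indicator_def)
    finally show ?thesis by (simp add: ennreal_indicator)
  qed
  have "(\<integral>x. indicator D x * f x * hX gm i \<phi> x \<partial>lborel)
      = - ((\<integral>x. \<phi> x \<partial>density \<mu> (indicator D)) - (\<integral>x. \<phi> x \<partial>density \<nu> (indicator D)))"
    if \<phi>: "C1_fun \<phi>" "supp_cpt D \<phi>" for \<phi>
  proof -
    have c: "continuous_on UNIV \<phi>" by (rule C1_fun_continuous[OF \<phi>(1)])
    have "(\<lambda>k. \<integral>x. \<phi> x * H i (r k) x \<partial>lborel) \<longlonglongrightarrow> - (\<integral>x. indicator D x * f x * hX gm i \<phi> x \<partial>lborel)"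
      using LIMSEQ_subseq_LIMSEQ[OF H_limit[OF i \<phi>] r] by (simp add: comp_def)
    moreover have "(\<lambda>k. \<integral>x. \<phi> x * H i (r k) x \<partial>lborel) \<longlonglongrightarrow> (\<integral>x. \<phi> x \<partial>\<mu>) - (\<integral>x. \<phi> x \<partial>\<nu>)"
      using lim[OF c supp_cpt_mono[OF \<phi>(2)]] by simp
    ultimately have "- (\<integral>x. indicator D x * f x * hX gm i \<phi> x \<partial>lborel) = (\<integral>x. \<phi> x \<partial>\<mu>) - (\<integral>x. \<phi> x \<partial>\<nu>)"
      by (rule LIMSEQ_unique)
    then show ?thesis unfolding restr[OF c \<phi>(2) \<mu>(2)] restr[OF c \<phi>(2) \<nu>(2)] by linarith
  qed
  moreover have "fin_meas_on D (density \<mu> (indicator D))" "fin_meas_on D (density \<nu> (indicator D))"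
    using fin_meas_on_density[OF \<mu>] fin_meas_on_density[OF \<nu>] by auto
  ultimately show ?thesis by blast
qed

text \<open>Vague limits are taken of \<rho> times the two parts of \<open>H i k\<close>. Young's
  inequality passes the uniform L^q bound on to the limit measures, in the form from which
  \<open>Lq_density_of_functional_bound\<close> produces densities \<rho> h with h in L^q. Testing
  with \<phi> / \<rho> removes the weight.\<close>

lemma ex_densities:
  assumes q1: "q > 1" and i: "w i = 1"
  shows "\<exists>hp hn. hp \<in> borel_measurable borel \<and> hn \<in> borel_measurable borel \<and> (\<forall>x. 0 \<le> hp x) \<and> (\<forall>x. 0 \<le> hn x) \<and>
     (\<integral>\<^sup>+x. ennreal (hp x powr q) \<partial>lborel) < \<infinity> \<and> (\<integral>\<^sup>+x. ennreal (hn x powr q) \<partial>lborel) < \<infinity> \<and>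
     (\<forall>\<phi>. C1_fun \<phi> \<longrightarrow> supp_cpt D \<phi> \<longrightarrow> (\<integral>x. indicator D x * f x * hX gm i \<phi> x \<partial>lborel)
        = - ((\<integral>x. hp x * \<phi> x \<partial>lborel) - (\<integral>x. hn x * \<phi> x \<partial>lborel)))"
proof -
  let ?p = "q / (q - 1)"
  have p1: "?p \<ge> 1" using q1 by simp
  obtain C' where C'0: "C' \<ge> 0" and C': "\<And>k. (\<integral>\<^sup>+x. ennreal (\<bar>H i k x\<bar> powr q) \<partial>lborel) \<le> ennreal C'" using H_Lq by blast
  obtain \<rho> :: "real^'n \<Rightarrow> real" where \<rho>c: "continuous_on UNIV \<rho>" and \<rho>0: "\<And>x. 0 < \<rho> x" and \<rho>1: "\<And>x. \<rho> x \<le> 1"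
    and \<rho>i: "(\<integral>\<^sup>+x. ennreal (\<rho> x) \<partial>lborel) < \<infinity>" using weight_function by blast
  have \<rho>m [measurable]: "\<rho> \<in> borel_measurable borel" using \<rho>c by (rule borel_measurable_continuous_onI)
  obtain R where R: "(\<integral>\<^sup>+x. ennreal (\<rho> x) \<partial>lborel) = ennreal R" "R \<ge> 0"
    using \<rho>i by (cases "\<integral>\<^sup>+x. ennreal (\<rho> x) \<partial>lborel") auto
  \<comment> \<open>Young's inequality with the weight as second factor; since \<rho> is at most 1,
    its conjugate power is at most \<rho>, whose integral is R.\<close>
  have b: "(\<integral>\<^sup>+x. ennreal (\<rho> x * \<bar>H i k x\<bar>) \<partial>lborel) \<le> ennreal (C' + R)" for k
  proof -
    have "(\<integral>\<^sup>+x. ennreal (\<rho> x * \<bar>H i k x\<bar>) \<partial>lborel) \<le> (\<integral>\<^sup>+x. ennreal (\<bar>H i k x\<bar> powr q) + ennreal (\<rho> x) \<partial>lborel)"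
    proof (rule nn_integral_mono)
      fix x
      have "\<bar>H i k x\<bar> * \<rho> x \<le> \<bar>H i k x\<bar> powr q + \<rho> x powr ?p"
        using \<rho>0[of x] q1 by (intro mult_le_powr_add_powr) auto
      moreover have "\<rho> x powr ?p \<le> \<rho> x powr 1" using \<rho>0[of x] \<rho>1[of x] p1 by (intro powr_mono') auto
      ultimately have "\<rho> x * \<bar>H i k x\<bar> \<le> \<bar>H i k x\<bar> powr q + \<rho> x" using \<rho>0[of x] by (simp add: mult.commute)
      then have "ennreal (\<rho> x * \<bar>H i k x\<bar>) \<le> ennreal (\<bar>H i k x\<bar> powr q + \<rho> x)" by (rule ennreal_leI)
      then show "ennreal (\<rho> x * \<bar>H i k x\<bar>) \<le> ennreal (\<bar>H i k x\<bar> powr q) + ennreal (\<rho> x)"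
        using \<rho>0[of x] by (simp add: ennreal_plus)
    qed
    also have "\<dots> = (\<integral>\<^sup>+x. ennreal (\<bar>H i k x\<bar> powr q) \<partial>lborel) + ennreal R" by (simp add: nn_integral_add R)
    also have "\<dots> \<le> ennreal C' + ennreal R" by (rule add_right_mono[OF C'])
    finally show ?thesis using C'0 R by (simp add: ennreal_plus)
  qed
  obtain r \<mu> \<nu> where r: "strict_mono (r :: nat \<Rightarrow> nat)"
    and \<mu>: "finite_measure \<mu>" "sets \<mu> = sets borel" and \<nu>: "finite_measure \<nu>" "sets \<nu> = sets borel"
    and lim\<mu>: "\<And>\<phi>. continuous_on UNIV \<phi> \<Longrightarrow> supp_cpt UNIV \<phi> \<Longrightarrow>
      (\<lambda>k. \<integral>x. \<phi> x * (\<rho> x * max 0 (H i (r k) x)) \<partial>lborel) \<longlonglongrightarrow> (\<integral>x. \<phi> x \<partial>\<mu>)"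
    and lim\<nu>: "\<And>\<phi>. continuous_on UNIV \<phi> \<Longrightarrow> supp_cpt UNIV \<phi> \<Longrightarrow>
      (\<lambda>k. \<integral>x. \<phi> x * (\<rho> x * max 0 (- H i (r k) x)) \<partial>lborel) \<longlonglongrightarrow> (\<integral>x. \<phi> x \<partial>\<nu>)"
    and lim: "\<And>\<phi>. continuous_on UNIV \<phi> \<Longrightarrow> supp_cpt UNIV \<phi> \<Longrightarrow>
      (\<lambda>k. \<integral>x. \<phi> x * (\<rho> x * H i (r k) x) \<partial>lborel) \<longlonglongrightarrow> (\<integral>x. \<phi> x \<partial>\<mu>) - (\<integral>x. \<phi> x \<partial>\<nu>)"
    using vague_limit_pos_neg[of "H i" \<rho> "C' + R", OF H_measurable \<rho>m less_imp_le[OF \<rho>0] b] by blast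
  have bnd: "(\<integral>\<^sup>+x. ennreal (\<phi> x) \<partial>M) \<le> (\<integral>\<^sup>+x. ennreal ((\<rho> x * \<phi> x) powr ?p) \<partial>lborel) + ennreal C'"
    if M: "finite_measure M" "sets M = sets borel" and c: "\<bar>c\<bar> = 1"
      and limM: "(\<lambda>k. \<integral>x. \<phi> x * (\<rho> x * max 0 (c * H i (r k) x)) \<partial>lborel) \<longlonglongrightarrow> (\<integral>x. \<phi> x \<partial>M)"
      and \<phi>: "continuous_on UNIV \<phi>" "supp_cpt UNIV \<phi>" "\<And>x. 0 \<le> \<phi> x" for M c \<phi>
  proof -
    interpret M: finite_measure M by (rule M)
    have [measurable]: "\<phi> \<in> borel_measurable borel" using \<phi>(1) by (rule borel_measurable_continuous_onI)
    have m: "\<phi> \<in> borel_measurable M" using borel_measurable_continuous_onI[OF \<phi>(1)] measurable_cong_sets[OF M(2) refl] by blast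
    obtain B where B: "\<And>x. \<bar>\<phi> x\<bar> \<le> B" using supp_cpt_bounded[OF \<phi>(2,1)] by blast
    have int: "integrable M \<phi>" using B by (intro M.integrable_const_bound[of _ B] m) auto
    have le: "ennreal (\<integral>x. \<phi> x * (\<rho> x * max 0 (c * H i (r k) x)) \<partial>lborel)
        \<le> (\<integral>\<^sup>+x. ennreal ((\<rho> x * \<phi> x) powr ?p) \<partial>lborel) + ennreal C'" for k
    proof -
      have "ennreal (\<integral>x. \<phi> x * (\<rho> x * max 0 (c * H i (r k) x)) \<partial>lborel) \<le> (\<integral>\<^sup>+x. ennreal (\<phi> x * (\<rho> x * max 0 (c * H i (r k) x))) \<partial>lborel)"
        using \<phi>(3) \<rho>0 by (intro ennreal_integral_le_nn_integral) (auto intro!: mult_nonneg_nonneg less_imp_le[OF \<rho>0])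
      also have "\<dots> \<le> (\<integral>\<^sup>+x. ennreal ((\<rho> x * \<phi> x) powr ?p) + ennreal (\<bar>H i (r k) x\<bar> powr q) \<partial>lborel)"
      proof (rule nn_integral_mono)
        fix x
        have "max 0 (c * H i (r k) x) \<le> \<bar>c\<bar> * \<bar>H i (r k) x\<bar>" by (simp add: abs_mult[symmetric])
        then have "max 0 (c * H i (r k) x) * (\<rho> x * \<phi> x) \<le> \<bar>H i (r k) x\<bar> * (\<rho> x * \<phi> x)"
          using c \<phi>(3)[of x] \<rho>0[of x] by (intro mult_right_mono) auto
        also have "\<dots> \<le> \<bar>H i (r k) x\<bar> powr q + (\<rho> x * \<phi> x) powr ?p"
          using \<phi>(3)[of x] \<rho>0[of x] q1 by (intro mult_le_powr_add_powr) auto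
        finally have "\<phi> x * (\<rho> x * max 0 (c * H i (r k) x)) \<le> (\<rho> x * \<phi> x) powr ?p + \<bar>H i (r k) x\<bar> powr q"
          by (simp add: mult_ac add.commute)
        then have "ennreal (\<phi> x * (\<rho> x * max 0 (c * H i (r k) x))) \<le> ennreal ((\<rho> x * \<phi> x) powr ?p + \<bar>H i (r k) x\<bar> powr q)"
          by (rule ennreal_leI)
        then show "ennreal (\<phi> x * (\<rho> x * max 0 (c * H i (r k) x))) \<le> ennreal ((\<rho> x * \<phi> x) powr ?p) + ennreal (\<bar>H i (r k) x\<bar> powr q)"
          by (simp add: ennreal_plus)
      qed
      also have "\<dots> = (\<integral>\<^sup>+x. ennreal ((\<rho> x * \<phi> x) powr ?p) \<partial>lborel) + (\<integral>\<^sup>+x. ennreal (\<bar>H i (r k) x\<bar> powr q) \<partial>lborel)"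
        by (rule nn_integral_add) measurable
      also have "\<dots> \<le> (\<integral>\<^sup>+x. ennreal ((\<rho> x * \<phi> x) powr ?p) \<partial>lborel) + ennreal C'" by (rule add_left_mono[OF C'])
      finally show ?thesis .
    qed
    have "(\<integral>\<^sup>+x. ennreal (\<phi> x) \<partial>M) = ennreal (\<integral>x. \<phi> x \<partial>M)" using \<phi>(3) by (intro nn_integral_eq_integral int) auto
    also have "\<dots> \<le> (\<integral>\<^sup>+x. ennreal ((\<rho> x * \<phi> x) powr ?p) \<partial>lborel) + ennreal C'"
      using le by (intro LIMSEQ_le_const2[OF tendsto_ennrealI[OF limM]]) auto
    finally show ?thesis .
  qed
  have "\<exists>h. h \<in> borel_measurable borel \<and> (\<forall>x. 0 \<le> h x) \<and> \<mu> = density lborel (\<lambda>x. ennreal (\<rho> x * h x)) \<and>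
     (\<integral>\<^sup>+x. ennreal (h x powr q) \<partial>lborel) < \<infinity>"
    by (rule Lq_density_of_functional_bound[OF \<mu> \<rho>c \<rho>0 \<rho>1 q1 C'0]) (use lim\<mu> in \<open>auto intro!: bnd[OF \<mu>, of 1]\<close>)
  then obtain hp where hp [measurable]: "hp \<in> borel_measurable borel" and hp0: "\<And>x. 0 \<le> hp x"
    and \<mu>h: "\<mu> = density lborel (\<lambda>x. ennreal (\<rho> x * hp x))" and hpq: "(\<integral>\<^sup>+x. ennreal (hp x powr q) \<partial>lborel) < \<infinity>"
    by blast
  have "\<exists>h. h \<in> borel_measurable borel \<and> (\<forall>x. 0 \<le> h x) \<and> \<nu> = density lborel (\<lambda>x. ennreal (\<rho> x * h x)) \<and>
     (\<integral>\<^sup>+x. ennreal (h x powr q) \<partial>lborel) < \<infinity>"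
    by (rule Lq_density_of_functional_bound[OF \<nu> \<rho>c \<rho>0 \<rho>1 q1 C'0]) (use lim\<nu> in \<open>auto intro!: bnd[OF \<nu>, of "-1"]\<close>)
  then obtain hn where hn [measurable]: "hn \<in> borel_measurable borel" and hn0: "\<And>x. 0 \<le> hn x"
    and \<nu>h: "\<nu> = density lborel (\<lambda>x. ennreal (\<rho> x * hn x))" and hnq: "(\<integral>\<^sup>+x. ennreal (hn x powr q) \<partial>lborel) < \<infinity>"
    by blast
  have "(\<integral>x. indicator D x * f x * hX gm i \<phi> x \<partial>lborel) = - ((\<integral>x. hp x * \<phi> x \<partial>lborel) - (\<integral>x. hn x * \<phi> x \<partial>lborel))"
    if \<phi>: "C1_fun \<phi>" "supp_cpt D \<phi>" for \<phi>
  proof -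
    have c: "continuous_on UNIV \<phi>" by (rule C1_fun_continuous[OF \<phi>(1)])
    have [measurable]: "\<phi> \<in> borel_measurable borel" using c by (rule borel_measurable_continuous_onI)
    \<comment> \<open>Continuous and compactly supported, because \<rho> is continuous and nowhere
      zero; the factors \<rho> cancel in the quotient pairings and in the limit.\<close>
    define \<psi> where "\<psi> x = (1 / \<rho> x) * \<phi> x" for x
    have \<rho>n: "\<rho> x \<noteq> 0" for x using \<rho>0[of x] by simp
    have \<psi>c: "continuous_on UNIV \<psi>" unfolding \<psi>_def using \<rho>n by (intro continuous_intros \<rho>c c) auto
    have \<psi>m [measurable]: "\<psi> \<in> borel_measurable borel" using \<psi>c by (rule borel_measurable_continuous_onI)
    have \<psi>s: "supp_cpt UNIV \<psi>" unfolding \<psi>_def by (rule supp_cpt_mult[OF supp_cpt_mono[OF \<phi>(2)]]) simp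
    have dens: "(\<integral>x. \<psi> x \<partial>density lborel (\<lambda>x. ennreal (\<rho> x * h x))) = (\<integral>x. h x * \<phi> x \<partial>lborel)"
      if [measurable]: "h \<in> borel_measurable borel" and h0: "\<And>x. 0 \<le> h x" for h
    proof -
      have "(\<integral>x. \<psi> x \<partial>density lborel (\<lambda>x. ennreal (\<rho> x * h x))) = (\<integral>x. (\<rho> x * h x) *\<^sub>R \<psi> x \<partial>lborel)"
        using h0 by (intro integral_density) (auto intro!: AE_I2 mult_nonneg_nonneg less_imp_le[OF \<rho>0])
      also have "(\<lambda>x. (\<rho> x * h x) *\<^sub>R \<psi> x) = (\<lambda>x. h x * \<phi> x)" using \<rho>n by (simp add: \<psi>_def fun_eq_iff)
      finally show ?thesis .
    qed
    have "(\<lambda>k. \<integral>x. \<phi> x * H i (r k) x \<partial>lborel) \<longlonglongrightarrow> - (\<integral>x. indicator D x * f x * hX gm i \<phi> x \<partial>lborel)"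
      using LIMSEQ_subseq_LIMSEQ[OF H_limit[OF i \<phi>] r] by (simp add: comp_def)
    moreover have "(\<lambda>x. \<psi> x * (\<rho> x * H i k x)) = (\<lambda>x. \<phi> x * H i k x)" for k using \<rho>n by (simp add: \<psi>_def fun_eq_iff)
    then have "(\<lambda>k. \<integral>x. \<phi> x * H i (r k) x \<partial>lborel) \<longlonglongrightarrow> (\<integral>x. \<psi> x \<partial>\<mu>) - (\<integral>x. \<psi> x \<partial>\<nu>)"
      using lim[OF \<psi>c \<psi>s] by simp
    ultimately have "- (\<integral>x. indicator D x * f x * hX gm i \<phi> x \<partial>lborel) = (\<integral>x. \<psi> x \<partial>\<mu>) - (\<integral>x. \<psi> x \<partial>\<nu>)"
      by (rule LIMSEQ_unique)
    then show ?thesis unfolding \<mu>h \<nu>h dens[OF hp hp0] dens[OF hn hn0] by linarith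
  qed
  then show ?thesis using hp hn hp0 hn0 hpq hnq by blast
qed

text \<open>Both sides are continuous with respect to uniform convergence of the test function.\<close>

lemma measure_limit:
  assumes q1: "q = 1"
    and \<mu>: "\<And>i. w i = 1 \<Longrightarrow> fin_meas_on D (\<mu> i)" and \<nu>: "\<And>i. w i = 1 \<Longrightarrow> fin_meas_on D (\<nu> i)"
    and rep: "\<And>i \<phi>. w i = 1 \<Longrightarrow> C1_fun \<phi> \<Longrightarrow> supp_cpt D \<phi> \<Longrightarrow>
       (\<integral>x. indicator D x * f x * hX gm i \<phi> x \<partial>lborel) = - ((\<integral>x. \<phi> x \<partial>\<mu> i) - (\<integral>x. \<phi> x \<partial>\<nu> i))"
    and \<phi>: "continuous_on UNIV (\<phi> :: (real^'n) \<times> (real^'n) \<Rightarrow> real)" "supp_cpt (D \<times> UNIV) \<phi>"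
  shows "(\<lambda>k. \<integral>p. indicator D (fst p) * \<phi> p * Q k p \<partial>lborel) \<longlonglongrightarrow>
    (\<Sum>i\<in>{i. w i = 1}. (\<integral>x. (\<integral>z. \<phi> (x, z) * indicator U1 z * z $ i \<partial>lborel) \<partial>\<mu> i)
                      - (\<integral>x. (\<integral>z. \<phi> (x, z) * indicator U1 z * z $ i \<partial>lborel) \<partial>\<nu> i))"
proof (rule LIMSEQ_I)
  fix r :: real assume r: "r > 0"
  define u where "u = measure lborel U1"
  have u: "u > 0" unfolding u_def by (rule emeasure_U1)
  define J where "J M i \<psi> = (\<integral>x. (\<integral>z. \<psi> (x, z) * indicator U1 z * z $ i \<partial>lborel) \<partial>M)"
    for M :: "(real^'n) measure" and i and \<psi> :: "(real^'n) \<times> (real^'n) \<Rightarrow> real"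
  \<comment> \<open>The total mass of all limit measures. As |z_i| is at most 1 on the cube, a
    uniform error t in the test function changes the right-hand side by at most t u m.\<close>
  define m where "m = (\<Sum>i\<in>{i. w i = 1}. measure (\<mu> i) UNIV + measure (\<nu> i) UNIV)"
  have m0: "m \<ge> 0" unfolding m_def by (intro sum_nonneg) auto
  \<comment> \<open>C bounds the L^1 norms of the quotients, so with t X = r/4 the errors on the two
    sides together are at most r/4. The added 1 keeps X positive.\<close>
  define X where "X = C + u * m + 1"
  define t where "t = r / (4 * X)"
  have "C + u * m \<ge> 0" using C u m0 by simp
  then have X: "X > 0" unfolding X_def by linarith
  have t: "t > 0" unfolding t_def using r X by simp
  have tC: "t * C + t * (u * m) \<le> r / 4"
  proof -
    have "t * X = r / 4" unfolding t_def using X by simp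
    then show ?thesis unfolding X_def using t by (simp add: distrib_left)
  qed
  have W: "open (D \<times> (UNIV :: (real^'n) set))" using D by (intro open_Times) auto
  obtain K1 where K1: "compact K1" "K1 \<subseteq> D \<times> UNIV" and ex: "\<And>\<eta>. \<eta> > 0 \<Longrightarrow> \<exists>\<Psi>. C1_fun \<Psi> \<and> (\<forall>p. p \<notin> K1 \<longrightarrow> \<Psi> p = 0) \<and> (\<forall>p. \<bar>\<Psi> p - \<phi> p\<bar> \<le> \<eta>)"
    and \<phi>0: "\<And>p. p \<notin> K1 \<Longrightarrow> \<phi> p = 0"
    using C1c_uniform_approx[OF W \<phi>] by blast
  obtain \<Psi> where \<Psi>: "C1_fun \<Psi>" and \<Psi>0: "\<And>p. p \<notin> K1 \<Longrightarrow> \<Psi> p = 0" and \<Psi>\<phi>: "\<And>p. \<bar>\<Psi> p - \<phi> p\<bar> \<le> t"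
    using ex[OF t] by blast
  define K where "K = fst ` K1"
  have K: "compact K" "K \<subseteq> D" unfolding K_def using K1 by (auto intro!: compact_continuous_image continuous_intros)
  have inK: "(x, z) \<notin> K1" if "x \<notin> K" for x z using that unfolding K_def by force
  have \<Psi>K: "\<Psi> (x, z) = 0" if "x \<notin> K" for x z by (rule \<Psi>0[OF inK[OF that]])
  have \<phi>K: "\<phi> (x, z) = 0" if "x \<notin> K" for x z by (rule \<phi>0[OF inK[OF that]])
  have \<Psi>c: "continuous_on UNIV \<Psi>" by (rule C1_fun_continuous[OF \<Psi>])
  have Km [measurable]: "K \<in> sets borel" using K(1) by (simp add: compact_imp_closed)
  have lim: "(\<lambda>k. \<integral>p. indicator D (fst p) * \<Psi> p * Q k p \<partial>lborel) \<longlonglongrightarrow> (\<Sum>i\<in>{i. w i = 1}. J (\<mu> i) i \<Psi> - J (\<nu> i) i \<Psi>)"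
  proof -
    have "- (\<integral>x. indicator D x * f x * (\<integral>z. indicator U1 z * hdir \<Psi> (x, z) \<partial>lborel) \<partial>lborel)
        = (\<Sum>i\<in>{i. w i = 1}. J (\<mu> i) i \<Psi> - J (\<nu> i) i \<Psi>)"
      unfolding J_def
    proof (rule hdir_representation[OF K local_integrable(2)[OF K(1)] _ _ _ \<Psi> \<Psi>K])
      show "finite_measure (\<mu> i) \<and> sets (\<mu> i) = sets borel" if "w i = 1" for i using \<mu>[OF that] unfolding fin_meas_on_def by blast
      show "finite_measure (\<nu> i) \<and> sets (\<nu> i) = sets borel" if "w i = 1" for i using \<nu>[OF that] unfolding fin_meas_on_def by blast
      show "(\<integral>x. indicator D x * f x * hX gm i g x \<partial>lborel) = - ((\<integral>x. g x \<partial>\<mu> i) - (\<integral>x. g x \<partial>\<nu> i))"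
        if "w i = 1" "C1_fun g" "\<forall>x. x \<notin> K \<longrightarrow> g x = 0" for i g
        using that K by (intro rep) (auto simp: supp_cpt_def)
    qed
    then show ?thesis using C1_limit[OF \<Psi> K \<Psi>K] by simp
  qed
  have QD: "integrable lborel (\<lambda>p. indicator D (fst p) * Q k p)" for k
  proof (rule integrableI_bounded)
    have "(\<integral>\<^sup>+p. ennreal (norm (indicator D (fst p) * Q k p)) \<partial>lborel) \<le> ennreal C" using Q_Lq[of k] q1 by simp
    then show "(\<integral>\<^sup>+p. ennreal (norm (indicator D (fst p) * Q k p)) \<partial>lborel) < \<infinity>" by (rule le_less_trans) simp
  qed measurable
  have QDC: "(\<integral>p. \<bar>indicator D (fst p) * Q k p\<bar> \<partial>lborel) \<le> C" for k
  proof -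
    have "ennreal (\<integral>p. \<bar>indicator D (fst p) * Q k p\<bar> \<partial>lborel) \<le> (\<integral>\<^sup>+p. ennreal \<bar>indicator D (fst p) * Q k p\<bar> \<partial>lborel)"
      by (rule ennreal_integral_le_nn_integral) simp
    also have "\<dots> \<le> ennreal C" using Q_Lq[of k] q1 by simp
    finally show ?thesis using C by (simp add: ennreal_le_iff)
  qed
  have est1: "\<bar>(\<integral>p. indicator D (fst p) * \<Psi> p * Q k p \<partial>lborel) - (\<integral>p. indicator D (fst p) * \<phi> p * Q k p \<partial>lborel)\<bar> \<le> t * C" for k
  proof -
    have int: "integrable lborel (\<lambda>p. indicator D (fst p) * g p * Q k p)"
      if g: "continuous_on UNIV g" "\<And>p. p \<notin> K1 \<Longrightarrow> g p = 0" for g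
    proof -
      have "supp_cpt UNIV g" unfolding supp_cpt_def using K1 g(2) by blast
      then obtain b where b: "\<And>p. \<bar>g p\<bar> \<le> b" using supp_cpt_bounded g(1) by blast
      have gm [measurable]: "g \<in> borel_measurable borel" using g(1) by (rule borel_measurable_continuous_onI)
      show ?thesis
      proof (rule Bochner_Integration.integrable_bound)
        show "integrable lborel (\<lambda>p. b * (indicator D (fst p) * Q k p))" using QD by simp
        show "AE p in lborel. norm (indicator D (fst p) * g p * Q k p) \<le> norm (b * (indicator D (fst p) * Q k p))"
        proof (rule AE_I2)
          fix p
          have "\<bar>g p\<bar> \<le> \<bar>b\<bar>" using b[of p] by linarith
          then have "\<bar>g p\<bar> * \<bar>indicator D (fst p) * Q k p\<bar> \<le> \<bar>b\<bar> * \<bar>indicator D (fst p) * Q k p\<bar>" by (intro mult_right_mono) auto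
          then show "norm (indicator D (fst p) * g p * Q k p) \<le> norm (b * (indicator D (fst p) * Q k p))"
            by (simp add: abs_mult mult_ac)
        qed
      qed measurable
    qed
    have i1: "integrable lborel (\<lambda>p. indicator D (fst p) * \<Psi> p * Q k p)" by (rule int[OF \<Psi>c \<Psi>0])
    have i2: "integrable lborel (\<lambda>p. indicator D (fst p) * \<phi> p * Q k p)" by (rule int[OF \<phi>(1) \<phi>0])
    have "(\<integral>p. indicator D (fst p) * \<Psi> p * Q k p \<partial>lborel) - (\<integral>p. indicator D (fst p) * \<phi> p * Q k p \<partial>lborel)
        = (\<integral>p. (\<Psi> p - \<phi> p) * (indicator D (fst p) * Q k p) \<partial>lborel)"
      using i1 i2 by (subst Bochner_Integration.integral_diff[symmetric]) (auto simp: algebra_simps)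
    also have "\<bar>\<dots>\<bar> \<le> (\<integral>p. t * \<bar>indicator D (fst p) * Q k p\<bar> \<partial>lborel)"
    proof (rule order_trans[OF integral_abs_bound], rule integral_mono_AE')
      show "integrable lborel (\<lambda>p. t * \<bar>indicator D (fst p) * Q k p\<bar>)" using QD by (intro integrable_mult_right integrable_abs)
      show "AE p in lborel. \<bar>(\<Psi> p - \<phi> p) * (indicator D (fst p) * Q k p)\<bar> \<le> t * \<bar>indicator D (fst p) * Q k p\<bar>"
        unfolding abs_mult[of "_ - _"] by (intro AE_I2 mult_right_mono \<Psi>\<phi>) simp
    qed (use t in auto)
    also have "\<dots> = t * (\<integral>p. \<bar>indicator D (fst p) * Q k p\<bar> \<partial>lborel)" by simp
    also have "\<dots> \<le> t * C" using t QDC by (intro mult_left_mono) auto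
    finally show ?thesis .
  qed
  have est2: "\<bar>J M i \<Psi> - J M i \<phi>\<bar> \<le> t * u * measure M UNIV" if M: "fin_meas_on D M" for M i
  proof -
    interpret M: finite_measure M using M unfolding fin_meas_on_def by blast
    have sM [measurable_cong]: "sets M = sets borel" using M unfolding fin_meas_on_def by blast
    have spM: "space M = UNIV" using sets_eq_imp_space_eq[OF sM] by simp
    have sl: "integrable lborel (\<lambda>z. g (x, z) * indicator U1 z * z $ i)" if "continuous_on UNIV g" for g :: "(real^'n) \<times> (real^'n) \<Rightarrow> real" and x
    proof -
      have "continuous_on UNIV (\<lambda>z. g (x, z) * z $ i)" by (intro continuous_intros continuous_on_compose2[OF that]) auto
      from integrable_U1_continuous[OF this] show ?thesis by (simp add: mult_ac)
    qed
    have sm: "(\<lambda>x. \<integral>z. g (x, z) * indicator U1 z * z $ i \<partial>lborel) \<in> borel_measurable M" if "continuous_on UNIV g" for g :: "(real^'n) \<times> (real^'n) \<Rightarrow> real"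
    proof -
      have [measurable]: "g \<in> borel_measurable borel" using that by (rule borel_measurable_continuous_onI)
      have "continuous_on UNIV (\<lambda>p::(real^'n) \<times> (real^'n). snd p $ i)" by (intro continuous_intros)
      then have [measurable]: "(\<lambda>p::(real^'n) \<times> (real^'n). snd p $ i) \<in> borel_measurable borel"
        by (rule borel_measurable_continuous_onI)
      have "(\<lambda>p. g p * indicator U1 (snd p) * snd p $ i) \<in> borel_measurable borel" by measurable
      moreover have "sets (M \<Otimes>\<^sub>M lborel) = sets (borel :: ((real^'n) \<times> (real^'n)) measure)"
        by (simp add: borel_prod[symmetric] sM cong: sets_pair_measure_cong)
      ultimately have "case_prod (\<lambda>x z. g (x, z) * indicator U1 z * z $ i) \<in> borel_measurable (M \<Otimes>\<^sub>M lborel)"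
        by (simp add: case_prod_beta' cong: measurable_cong_sets)
      then show ?thesis by (rule lborel.borel_measurable_lebesgue_integral)
    qed
    have zb: "\<bar>(\<integral>z. g (x, z) * indicator U1 z * z $ i \<partial>lborel)\<bar> \<le> b * u"
      if gb: "\<And>p. \<bar>g p\<bar> \<le> b" and b0: "b \<ge> 0" for g :: "(real^'n) \<times> (real^'n) \<Rightarrow> real" and b x
    proof -
      have "\<bar>(\<integral>z. g (x, z) * indicator U1 z * z $ i \<partial>lborel)\<bar> \<le> (\<integral>z. b * indicator U1 z \<partial>lborel)"
      proof (rule order_trans[OF integral_abs_bound], rule integral_mono_AE')
        show "integrable lborel (\<lambda>z. b * indicator U1 z)"
          using emeasure_U1(1) by (intro integrable_mult_right integrable_real_indicator) auto
        show "AE z in lborel. \<bar>g (x, z) * indicator U1 z * z $ i\<bar> \<le> b * indicator U1 z"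
        proof (rule AE_I2)
          fix z
          show "\<bar>g (x, z) * indicator U1 z * z $ i\<bar> \<le> b * indicator U1 z"
          proof (cases "z \<in> U1")
            case True
            then have "\<bar>z $ i\<bar> \<le> 1" by (simp add: U1_iff less_imp_le)
            then have "\<bar>g (x, z)\<bar> * \<bar>z $ i\<bar> \<le> b * 1" using gb[of "(x, z)"] b0 by (intro mult_mono) auto
            then show ?thesis using True by (simp add: abs_mult)
          qed simp
        qed
      qed (use b0 in auto)
      then show ?thesis by (simp add: u_def)
    qed
    have xi: "integrable M (\<lambda>x. \<integral>z. g (x, z) * indicator U1 z * z $ i \<partial>lborel)"
      if g: "continuous_on UNIV g" "\<And>p. p \<notin> K1 \<Longrightarrow> g p = 0" for g :: "(real^'n) \<times> (real^'n) \<Rightarrow> real"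
    proof -
      have "supp_cpt UNIV g" unfolding supp_cpt_def using K1 g(2) by blast
      then obtain b where b: "\<And>p. \<bar>g p\<bar> \<le> b" using supp_cpt_bounded g(1) by blast
      have "b \<ge> 0" using b[of undefined] by linarith
      then show ?thesis using zb[of g b, OF b] by (intro M.integrable_const_bound[of _ "b * u"] sm g(1)) auto
    qed
    have dc: "continuous_on UNIV (\<lambda>p. \<Psi> p - \<phi> p)" by (intro continuous_intros \<Psi>c \<phi>)
    have "J M i \<Psi> - J M i \<phi> = (\<integral>x. (\<integral>z. (\<Psi> (x, z) - \<phi> (x, z)) * indicator U1 z * z $ i \<partial>lborel) \<partial>M)"
    proof -
      have "(\<integral>z. (\<Psi> (x, z) - \<phi> (x, z)) * indicator U1 z * z $ i \<partial>lborel)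
          = (\<integral>z. \<Psi> (x, z) * indicator U1 z * z $ i \<partial>lborel) - (\<integral>z. \<phi> (x, z) * indicator U1 z * z $ i \<partial>lborel)" for x
        using sl[OF \<Psi>c, of x] sl[OF \<phi>(1), of x] by (simp add: left_diff_distrib)
      then show ?thesis unfolding J_def using xi[OF \<Psi>c \<Psi>0] xi[OF \<phi>(1) \<phi>0] by simp
    qed
    also have "\<bar>\<dots>\<bar> \<le> (\<integral>x. t * u \<partial>M)"
    proof (rule order_trans[OF integral_abs_bound], rule integral_mono_AE')
      show "AE x in M. \<bar>\<integral>z. (\<Psi> (x, z) - \<phi> (x, z)) * indicator U1 z * z $ i \<partial>lborel\<bar> \<le> t * u"
        using zb[of "\<lambda>p. \<Psi> p - \<phi> p" t] \<Psi>\<phi> t by (intro AE_I2) auto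
    qed (use t u in auto)
    also have "\<dots> = t * u * measure M UNIV" by (simp add: spM mult.commute)
    finally show ?thesis .
  qed
  define L where "L \<psi> = (\<Sum>i\<in>{i. w i = 1}. J (\<mu> i) i \<psi> - J (\<nu> i) i \<psi>)" for \<psi>
  have est3: "\<bar>L \<Psi> - L \<phi>\<bar> \<le> t * (u * m)"
  proof -
    have "\<bar>L \<Psi> - L \<phi>\<bar> = \<bar>\<Sum>i\<in>{i. w i = 1}. (J (\<mu> i) i \<Psi> - J (\<mu> i) i \<phi>) - (J (\<nu> i) i \<Psi> - J (\<nu> i) i \<phi>)\<bar>"
      unfolding L_def sum_subtractf[symmetric] by (simp add: algebra_simps)
    also have "\<dots> \<le> (\<Sum>i\<in>{i. w i = 1}. \<bar>(J (\<mu> i) i \<Psi> - J (\<mu> i) i \<phi>) - (J (\<nu> i) i \<Psi> - J (\<nu> i) i \<phi>)\<bar>)"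
      by (rule sum_abs)
    also have "\<dots> \<le> (\<Sum>i\<in>{i. w i = 1}. t * u * (measure (\<mu> i) UNIV + measure (\<nu> i) UNIV))"
    proof (rule sum_mono)
      fix i assume "i \<in> {i. w i = 1}"
      then have i: "w i = 1" by simp
      show "\<bar>(J (\<mu> i) i \<Psi> - J (\<mu> i) i \<phi>) - (J (\<nu> i) i \<Psi> - J (\<nu> i) i \<phi>)\<bar> \<le> t * u * (measure (\<mu> i) UNIV + measure (\<nu> i) UNIV)"
        using est2[OF \<mu>[OF i], of i] est2[OF \<nu>[OF i], of i] unfolding distrib_left by linarith
    qed
    also have "\<dots> = t * (u * m)" unfolding m_def by (simp add: sum_distrib_left mult.assoc)
    finally show ?thesis .
  qed
  obtain N where N: "\<And>k. k \<ge> N \<Longrightarrow> \<bar>(\<integral>p. indicator D (fst p) * \<Psi> p * Q k p \<partial>lborel) - L \<Psi>\<bar> < r / 4"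
    using LIMSEQ_D[OF lim, of "r / 4"] r unfolding L_def by auto
  have "norm ((\<integral>p. indicator D (fst p) * \<phi> p * Q k p \<partial>lborel) - L \<phi>) < r" if "k \<ge> N" for k
    using N[OF that] est1[of k] est3 tC r unfolding real_norm_def by linarith
  then show "\<exists>no. \<forall>k\<ge>no. norm ((\<integral>p. indicator D (fst p) * \<phi> p * Q k p \<partial>lborel) -
     (\<Sum>i\<in>{i. w i = 1}. (\<integral>x. (\<integral>z. \<phi> (x, z) * indicator U1 z * z $ i \<partial>lborel) \<partial>\<mu> i)
                      - (\<integral>x. (\<integral>z. \<phi> (x, z) * indicator U1 z * z $ i \<partial>lborel) \<partial>\<nu> i))) < r"
    unfolding L_def J_def by blast
qed

end

text \<open>Replace every term by the largest one, whose power is itself one of the summands on the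
  right.\<close>

lemma sum_powr_le:
  fixes a :: "'i \<Rightarrow> real"
  assumes "finite I" and a: "\<And>i. i \<in> I \<Longrightarrow> 0 \<le> a i" and q: "q \<ge> 1"
  shows "(\<Sum>i\<in>I. a i) powr q \<le> real (card I) powr q * (\<Sum>i\<in>I. a i powr q)"
proof (cases "I = {}")
  case False
  define m where "m = Max (a ` I)"
  have m: "m \<in> a ` I" "\<And>i. i \<in> I \<Longrightarrow> a i \<le> m" unfolding m_def using assms(1) False by auto
  then obtain j where j: "j \<in> I" "m = a j" by blast
  have "(\<Sum>i\<in>I. a i) \<le> real (card I) * m" using sum_bounded_above[of I a m] m(2) by simp
  then have "(\<Sum>i\<in>I. a i) powr q \<le> (real (card I) * m) powr q"
    using a q by (intro powr_mono2 sum_nonneg) auto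
  also have "\<dots> = real (card I) powr q * m powr q" using a j by (simp add: powr_mult)
  also have "m powr q \<le> (\<Sum>i\<in>I. a i powr q)"
    unfolding j(2) using assms(1) j(1) by (intro member_le_sum) auto
  finally show ?thesis by (simp add: mult_left_mono)
qed simp

context carnot_seq begin

text \<open>The quotients and the candidate limit are bounded in L^q, so both sides depend
  continuously on \<psi> in the dual norm, and \<open>Lp_density_induct\<close> reduces the claim to
  C^1 test functions. For these the limit is given by \<open>C1_limit\<close> and rewritten by
  \<open>hdir_representation\<close>.\<close>

lemma density_limit:
  fixes hp hn :: "'n \<Rightarrow> real^'n \<Rightarrow> real"
  assumes q1: "q > 1"
    and hm: "\<And>i. w i = 1 \<Longrightarrow> hp i \<in> borel_measurable borel \<and> hn i \<in> borel_measurable borel"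
    and h0: "\<And>i x. w i = 1 \<Longrightarrow> 0 \<le> hp i x \<and> 0 \<le> hn i x"
    and hq: "\<And>i. w i = 1 \<Longrightarrow> (\<integral>\<^sup>+x. ennreal (hp i x powr q) \<partial>lborel) < \<infinity> \<and> (\<integral>\<^sup>+x. ennreal (hn i x powr q) \<partial>lborel) < \<infinity>"
    and rep: "\<And>i \<phi>. w i = 1 \<Longrightarrow> C1_fun \<phi> \<Longrightarrow> supp_cpt D \<phi> \<Longrightarrow>
       (\<integral>x. indicator D x * f x * hX gm i \<phi> x \<partial>lborel) = - ((\<integral>x. hp i x * \<phi> x \<partial>lborel) - (\<integral>x. hn i x * \<phi> x \<partial>lborel))"
    and \<psi>: "\<psi> \<in> borel_measurable borel"
      "(\<integral>\<^sup>+p. ennreal (\<bar>\<psi> p\<bar> powr (q / (q - 1))) * indicator (D \<times> UNIV) p \<partial>lborel) < \<infinity>"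
  shows "(\<lambda>k. \<integral>p. indicator D (fst p) * Q k p * \<psi> p \<partial>lborel) \<longlonglongrightarrow>
    (\<integral>p. indicator D (fst p) * (indicator U1 (snd p) * (\<Sum>i\<in>{i. w i = 1}. snd p $ i * (hp i (fst p) - hn i (fst p)))) * \<psi> p \<partial>lborel)"
proof -
  let ?I = "{i. w i = 1}"
  \<comment> \<open>The value 0 outside the first layer makes measurability available for every
    index.\<close>
  define g where "g i x = (if w i = 1 then hp i x - hn i x else 0)" for i x
  define S where "S p = indicator D (fst p) * (indicator U1 (snd p) * (\<Sum>i\<in>?I. snd p $ i * g i (fst p)))" for p
  have gm [measurable]: "g i \<in> borel_measurable borel" for i
    unfolding g_def using hm[of i] by (cases "w i = 1") auto
  have sndm [measurable]: "(\<lambda>p::(real^'n) \<times> (real^'n). snd p $ i) \<in> borel_measurable borel" for i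
    by (intro borel_measurable_continuous_onI continuous_intros)
  have Sm [measurable]: "S \<in> borel_measurable borel" unfolding S_def by measurable
  have W: "open (D \<times> (UNIV :: (real^'n) set))" using D by (intro open_Times) auto
  have Wm: "D \<times> (UNIV :: (real^'n) set) \<in> sets borel" using W by (rule borel_open)
  have "(\<integral>\<^sup>+p. ennreal (\<bar>S p\<bar> powr q) \<partial>lborel) < \<infinity>"
  proof -
    have pt: "ennreal (\<bar>S p\<bar> powr q) \<le> ennreal (real (card ?I) powr q) *
        (\<Sum>i\<in>?I. (ennreal (hp i (fst p) powr q) + ennreal (hn i (fst p) powr q)) * indicator U1 (snd p))" for p
    proof (cases "snd p \<in> U1")
      case True
      have "\<bar>S p\<bar> \<le> \<bar>\<Sum>i\<in>?I. snd p $ i * g i (fst p)\<bar>" unfolding S_def using True by (simp add: indicator_def)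
      also have "\<dots> \<le> (\<Sum>i\<in>?I. \<bar>g i (fst p)\<bar>)"
      proof (rule order_trans[OF sum_abs], rule sum_mono)
        fix i
        have "\<bar>snd p $ i\<bar> \<le> 1" using True by (simp add: U1_iff less_imp_le)
        then have "\<bar>snd p $ i\<bar> * \<bar>g i (fst p)\<bar> \<le> 1 * \<bar>g i (fst p)\<bar>" by (intro mult_right_mono) auto
        then show "\<bar>snd p $ i * g i (fst p)\<bar> \<le> \<bar>g i (fst p)\<bar>" by (simp add: abs_mult)
      qed
      finally have "\<bar>S p\<bar> powr q \<le> (\<Sum>i\<in>?I. \<bar>g i (fst p)\<bar>) powr q" using q by (intro powr_mono2) auto
      also have "\<dots> \<le> real (card ?I) powr q * (\<Sum>i\<in>?I. \<bar>g i (fst p)\<bar> powr q)" using q by (intro sum_powr_le) auto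
      also have "\<dots> \<le> real (card ?I) powr q * (\<Sum>i\<in>?I. hp i (fst p) powr q + hn i (fst p) powr q)"
      proof (intro mult_left_mono sum_mono)
        fix i assume i: "i \<in> ?I"
        then have nn: "0 \<le> hp i (fst p)" "0 \<le> hn i (fst p)" using h0[of i "fst p"] by auto
        have "\<bar>g i (fst p)\<bar> \<le> max (hp i (fst p)) (hn i (fst p))" unfolding g_def using i nn by auto
        then have "\<bar>g i (fst p)\<bar> powr q \<le> (max (hp i (fst p)) (hn i (fst p))) powr q" using q by (intro powr_mono2) auto
        also have "\<dots> \<le> hp i (fst p) powr q + hn i (fst p) powr q" by (auto simp: max_def)
        finally show "\<bar>g i (fst p)\<bar> powr q \<le> hp i (fst p) powr q + hn i (fst p) powr q" .
      qed simp
      finally have "ennreal (\<bar>S p\<bar> powr q) \<le> ennreal (real (card ?I) powr q * (\<Sum>i\<in>?I. hp i (fst p) powr q + hn i (fst p) powr q))"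
        by (rule ennreal_leI)
      also have "\<dots> = ennreal (real (card ?I) powr q) * (\<Sum>i\<in>?I. ennreal (hp i (fst p) powr q + hn i (fst p) powr q))"
        by (subst sum_ennreal) (simp_all add: ennreal_mult')
      finally show ?thesis using True by (simp add: ennreal_plus)
    qed (simp add: S_def)
    have hpm: "hp i \<in> borel_measurable borel" "hn i \<in> borel_measurable borel" if "i \<in> ?I" for i using hm[of i] that by auto
    have "(\<integral>\<^sup>+p. ennreal (\<bar>S p\<bar> powr q) \<partial>lborel) \<le> (\<integral>\<^sup>+p. ennreal (real (card ?I) powr q) *
        (\<Sum>i\<in>?I. (ennreal (hp i (fst p) powr q) + ennreal (hn i (fst p) powr q)) * indicator U1 (snd p)) \<partial>lborel)"
      by (intro nn_integral_mono pt)
    also have "\<dots> = ennreal (real (card ?I) powr q) * (\<Sum>i\<in>?I. \<integral>\<^sup>+p. (ennreal (hp i (fst p) powr q) + ennreal (hn i (fst p) powr q)) * indicator U1 (snd p) \<partial>lborel)"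
    proof -
      have m: "(\<lambda>p. (ennreal (hp i (fst p) powr q) + ennreal (hn i (fst p) powr q)) * indicator U1 (snd p)) \<in> borel_measurable lborel"
        if "i \<in> ?I" for i using hpm[OF that] by measurable
      have ms: "(\<lambda>p. \<Sum>i\<in>?I. (ennreal (hp i (fst p) powr q) + ennreal (hn i (fst p) powr q)) * indicator U1 (snd p)) \<in> borel_measurable lborel"
        by (rule borel_measurable_sum[OF m])
      show ?thesis by (simp only: nn_integral_cmult[OF ms] nn_integral_sum[OF m])
    qed
    also have "\<dots> < \<infinity>"
    proof -
      have "(\<integral>\<^sup>+p. (ennreal (hp i (fst p) powr q) + ennreal (hn i (fst p) powr q)) * indicator U1 (snd p) \<partial>lborel) < \<infinity>" if i: "i \<in> ?I" for i
      proof -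
        have [measurable]: "hp i \<in> borel_measurable borel" "hn i \<in> borel_measurable borel" using hpm[OF i] by auto
        have "(\<integral>\<^sup>+p. (ennreal (hp i (fst p) powr q) + ennreal (hn i (fst p) powr q)) * indicator U1 (snd p) \<partial>lborel)
            = (\<integral>\<^sup>+x. (\<integral>\<^sup>+z. (ennreal (hp i x powr q) + ennreal (hn i x powr q)) * indicator U1 z \<partial>lborel) \<partial>lborel)"
          by (subst nn_integral_lborel_fst) auto
        also have "\<dots> = (\<integral>\<^sup>+x. (ennreal (hp i x powr q) + ennreal (hn i x powr q)) * emeasure lborel U1 \<partial>lborel)"
          by (simp add: nn_integral_cmult_indicator)
        also have "\<dots> = ((\<integral>\<^sup>+x. ennreal (hp i x powr q) \<partial>lborel) + (\<integral>\<^sup>+x. ennreal (hn i x powr q) \<partial>lborel)) * emeasure lborel U1"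
          by (simp add: nn_integral_multc nn_integral_add)
        also have "\<dots> < \<infinity>" using hq[of i] i emeasure_U1(1) by (auto simp: ennreal_mult_less_top)
        finally show ?thesis .
      qed
      then show ?thesis by (auto simp: ennreal_mult_less_top)
    qed
    finally show ?thesis .
  qed
  then obtain C2 where C2: "(\<integral>\<^sup>+p. ennreal (\<bar>S p\<bar> powr q) \<partial>lborel) = ennreal C2" "C2 \<ge> 0"
    by (cases "\<integral>\<^sup>+p. ennreal (\<bar>S p\<bar> powr q) \<partial>lborel") auto
  define C3 where "C3 = max C C2"
  have QC: "(\<integral>\<^sup>+p. ennreal (\<bar>indicator D (fst p) * Q k p\<bar> powr q) \<partial>lborel) \<le> ennreal C3" for k
    using Q_Lq[of k] unfolding C3_def by (rule order_trans) (simp add: ennreal_leI)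
  have SC: "(\<integral>\<^sup>+p. ennreal (\<bar>S p\<bar> powr q) \<partial>lborel) \<le> ennreal C3" unfolding C2 C3_def by (simp add: ennreal_leI)
  have C3: "C3 \<ge> 0" unfolding C3_def using C by simp
  have QDm: "(\<lambda>p. indicator D (fst p) * Q k p) \<in> borel_measurable borel" for k by measurable
  have "(\<lambda>k. \<integral>p. indicator D (fst p) * Q k p * \<psi> p \<partial>lborel) \<longlonglongrightarrow> (\<integral>p. S p * \<psi> p \<partial>lborel)"
  proof (rule Lp_density_induct[OF W _ _ _ \<psi>, where P = "\<lambda>\<psi>. (\<lambda>k. \<integral>p. indicator D (fst p) * Q k p * \<psi> p \<partial>lborel) \<longlonglongrightarrow> (\<integral>p. S p * \<psi> p \<partial>lborel)"])
    show "q / (q - 1) > 0" using q1 by simp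
  next
    fix u :: "nat \<Rightarrow> (real^'n) \<times> (real^'n) \<Rightarrow> real" and v :: "(real^'n) \<times> (real^'n) \<Rightarrow> real"
    assume um: "\<And>n. u n \<in> borel_measurable borel" and vm: "v \<in> borel_measurable borel"
      and conv: "\<And>n. (\<lambda>k. \<integral>p. indicator D (fst p) * Q k p * u n p \<partial>lborel) \<longlonglongrightarrow> (\<integral>p. S p * u n p \<partial>lborel)"
      and up: "\<And>n. (\<integral>\<^sup>+p. ennreal (\<bar>u n p\<bar> powr (q / (q - 1))) * indicator (D \<times> UNIV) p \<partial>lborel) < \<infinity>"
      and vp: "(\<integral>\<^sup>+p. ennreal (\<bar>v p\<bar> powr (q / (q - 1))) * indicator (D \<times> UNIV) p \<partial>lborel) < \<infinity>"
      and uv: "(\<lambda>n. \<integral>\<^sup>+p. ennreal (\<bar>u n p - v p\<bar> powr (q / (q - 1))) * indicator (D \<times> UNIV) p \<partial>lborel) \<longlonglongrightarrow> 0"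
    have z1: "indicator D (fst p) * Q k p = 0" if "p \<notin> D \<times> UNIV" for p k using that by (cases p) auto
    have z2: "S p = 0" if "p \<notin> D \<times> UNIV" for p using that by (cases p) (auto simp: S_def)
    show "(\<lambda>k. \<integral>p. indicator D (fst p) * Q k p * v p \<partial>lborel) \<longlonglongrightarrow> (\<integral>p. S p * v p \<partial>lborel)"
      by (rule weak_convergence_Lp_closed[OF QDm Sm Wm z1 z2 q1 QC SC C3 um vm up vp uv conv])
  next
    fix \<Psi> :: "(real^'n) \<times> (real^'n) \<Rightarrow> real" assume \<Psi>: "C1_fun \<Psi>" "supp_cpt (D \<times> UNIV) \<Psi>"
    obtain K1 where K1: "compact K1" "K1 \<subseteq> D \<times> UNIV" "\<And>p. p \<notin> K1 \<Longrightarrow> \<Psi> p = 0"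
      using \<Psi>(2) unfolding supp_cpt_def by blast
    define K where "K = fst ` K1"
    have K: "compact K" "K \<subseteq> D" unfolding K_def using K1 by (auto intro!: compact_continuous_image continuous_intros)
    have Km [measurable]: "K \<in> sets borel" using K(1) by (simp add: compact_imp_closed)
    have \<Psi>K: "\<Psi> (x, z) = 0" if "x \<notin> K" for x z using that K1(3)[of "(x, z)"] unfolding K_def by force
    have \<Psi>c: "continuous_on UNIV \<Psi>" by (rule C1_fun_continuous[OF \<Psi>(1)])
    \<comment> \<open>The densities are in L^q and need not be integrable over D. Restricted to the
      compact set K they define finite measures, to which the representation applies.\<close>
    define \<mu> where "\<mu> i = density lborel (\<lambda>x. ennreal (indicator K x * hp i x))" for i
    define \<nu> where "\<nu> i = density lborel (\<lambda>x. ennreal (indicator K x * hn i x))" for i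
    have loc: "integrable lborel (\<lambda>x. indicator K x * hp i x)" "integrable lborel (\<lambda>x. indicator K x * hn i x)" if i: "w i = 1" for i
      using hm[OF i] h0[OF i] hq[OF i] emeasure_compact_finite[OF K(1)]
      by (auto intro!: integrable_indicator_Lq[OF _ q] simp: less_top)
    have dens: "finite_measure (density lborel (\<lambda>x. ennreal (indicator K x * h x)))"
        "\<And>\<phi>. \<phi> \<in> borel_measurable borel \<Longrightarrow> (\<integral>x. \<phi> x \<partial>density lborel (\<lambda>x. ennreal (indicator K x * h x))) = (\<integral>x. indicator K x * h x * \<phi> x \<partial>lborel)"
      if h: "integrable lborel (\<lambda>x. indicator K x * h x)" "\<And>x. 0 \<le> h x" "h \<in> borel_measurable borel" for h :: "real^'n \<Rightarrow> real"
    proof -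
      have [measurable]: "h \<in> borel_measurable borel" by fact
      show "finite_measure (density lborel (\<lambda>x. ennreal (indicator K x * h x)))"
      proof (rule finite_measureI)
        have "emeasure (density lborel (\<lambda>x. ennreal (indicator K x * h x))) UNIV = (\<integral>\<^sup>+x. ennreal (indicator K x * h x) \<partial>lborel)"
          by (subst emeasure_density) auto
        also have "\<dots> = ennreal (\<integral>x. indicator K x * h x \<partial>lborel)" using h(2) by (intro nn_integral_eq_integral h) auto
        finally show "emeasure (density lborel (\<lambda>x. ennreal (indicator K x * h x))) (space (density lborel (\<lambda>x. ennreal (indicator K x * h x)))) \<noteq> \<infinity>" by simp
      qed
      show "(\<integral>x. \<phi> x \<partial>density lborel (\<lambda>x. ennreal (indicator K x * h x))) = (\<integral>x. indicator K x * h x * \<phi> x \<partial>lborel)"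
        if "\<phi> \<in> borel_measurable borel" for \<phi> :: "real^'n \<Rightarrow> real"
        using that h(2) by (subst integral_density) auto
    qed
    have d\<mu>: "finite_measure (\<mu> i)" "\<And>\<phi>. \<phi> \<in> borel_measurable borel \<Longrightarrow> (\<integral>x. \<phi> x \<partial>\<mu> i) = (\<integral>x. indicator K x * hp i x * \<phi> x \<partial>lborel)" if i: "w i = 1" for i
      unfolding \<mu>_def using dens[of "hp i"] loc[OF i] h0[OF i] hm[OF i] by auto
    have d\<nu>: "finite_measure (\<nu> i)" "\<And>\<phi>. \<phi> \<in> borel_measurable borel \<Longrightarrow> (\<integral>x. \<phi> x \<partial>\<nu> i) = (\<integral>x. indicator K x * hn i x * \<phi> x \<partial>lborel)" if i: "w i = 1" for i
      unfolding \<nu>_def using dens[of "hn i"] loc[OF i] h0[OF i] hm[OF i] by auto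
    have gi: "integrable lborel (\<lambda>p. a (fst p) * (indicator U1 (snd p) * (\<Psi> p * snd p $ i)))"
      and gie: "(\<integral>x. a x * (\<integral>z. \<Psi> (x, z) * indicator U1 z * z $ i \<partial>lborel) \<partial>lborel) = (\<integral>p. a (fst p) * (indicator U1 (snd p) * (\<Psi> p * snd p $ i)) \<partial>lborel)"
      if a: "integrable lborel a" "\<And>x. x \<notin> K \<Longrightarrow> a x = 0" for a i
    proof -
      show int: "integrable lborel (\<lambda>p. a (fst p) * (indicator U1 (snd p) * (\<Psi> p * snd p $ i)))"
        by (rule integrable_times_U1_continuous[OF a(1) K(1) a(2)]) (auto intro!: continuous_intros \<Psi>c)
      show "(\<integral>x. a x * (\<integral>z. \<Psi> (x, z) * indicator U1 z * z $ i \<partial>lborel) \<partial>lborel) = (\<integral>p. a (fst p) * (indicator U1 (snd p) * (\<Psi> p * snd p $ i)) \<partial>lborel)"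
        by (subst integral_lborel_fst[OF int]) (simp add: mult_ac)
    qed
    have zm: "(\<lambda>x. \<integral>z. \<Psi> (x, z) * indicator U1 z * z $ i \<partial>lborel) \<in> borel_measurable borel" for i
    proof -
      have [measurable]: "\<Psi> \<in> borel_measurable borel" using \<Psi>c by (rule borel_measurable_continuous_onI)
      have "(\<lambda>p. \<Psi> p * indicator U1 (snd p) * snd p $ i) \<in> borel_measurable borel" by measurable
      moreover have "sets (borel \<Otimes>\<^sub>M lborel) = sets (borel :: ((real^'n) \<times> (real^'n)) measure)"
        by (simp add: borel_prod[symmetric] cong: sets_pair_measure_cong)
      ultimately have "case_prod (\<lambda>x z. \<Psi> (x, z) * indicator U1 z * z $ i) \<in> borel_measurable (borel \<Otimes>\<^sub>M lborel)"
        by (simp add: case_prod_beta' cong: measurable_cong_sets)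
      then show ?thesis by (rule lborel.borel_measurable_lebesgue_integral)
    qed
    have "- (\<integral>x. indicator D x * f x * (\<integral>z. indicator U1 z * hdir \<Psi> (x, z) \<partial>lborel) \<partial>lborel)
        = (\<Sum>i\<in>?I. (\<integral>x. (\<integral>z. \<Psi> (x, z) * indicator U1 z * z $ i \<partial>lborel) \<partial>\<mu> i)
                 - (\<integral>x. (\<integral>z. \<Psi> (x, z) * indicator U1 z * z $ i \<partial>lborel) \<partial>\<nu> i))"
    proof (rule hdir_representation[OF K local_integrable(2)[OF K(1)] _ _ _ \<Psi>(1) \<Psi>K])
      show "finite_measure (\<mu> i) \<and> sets (\<mu> i) = sets borel" if "w i = 1" for i using d\<mu>(1)[OF that] by (simp add: \<mu>_def)
      show "finite_measure (\<nu> i) \<and> sets (\<nu> i) = sets borel" if "w i = 1" for i using d\<nu>(1)[OF that] by (simp add: \<nu>_def)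
      show "(\<integral>x. indicator D x * f x * hX gm i \<phi> x \<partial>lborel) = - ((\<integral>x. \<phi> x \<partial>\<mu> i) - (\<integral>x. \<phi> x \<partial>\<nu> i))"
        if i: "w i = 1" and \<phi>: "C1_fun \<phi>" "\<forall>x. x \<notin> K \<longrightarrow> \<phi> x = 0" for i \<phi>
      proof -
        have m: "\<phi> \<in> borel_measurable borel" by (rule borel_measurable_continuous_onI[OF C1_fun_continuous[OF \<phi>(1)]])
        have "(\<lambda>x. indicator K x * h x * \<phi> x) = (\<lambda>x. h x * \<phi> x)" for h :: "real^'n \<Rightarrow> real"
          using \<phi>(2) by (auto simp: fun_eq_iff indicator_def)
        moreover have "supp_cpt D \<phi>" unfolding supp_cpt_def using K \<phi>(2) by blast
        ultimately show ?thesis using rep[OF i \<phi>(1)] d\<mu>(2)[OF i m] d\<nu>(2)[OF i m] by simp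
      qed
    qed
    also have "\<dots> = (\<Sum>i\<in>?I. (\<integral>p. indicator K (fst p) * hp i (fst p) * (indicator U1 (snd p) * (\<Psi> p * snd p $ i)) \<partial>lborel)
        - (\<integral>p. indicator K (fst p) * hn i (fst p) * (indicator U1 (snd p) * (\<Psi> p * snd p $ i)) \<partial>lborel))"
    proof (rule sum.cong)
      fix i assume "i \<in> ?I"
      then have i: "w i = 1" by simp
      show "(\<integral>x. (\<integral>z. \<Psi> (x, z) * indicator U1 z * z $ i \<partial>lborel) \<partial>\<mu> i) - (\<integral>x. (\<integral>z. \<Psi> (x, z) * indicator U1 z * z $ i \<partial>lborel) \<partial>\<nu> i)
        = (\<integral>p. indicator K (fst p) * hp i (fst p) * (indicator U1 (snd p) * (\<Psi> p * snd p $ i)) \<partial>lborel)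
        - (\<integral>p. indicator K (fst p) * hn i (fst p) * (indicator U1 (snd p) * (\<Psi> p * snd p $ i)) \<partial>lborel)"
        unfolding d\<mu>(2)[OF i zm] d\<nu>(2)[OF i zm] using gie[OF loc(1)[OF i]] gie[OF loc(2)[OF i]] by simp
    qed simp
    also have "\<dots> = (\<Sum>i\<in>?I. \<integral>p. indicator K (fst p) * hp i (fst p) * (indicator U1 (snd p) * (\<Psi> p * snd p $ i))
        - indicator K (fst p) * hn i (fst p) * (indicator U1 (snd p) * (\<Psi> p * snd p $ i)) \<partial>lborel)"
    proof (rule sum.cong)
      fix i assume "i \<in> ?I"
      then have i: "w i = 1" by simp
      show "(\<integral>p. indicator K (fst p) * hp i (fst p) * (indicator U1 (snd p) * (\<Psi> p * snd p $ i)) \<partial>lborel)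
        - (\<integral>p. indicator K (fst p) * hn i (fst p) * (indicator U1 (snd p) * (\<Psi> p * snd p $ i)) \<partial>lborel)
        = (\<integral>p. indicator K (fst p) * hp i (fst p) * (indicator U1 (snd p) * (\<Psi> p * snd p $ i))
        - indicator K (fst p) * hn i (fst p) * (indicator U1 (snd p) * (\<Psi> p * snd p $ i)) \<partial>lborel)"
        by (rule Bochner_Integration.integral_diff[symmetric]) (auto intro!: gi loc i)
    qed simp
    also have "\<dots> = (\<integral>p. (\<Sum>i\<in>?I. indicator K (fst p) * hp i (fst p) * (indicator U1 (snd p) * (\<Psi> p * snd p $ i))
        - indicator K (fst p) * hn i (fst p) * (indicator U1 (snd p) * (\<Psi> p * snd p $ i))) \<partial>lborel)"
      by (rule Bochner_Integration.integral_sum[symmetric]) (auto intro!: Bochner_Integration.integrable_diff gi loc)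
    also have "\<dots> = (\<integral>p. S p * \<Psi> p \<partial>lborel)"
    proof (rule Bochner_Integration.integral_cong)
      fix p
      show "(\<Sum>i\<in>?I. indicator K (fst p) * hp i (fst p) * (indicator U1 (snd p) * (\<Psi> p * snd p $ i))
        - indicator K (fst p) * hn i (fst p) * (indicator U1 (snd p) * (\<Psi> p * snd p $ i))) = S p * \<Psi> p"
      proof (cases "fst p \<in> K")
        case True
        then have D': "fst p \<in> D" using K by auto
        have "(\<Sum>i\<in>?I. hp i (fst p) * (indicator U1 (snd p) * (\<Psi> p * snd p $ i)) - hn i (fst p) * (indicator U1 (snd p) * (\<Psi> p * snd p $ i)))
          = (\<Sum>i\<in>?I. indicator U1 (snd p) * (snd p $ i * g i (fst p)) * \<Psi> p)"
          by (rule sum.cong) (auto simp: g_def algebra_simps)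
        also have "\<dots> = S p * \<Psi> p"
          by (simp only: S_def indicator_simps(1)[OF D'] mult_1_left sum_distrib_left sum_distrib_right)
        finally show ?thesis using True by simp
      next
        case False
        then have "\<Psi> p = 0" using \<Psi>K[of "fst p" "snd p"] by simp
        then show ?thesis by simp
      qed
    qed simp
    finally have eq: "- (\<integral>x. indicator D x * f x * (\<integral>z. indicator U1 z * hdir \<Psi> (x, z) \<partial>lborel) \<partial>lborel) = (\<integral>p. S p * \<Psi> p \<partial>lborel)" .
    have "(\<lambda>p. indicator D (fst p) * \<Psi> p * Q k p) = (\<lambda>p. indicator D (fst p) * Q k p * \<Psi> p)" for k by (simp add: fun_eq_iff)
    then show "(\<lambda>k. \<integral>p. indicator D (fst p) * Q k p * \<Psi> p \<partial>lborel) \<longlonglongrightarrow> (\<integral>p. S p * \<Psi> p \<partial>lborel)"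
      using C1_limit[OF \<Psi>(1) K \<Psi>K] unfolding eq by simp
  qed
  moreover have "S p * \<psi> p = indicator D (fst p) * (indicator U1 (snd p) * (\<Sum>i\<in>?I. snd p $ i * (hp i (fst p) - hn i (fst p)))) * \<psi> p" for p
    unfolding S_def g_def by simp
  ultimately show ?thesis by simp
qed

end

section \<open>From Lebesgue measurable functions to Borel representatives\<close>

lemma lebesgue_measurable_AE_eq:
  fixes X X' :: "'a::euclidean_space \<Rightarrow> real"
  assumes X': "X' \<in> borel_measurable borel" and ae: "AE x in lborel. X x = X' x"
  shows "X \<in> borel_measurable lebesgue"
proof (rule measurableI)
  fix S :: "real set" assume S: "S \<in> sets borel"
  have "X' -` S \<in> sets borel" using measurable_sets[OF X' S] by simp
  then have A: "X' -` S \<in> sets lebesgue" by (intro sets_completionI_sets) simp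
  have "AE x in lebesgue. X x = X' x" using ae by (rule AE_completion)
  then have "AE x in lebesgue. x \<in> X' -` S \<longleftrightarrow> x \<in> X -` S" by eventually_elim simp
  from completion.in_sets_AE[OF this A] show "X -` S \<inter> space lebesgue \<in> sets lebesgue" by simp
qed simp

text \<open>Completeness of Lebesgue measure supplies a Borel function; multiplying it by the
  indicator once more makes it vanish at every point off A, not just at almost every one.\<close>

lemma set_borel_measurable_representative:
  fixes g :: "'a::euclidean_space \<Rightarrow> real"
  assumes g: "set_borel_measurable lebesgue A g" and A [measurable]: "A \<in> sets borel"
  shows "\<exists>g'\<in>borel_measurable borel. (AE x in lborel. indicator A x * g x = g' x) \<and> (\<forall>x. x \<notin> A \<longrightarrow> g' x = 0)"
proof -
  have "(\<lambda>x. indicator A x * g x) \<in> borel_measurable (completion lborel)"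
    using g unfolding set_borel_measurable_def by simp
  from completion_ex_borel_measurable_real[OF this]
  obtain g' where g' [measurable]: "g' \<in> borel_measurable borel" and ae: "AE x in lborel. indicator A x * g x = g' x" by auto
  have "AE x in lborel. indicator A x * g x = indicator A x * g' x"
    using ae by eventually_elim (auto simp: indicator_def split: if_splits)
  moreover have "(\<lambda>x. indicator A x * g' x) \<in> borel_measurable borel" by measurable
  ultimately show ?thesis by (intro bexI[of _ "\<lambda>x. indicator A x * g' x"]) auto
qed

text \<open>The indicator is idempotent and can be shared by both factors, so the product of
  representatives represents the integrand.\<close>

lemma set_integral_representative:
  fixes g h g' h' :: "'a::euclidean_space \<Rightarrow> real"
  assumes [measurable]: "g' \<in> borel_measurable borel" "h' \<in> borel_measurable borel"
    and g: "AE x in lborel. indicator A x * g x = g' x" and h: "AE x in lborel. indicator A x * h x = h' x"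
  shows "(LINT x:A|lebesgue. g x * h x) = (\<integral>x. g' x * h' x \<partial>lborel)"
proof -
  have ae: "AE x in lborel. indicator A x *\<^sub>R (g x * h x) = g' x * h' x"
    using g h by eventually_elim (auto simp: indicator_def split: if_splits)
  have m: "(\<lambda>x. g' x * h' x) \<in> borel_measurable borel" by measurable
  have "(LINT x:A|lebesgue. g x * h x) = (\<integral>x. g' x * h' x \<partial>lebesgue)"
    unfolding set_lebesgue_integral_def
    by (rule integral_cong_AE[OF lebesgue_measurable_AE_eq[OF m ae] _ AE_completion[OF ae]])
       (intro measurable_completion, simp)
  also have "\<dots> = (\<integral>x. g' x * h' x \<partial>lborel)" by (rule integral_completion) simp
  finally show ?thesis .
qed

lemma Lq_representative:
  fixes g g' :: "'a::euclidean_space \<Rightarrow> real"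
  assumes g: "Lq lebesgue A q g" and q: "q > 0" and ae: "AE x in lborel. indicator A x * g x = g' x"
  shows "(\<integral>\<^sup>+x. ennreal (\<bar>g' x\<bar> powr q) \<partial>lborel) < \<infinity>"
proof -
  have "integrable lebesgue (\<lambda>x. indicator A x *\<^sub>R \<bar>g x\<bar> powr q)" using g unfolding Lq_def set_integrable_def by blast
  then have "(\<integral>\<^sup>+x. ennreal (norm (indicator A x *\<^sub>R \<bar>g x\<bar> powr q)) \<partial>lebesgue) < \<infinity>"
    by (simp add: integrable_iff_bounded)
  moreover have "(\<integral>\<^sup>+x. ennreal (norm (indicator A x *\<^sub>R \<bar>g x\<bar> powr q)) \<partial>lborel) = (\<integral>\<^sup>+x. ennreal (\<bar>g' x\<bar> powr q) \<partial>lborel)"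
  proof (rule nn_integral_cong_AE)
    show "AE x in lborel. ennreal (norm (indicator A x *\<^sub>R \<bar>g x\<bar> powr q)) = ennreal (\<bar>g' x\<bar> powr q)"
      using ae by eventually_elim (use q in \<open>auto simp: indicator_def split: if_splits\<close>)
  qed
  ultimately show ?thesis by (simp add: nn_integral_completion)
qed

lemma Lq_borel:
  fixes g :: "'a::euclidean_space \<Rightarrow> real"
  assumes [measurable]: "g \<in> borel_measurable borel" "A \<in> sets borel"
    and fin: "(\<integral>\<^sup>+x. ennreal (\<bar>g x\<bar> powr q) \<partial>lborel) < \<infinity>"
  shows "Lq lebesgue A q g"
proof -
  have "integrable lborel (\<lambda>x. \<bar>g x\<bar> powr q)" using fin by (intro integrableI_bounded) auto
  then have "integrable lborel (\<lambda>x. indicator A x *\<^sub>R \<bar>g x\<bar> powr q)" by (intro integrable_mult_indicator) auto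
  then have "integrable lebesgue (\<lambda>x. indicator A x *\<^sub>R \<bar>g x\<bar> powr q)" by (subst integrable_completion) auto
  moreover have "(\<lambda>x. indicator A x *\<^sub>R g x) \<in> borel_measurable lebesgue"
    by (rule measurable_completion) simp
  ultimately show ?thesis unfolding Lq_def set_borel_measurable_def set_integrable_def by blast
qed

lemma test_fn_C1: "test_fn D \<phi> \<Longrightarrow> C1_fun \<phi> \<and> supp_cpt D \<phi>"
  unfolding test_fn_def by (auto intro: smooth_on_C1_fun csupp_supp_cpt)

context carnot begin

text \<open>Off a null set N of base points the two functions agree. The quotient also evaluates
  them at x \<circ> \<delta>_e(z), and the pairs for which this point falls into N form a null set
  because the shear preserves measure.\<close>

lemma diff_quot_AE_cong:
  assumes ae: "AE x in lborel. indicator D x * g x = g' x"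
  shows "AE p in lborel. indicator (D \<times> UNIV) p * diff_quot gm w D e g p = indicator D (fst p) * diff_quot gm w D e g' p"
proof -
  obtain N where N: "{x. indicator D x * g x \<noteq> g' x} \<subseteq> N" "N \<in> null_sets lborel"
    using ae by (auto simp: eventually_ae_filter)
  have Nb [measurable]: "N \<in> sets borel" using N(2) by auto
  have "emeasure lborel (N \<times> (UNIV :: (real^'n) set)) = emeasure lborel N * emeasure lborel (UNIV :: (real^'n) set)"
    unfolding lborel_prod[symmetric] by (rule lborel.emeasure_pair_measure_Times) auto
  also have "\<dots> = 0" using N(2) by (simp add: null_sets_def)
  finally have "N \<times> (UNIV :: (real^'n) set) \<in> null_sets lborel"
    using Nb by (simp add: null_sets_def borel_prod[symmetric])
  from AE_not_in[OF this] have a1: "AE p in (lborel :: ((real^'n) \<times> (real^'n)) measure). fst p \<notin> N" by eventually_elim auto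
  let ?F = "\<lambda>p::(real^'n) \<times> (real^'n). (gm (fst p) (dil w e (snd p)), snd p)"
  have dc: "continuous_on UNIV (dil w e)"
    using dil_linear by (intro linear_continuous_on) (simp add: linear_conv_bounded_linear)
  have Fm: "?F \<in> borel_measurable borel"
    by (intro borel_measurable_continuous_onI continuous_on_Pair gm_continuous' continuous_on_compose2[OF dc] continuous_intros) auto
  have "AE p in distr lborel borel ?F. fst p \<notin> N" unfolding shear_lborel by (rule a1)
  then have a2: "AE p in lborel. fst (?F p) \<notin> N"
    using Fm by (subst (asm) AE_distr_iff) (auto simp: pred_def)
  from a1 a2 show ?thesis
  proof eventually_elim
    case (elim p)
    have x: "indicator D (fst p) * g (fst p) = g' (fst p)" using elim(1) N(1) by auto
    have y: "indicator D (gm (fst p) (dil w e (snd p))) * g (gm (fst p) (dil w e (snd p))) = g' (gm (fst p) (dil w e (snd p)))"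
      using elim(2) N(1) by auto
    have i: "indicator (D \<times> UNIV) p = (indicator D (fst p) :: real)" by (cases p) (simp add: indicator_def)
    show ?case
    proof (cases "fst p \<in> D \<and> gm (fst p) (dil w e (snd p)) \<in> D")
      case True
      then show ?thesis unfolding i using x y by (simp add: diff_quot_def Let_def)
    qed (auto simp: i diff_quot_def Let_def)
  qed
qed

text \<open>After the substitution y = x \<circ> \<delta>_e(z) the average over the ball is an
  integral over the cube divided by its volume. Points y outside D contribute to the hypothesis
  through the extension by zero and are cut off in the quotient; hence an inequality.\<close>

lemma diff_quot_bound:
  assumes D: "open D" and q: "q \<ge> 1" and e: "e > 0"
    and g'm [measurable]: "g' \<in> borel_measurable borel"
    and ae: "AE x in lborel. indicator D x * g x = g' x"
    and bound: "(\<integral>\<^sup>+ x\<in>D. ennreal (1 / measure lebesgue (Uball gm w x e)) *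
           (\<integral>\<^sup>+ y\<in>Uball gm w x e.
               ennreal (\<bar>indicator D y * g y - indicator D x * g x\<bar> powr q) \<partial>lebesgue) \<partial>lebesgue)
       \<le> ennreal (M * e powr q)"
  shows "(\<integral>\<^sup>+p. ennreal (\<bar>diff_quot gm w D e g' p\<bar> powr q) * indicator D (fst p) \<partial>lborel) \<le> ennreal (measure lborel U1 * \<bar>M\<bar>)"
proof -
  have Dm [measurable]: "D \<in> sets borel" using D by auto
  have Um [measurable]: "U1 \<in> sets borel" by (rule U1_measurable)
  define c where "c = measure lborel U1"
  have c: "c > 0" unfolding c_def by (rule emeasure_U1)
  define V where "V x = (\<integral>\<^sup>+z. ennreal (\<bar>g' (gm x (dil w e z)) - g' x\<bar> powr q) * indicator U1 z \<partial>lborel)" for x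
  have "ennreal (1 / measure lebesgue (Uball gm w x e)) *
      (\<integral>\<^sup>+ y\<in>Uball gm w x e. ennreal (\<bar>indicator D y * g y - indicator D x * g x\<bar> powr q) \<partial>lebesgue) = ennreal (1 / c) * V x"
    if x: "indicator D x * g x = g' x" for x
  proof -
    have "(\<integral>\<^sup>+ y\<in>Uball gm w x e. ennreal (\<bar>indicator D y * g y - indicator D x * g x\<bar> powr q) \<partial>lebesgue)
        = (\<integral>\<^sup>+y. ennreal (\<bar>g' y - g' x\<bar> powr q) * indicator (Uball gm w x e) y \<partial>lborel)"
      unfolding nn_integral_completion
      by (rule nn_integral_cong_AE) (use ae in eventually_elim, simp only: x)
    moreover have "(\<lambda>y. ennreal (\<bar>g' y - g' x\<bar> powr q)) \<in> borel_measurable borel" by measurable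
    ultimately show ?thesis unfolding V_def c_def using average_Uball[OF e] by simp
  qed
  then have "AE x in lborel. ennreal (1 / measure lebesgue (Uball gm w x e)) *
      (\<integral>\<^sup>+ y\<in>Uball gm w x e. ennreal (\<bar>indicator D y * g y - indicator D x * g x\<bar> powr q) \<partial>lebesgue) * indicator D x = ennreal (1 / c) * V x * indicator D x"
    using ae by (auto elim!: eventually_mono)
  from nn_integral_cong_AE[OF this] bound
  have b: "(\<integral>\<^sup>+x. ennreal (1 / c) * V x * indicator D x \<partial>lborel) \<le> ennreal (M * e powr q)"
    unfolding nn_integral_completion by simp
  have dc: "continuous_on UNIV (dil w e)"
    using dil_linear by (intro linear_continuous_on) (simp add: linear_conv_bounded_linear)
  have [measurable]: "(\<lambda>p. gm (fst p) (dil w e (snd p))) \<in> borel_measurable borel"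
    by (intro borel_measurable_continuous_onI gm_continuous' continuous_on_compose2[OF dc] continuous_intros) auto
  have Wm [measurable]: "(\<lambda>p. ennreal (\<bar>g' (gm (fst p) (dil w e (snd p))) - g' (fst p)\<bar> powr q) * indicator U1 (snd p) * indicator D (fst p)) \<in> borel_measurable borel"
    by measurable
  have Vm: "(\<lambda>x. V x * indicator D x) \<in> borel_measurable lborel"
  proof -
    have "(\<lambda>p. ennreal (\<bar>g' (gm (fst p) (dil w e (snd p))) - g' (fst p)\<bar> powr q) * indicator U1 (snd p)) \<in> borel_measurable (lborel \<Otimes>\<^sub>M lborel)"
      unfolding lborel_prod by measurable
    from lborel.borel_measurable_nn_integral_fst[OF this] have [measurable]: "V \<in> borel_measurable lborel" unfolding V_def[abs_def] by simp
    show ?thesis by measurable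
  qed
  define E where "E = (1 / e) powr q"
  have E0: "E \<ge> 0" unfolding E_def by simp
  have "(\<integral>\<^sup>+p. ennreal (\<bar>diff_quot gm w D e g' p\<bar> powr q) * indicator D (fst p) \<partial>lborel)
      \<le> (\<integral>\<^sup>+p. ennreal E * (ennreal (\<bar>g' (gm (fst p) (dil w e (snd p))) - g' (fst p)\<bar> powr q) * indicator U1 (snd p) * indicator D (fst p)) \<partial>lborel)"
  proof (rule nn_integral_mono)
    fix p :: "(real^'n) \<times> (real^'n)"
    show "ennreal (\<bar>diff_quot gm w D e g' p\<bar> powr q) * indicator D (fst p)
      \<le> ennreal E * (ennreal (\<bar>g' (gm (fst p) (dil w e (snd p))) - g' (fst p)\<bar> powr q) * indicator U1 (snd p) * indicator D (fst p))"
    proof (cases "snd p \<in> U1 \<and> gm (fst p) (dil w e (snd p)) \<in> D")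
      case True
      then have "\<bar>diff_quot gm w D e g' p\<bar> = 1 / e * \<bar>g' (gm (fst p) (dil w e (snd p))) - g' (fst p)\<bar>"
        using e by (simp add: diff_quot_def Let_def)
      then have "\<bar>diff_quot gm w D e g' p\<bar> powr q = E * \<bar>g' (gm (fst p) (dil w e (snd p))) - g' (fst p)\<bar> powr q"
        unfolding E_def using e by (simp only: powr_mult)
      then show ?thesis using True E0 by (simp add: ennreal_mult' mult.assoc)
    qed (auto simp: diff_quot_def Let_def)
  qed
  also have "\<dots> = ennreal E * (\<integral>\<^sup>+p. ennreal (\<bar>g' (gm (fst p) (dil w e (snd p))) - g' (fst p)\<bar> powr q) * indicator U1 (snd p) * indicator D (fst p) \<partial>lborel)"
    by (rule nn_integral_cmult) simp
  also have "(\<integral>\<^sup>+p. ennreal (\<bar>g' (gm (fst p) (dil w e (snd p))) - g' (fst p)\<bar> powr q) * indicator U1 (snd p) * indicator D (fst p) \<partial>lborel)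
      = (\<integral>\<^sup>+x. V x * indicator D x \<partial>lborel)"
  proof -
    have "(\<integral>\<^sup>+z. ennreal (\<bar>g' (gm x (dil w e z)) - g' x\<bar> powr q) * indicator U1 z * indicator D x \<partial>lborel) = V x * indicator D x" for x
      unfolding V_def by (cases "x \<in> D") auto
    then show ?thesis by (subst nn_integral_lborel_fst[OF Wm]) simp
  qed
  also have "ennreal E * (\<integral>\<^sup>+x. V x * indicator D x \<partial>lborel) = ennreal (E * c) * (\<integral>\<^sup>+x. ennreal (1 / c) * V x * indicator D x \<partial>lborel)"
  proof -
    have "(\<integral>\<^sup>+x. ennreal (1 / c) * V x * indicator D x \<partial>lborel) = ennreal (1 / c) * (\<integral>\<^sup>+x. V x * indicator D x \<partial>lborel)"
      using nn_integral_cmult[OF Vm, of "ennreal (1 / c)"] by (simp add: mult.assoc)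
    moreover have "ennreal (E * c) * ennreal (1 / c) = ennreal E" using c E0 by (simp add: ennreal_mult[symmetric])
    ultimately show ?thesis by (simp add: mult.assoc[symmetric])
  qed
  also have "\<dots> \<le> ennreal (E * c) * ennreal (M * e powr q)" by (rule mult_left_mono[OF b]) simp
  \<comment> \<open>\<open>ennreal\<close> sends a negative argument to 0; with the modulus of M the
    factors are nonnegative and can be multiplied out.\<close>
  also have "\<dots> \<le> ennreal (E * c) * ennreal (\<bar>M\<bar> * e powr q)" by (intro mult_left_mono ennreal_leI mult_right_mono) auto
  also have "\<dots> = ennreal (E * c * (\<bar>M\<bar> * e powr q))" using E0 c by (intro ennreal_mult[symmetric]) auto
  also have "E * c * (\<bar>M\<bar> * e powr q) = c * \<bar>M\<bar>"
  proof -
    have "E * e powr q = 1" unfolding E_def using e by (simp add: powr_mult[symmetric])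
    then have "E * c * (\<bar>M\<bar> * e powr q) = c * \<bar>M\<bar> * (E * e powr q)" "E * e powr q = 1" by (simp_all add: mult_ac)
    then show ?thesis by simp
  qed
  finally show ?thesis unfolding c_def .
qed

end

theorem theorem4p4:
  fixes gm :: "real^'n::finite \<Rightarrow> real^'n \<Rightarrow> real^'n" and w :: "'n \<Rightarrow> nat"
    and D :: "(real^'n) set" and q :: real
    and eps :: "nat \<Rightarrow> real" and fe :: "nat \<Rightarrow> real^'n \<Rightarrow> real" and f :: "real^'n \<Rightarrow> real"
  assumes G: "carnot_group gm w"
    and D: "open D"
    and q: "q \<ge> 1"
    and eps_pos: "\<forall>k. eps k > 0" and eps_lim: "eps \<longlonglongrightarrow> 0"
    and fe_Lq: "\<forall>k. Lq lebesgue D q (fe k)" and f_Lq: "Lq lebesgue D q f"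
    and weak: "weak_Lq_conv lebesgue D q fe f"
    and bound: "\<exists>M. \<forall>k.
       (\<integral>\<^sup>+ x\<in>D. ennreal (1 / measure lebesgue (Uball gm w x (eps k))) *
           (\<integral>\<^sup>+ y\<in>Uball gm w x (eps k).
               ennreal (\<bar>indicator D y * fe k y - indicator D x * fe k x\<bar> powr q) \<partial>lebesgue) \<partial>lebesgue)
       \<le> ennreal (M * eps k powr q)"
  shows "(q > 1 \<longrightarrow>
            W1q_X gm w D q f \<and>
            (\<exists>g. (\<forall>i. w i = 1 \<longrightarrow> Lq lebesgue D q (g i) \<and> weak_hderiv gm D i f (g i)) \<and>
                 (\<exists>r. strict_mono r \<and>
                    weak_Lq_conv lebesgue (D \<times> UNIV) q
                      (\<lambda>k. diff_quot gm w D (eps (r k)) (fe (r k)))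
                      (\<lambda>p. indicator (Uball gm w 0 1) (snd p) *
                             (\<Sum>i\<in>{i. w i = 1}. snd p $ i * g i (fst p))))))
       \<and> (q = 1 \<longrightarrow>
            BV_X gm w D f \<and>
            (\<exists>\<mu>p \<mu>n. (\<forall>i. w i = 1 \<longrightarrow> meas_hderiv gm D i f (\<mu>p i) (\<mu>n i)) \<and>
                 (\<exists>r. strict_mono r \<and>
                    (\<forall>\<phi>::(real^'n) \<times> (real^'n) \<Rightarrow> real.
                       continuous_on UNIV \<phi> \<and> compact (csupp \<phi>) \<and> csupp \<phi> \<subseteq> D \<times> UNIV \<longrightarrow>
                       (\<lambda>k. LINT p:D \<times> UNIV|lebesgue.
                              \<phi> p * diff_quot gm w D (eps (r k)) (fe (r k)) p)
                       \<longlonglongrightarrow>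
                       (\<Sum>i\<in>{i. w i = 1}.
                          (\<integral>x. (LINT z|lebesgue. \<phi> (x, z) * indicator (Uball gm w 0 1) z * z $ i) \<partial>(\<mu>p i))
                        - (\<integral>x. (LINT z|lebesgue. \<phi> (x, z) * indicator (Uball gm w 0 1) z * z $ i) \<partial>(\<mu>n i)))))))"
proof -
  interpret carnot gm w by unfold_locales (rule G)
  have Dm [measurable]: "D \<in> sets borel" using D by auto
  have q0: "q > 0" using q by simp
  obtain M where M: "\<And>k. (\<integral>\<^sup>+ x\<in>D. ennreal (1 / measure lebesgue (Uball gm w x (eps k))) *
           (\<integral>\<^sup>+ y\<in>Uball gm w x (eps k).
               ennreal (\<bar>indicator D y * fe k y - indicator D x * fe k x\<bar> powr q) \<partial>lebesgue) \<partial>lebesgue)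
       \<le> ennreal (M * eps k powr q)" using bound by blast
  have "\<forall>k. \<exists>g. g \<in> borel_measurable borel \<and> (AE x in lborel. indicator D x * fe k x = g x) \<and> (\<forall>x. x \<notin> D \<longrightarrow> g x = 0)"
    using fe_Lq set_borel_measurable_representative[OF _ Dm] unfolding Lq_def by blast
  \<comment> \<open>These representatives vanish off D and so realise the extension by zero that the
    oscillation bound refers to.\<close>
  then obtain fk where fk [measurable]: "\<And>k. fk k \<in> borel_measurable borel"
    and fk_ae: "\<And>k. AE x in lborel. indicator D x * fe k x = fk k x" and fk0: "\<And>k x. x \<notin> D \<Longrightarrow> fk k x = 0"
    by metis
  obtain f' where f' [measurable]: "f' \<in> borel_measurable borel"
    and f'_ae: "AE x in lborel. indicator D x * f x = f' x" and f'0: "\<And>x. x \<notin> D \<Longrightarrow> f' x = 0"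
    using f_Lq set_borel_measurable_representative[OF _ Dm] unfolding Lq_def by blast
  have triv: "AE x in lborel. indicator D x * g x = indicator D x * g x" for g :: "real^'n \<Rightarrow> real" by simp
  have pair_f: "(LINT x:D|lebesgue. f x * g x) = (\<integral>x. indicator D x * f' x * g x \<partial>lborel)"
    if [measurable]: "g \<in> borel_measurable borel" for g
  proof -
    have "(LINT x:D|lebesgue. f x * g x) = (\<integral>x. f' x * (indicator D x * g x) \<partial>lborel)"
      by (rule set_integral_representative[OF f' _ f'_ae triv]) measurable
    also have "(\<lambda>x. f' x * (indicator D x * g x)) = (\<lambda>x. indicator D x * f' x * g x)" by (simp add: fun_eq_iff)
    finally show ?thesis .
  qed
  \<comment> \<open>The factor is the volume of the unit ball, by which the averages in the
    hypothesis are divided.\<close>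
  define C where "C = measure lborel U1 * \<bar>M\<bar>"
  have seq: "carnot_seq gm w D q eps fk f' C"
  proof (unfold_locales)
    show "(\<integral>\<^sup>+x. ennreal (\<bar>fk k x\<bar> powr q) \<partial>lborel) < \<infinity>" for k
      using fe_Lq by (intro Lq_representative[OF _ q0 fk_ae]) auto
    show "(\<integral>\<^sup>+x. ennreal (\<bar>f' x\<bar> powr q) \<partial>lborel) < \<infinity>"
      by (rule Lq_representative[OF f_Lq q0 f'_ae])
    show "C \<ge> 0" unfolding C_def using emeasure_U1(2) by simp
    show "(\<integral>\<^sup>+p. ennreal (\<bar>diff_quot gm w D (eps k) (fk k) p\<bar> powr q) * indicator D (fst p) \<partial>lborel) \<le> ennreal C" for k
      unfolding C_def using eps_pos by (intro diff_quot_bound[OF D q _ fk fk_ae M]) auto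
    show "(\<lambda>k. \<integral>x. fk k x * g x \<partial>lborel) \<longlonglongrightarrow> (\<integral>x. f' x * g x \<partial>lborel)"
      if g [measurable]: "g \<in> borel_measurable borel"
        and gb: "if q = 1 then bounded (range g) else (\<integral>\<^sup>+x. ennreal (\<bar>g x\<bar> powr (q / (q - 1))) \<partial>lborel) < \<infinity>" for g
    proof -
      have gL: "set_borel_measurable lebesgue D g"
        unfolding set_borel_measurable_def by (rule measurable_completion) simp
      have "if q = 1 then Linf lebesgue D g else Lq lebesgue D (q / (q - 1)) g"
      proof (cases "q = 1")
        case True
        then obtain b where "\<And>x. \<bar>g x\<bar> \<le> b" using gb unfolding bounded_iff by auto
        then show ?thesis using True gL unfolding Linf_def by auto
      next
        case False
        then show ?thesis using gb by (auto intro!: Lq_borel)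
      qed
      then have "(\<lambda>k. LINT x:D|lebesgue. fe k x * g x) \<longlonglongrightarrow> (LINT x:D|lebesgue. f x * g x)"
        using weak unfolding weak_Lq_conv_def by blast
      moreover have "(LINT x:D|lebesgue. fe k x * g x) = (\<integral>x. fk k x * g x \<partial>lborel)" for k
      proof -
        have "(LINT x:D|lebesgue. fe k x * g x) = (\<integral>x. fk k x * (indicator D x * g x) \<partial>lborel)"
          by (rule set_integral_representative[OF fk _ fk_ae triv]) measurable
        also have "(\<lambda>x. fk k x * (indicator D x * g x)) = (\<lambda>x. fk k x * g x)"
          using fk0 by (auto simp: fun_eq_iff indicator_def)
        finally show ?thesis .
      qed
      moreover have "(\<lambda>x. indicator D x * f' x * g x) = (\<lambda>x. f' x * g x)"
        using f'0 by (auto simp: fun_eq_iff indicator_def)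
      ultimately show ?thesis using pair_f[OF g] by simp
    qed
  qed (use D q eps_pos eps_lim in auto)
  interpret S: carnot_seq gm w D q eps fk f' C by (rule seq)
  have sndm [measurable]: "(\<lambda>p::(real^'n) \<times> (real^'n). snd p $ i) \<in> borel_measurable borel" for i
    by (intro borel_measurable_continuous_onI continuous_intros)
  have Um [measurable]: "U1 \<in> sets borel" by (rule U1_measurable)
  have QDm: "(\<lambda>p. indicator D (fst p) * diff_quot gm w D (eps k) (fk k) p) \<in> borel_measurable borel" for k
    by measurable
  have indDU: "indicator (D \<times> UNIV) p = (indicator D (fst p) :: real)" for p :: "(real^'n) \<times> (real^'n)"
    by (cases p) (simp add: indicator_def)
  have hX_test: "(LINT x:D|lebesgue. f x * hX gm i \<phi> x) = (\<integral>x. indicator D x * f' x * hX gm i \<phi> x \<partial>lborel)"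
    if "test_fn D \<phi>" for i \<phi>
    using test_fn_C1[OF that] by (intro pair_f borel_measurable_continuous_onI hX_C1) auto
  show ?thesis
  proof (intro conjI impI)
    assume q1: "q > 1"
    \<comment> \<open>Bundles the properties of a pair of densities, so that one pair can be chosen
      for all indices at once; the implication leaves the pair arbitrary outside the first
      layer.\<close>
    define PR where "PR i h \<longleftrightarrow> fst h \<in> borel_measurable borel \<and> snd h \<in> borel_measurable borel \<and> (\<forall>x. 0 \<le> fst h x) \<and> (\<forall>x. 0 \<le> snd h x) \<and>
       (\<integral>\<^sup>+x. ennreal (fst h x powr q) \<partial>lborel) < \<infinity> \<and> (\<integral>\<^sup>+x. ennreal (snd h x powr q) \<partial>lborel) < \<infinity> \<and>
       (\<forall>\<phi>. C1_fun \<phi> \<longrightarrow> supp_cpt D \<phi> \<longrightarrow> (\<integral>x. indicator D x * f' x * hX gm i \<phi> x \<partial>lborel)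
          = - ((\<integral>x. fst h x * \<phi> x \<partial>lborel) - (\<integral>x. snd h x * \<phi> x \<partial>lborel)))"
      for i and h :: "(real^'n \<Rightarrow> real) \<times> (real^'n \<Rightarrow> real)"
    have "\<forall>i. \<exists>h. w i = 1 \<longrightarrow> PR i h"
    proof (intro allI)
      fix i
      show "\<exists>h. w i = 1 \<longrightarrow> PR i h"
      proof (cases "w i = 1")
        case True
        from S.ex_densities[OF q1 True] obtain hp hn where "PR i (hp, hn)" unfolding PR_def fst_conv snd_conv by blast
        then show ?thesis by blast
      qed simp
    qed
    then obtain h where h: "\<And>i. w i = 1 \<Longrightarrow> PR i (h i)" by metis
    define hp hn where "hp i = fst (h i)" and "hn i = snd (h i)" for i
    have hm: "hp i \<in> borel_measurable borel \<and> hn i \<in> borel_measurable borel"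
      and h0: "\<And>x. 0 \<le> hp i x \<and> 0 \<le> hn i x"
      and hq: "(\<integral>\<^sup>+x. ennreal (hp i x powr q) \<partial>lborel) < \<infinity> \<and> (\<integral>\<^sup>+x. ennreal (hn i x powr q) \<partial>lborel) < \<infinity>"
      and rep: "\<And>\<phi>. C1_fun \<phi> \<Longrightarrow> supp_cpt D \<phi> \<Longrightarrow> (\<integral>x. indicator D x * f' x * hX gm i \<phi> x \<partial>lborel)
          = - ((\<integral>x. hp i x * \<phi> x \<partial>lborel) - (\<integral>x. hn i x * \<phi> x \<partial>lborel))"
      if "w i = 1" for i
      using h[OF that] unfolding PR_def hp_def hn_def by blast+
    define g where "g i x = hp i x - hn i x" for i x
    have g1: "Lq lebesgue D q (g i) \<and> weak_hderiv gm D i f (g i)" if i: "w i = 1" for i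
    proof
      have [measurable]: "hp i \<in> borel_measurable borel" "hn i \<in> borel_measurable borel" using hm[OF i] by auto
      have gm' [measurable]: "g i \<in> borel_measurable borel" unfolding g_def by measurable
      show "Lq lebesgue D q (g i)"
      proof (rule Lq_borel[OF gm' Dm])
        have "(\<integral>\<^sup>+x. ennreal (\<bar>g i x\<bar> powr q) \<partial>lborel) \<le> (\<integral>\<^sup>+x. ennreal (hp i x powr q) + ennreal (hn i x powr q) \<partial>lborel)"
        proof (rule nn_integral_mono)
          fix x
          have "\<bar>g i x\<bar> \<le> max (hp i x) (hn i x)" unfolding g_def using h0[OF i, of x] by auto
          then have "\<bar>g i x\<bar> powr q \<le> (max (hp i x) (hn i x)) powr q" using q by (intro powr_mono2) auto
          also have "\<dots> \<le> hp i x powr q + hn i x powr q" by (auto simp: max_def)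
          finally have "ennreal (\<bar>g i x\<bar> powr q) \<le> ennreal (hp i x powr q + hn i x powr q)" by (rule ennreal_leI)
          then show "ennreal (\<bar>g i x\<bar> powr q) \<le> ennreal (hp i x powr q) + ennreal (hn i x powr q)" by (simp add: ennreal_plus)
        qed
        also have "\<dots> = (\<integral>\<^sup>+x. ennreal (hp i x powr q) \<partial>lborel) + (\<integral>\<^sup>+x. ennreal (hn i x powr q) \<partial>lborel)"
          by (rule nn_integral_add) measurable
        also have "\<dots> < \<infinity>" using hq[OF i] by simp
        finally show "(\<integral>\<^sup>+x. ennreal (\<bar>g i x\<bar> powr q) \<partial>lborel) < \<infinity>" .
      qed
      show "weak_hderiv gm D i f (g i)" unfolding weak_hderiv_def
      proof (intro allI impI)
        fix \<phi> assume t: "test_fn D \<phi>"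
        then have \<phi>: "C1_fun \<phi>" "supp_cpt D \<phi>" using test_fn_C1 by auto
        have \<phi>c: "continuous_on UNIV \<phi>" by (rule C1_fun_continuous[OF \<phi>(1)])
        have \<phi>m [measurable]: "\<phi> \<in> borel_measurable borel" using \<phi>c by (rule borel_measurable_continuous_onI)
        obtain K where K: "compact K" "K \<subseteq> D" "\<And>x. x \<notin> K \<Longrightarrow> \<phi> x = 0" using \<phi>(2) unfolding supp_cpt_def by blast
        have Km [measurable]: "K \<in> sets borel" using K(1) by (simp add: compact_imp_closed)
        obtain b where b: "\<And>x. \<bar>\<phi> x\<bar> \<le> b" using supp_cpt_bounded[OF \<phi>(2) \<phi>c] by blast
        \<comment> \<open>Integrability on the compact support of \<phi>, where L^q functions are
          integrable; it is what allows the integral of the difference \<open>g i\<close> to be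
          split into its two parts.\<close>
        have int: "integrable lborel (\<lambda>x. v x * \<phi> x)"
          if [measurable]: "v \<in> borel_measurable borel" and v: "(\<integral>\<^sup>+x. ennreal (v x powr q) \<partial>lborel) < \<infinity>" "\<And>x. 0 \<le> v x" for v
        proof (rule Bochner_Integration.integrable_bound)
          have "(\<integral>\<^sup>+x. ennreal (\<bar>v x\<bar> powr q) \<partial>lborel) < \<infinity>" using v by simp
          then show "integrable lborel (\<lambda>x. b * (indicator K x * v x))"
            using emeasure_compact_finite[OF K(1)] by (intro integrable_mult_right integrable_indicator_Lq[OF _ q]) (auto simp: less_top)
          show "AE x in lborel. norm (v x * \<phi> x) \<le> norm (b * (indicator K x * v x))"
          proof (rule AE_I2)
            fix x
            have "\<bar>\<phi> x\<bar> \<le> \<bar>b\<bar>" using b[of x] by linarith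
            then have "\<bar>\<phi> x\<bar> * \<bar>v x\<bar> \<le> \<bar>b\<bar> * \<bar>v x\<bar>" by (intro mult_right_mono) auto
            then show "norm (v x * \<phi> x) \<le> norm (b * (indicator K x * v x))"
              using K(3)[of x] by (cases "x \<in> K") (auto simp: abs_mult mult.commute)
          qed
        qed measurable
        have "(LINT x:D|lebesgue. g i x * \<phi> x) = (\<integral>x. (indicator D x * g i x) * (indicator D x * \<phi> x) \<partial>lborel)"
          by (rule set_integral_representative[OF _ _ triv triv]) measurable
        also have "(\<lambda>x. (indicator D x * g i x) * (indicator D x * \<phi> x)) = (\<lambda>x. hp i x * \<phi> x - hn i x * \<phi> x)"
          using K by (auto simp: fun_eq_iff g_def indicator_def left_diff_distrib)
        also have "(\<integral>x. hp i x * \<phi> x - hn i x * \<phi> x \<partial>lborel) = (\<integral>x. hp i x * \<phi> x \<partial>lborel) - (\<integral>x. hn i x * \<phi> x \<partial>lborel)"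
          using int[of "hp i"] int[of "hn i"] hq[OF i] h0[OF i] by simp
        finally show "(LINT x:D|lebesgue. f x * hX gm i \<phi> x) = - (LINT x:D|lebesgue. g i x * \<phi> x)"
          unfolding hX_test[OF t] rep[OF i \<phi>] by simp
      qed
    qed
    show "W1q_X gm w D q f" unfolding W1q_X_def using f_Lq g1 by blast
    have conv: "weak_Lq_conv lebesgue (D \<times> UNIV) q (\<lambda>k. diff_quot gm w D (eps (id k)) (fe (id k)))
        (\<lambda>p. indicator U1 (snd p) * (\<Sum>i\<in>{i. w i = 1}. snd p $ i * g i (fst p)))"
      unfolding weak_Lq_conv_def
    proof (intro allI impI)
      fix \<psi>0 :: "(real^'n) \<times> (real^'n) \<Rightarrow> real"
      assume "if q = 1 then Linf lebesgue (D \<times> UNIV) \<psi>0 else Lq lebesgue (D \<times> UNIV) (q / (q - 1)) \<psi>0"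
      then have \<psi>0: "Lq lebesgue (D \<times> UNIV) (q / (q - 1)) \<psi>0" using q1 by simp
      have p0: "q / (q - 1) > 0" using q1 by simp
      have DU: "D \<times> (UNIV :: (real^'n) set) \<in> sets borel" using D by (intro borel_open open_Times) auto
      obtain \<psi> where \<psi>m [measurable]: "\<psi> \<in> borel_measurable borel" and \<psi>ae: "AE p in lborel. indicator (D \<times> UNIV) p * \<psi>0 p = \<psi> p"
        using \<psi>0 set_borel_measurable_representative[OF _ DU] unfolding Lq_def by blast
      have "(\<integral>\<^sup>+p. ennreal (\<bar>\<psi> p\<bar> powr (q / (q - 1))) * indicator (D \<times> UNIV) p \<partial>lborel) \<le> (\<integral>\<^sup>+p. ennreal (\<bar>\<psi> p\<bar> powr (q / (q - 1))) \<partial>lborel)"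
        by (intro nn_integral_mono) (auto simp: indicator_def)
      also have "\<dots> < \<infinity>" by (rule Lq_representative[OF \<psi>0 p0 \<psi>ae])
      finally have \<psi>p: "(\<integral>\<^sup>+p. ennreal (\<bar>\<psi> p\<bar> powr (q / (q - 1))) * indicator (D \<times> UNIV) p \<partial>lborel) < \<infinity>" .
      let ?L = "\<lambda>p. indicator U1 (snd p) * (\<Sum>i\<in>{i. w i = 1}. snd p $ i * g i (fst p))"
      have gm'': "(\<lambda>p. \<Sum>i\<in>{i. w i = 1}. snd p $ i * g i (fst p)) \<in> borel_measurable borel"
      proof (rule borel_measurable_sum)
        fix i assume "i \<in> {i. w i = 1}"
        then have [measurable]: "hp i \<in> borel_measurable borel" "hn i \<in> borel_measurable borel" using hm by auto
        show "(\<lambda>p::(real^'n) \<times> (real^'n). snd p $ i * g i (fst p)) \<in> borel_measurable borel" unfolding g_def by measurable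
      qed
      have e1: "(LINT p:D \<times> UNIV|lebesgue. diff_quot gm w D (eps k) (fe k) p * \<psi>0 p)
          = (\<integral>p. indicator D (fst p) * diff_quot gm w D (eps k) (fk k) p * \<psi> p \<partial>lborel)" for k
        by (rule set_integral_representative[OF QDm \<psi>m diff_quot_AE_cong[OF fk_ae] \<psi>ae])
      have e2: "(LINT p:D \<times> UNIV|lebesgue. ?L p * \<psi>0 p) = (\<integral>p. indicator D (fst p) * ?L p * \<psi> p \<partial>lborel)"
      proof (rule set_integral_representative[OF _ \<psi>m _ \<psi>ae])
        show "(\<lambda>p. indicator D (fst p) * ?L p) \<in> borel_measurable borel" using gm'' by measurable
        show "AE p in lborel. indicator (D \<times> UNIV) p * ?L p = indicator D (fst p) * ?L p" by (simp only: indDU) simp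
      qed
      show "(\<lambda>k. LINT p:D \<times> UNIV|lebesgue. diff_quot gm w D (eps (id k)) (fe (id k)) p * \<psi>0 p) \<longlonglongrightarrow> (LINT p:D \<times> UNIV|lebesgue. ?L p * \<psi>0 p)"
        unfolding id_apply e1 e2 unfolding g_def by (rule S.density_limit[OF q1 hm h0 hq rep \<psi>m \<psi>p])
    qed
    show "\<exists>g. (\<forall>i. w i = 1 \<longrightarrow> Lq lebesgue D q (g i) \<and> weak_hderiv gm D i f (g i)) \<and>
                 (\<exists>r. strict_mono r \<and>
                    weak_Lq_conv lebesgue (D \<times> UNIV) q
                      (\<lambda>k. diff_quot gm w D (eps (r k)) (fe (r k)))
                      (\<lambda>p. indicator (Uball gm w 0 1) (snd p) *
                             (\<Sum>i\<in>{i. w i = 1}. snd p $ i * g i (fst p))))"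
    proof (rule exI[of _ g], rule conjI)
      show "\<forall>i. w i = 1 \<longrightarrow> Lq lebesgue D q (g i) \<and> weak_hderiv gm D i f (g i)" using g1 by (intro allI impI)
    qed (rule exI[of _ id], rule conjI[OF strict_mono_id conv])
  next
    assume q1: "q = 1"
    define PR where "PR i h \<longleftrightarrow> fin_meas_on D (fst h) \<and> fin_meas_on D (snd h) \<and> (\<forall>\<phi>. C1_fun \<phi> \<longrightarrow> supp_cpt D \<phi> \<longrightarrow>
       (\<integral>x. indicator D x * f' x * hX gm i \<phi> x \<partial>lborel) = - ((\<integral>x. \<phi> x \<partial>fst h) - (\<integral>x. \<phi> x \<partial>snd h)))"
      for i and h :: "(real^'n) measure \<times> (real^'n) measure"
    have "\<forall>i. \<exists>h. w i = 1 \<longrightarrow> PR i h"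
    proof (intro allI)
      fix i
      show "\<exists>h. w i = 1 \<longrightarrow> PR i h"
      proof (cases "w i = 1")
        case True
        from S.ex_measures[OF q1 True] obtain \<mu> \<nu> where "PR i (\<mu>, \<nu>)" unfolding PR_def fst_conv snd_conv by blast
        then show ?thesis by blast
      qed simp
    qed
    then obtain h where h: "\<And>i. w i = 1 \<Longrightarrow> PR i (h i)" by metis
    define \<mu>p \<mu>n where "\<mu>p i = fst (h i)" and "\<mu>n i = snd (h i)" for i
    have fin: "fin_meas_on D (\<mu>p i)" "fin_meas_on D (\<mu>n i)"
      and rep: "\<And>\<phi>. C1_fun \<phi> \<Longrightarrow> supp_cpt D \<phi> \<Longrightarrow>
       (\<integral>x. indicator D x * f' x * hX gm i \<phi> x \<partial>lborel) = - ((\<integral>x. \<phi> x \<partial>\<mu>p i) - (\<integral>x. \<phi> x \<partial>\<mu>n i))"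
      if "w i = 1" for i
      using h[OF that] unfolding PR_def \<mu>p_def \<mu>n_def by blast+
    have m1: "meas_hderiv gm D i f (\<mu>p i) (\<mu>n i)" if i: "w i = 1" for i
      unfolding meas_hderiv_def
    proof (intro conjI allI impI fin[OF i])
      fix \<phi> assume t: "test_fn D \<phi>"
      then have \<phi>: "C1_fun \<phi>" "supp_cpt D \<phi>" using test_fn_C1 by auto
      show "(LINT x:D|lebesgue. f x * hX gm i \<phi> x) = - ((\<integral>x. \<phi> x \<partial>\<mu>p i) - (\<integral>x. \<phi> x \<partial>\<mu>n i))"
        unfolding hX_test[OF t] by (rule rep[OF i \<phi>])
    qed
    show "BV_X gm w D f" unfolding BV_X_def using f_Lq q1 m1 by blast
    have conv: "(\<lambda>k. LINT p:D \<times> UNIV|lebesgue. \<phi> p * diff_quot gm w D (eps (id k)) (fe (id k)) p) \<longlonglongrightarrow>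
        (\<Sum>i\<in>{i. w i = 1}.
           (\<integral>x. (LINT z|lebesgue. \<phi> (x, z) * indicator U1 z * z $ i) \<partial>(\<mu>p i))
         - (\<integral>x. (LINT z|lebesgue. \<phi> (x, z) * indicator U1 z * z $ i) \<partial>(\<mu>n i)))"
      if \<phi>: "continuous_on UNIV \<phi>" "compact (csupp \<phi>)" "csupp \<phi> \<subseteq> D \<times> UNIV" for \<phi> :: "(real^'n) \<times> (real^'n) \<Rightarrow> real"
    proof -
      have \<phi>m [measurable]: "\<phi> \<in> borel_measurable borel" using \<phi>(1) by (rule borel_measurable_continuous_onI)
      have s: "supp_cpt (D \<times> UNIV) \<phi>" by (rule csupp_supp_cpt[OF \<phi>(2,3)])
      \<comment> \<open>The indicator of D is distributed over \<phi> and the quotient, so that each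
        factor has a Borel representative on the product space.\<close>
      have e1: "(LINT p:D \<times> UNIV|lebesgue. \<phi> p * diff_quot gm w D (eps k) (fe k) p)
          = (\<integral>p. indicator D (fst p) * \<phi> p * diff_quot gm w D (eps k) (fk k) p \<partial>lborel)" for k
      proof -
        have "(LINT p:D \<times> UNIV|lebesgue. \<phi> p * diff_quot gm w D (eps k) (fe k) p)
          = (\<integral>p. (indicator D (fst p) * \<phi> p) * (indicator D (fst p) * diff_quot gm w D (eps k) (fk k) p) \<partial>lborel)"
        proof (rule set_integral_representative[OF _ QDm _ diff_quot_AE_cong[OF fk_ae]])
          show "(\<lambda>p. indicator D (fst p) * \<phi> p) \<in> borel_measurable borel" by measurable
          show "AE p in lborel. indicator (D \<times> UNIV) p * \<phi> p = indicator D (fst p) * \<phi> p" by (simp only: indDU) simp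
        qed
        also have "(\<lambda>p. (indicator D (fst p) * \<phi> p) * (indicator D (fst p) * diff_quot gm w D (eps k) (fk k) p))
            = (\<lambda>p. indicator D (fst p) * \<phi> p * diff_quot gm w D (eps k) (fk k) p)"
          by (auto simp: fun_eq_iff indicator_def)
        finally show ?thesis .
      qed
      have e2: "(LINT z|lebesgue. \<phi> (x, z) * indicator U1 z * z $ i) = (\<integral>z. \<phi> (x, z) * indicator U1 z * z $ i \<partial>lborel)" for x i
      proof (rule integral_completion)
        have "(\<lambda>p. \<phi> p * indicator U1 (snd p) * snd p $ i) \<in> borel_measurable borel" by measurable
        from slice_borel_measurable(2)[OF this, of x]
        show "(\<lambda>z. \<phi> (x, z) * indicator U1 z * z $ i) \<in> borel_measurable lborel" by simp
      qed
      show ?thesis unfolding id_apply e1 e2 by (rule S.measure_limit[OF q1 fin rep \<phi>(1) s])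
    qed
    show "\<exists>\<mu>p \<mu>n. (\<forall>i. w i = 1 \<longrightarrow> meas_hderiv gm D i f (\<mu>p i) (\<mu>n i)) \<and>
                 (\<exists>r. strict_mono r \<and>
                    (\<forall>\<phi>::(real^'n) \<times> (real^'n) \<Rightarrow> real.
                       continuous_on UNIV \<phi> \<and> compact (csupp \<phi>) \<and> csupp \<phi> \<subseteq> D \<times> UNIV \<longrightarrow>
                       (\<lambda>k. LINT p:D \<times> UNIV|lebesgue.
                              \<phi> p * diff_quot gm w D (eps (r k)) (fe (r k)) p)
                       \<longlonglongrightarrow>
                       (\<Sum>i\<in>{i. w i = 1}.
                          (\<integral>x. (LINT z|lebesgue. \<phi> (x, z) * indicator (Uball gm w 0 1) z * z $ i) \<partial>(\<mu>p i))
                        - (\<integral>x. (LINT z|lebesgue. \<phi> (x, z) * indicator (Uball gm w 0 1) z * z $ i) \<partial>(\<mu>n i)))))"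
    proof (rule exI[of _ \<mu>p], rule exI[of _ \<mu>n], rule conjI)
      show "\<forall>i. w i = 1 \<longrightarrow> meas_hderiv gm D i f (\<mu>p i) (\<mu>n i)" using m1 by (intro allI impI)
    qed (rule exI[of _ id], rule conjI[OF strict_mono_id], intro allI impI, elim conjE, rule conv)
  qed
qed

end
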